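(* Let $G$ be an $\{\mathrm{ISK}_4, \text{diamond}, \text{bowtie}, \text{prism}, K_{3,3}\}$-free graph, and let $x$ be the center of a proper wheel in $G$. Let $W=(C,x)$ be a proper wheel in $G$ with center $x$ having the minimum number of spokes among all proper wheels with center $x$. Then (i) every connected component of $G\setminus N[x]$ contains the interior of at most one sector of $W$; and (ii) for every $u\in N(x)$, the component $D$ of $G\setminus (N[x]\setminus\{u\})$ containing $u$ contains the interiors of at most two sectors of $W$, and if $S_1,S_2$ are sectors with $S_1^*\subseteq V(D)$ and $S_2^*\subseteq V(D)$, then $V(S_1)\cap V(S_2)\neq\emptyset$.
   Context: "$H$-free" means no induced subgraph isomorphic to $H$; $\mathrm{ISK}_4$-free means no induced subdivision of $K_4$. Diamond: $K_4$ minus an edge. Bowtie: two triangles sharing one vertex. Prism: three vertex-disjoint paths $a_i\ldots b_i$ ($i=1,2,3$) of length $\ge1$ with $a_1a_2a_3$ and $b_1b_2b_3$ triangles and no other edges between the paths. $N[x]$ is the closed neighborhood. For a path $S$, $S^*$ is its set of internal vertices (its interior). A hole is an induced cycle of length at least four. A wheel $W=(C,x)$ (center $x$) consists of a hole $C$ and a vertex $x\notin V(C)$ with at least three neighbors in $V(C)$; $V(W)=V(C)\cup\{x\}$; spokes are the neighbors of $x$ in $C$; a sector is a subpath of $C$ whose ends are spokes and whose interior contains no spoke. A vertex $v$ is proper for $W$ if $v\in V(W)$, or all neighbors of $v$ in $V(C)$ lie in one sector and, if $v$ has more than two neighbors in $V(C)$, then $vx\in E(G)$. $W$ is proper in $G$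 if every vertex of $G$ is proper for $W$; $x$ is the center of a proper wheel in $G$ if some proper wheel in $G$ has center $x$.
   Formalization: In (i) and (ii) only sectors with nonempty interior are considered: a sector of length one has empty interior, contained in every component, and counting it makes both parts false (e.g. G a wheel with four spokes and exactly one sector of length one). *)

theory Defs
  imports "Graph_Theory.Graph_Theory"
begin

text \<open>Finite simple graphs are modelled by \<^locale>\<open>pair_graph\<close>. The pair representation matters for
  subdivisions: the library's subdivision relation keeps the arc type together with its
  head and tail functions, so over an arbitrary arc type the arcs of the \<open>K\<^sub>4\<close> being subdivided
  need not exist.\<close>

definition induced_free :: "('a pair_pre_digraph \<Rightarrow> bool) \<Rightarrow> 'a pair_pre_digraph \<Rightarrow> bool" where
  "induced_free P G \<longleftrightarrow> \<not> (\<exists>H. induced_subgraph (with_proj H) (with_proj G) \<and> P H)"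

definition is_K33 :: "'a pair_pre_digraph \<Rightarrow> bool" where
  "is_K33 H \<longleftrightarrow> K\<^bsub>3,3\<^esub> (with_proj H)"

definition is_subdivided_K4 :: "'a pair_pre_digraph \<Rightarrow> bool" where
  "is_subdivided_K4 H \<longleftrightarrow> (\<exists>K. K\<^bsub>4\<^esub> (with_proj K) \<and> subdivision_pair K H)"

definition is_diamond :: "'a pair_pre_digraph \<Rightarrow> bool" where
  "is_diamond H \<longleftrightarrow> (\<exists>a b c d. distinct [a, b, c, d] \<and> pverts H = {a, b, c, d}
     \<and> parcs H = symcl {(a,b), (a,c), (a,d), (b,c), (b,d)})"

definition is_bowtie :: "'a pair_pre_digraph \<Rightarrow> bool" where
  "is_bowtie H \<longleftrightarrow> (\<exists>a b c d e. distinct [a, b, c, d, e] \<and> pverts H = {a, b, c, d, e}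
     \<and> parcs H = symcl {(a,b), (b,c), (c,a), (a,d), (d,e), (e,a)})"

definition is_prism :: "'a pair_pre_digraph \<Rightarrow> bool" where
  "is_prism H \<longleftrightarrow> (\<exists>p q r. 2 \<le> length p \<and> 2 \<le> length q \<and> 2 \<le> length r \<and> distinct (p @ q @ r)
     \<and> pverts H = set p \<union> set q \<union> set r
     \<and> parcs H = symcl (set (vwalk_arcs p) \<union> set (vwalk_arcs q) \<union> set (vwalk_arcs r)
         \<union> {(hd p, hd q), (hd q, hd r), (hd r, hd p)}
         \<union> {(last p, last q), (last q, last r), (last r, last p)}))"

definition nbhd :: "'a pair_pre_digraph \<Rightarrow> 'a \<Rightarrow> 'a set" where
  "nbhd G x = {y. x \<rightarrow>\<^bsub>with_proj G\<^esub> y}"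

definition closed_nbhd :: "'a pair_pre_digraph \<Rightarrow> 'a \<Rightarrow> 'a set" where
  "closed_nbhd G x = insert x (nbhd G x)"

text \<open>Being induced, a hole is determined by its vertex set, which is how it is represented.\<close>

definition hole :: "'a pair_pre_digraph \<Rightarrow> 'a set \<Rightarrow> bool" where
  "hole G C \<longleftrightarrow> (\<exists>es. pre_digraph.cycle (with_proj G) es \<and> 4 \<le> length es
     \<and> C = fst ` set es \<and> arcs (with_proj G \<restriction> C) = symcl (set es))"

definition spokes :: "'a pair_pre_digraph \<Rightarrow> 'a set \<Rightarrow> 'a \<Rightarrow> 'a set" where
  "spokes G C x = nbhd G x \<inter> C"

definition wheel :: "'a pair_pre_digraph \<Rightarrow> 'a set \<Rightarrow> 'a \<Rightarrow> bool" where
  "wheel G C x \<longleftrightarrow> hole G C \<and> x \<in> pverts G \<and> x \<notin> C \<and> 3 \<le> card (spokes G C x)"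

definition path_interior :: "'a list \<Rightarrow> 'a set" where
  "path_interior p = set (butlast (tl p))"

definition sector_path :: "'a pair_pre_digraph \<Rightarrow> 'a set \<Rightarrow> 'a \<Rightarrow> 'a list \<Rightarrow> bool" where
  "sector_path G C x p \<longleftrightarrow> vpath p (with_proj G \<restriction> C) \<and> 2 \<le> length p
     \<and> hd p \<in> spokes G C x \<and> last p \<in> spokes G C x \<and> path_interior p \<inter> spokes G C x = {}"

text \<open>Each sector is traversed by two lists, one in each direction; since a wheel has at least three
  spokes, its sectors are distinguished by their vertex sets, so these are what is counted.

  A sector of length one has empty interior and is not regarded as having its interior inside
  \<open>X\<close>. Otherwise it would count for every \<open>X\<close>: a wheel with one sector of length one and three
  longer ones is, as a graph of its own, free of all the excluded configurations, yet each
  component of the non-neighbours of its center would contain two interiors.\<close>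

definition sectors_with_interior_in ::
    "'a pair_pre_digraph \<Rightarrow> 'a set \<Rightarrow> 'a \<Rightarrow> 'a set \<Rightarrow> 'a set set" where
  "sectors_with_interior_in G C x X =
     {set p |p. sector_path G C x p \<and> path_interior p \<noteq> {} \<and> path_interior p \<subseteq> X}"

definition proper_vertex :: "'a pair_pre_digraph \<Rightarrow> 'a set \<Rightarrow> 'a \<Rightarrow> 'a \<Rightarrow> bool" where
  "proper_vertex G C x v \<longleftrightarrow> v \<in> insert x C
     \<or> (\<exists>p. sector_path G C x p \<and> nbhd G v \<inter> C \<subseteq> set p)
       \<and> (card (nbhd G v \<inter> C) > 2 \<longrightarrow> x \<in> nbhd G v)"

definition proper_wheel :: "'a pair_pre_digraph \<Rightarrow> 'a set \<Rightarrow> 'a \<Rightarrow> bool" where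
  "proper_wheel G C x \<longleftrightarrow> wheel G C x \<and> (\<forall>v \<in> pverts G. proper_vertex G C x v)"

text \<open>Graphs being symmetric digraphs, connected components are strong components.\<close>

definition components_without ::
    "'a pair_pre_digraph \<Rightarrow> 'a set \<Rightarrow> ('a, 'a \<times> 'a) pre_digraph set" where
  "components_without G X = pre_digraph.sccs (with_proj G \<restriction> (pverts G - X))"

end

theory Submission
  imports Defs
begin

text \<open>Every vertex lies in at most one triangle, and no connected set sends exactly three edges, with
  three different ends, to a disjoint induced cycle: otherwise there is a subdivided \<open>K\<^sub>4\<close> or a prism.

  Call \<^emph>\<open>detour\<close> a hole that consists of an arc of the rim and a path off the rim, and that has fewer
  spokes than the rim. A path through non-neighbours of \<open>x\<close> between two places of the rim that are
  separated by spokes yields a detour, and so does a path through a single neighbour of \<open>x\<close> between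
  the interiors of two disjoint sectors. So it is enough to exclude detours. A vertex that is
  improper for a minimal detour is a neighbour of \<open>x\<close> attached to both sectors at one of at most two
  spokes; exchanging these spokes for such vertices turns the detour into a proper wheel with
  center \<open>x\<close> and fewer spokes, against the choice of \<open>W\<close>.\<close>

section \<open>Lists and symmetric arc sets\<close>

lemma before_first_occurrence:
  assumes eq: "xs @ a # ys = us @ b # vs" and b: "P b" and none: "\<And>z. z \<in> set xs \<Longrightarrow> \<not> P z"
  obtains ws where "us = xs @ ws" "a # ys = ws @ b # vs"
proof -
  consider (after) ws where "us = xs @ ws" "a # ys = ws @ b # vs"
    | (before) ws where "xs = us @ ws" "ws @ a # ys = b # vs"
    using eq unfolding append_eq_append_conv2 by blast
  then show thesis
  proof cases
    case after
    then show thesis by (rule that)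
  next
    case before
    then have "ws = []" using b none by (cases ws) auto
    then show thesis using before that[of "[]"] by simp
  qed
qed

lemma after_last_occurrence:
  assumes eq: "xs @ a # ys = us @ b # vs" and b: "P b" and none: "\<And>z. z \<in> set ys \<Longrightarrow> \<not> P z"
  obtains ws where "vs = ws @ ys" "xs @ [a] = us @ b # ws"
proof -
  have "rev ys @ a # rev xs = rev vs @ b # rev us" using arg_cong[OF eq, of rev] by simp
  then obtain ws where ws: "rev vs = rev ys @ ws" "a # rev xs = ws @ b # rev us"
    by (rule before_first_occurrence[of _ _ _ _ _ _ P]) (use b none in auto)
  have "vs = rev ws @ ys" using arg_cong[OF ws(1), of rev] by simp
  moreover have "xs @ [a] = us @ b # rev ws" using arg_cong[OF ws(2), of rev] by simp
  ultimately show thesis by (rule that)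
qed

lemma first_occurrence_unique:
  assumes "xs @ a # ys = us @ b # vs" "P a" "P b"
    and "\<And>z. z \<in> set xs \<Longrightarrow> \<not> P z" "\<And>z. z \<in> set us \<Longrightarrow> \<not> P z"
  shows "xs = us \<and> a = b \<and> ys = vs"
proof -
  obtain ws where ws: "us = xs @ ws" "a # ys = ws @ b # vs"
    by (rule before_first_occurrence[OF assms(1), of P, OF assms(3,4)])
  then have "ws = []" using assms(2,5) by (cases ws) auto
  then show ?thesis using ws by simp
qed

lemma last_occurrence_unique:
  assumes "xs @ a # ys = us @ b # vs" "P a" "P b"
    and "\<And>z. z \<in> set ys \<Longrightarrow> \<not> P z" "\<And>z. z \<in> set vs \<Longrightarrow> \<not> P z"
  shows "xs = us \<and> a = b \<and> ys = vs"
proof -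
  have "rev ys @ a # rev xs = rev vs @ b # rev us" using arg_cong[OF assms(1), of rev] by simp
  then have "rev ys = rev vs \<and> a = b \<and> rev xs = rev us"
    by (rule first_occurrence_unique[of _ _ _ _ _ _ P]) (use assms(2-) in auto)
  then show ?thesis by simp
qed

lemma append_Cons_before_notin:
  assumes eq: "Y @ a # L = X @ c # Z" and a: "a \<notin> set X" "a \<noteq> c"
  obtains W where "Y = X @ c # W"
proof -
  obtain W where "Y = X @ W" "c # Z = W @ a # L"
    by (rule before_first_occurrence[OF eq[symmetric], of "\<lambda>z. z = a"]) (use a in auto)
  then show thesis using that a(2) by (cases W) auto
qed

lemma outermost_occurrences:
  obtains (none) "\<And>b. b \<in> set L \<Longrightarrow> \<not> P b"
  | (one) X c Z where "L = X @ c # Z" "P c" "\<And>b. b \<in> set (X @ Z) \<Longrightarrow> \<not> P b"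
  | (two) X c M c' Z where "L = X @ c # M @ c' # Z" "P c" "P c'" "\<And>b. b \<in> set (X @ Z) \<Longrightarrow> \<not> P b"
proof (cases "\<exists>b\<in>set L. P b")
  case False
  then show thesis using none by blast
next
  case True
  then obtain X c Y where X: "L = X @ c # Y" "P c" "\<forall>b\<in>set X. \<not> P b" by (rule split_list_first_propE)
  show thesis
  proof (cases "\<exists>b\<in>set Y. P b")
    case False
    then show thesis using one[of X c Y] X by auto
  next
    case True
    then obtain M c' Z where "Y = M @ c' # Z" "P c'" "\<forall>b\<in>set Z. \<not> P b" by (rule split_list_last_propE)
    then show thesis using two[of X c M c' Z] X by auto
  qed
qed

lemma infix_between:
  assumes "q \<in> set L" "q' \<in> set L"
  obtains Qa M Qb where "L = Qa @ M @ Qb" "M \<noteq> []" "hd M = q \<and> last M = q' \<or> hd M = q' \<and> last M = q"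
proof -
  obtain A B where L: "L = A @ q # B" using assms(1) by (meson split_list)
  consider (same) "q' = q" | (before) "q' \<in> set A" | (after) "q' \<in> set B" using assms(2) L by auto
  then show thesis
  proof cases
    case same
    then show ?thesis using that[of A "[q]" B] L by simp
  next
    case before
    then obtain A1 A2 where "A = A1 @ q' # A2" by (meson split_list)
    then show ?thesis using that[of A1 "q' # A2 @ [q]" B] L by simp
  next
    case after
    then obtain B1 B2 where "B = B1 @ q' # B2" by (meson split_list)
    then show ?thesis using that[of A "q # B1 @ [q']" B2] L by simp
  qed
qed

lemma distinct_reorder: "distinct xs \<Longrightarrow> set ys = set xs \<Longrightarrow> length ys = length xs \<Longrightarrow> distinct ys"
  by (metis card_distinct distinct_card)

lemma card_subset_pair_le: "S \<subseteq> {a, b} \<Longrightarrow> card S \<le> 2"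
  using card_mono[of "{a, b}" S] card_insert_le_m1[of 2 "{b}" a] by simp

lemma symcl_iff: "(x, y) \<in> symcl S \<longleftrightarrow> (x, y) \<in> S \<or> (y, x) \<in> S"
  unfolding symcl_def by auto

lemma symcl_empty[simp]: "symcl {} = {}"
  by (auto simp: symcl_iff)

lemma symcl_insert[simp]: "symcl (insert (x, y) S) = insert (x, y) (insert (y, x) (symcl S))"
  by (auto simp: symcl_iff)

lemma symcl_Un: "symcl (A \<union> B) = symcl A \<union> symcl B"
  by (auto simp: symcl_iff)

definition path_edges :: "'a list \<Rightarrow> ('a \<times> 'a) set" where
  "path_edges p = symcl (set (vwalk_arcs p))"

lemma path_edges_simps[simp]:
  "path_edges [] = {}" "path_edges [a] = {}"
  "path_edges (a # b # p) = insert (a, b) (insert (b, a) (path_edges (b # p)))"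
  unfolding path_edges_def by auto

lemma path_edges_subset: "path_edges p \<subseteq> set p \<times> set p"
  by (induction p rule: induct_list012) auto

lemma path_edges_append:
  assumes "p \<noteq> []" "q \<noteq> []"
  shows "path_edges (p @ q) = path_edges p \<union> {(last p, hd q), (hd q, last p)} \<union> path_edges q"
  unfolding path_edges_def vwalk_arcs_append[OF assms] by (auto simp: symcl_iff)

lemma path_edges_snoc:
  "path_edges (a # p @ [b]) = path_edges (a # p) \<union> {(last (a # p), b), (b, last (a # p))}"
  using path_edges_append[of "a # p" "[b]"] by simp

lemma path_edges_glue: "path_edges (p @ b # q) = path_edges (p @ [b]) \<union> path_edges (b # q)"
  using path_edges_append[of p "b # q"] path_edges_append[of p "[b]"] by (cases "p = []") auto

lemma path_edges_rev: "path_edges (rev p) = path_edges p"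
proof (induction p rule: induct_list012)
  case (3 a b p)
  then show ?case using path_edges_glue[of "rev p" b "[a]"] by auto
qed auto

section \<open>Induced paths, induced cycles and connected sets\<close>

locale simple_graph =
  fixes V :: "'a set" and E :: "'a \<Rightarrow> 'a \<Rightarrow> bool"
  assumes finite_V: "finite V"
    and E_sym: "E a b \<Longrightarrow> E b a"
    and E_irrefl: "\<not> E a a"
    and E_V: "E a b \<Longrightarrow> a \<in> V"
begin

lemma E_commute: "E a b \<longleftrightarrow> E b a"
  using E_sym by blast

definition nbrs_in :: "'a \<Rightarrow> 'a set \<Rightarrow> 'a set" where
  "nbrs_in v S = {h\<in>S. E v h}"

definition edges_between :: "'a set \<Rightarrow> 'a set \<Rightarrow> ('a \<times> 'a) set" where
  "edges_between A B = {(a, b). a \<in> A \<and> b \<in> B \<and> E a b}"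

definition adj_on :: "'a set \<Rightarrow> ('a \<times> 'a) set" where
  "adj_on Q = {(a, b). a \<in> Q \<and> b \<in> Q \<and> E a b}"

fun induced_path :: "'a list \<Rightarrow> bool" where
  "induced_path [] \<longleftrightarrow> True"
| "induced_path (a # xs) \<longleftrightarrow>
     a \<in> V \<and> a \<notin> set xs \<and> induced_path xs \<and> (\<forall>b\<in>set xs. E a b \<longleftrightarrow> b = hd xs)"

fun induced_cycle :: "'a list \<Rightarrow> bool" where
  "induced_cycle [] \<longleftrightarrow> False"
| "induced_cycle (a # xs) \<longleftrightarrow> 2 \<le> length xs \<and> a \<in> V \<and> a \<notin> set xs \<and> induced_path xs
     \<and> (\<forall>b\<in>set xs. E a b \<longleftrightarrow> b = hd xs \<or> b = last xs)"

definition connected_set :: "'a set \<Rightarrow> bool" where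
  "connected_set Q \<longleftrightarrow> Q \<noteq> {} \<and> Q \<subseteq> V \<and> (\<forall>a\<in>Q. \<forall>b\<in>Q. (a, b) \<in> (adj_on Q)\<^sup>*)"

lemma nbrs_in_insert:
  "nbrs_in v (insert a S) = (if E v a then insert a (nbrs_in v S) else nbrs_in v S)" "nbrs_in v {} = {}"
  unfolding nbrs_in_def by auto

lemma card_nbrs_in_mono: "S \<subseteq> T \<Longrightarrow> finite T \<Longrightarrow> card (nbrs_in v S) \<le> card (nbrs_in v T)"
  unfolding nbrs_in_def by (intro card_mono) auto

lemma adj_on_Un: "adj_on (A \<union> B) = adj_on A \<union> adj_on B \<union> symcl (edges_between A B)"
  unfolding adj_on_def edges_between_def by (auto simp: symcl_iff E_commute)

lemma adj_on_insert:
  "adj_on (insert a S) = symcl (Pair a ` nbrs_in a S) \<union> adj_on S" "adj_on {} = {}"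
  unfolding adj_on_def nbrs_in_def using E_irrefl by (auto simp: symcl_iff E_commute)

lemma adj_on_singleton[simp]: "adj_on {a} = {}"
  unfolding adj_on_def using E_irrefl by auto

lemma edges_between_Un: "edges_between (A \<union> B) C = edges_between A C \<union> edges_between B C"
  "edges_between A (B \<union> C) = edges_between A B \<union> edges_between A C"
  unfolding edges_between_def by auto

lemma induced_path_distinct: "induced_path xs \<Longrightarrow> distinct xs"
  by (induction xs) auto

lemma induced_path_subset: "induced_path xs \<Longrightarrow> set xs \<subseteq> V"
  by (induction xs) auto

lemma induced_path_append:
  "induced_path (xs @ ys) \<longleftrightarrow> induced_path xs \<and> induced_path ys \<and> set xs \<inter> set ys = {}
     \<and> (\<forall>a\<in>set xs. \<forall>b\<in>set ys. E a b \<longleftrightarrow> a = last xs \<and> b = hd ys)"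
proof (induction xs)
  case (Cons a xs)
  show ?case
  proof (cases "xs = []")
    case False
    then have ends: "last (a # xs) = last xs" "last xs \<in> set xs" "hd (xs @ ys) = hd xs" "hd xs \<in> set xs"
      by auto
    show ?thesis
      unfolding append_Cons induced_path.simps Cons.IH ends
      using ends(2,4) by (auto 0 3)
  qed auto
qed auto

lemma induced_cycle_append:
  assumes "xs \<noteq> []" "ys \<noteq> []"
  shows "induced_cycle (xs @ ys) \<longleftrightarrow>
     3 \<le> length (xs @ ys) \<and> induced_path xs \<and> induced_path ys \<and> set xs \<inter> set ys = {}
     \<and> (\<forall>a\<in>set xs. \<forall>b\<in>set ys. E a b \<longleftrightarrow> a = last xs \<and> b = hd ys \<or> a = hd xs \<and> b = last ys)"
    (is "_ \<longleftrightarrow> ?split")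
proof -
  obtain a zs where xs: "xs = a # zs" using assms(1) by (cases xs) auto
  show ?thesis
  proof (cases "zs = []")
    case True
    then show ?thesis using assms(2) by (auto simp: xs)
  next
    case False
    have ends: "last xs = last zs" "last zs \<in> set zs" "hd xs = a" "last (zs @ ys) = last ys"
      "last ys \<in> set ys"
      "hd (zs @ ys) = hd zs" "hd zs \<in> set zs" "hd ys \<in> set ys"
      using False assms(2) by (auto simp: xs)
    show ?thesis
    proof (cases "3 \<le> length (xs @ ys) \<and> a \<notin> set zs \<and> a \<notin> set ys \<and> set zs \<inter> set ys = {}
        \<and> induced_path zs \<and> induced_path ys \<and> a \<in> V")
      case True
      have "induced_cycle (xs @ ys) \<longleftrightarrow> (\<forall>b\<in>set zs. \<forall>c\<in>set ys. E b c \<longleftrightarrow> b = last zs \<and> c = hd ys)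
          \<and> (\<forall>b\<in>set zs. E a b \<longleftrightarrow> b = hd zs) \<and> (\<forall>c\<in>set ys. E a c \<longleftrightarrow> c = last ys)"
        using True ends unfolding xs append_Cons induced_cycle.simps induced_path_append ends(4,6)
        by (auto 0 3)
      also have "\<dots> \<longleftrightarrow> ?split"
        using True ends unfolding ends(1,3) unfolding xs by (auto 0 3)
      finally show ?thesis .
    next
      case False
      then show ?thesis unfolding xs append_Cons induced_cycle.simps induced_path_append by auto
    qed
  qed
qed

lemma induced_cycle_distinct: "induced_cycle xs \<Longrightarrow> distinct xs"
  by (cases xs) (auto dest: induced_path_distinct)

lemma induced_cycle_subset: "induced_cycle xs \<Longrightarrow> set xs \<subseteq> V"
  by (cases xs) (auto dest: induced_path_subset)

lemma induced_cycle_rotate: "induced_cycle (xs @ ys) \<Longrightarrow> induced_cycle (ys @ xs)"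
proof (cases "xs = [] \<or> ys = []")
  case False
  assume cyc: "induced_cycle (xs @ ys)"
  have "E a b \<longleftrightarrow> a = last ys \<and> b = hd xs \<or> a = hd ys \<and> b = last xs"
    if "a \<in> set ys" "b \<in> set xs" for a b
    using cyc False that E_commute[of a b] by (auto simp: induced_cycle_append)
  then show ?thesis using cyc False by (simp add: induced_cycle_append Int_commute)
qed auto

lemma induced_path_rev: "induced_path (rev xs) \<longleftrightarrow> induced_path xs"
proof (induction xs)
  case (Cons a xs)
  show ?case using Cons.IH by (auto simp: induced_path_append last_rev E_commute)
qed auto

lemma induced_path_join:
  assumes paths: "induced_path (u # Y)" "induced_path (u # Z)"
    and apart: "set Y \<inter> set Z = {}" "edges_between (set Y) (set Z) = {}"
  shows "induced_path (rev Y @ u # Z)"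
proof -
  have "induced_path (rev Y @ [u])" using paths(1) induced_path_rev[of "u # Y"] by simp
  then have "induced_path ((rev Y @ [u]) @ Z)"
    using paths apart unfolding induced_path_append[of "rev Y @ [u]"] edges_between_def by auto
  then show ?thesis by simp
qed

lemma induced_cycle_rev: "induced_cycle xs \<Longrightarrow> induced_cycle (rev xs)"
proof -
  assume cyc: "induced_cycle xs"
  then obtain b ys where xs: "xs = b # ys" by (cases xs) auto
  with cyc have "ys \<noteq> []" by auto
  then have "induced_cycle ([b] @ rev ys)"
    using cyc by (auto simp: xs induced_path_rev hd_rev last_rev)
  then have "induced_cycle (rev ys @ [b])" by (rule induced_cycle_rotate)
  then show ?thesis by (simp add: xs)
qed

lemma induced_path_infix: "induced_path (xs @ ys @ zs) \<Longrightarrow> induced_path ys"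
  by (auto simp: induced_path_append)

lemma induced_cycle_infix:
  assumes "induced_cycle (xs @ ys @ zs)" "xs @ zs \<noteq> []"
  shows "induced_path ys"
proof (cases "ys = []")
  case False
  have "induced_cycle (ys @ zs @ xs)" using assms(1) induced_cycle_rotate[of xs "ys @ zs"] by simp
  then show ?thesis using False assms(2) by (subst (asm) induced_cycle_append) auto
qed auto

lemma induced_cycle_cross:
  assumes "induced_cycle (xs @ ys)" "a \<in> set xs" "b \<in> set ys"
  shows "E a b \<longleftrightarrow> a = last xs \<and> b = hd ys \<or> a = hd xs \<and> b = last ys"
  using assms by (subst (asm) induced_cycle_append) auto

lemma induced_cycle_bypass:
  assumes "induced_cycle (xs @ ys)" "2 \<le> length xs" "ys \<noteq> []" "v \<in> V" "v \<notin> set xs"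
    and "E v (hd xs)" "E v (last xs)" "\<And>b. b \<in> set (butlast (tl xs)) \<Longrightarrow> \<not> E v b"
  shows "induced_cycle (v # xs)"
proof -
  have path: "induced_path xs" using induced_cycle_infix[of "[]" xs ys] assms by auto
  obtain a bs where xs: "xs = a # bs" using assms(2) by (cases xs) auto
  then obtain ms c where bs: "bs = ms @ [c]" using assms(2) by (cases bs rule: rev_cases) auto
  show ?thesis using assms path by (auto simp: xs bs)
qed

lemma induced_cycle_bypass_Cons:
  assumes "induced_cycle (c # I @ c' # Z)" "Z \<noteq> []" "v \<in> V" "v \<notin> set (c # I @ [c'])" "E v c" "E v c'"
    "\<And>b. b \<in> set I \<Longrightarrow> \<not> E v b"
  shows "induced_cycle (v # c # I @ [c'])"
  by (rule induced_cycle_bypass[of "c # I @ [c']" Z]) (use assms in auto)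

lemma adj_on_induced_path: "induced_path p \<Longrightarrow> adj_on (set p) = path_edges p"
proof (induction p rule: induct_list012)
  case 1
  then show ?case by (simp add: adj_on_def)
next
  case (2 a)
  then show ?case by simp
next
  case (3 a b p)
  have "edges_between {a} (set (b # p)) = {(a, b)}" using 3 unfolding edges_between_def by auto
  moreover have "adj_on (set (b # p)) = path_edges (b # p)" using 3 by simp
  ultimately show ?case using adj_on_Un[of "{a}" "set (b # p)"] by (simp add: insert_commute)
qed

lemma adj_on_induced_cycle:
  assumes "induced_cycle (a # L)"
  shows "adj_on (set (a # L)) = path_edges (a # L @ [a])"
proof -
  have L: "L \<noteq> []" using assms by auto
  then have "edges_between {a} (set L) = {(a, hd L), (a, last L)}"
    using assms unfolding edges_between_def by auto
  then have "adj_on (set (a # L)) = path_edges L \<union> symcl {(a, hd L), (a, last L)}"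
    using adj_on_Un[of "{a}" "set L"] adj_on_induced_path[of L] assms by simp
  also have "\<dots> = path_edges (a # L @ [a])"
    using L path_edges_append[of "[a]" "L @ [a]"] path_edges_append[of L "[a]"] by auto
  finally show ?thesis .
qed

lemma adj_on_inject: "adj_on S = R \<Longrightarrow> a \<in> S \<Longrightarrow> b \<in> S \<Longrightarrow> E a b \<longleftrightarrow> (a, b) \<in> R"
  unfolding adj_on_def by blast

lemma adj_on_path_edges_tl:
  assumes "adj_on (insert a (set p)) = R \<union> path_edges p" "a \<notin> set p" "\<And>y z. (y, z) \<in> R \<Longrightarrow> y = a \<or> z = a"
  shows "adj_on (set p) = path_edges p"
proof -
  have "adj_on (set p) = {e \<in> adj_on (insert a (set p)). fst e \<in> set p \<and> snd e \<in> set p}"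
    unfolding adj_on_def by auto
  then show ?thesis using assms path_edges_subset[of p] by fastforce
qed

lemma induced_pathI:
  "distinct p \<Longrightarrow> set p \<subseteq> V \<Longrightarrow> adj_on (set p) = path_edges p \<Longrightarrow> induced_path p"
proof (induction p rule: induct_list012)
  case (3 a b p)
  have "adj_on (set (b # p)) = path_edges (b # p)"
    by (rule adj_on_path_edges_tl[of a _ "{(a, b), (b, a)}"]) (use 3(3,5) in auto)
  then have path: "induced_path (b # p)" using 3 by simp
  have "E a c \<longleftrightarrow> c = b" if c: "c \<in> set (b # p)" for c
    using adj_on_inject[OF 3(5), of a c] c 3(3) path_edges_subset[of "b # p"] by auto
  then show ?case using path 3(3,4) by auto
qed auto

lemma induced_cycleI:
  assumes dist: "distinct (a # L)" and len: "2 \<le> length L" and V: "set (a # L) \<subseteq> V"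
    and adj: "adj_on (set (a # L)) = path_edges (a # L @ [a])"
  shows "induced_cycle (a # L)"
proof -
  have L: "L \<noteq> []" using len by auto
  have edges: "path_edges (a # L @ [a]) = symcl {(a, hd L), (a, last L)} \<union> path_edges L"
    using L path_edges_append[of "[a]" "L @ [a]"] path_edges_append[of L "[a]"] by auto
  have "adj_on (set L) = path_edges L"
    by (rule adj_on_path_edges_tl[of a _ "symcl {(a, hd L), (a, last L)}"])
      (use adj dist in \<open>auto simp del: symcl_insert simp: edges symcl_iff\<close>)
  then have "induced_path L" using dist V by (intro induced_pathI) auto
  moreover have "E a c \<longleftrightarrow> c = hd L \<or> c = last L" if "c \<in> set L" for c
    using adj_on_inject[OF adj, of a c] that dist path_edges_subset[of L] unfolding edges by auto
  ultimately show ?thesis using dist len V by auto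
qed

lemma rtrancl_adj_on_mono: "Q \<subseteq> R \<Longrightarrow> (a, b) \<in> (adj_on Q)\<^sup>* \<Longrightarrow> (a, b) \<in> (adj_on R)\<^sup>*"
  using rtrancl_mono[of "adj_on Q" "adj_on R"] unfolding adj_on_def by blast

lemma sym_rtrancl_adj_on: "sym ((adj_on Q)\<^sup>*)"
  unfolding adj_on_def by (rule sym_rtrancl) (auto simp: sym_def E_commute)

lemma connected_setI:
  assumes "r \<in> Q" "Q \<subseteq> V" "\<And>a. a \<in> Q \<Longrightarrow> (r, a) \<in> (adj_on Q)\<^sup>*"
  shows "connected_set Q"
  unfolding connected_set_def using assms sym_rtrancl_adj_on by (meson empty_iff rtrancl_trans symD)

lemma connected_set_reach: "connected_set Q \<Longrightarrow> a \<in> Q \<Longrightarrow> b \<in> Q \<Longrightarrow> Q \<subseteq> R \<Longrightarrow> (a, b) \<in> (adj_on R)\<^sup>*"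
  unfolding connected_set_def using rtrancl_adj_on_mono by blast

lemma connected_set_singleton: "a \<in> V \<Longrightarrow> connected_set {a}"
  by (rule connected_setI) auto

lemma connected_set_induced_path: "induced_path p \<Longrightarrow> p \<noteq> [] \<Longrightarrow> connected_set (set p)"
proof (rule connected_setI[of "hd p"])
  fix c assume "induced_path p" "c \<in> set p"
  then show "(hd p, c) \<in> (adj_on (set p))\<^sup>*"
  proof (induction p)
    case (Cons d p)
    show ?case
    proof (cases "c = d")
      case False
      then have c: "c \<in> set p" "p \<noteq> []" using Cons.prems by auto
      then have "(d, hd p) \<in> adj_on (set (d # p))" using Cons.prems unfolding adj_on_def by auto
      moreover have "(hd p, c) \<in> (adj_on (set (d # p)))\<^sup>*"
        by (rule rtrancl_adj_on_mono[OF _ Cons.IH]) (use Cons.prems c in auto)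
      ultimately show ?thesis unfolding list.sel by (rule converse_rtrancl_into_rtrancl)
    qed simp
  qed simp
qed (use induced_path_subset in auto)

lemma connected_set_star:
  assumes x: "x \<in> V"
    and D: "\<And>d. d \<in> D \<Longrightarrow> \<exists>s. induced_path s \<and> d \<in> set s \<and> set s \<subseteq> D \<and> (\<exists>q\<in>set s. E x q)"
  shows "connected_set (insert x D)"
proof (rule connected_setI[of x])
  show "insert x D \<subseteq> V" using x D induced_path_subset by blast
  fix d assume d: "d \<in> insert x D"
  show "(x, d) \<in> (adj_on (insert x D))\<^sup>*"
  proof (cases "d = x")
    case False
    then obtain s q where s: "induced_path s" "d \<in> set s" "set s \<subseteq> D" "q \<in> set s" "E x q"
      using D d by blast
    then have "(x, q) \<in> adj_on (insert x D)" unfolding adj_on_def by auto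
    moreover have "(q, d) \<in> (adj_on (insert x D))\<^sup>*"
      by (rule connected_set_reach[OF connected_set_induced_path[of s]]) (use s in auto)
    ultimately show ?thesis by (rule converse_rtrancl_into_rtrancl)
  qed simp
qed simp

lemma connected_set_union_meet:
  assumes "connected_set A" "connected_set B" "A \<inter> B \<noteq> {}"
  shows "connected_set (A \<union> B)"
proof -
  obtain z where z: "z \<in> A" "z \<in> B" using assms by blast
  show ?thesis
  proof (rule connected_setI[of z])
    show "A \<union> B \<subseteq> V" using assms unfolding connected_set_def by blast
    show "(z, a) \<in> (adj_on (A \<union> B))\<^sup>*" if "a \<in> A \<union> B" for a
      using that connected_set_reach[OF assms(1) z(1), of a "A \<union> B"]
        connected_set_reach[OF assms(2) z(2), of a "A \<union> B"] by blast
  qed (use z in simp)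
qed

lemma connected_set_union:
  assumes "connected_set A" "connected_set B" "a \<in> A" "b \<in> B" "E a b"
  shows "connected_set (A \<union> B)"
proof (rule connected_setI[of a])
  show "A \<union> B \<subseteq> V" using assms unfolding connected_set_def by blast
  have ab: "(a, b) \<in> adj_on (A \<union> B)" using assms unfolding adj_on_def by auto
  fix c assume "c \<in> A \<union> B"
  then show "(a, c) \<in> (adj_on (A \<union> B))\<^sup>*"
  proof
    assume "c \<in> B"
    then have "(b, c) \<in> (adj_on (A \<union> B))\<^sup>*" using connected_set_reach[OF assms(2,4)] by blast
    then show ?thesis using ab by (rule converse_rtrancl_into_rtrancl[rotated])
  qed (use connected_set_reach[OF assms(1,3)] in blast)
qed (use assms in simp)

lemma connected_set_insert:
  assumes "connected_set Q" "q \<in> Q" "E q w"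
  shows "connected_set (insert w Q)"
  using connected_set_union[OF assms(1) connected_set_singleton[OF E_V[OF E_sym[OF assms(3)]]] assms(2)
    _ assms(3)]
  by simp

lemma connected_set_obtain_path:
  assumes "connected_set Q" "a \<in> Q" "b \<in> Q"
  obtains p where "induced_path p" "p \<noteq> []" "set p \<subseteq> Q" "hd p = a" "last p = b"
proof -
  have Q: "Q \<subseteq> V" using assms(1) unfolding connected_set_def by blast
  have "(a, b) \<in> (adj_on Q)\<^sup>*" using assms unfolding connected_set_def by blast
  then have "\<exists>p. induced_path p \<and> p \<noteq> [] \<and> set p \<subseteq> Q \<and> hd p = a \<and> last p = b"
  proof (induction rule: rtrancl_induct)
    case base
    show ?case using assms Q by (intro exI[of _ "[a]"]) auto
  next
    case (step b c)
    then obtain p where p: "induced_path p" "p \<noteq> []" "set p \<subseteq> Q" "hd p = a" "last p = b" by blast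
    have bc: "E b c" "c \<in> Q" using step unfolding adj_on_def by auto
    have "\<exists>z\<in>set p. z = c \<or> E z c" using p bc by (metis last_in_set)
    then obtain p1 z p2 where z: "p = p1 @ z # p2" "z = c \<or> E z c" "\<forall>y\<in>set p1. \<not> (y = c \<or> E y c)"
      by (rule split_list_first_propE)
    have path: "induced_path (p1 @ [z])" using induced_path_infix[of "[]" "p1 @ [z]" p2] p(1) z(1)
      by simp
    show ?case
    proof (cases "z = c")
      case True
      then show ?thesis using path p z(1) bc by (intro exI[of _ "p1 @ [c]"]) (cases p1; auto)
    next
      case False
      have "induced_path ((p1 @ [z]) @ [c])"
        unfolding induced_path_append[of "p1 @ [z]"] using path z False bc Q by auto
      then show ?thesis using p z(1) bc by (intro exI[of _ "p1 @ [z, c]"]) (cases p1; auto)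
    qed
  qed
  then show thesis using that by blast
qed

lemma induced_path_successively: "induced_path p \<Longrightarrow> successively E p"
  by (induction p rule: induct_list012) auto

lemma induced_cycle_successively:
  assumes "induced_cycle L"
  shows "successively E L"
proof (cases L)
  case (Cons a M)
  then have "induced_path M" "M \<noteq> []" using assms by auto
  moreover then have "E a (hd M)" using assms Cons by simp
  ultimately show ?thesis using Cons induced_path_successively[of M] by (cases M) auto
qed simp

lemma induced_cycle_reorient: "induced_cycle (e # M) \<Longrightarrow> induced_cycle (e # rev M)"
  using induced_cycle_rev[of "e # M"] induced_cycle_rotate[of "rev M" "[e]"]
  by (simp del: induced_cycle.simps)

lemma induced_cycle_walk_step:
  assumes L: "induced_cycle (p @ Z)" and p: "p \<noteq> []" "E (last p) y" "y \<in> set Z"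
  shows "Z = y # tl Z \<or> (\<exists>e. p = [e] \<and> rev Z = y # tl (rev Z))"
proof -
  have Z: "Z \<noteq> []" using p by auto
  consider (forward) "y = hd Z" | (backward) "last p = hd p" "y = last Z"
    using induced_cycle_cross[OF L last_in_set[OF p(1)] p(3)] p(2) by auto
  then show ?thesis
  proof cases
    case forward
    then show ?thesis using Z by auto
  next
    case backward
    have "distinct p" using induced_cycle_distinct[OF L] by simp
    then have "tl p = []" using backward p(1) by (cases p) (auto split: if_splits)
    then have "p = [hd p]" using p(1) by (cases p) auto
    moreover have "rev Z = y # tl (rev Z)" using backward Z
      by (metis hd_rev list.collapse rev_is_Nil_conv)
    ultimately show ?thesis by blast
  qed
qed

lemma induced_cycle_walk:
  assumes "induced_cycle (e # M)" "successively E p" "distinct p" "set p \<subseteq> set (e # M)" "p \<noteq> []"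
    "hd p = e"
  shows "\<exists>Z. e # M = p @ Z \<or> e # rev M = p @ Z"
  using assms(2-)
proof (induction p rule: rev_induct)
  case (snoc y p)
  show ?case
  proof (cases "p = []")
    case True
    then show ?thesis using snoc by auto
  next
    case False
    have walk: "successively E p" "E (last p) y" using snoc(2) False
      by (auto simp: successively_append_iff)
    moreover have "hd p = e" using snoc(6) False by simp
    ultimately obtain Z where Z: "e # M = p @ Z \<or> e # rev M = p @ Z" using snoc(1,3,4) False by auto
    have "y \<in> set (p @ Z)" using snoc(4) Z by (metis in_set_conv_decomp list.simps(15) set_rev subsetD)
    then have yZ: "y \<in> set Z" using snoc(3) by auto
    have "induced_cycle (p @ Z)" using Z assms(1) induced_cycle_reorient by metis
    from induced_cycle_walk_step[OF this False walk(2) yZ] show ?thesis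
    proof
      assume "Z = y # tl Z"
      then have "p @ Z = (p @ [y]) @ tl Z" by (metis append.assoc append_Cons append_Nil)
      then show ?thesis using Z by metis
    next
      assume "\<exists>e. p = [e] \<and> rev Z = y # tl (rev Z)"
      then have p: "p = [e]" "rev Z = y # tl (rev Z)" using snoc(6) by auto
      then have "e # rev Z = (p @ [y]) @ tl (rev Z)" by simp
      moreover have "e # M = e # rev Z \<or> e # rev M = e # rev Z" using Z p(1) by auto
      ultimately show ?thesis by metis
    qed
  qed
qed simp

end

section \<open>Subdivided complete graphs and prisms\<close>

lemma path_edges_inner:
  assumes "(y, z) \<in> path_edges (u # ws @ [v])" "ws \<noteq> []"
  shows "y \<in> set ws \<or> z \<in> set ws"
  using assms path_edges_append[of "[u]" "ws @ [v]"] path_edges_append[of ws "[v]"]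
    path_edges_subset[of ws]
  by auto

lemma subdivide_path:
  assumes "subdivision_pair K H" "(u, v) \<in> parcs H" "distinct ws" "set ws \<inter> pverts H = {}"
  shows "\<exists>H'. subdivision_pair K H' \<and> pverts H' = pverts H \<union> set ws
     \<and> parcs H' = (parcs H - {(u, v), (v, u)}) \<union> path_edges (u # ws @ [v])"
  using assms
proof (induction ws arbitrary: u H)
  case Nil
  interpret H: pair_bidirected_digraph H using bidirected_digraphI_subdivision[OF Nil(1)] .
  have "(v, u) \<in> parcs H" using Nil(2) H.arcs_symmetric by blast
  then show ?case using Nil by (intro exI[of _ H]) auto
next
  case (Cons w ws)
  interpret H: pair_bidirected_digraph H using bidirected_digraphI_subdivision[OF Cons(2)] .
  have uv: "u \<noteq> v" "u \<in> pverts H" "v \<in> pverts H"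
    using H.pair_no_loops[OF Cons(3)] H.arc_fst_in_verts[OF Cons(3)] H.arc_snd_in_verts[OF Cons(3)]
    by auto
  have w: "w \<notin> pverts H" using Cons by auto
  have w_isolated: "(w, y) \<notin> parcs H" "(y, w) \<notin> parcs H" for y
    using H.arc_fst_in_verts[of "(w, y)"] H.arc_snd_in_verts[of "(y, w)"] w by auto
  let ?H = "subdivide H (u, v) w"
  have subdivision: "subdivision_pair K ?H" using subdivision_pair_divide[OF Cons(3) w Cons(2)] .
  have "(w, v) \<in> parcs ?H" by simp
  moreover have "distinct ws" "set ws \<inter> pverts ?H = {}" using Cons by auto
  ultimately obtain H' where H': "subdivision_pair K H'" "pverts H' = pverts ?H \<union> set ws"
     "parcs H' = (parcs ?H - {(w, v), (v, w)}) \<union> path_edges (w # ws @ [v])"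
    using Cons(1)[OF subdivision] by blast
  have "parcs H' = (parcs H - {(u, v), (v, u)}) \<union> path_edges (u # (w # ws) @ [v])"
    unfolding H'(3) using w_isolated uv w by auto
  then show ?case using H' by (intro exI[of _ H']) auto
qed

definition end_arcs :: "('a \<times> 'a list \<times> 'a) list \<Rightarrow> ('a \<times> 'a) list" where
  "end_arcs ps = concat (map (\<lambda>(u, ws, v). [(u, v), (v, u)]) ps)"

definition inner_verts :: "('a \<times> 'a list \<times> 'a) list \<Rightarrow> 'a list" where
  "inner_verts ps = concat (map (\<lambda>(u, ws, v). ws) ps)"

lemma end_arcs_simps[simp]: "end_arcs [] = []" "end_arcs ((u, ws, v) # ps)
  = (u, v) # (v, u) # end_arcs ps"
  and inner_verts_simps[simp]: "inner_verts [] = []" "inner_verts ((u, ws, v) # ps)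
    = ws @ inner_verts ps"
  by (simp_all add: end_arcs_def inner_verts_def)

lemma subdivide_paths:
  assumes "subdivision_pair K H" "parcs H = set (end_arcs ps) \<union> F" "F \<inter> set (end_arcs ps) = {}"
    and "distinct (end_arcs ps)" "distinct (inner_verts ps)" "set (inner_verts ps) \<inter> pverts H = {}"
  shows "\<exists>H'. subdivision_pair K H' \<and> pverts H' = pverts H \<union> set (inner_verts ps)
     \<and> parcs H' = (\<Union>(u, ws, v)\<in>set ps. path_edges (u # ws @ [v])) \<union> F"
  using assms
proof (induction ps arbitrary: H F)
  case Nil
  then show ?case by (intro exI[of _ H]) auto
next
  case (Cons p ps)
  obtain u ws v where p: "p = (u, ws, v)" by (cases p)
  let ?rest = "set (end_arcs ps)" and ?F = "F \<union> path_edges (u # ws @ [v])"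
  have dist: "distinct (end_arcs ps)" "distinct (inner_verts ps)" using Cons.prems(4,5)
    by (auto simp: p)
  interpret H: pair_bidirected_digraph H using bidirected_digraphI_subdivision[OF Cons(2)] .
  have rest: "?rest \<subseteq> parcs H" "(u, v) \<notin> ?rest" "(v, u) \<notin> ?rest"
    using Cons.prems(2,4) by (auto simp: p)
  have "(u, v) \<in> parcs H" "distinct ws" "set ws \<inter> pverts H = {}" using Cons.prems by (auto simp: p)
  then obtain H1 where subdivided: "subdivision_pair K H1" "pverts H1 = pverts H \<union> set ws"
    "parcs H1 = (parcs H - {(u, v), (v, u)}) \<union> path_edges (u # ws @ [v])"
    using subdivide_path[OF Cons.prems(1)] by blast
  have arcs: "parcs H1 = ?rest \<union> ?F"
    unfolding subdivided(3) Cons.prems(2) using Cons.prems(3) rest(2,3) by (auto simp: p)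
  have disjoint: "?F \<inter> ?rest = {}"
  proof -
    have "(y, z) \<notin> path_edges (u # ws @ [v])" if "(y, z) \<in> ?rest" for y z
    proof (cases "ws = []")
      case False
      have "y \<in> pverts H" "z \<in> pverts H"
        using that rest(1) H.arc_fst_in_verts[of "(y, z)"] H.arc_snd_in_verts[of "(y, z)"] by auto
      then show ?thesis using path_edges_inner[OF _ False] \<open>set ws \<inter> pverts H = {}\<close> by blast
    qed (use that rest in auto)
    then show ?thesis using Cons.prems(3) by (auto simp: p)
  qed
  have "set (inner_verts ps) \<inter> pverts H1 = {}"
    using Cons.prems(5,6) unfolding subdivided(2) by (auto simp: p)
  from Cons.IH[OF subdivided(1) arcs disjoint dist this] show ?case
    unfolding subdivided(2) by (simp add: p Un_ac)
qed

lemma subdivided_K4I: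
  assumes dist: "distinct ([a, b, c, d] @ p1 @ p2 @ p3 @ p4 @ p5 @ p6)"
    and verts: "pverts H = set ([a, b, c, d] @ p1 @ p2 @ p3 @ p4 @ p5 @ p6)"
    and arcs: "parcs H = path_edges (a # p1 @ [b]) \<union> path_edges (a # p2 @ [c])
      \<union> path_edges (a # p3 @ [d])
      \<union> path_edges (b # p4 @ [c]) \<union> path_edges (b # p5 @ [d]) \<union> path_edges (c # p6 @ [d])"
  shows "is_subdivided_K4 H"
proof -
  let ?V = "{a, b, c, d}"
  let ?K = "\<lparr>pverts = ?V, parcs = {(u, v). (u, v) \<in> ?V \<times> ?V \<and> u \<noteq> v}\<rparr>"
  let ?ps = "[(a, p1, b), (a, p2, c), (a, p3, d), (b, p4, c), (b, p5, d), (c, p6, d)]"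
  have K: "K\<^bsub>4\<^esub> (with_proj ?K)" unfolding complete_digraph_pair_def using dist by auto
  have "pair_bidirected_digraph ?K" by unfold_locales (auto simp: symmetric_def sym_def)
  then have base: "subdivision_pair ?K ?K" by (rule subdivision_pair_base)
  have "parcs ?K = set (end_arcs ?ps) \<union> {}" using dist by auto
  from subdivide_paths[OF base this] obtain H' where H': "subdivision_pair ?K H'"
    "pverts H' = ?V \<union> set (p1 @ p2 @ p3 @ p4 @ p5 @ p6)"
    "parcs H' = (\<Union>(u, ws, v)\<in>set ?ps. path_edges (u # ws @ [v]))"
    using dist by (auto simp: Un_assoc)
  have "pverts H' = pverts H" "parcs H' = parcs H" using H'(2,3) verts arcs by (auto simp: Un_assoc)
  then have "H' = H" by (cases H'; cases H) simp
  then show ?thesis unfolding is_subdivided_K4_def using K H'(1) by blast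
qed

context simple_graph
begin

lemma edges_between_restrict:
  "edges_between A B = X \<Longrightarrow> A' \<subseteq> A \<Longrightarrow> B' \<subseteq> B \<Longrightarrow> X \<subseteq> A' \<times> B' \<Longrightarrow> edges_between A' B' = X"
  unfolding edges_between_def by auto

lemma adj_on_cycle_three_arcs:
  assumes "induced_cycle (a # A1 @ b # A2 @ c # A3)"
  shows "adj_on (set (a # A1 @ b # A2 @ c # A3))
    = path_edges (a # A1 @ [b]) \<union> path_edges (b # A2 @ [c]) \<union> path_edges (a # rev A3 @ [c])"
  using adj_on_induced_cycle[OF assms] path_edges_glue[of "a # A1" b "A2 @ c # A3 @ [a]"]
    path_edges_glue[of "b # A2" c "A3 @ [a]"] path_edges_rev[of "c # A3 @ [a]"] by auto

definition spider :: "'a \<Rightarrow> 'a list \<Rightarrow> 'a list \<Rightarrow> 'a list \<Rightarrow> bool" where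
  "spider u la lb lc \<longleftrightarrow> distinct (u # la @ lb @ lc) \<and> set (u # la @ lb @ lc) \<subseteq> V
     \<and> adj_on (set (u # la @ lb @ lc)) = path_edges (u # la) \<union> path_edges (u # lb)
       \<union> path_edges (u # lc)"

definition legged_triangle :: "'a \<Rightarrow> 'a list \<Rightarrow> 'a \<Rightarrow> 'a list \<Rightarrow> 'a \<Rightarrow> 'a list \<Rightarrow> bool" where
  "legged_triangle wa la wb lb wc lc \<longleftrightarrow>
     distinct ((wa # la) @ (wb # lb) @ (wc # lc)) \<and> set ((wa # la) @ (wb # lb) @ (wc # lc)) \<subseteq> V
     \<and> adj_on (set ((wa # la) @ (wb # lb) @ (wc # lc)))
       = path_edges (wa # la) \<union> path_edges (wb # lb) \<union> path_edges (wc # lc)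
         \<union> symcl {(wa, wb), (wb, wc), (wc, wa)}"

lemma legged_triangle_rotate: "legged_triangle wa la wb lb wc lc \<Longrightarrow> legged_triangle wb lb wc lc wa la"
  unfolding legged_triangle_def
  by (auto simp: insert_commute Un_ac)

lemma spider_on_path: "induced_path (R1 @ r # R2) \<Longrightarrow> spider r (rev R1) R2 []"
  unfolding spider_def
  using induced_path_distinct[of "R1 @ r # R2"] induced_path_subset[of "R1 @ r # R2"]
    adj_on_induced_path[of "R1 @ r # R2"] path_edges_glue[of R1 r R2] path_edges_rev[of "R1 @ [r]"]
  by auto

lemma spider_path_with_leg:
  assumes R: "induced_path (R1 @ r # R2)" and S: "induced_path S" "S \<noteq> []"
    and disjoint: "set S \<inter> set (R1 @ r # R2) = {}"
    and edges: "edges_between (set S) (set (R1 @ r # R2)) = {(hd S, r)}"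
  shows "spider r (rev R1) R2 S"
proof -
  have "adj_on (set S \<union> set (R1 @ r # R2))
    = path_edges S \<union> path_edges (R1 @ r # R2) \<union> symcl {(hd S, r)}"
    unfolding adj_on_Un edges adj_on_induced_path[OF R] adj_on_induced_path[OF S(1)] by (rule refl)
  also have "\<dots> = path_edges (r # rev R1) \<union> path_edges (r # R2) \<union> path_edges (r # S)"
    using path_edges_glue[of R1 r R2] path_edges_rev[of "R1 @ [r]"] path_edges_append[of "[r]" S] S(2)
    by auto
  finally have "adj_on (set S \<union> set (R1 @ r # R2)) = \<dots>" .
  moreover have "set (r # rev R1 @ R2 @ S) = set S \<union> set (R1 @ r # R2)" by auto
  ultimately show ?thesis
    unfolding spider_def using induced_path_distinct[OF R] induced_path_distinct[OF S(1)] disjoint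
      induced_path_subset[OF R] induced_path_subset[OF S(1)] by auto
qed

lemma spider_path_shortcut:
  assumes R: "induced_path (R1 @ ra # M @ rb # R2)" and M: "M \<noteq> []" and S: "induced_path (z # S)"
    and disjoint: "set (z # S) \<inter> set (R1 @ ra # M @ rb # R2) = {}"
    and edges: "edges_between (set (z # S)) (set (R1 @ [ra]) \<union> set (rb # R2)) = {(z, ra), (z, rb)}"
  shows "spider z (ra # rev R1) (rb # R2) S"
proof -
  have paths: "induced_path (R1 @ [ra])" "induced_path (rb # R2)"
    using induced_path_infix[of "[]" "R1 @ [ra]" "M @ rb # R2"]
      induced_path_infix[of "R1 @ ra # M" "rb # R2" "[]"] R
    by auto
  have dist: "distinct (R1 @ ra # M @ rb # R2)" using induced_path_distinct[OF R] .
  have "induced_path ((R1 @ [ra]) @ (M @ rb # R2))" using R by simp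
  then have "E y w \<longleftrightarrow> y = ra \<and> w = hd (M @ rb # R2)" if "y \<in> set (R1 @ [ra])" "w \<in> set (M @ rb # R2)"
    for y w
    unfolding induced_path_append[of "R1 @ [ra]"] last_snoc using that by blast
  moreover have "hd (M @ rb # R2) \<notin> set (rb # R2)" using M dist by (cases M) auto
  ultimately have apart: "edges_between (set (R1 @ [ra])) (set (rb # R2)) = {}"
    unfolding edges_between_def by auto
  have "adj_on (set (z # S) \<union> (set (R1 @ [ra]) \<union> set (rb # R2)))
    = path_edges (z # S) \<union> (path_edges (R1 @ [ra]) \<union> path_edges (rb # R2)) \<union> symcl {(z, ra), (z, rb)}"
    unfolding adj_on_Un edges apart adj_on_induced_path[OF paths(1)] adj_on_induced_path[OF paths(2)]
      adj_on_induced_path[OF S] by simp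
  also have "\<dots> = path_edges (z # ra # rev R1) \<union> path_edges (z # rb # R2) \<union> path_edges (z # S)"
    unfolding path_edges_simps symcl_insert symcl_empty using path_edges_rev[of "R1 @ [ra]"]
    by simp blast
  finally have "adj_on (set (z # S) \<union> (set (R1 @ [ra]) \<union> set (rb # R2))) = \<dots>" .
  moreover have "set (z # (ra # rev R1) @ (rb # R2) @ S)
    = set (z # S) \<union> (set (R1 @ [ra]) \<union> set (rb # R2))" by auto
  ultimately show ?thesis
    unfolding spider_def using dist induced_path_distinct[OF S] disjoint
      induced_path_subset[OF R] induced_path_subset[OF S] by auto
qed

lemma legged_triangle_on_path:
  assumes R: "induced_path (R1 @ ra # rb # R2)" and S: "induced_path (z # S)"
    and disjoint: "set (z # S) \<inter> set (R1 @ ra # rb # R2) = {}"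
    and edges: "edges_between (set (z # S)) (set (R1 @ ra # rb # R2)) = {(z, ra), (z, rb)}"
  shows "legged_triangle ra (rev R1) rb R2 z S"
proof -
  have "adj_on (set (z # S) \<union> set (R1 @ ra # rb # R2))
    = path_edges (z # S) \<union> path_edges (R1 @ ra # rb # R2) \<union> symcl {(z, ra), (z, rb)}"
    unfolding adj_on_Un edges adj_on_induced_path[OF R] adj_on_induced_path[OF S] by (rule refl)
  also have "\<dots> = path_edges (ra # rev R1) \<union> path_edges (rb # R2) \<union> path_edges (z # S)
    \<union> symcl {(ra, rb), (rb, z), (z, ra)}"
    using path_edges_glue[of R1 ra "rb # R2"] path_edges_rev[of "R1 @ [ra]"] by auto
  finally have "adj_on (set (z # S) \<union> set (R1 @ ra # rb # R2)) = \<dots>" .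
  moreover have "set ((ra # rev R1) @ (rb # R2) @ (z # S)) = set (z # S) \<union> set (R1 @ ra # rb # R2)"
    by auto
  ultimately show ?thesis
    unfolding legged_triangle_def using induced_path_distinct[OF R] induced_path_distinct[OF S] disjoint
      induced_path_subset[OF R] induced_path_subset[OF S] by auto
qed

lemma path_attachment_cases:
  assumes R: "induced_path R" and S: "induced_path (z # S)" and z: "z \<notin> set R" "\<exists>r\<in>set R. E z r"
    and apart: "set S \<inter> set R = {}" "edges_between (set S) (set R) = {}"
  obtains (spider) u la lb lc where "spider u la lb lc" "set (u # la @ lb @ lc) \<subseteq> set R \<union> set (z # S)"
      "last (u # la) = hd R" "last (u # lb) = last R" "last (u # lc) = last (z # S)"
  | (triangle) wa la wb lb wc lc where "legged_triangle wa la wb lb wc lc"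
      "set ((wa # la) @ (wb # lb) @ (wc # lc)) \<subseteq> set R \<union> set (z # S)"
      "last (wa # la) = hd R" "last (wb # lb) = last R" "last (wc # lc) = last (z # S)"
proof (rule outermost_occurrences[of R "E z"])
  assume "\<And>r. r \<in> set R \<Longrightarrow> \<not> E z r"
  then show thesis using z(2) by blast
next
  fix R1 r R2 assume split: "R = R1 @ r # R2" and r: "E z r" and only: "\<And>y. y \<in> set (R1 @ R2) \<Longrightarrow> \<not> E z y"
  have "edges_between (set (z # S)) (set R) = {(z, r)}"
    using apart(2) r only unfolding edges_between_def split by auto
  then have "spider r (rev R1) R2 (z # S)"
    by (intro spider_path_with_leg) (use R S z(1) apart(1) split in auto)
  then show thesis
    by (rule spider) (use split in \<open>auto simp: last_rev hd_append split: if_splits\<close>)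
next
  fix R1 ra M rb R2 assume split: "R = R1 @ ra # M @ rb # R2" and r: "E z ra" "E z rb"
    and only: "\<And>y. y \<in> set (R1 @ R2) \<Longrightarrow> \<not> E z y"
  have edges: "edges_between (set (z # S)) (set (R1 @ [ra]) \<union> set (rb # R2)) = {(z, ra), (z, rb)}"
    using apart(2) r only unfolding edges_between_def split by auto
  show thesis
  proof (cases "M = []")
    case False
    have "spider z (ra # rev R1) (rb # R2) S"
      by (rule spider_path_shortcut[OF _ False S _ edges]) (use R z(1) apart(1) split in auto)
    then show thesis
      by (rule spider) (use split in \<open>auto simp: last_rev hd_append split: if_splits\<close>)
  next
    case True
    have "legged_triangle ra (rev R1) rb R2 z S"
      by (rule legged_triangle_on_path[OF _ S])
        (use R z(1) apart(1) split True edges in \<open>auto simp: insert_commute\<close>)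
    then show thesis
      by (rule triangle) (use split True in \<open>auto simp: last_rev hd_append split: if_splits\<close>)
  qed
qed

lemma connected_set_path_to_path:
  assumes Q: "connected_set Q" and R: "R \<noteq> []" "set R \<subseteq> Q" and q: "q \<in> Q" "q \<notin> set R"
  obtains z S where "induced_path (z # S)" "set (z # S) \<subseteq> Q" "last (z # S) = q" "z \<notin> set R"
    "\<exists>r\<in>set R. E z r"
    "set S \<inter> set R = {}" "edges_between (set S) (set R) = {}"
proof -
  have "hd R \<in> Q" using R by auto
  then obtain p where p: "induced_path p" "p \<noteq> []" "set p \<subseteq> Q" "hd p = q" "last p = hd R"
    using connected_set_obtain_path[OF Q q(1)] by blast
  then have "hd R \<in> set p" using last_in_set by metis
  then have "\<exists>z\<in>set p. z \<in> set R \<or> (\<exists>r\<in>set R. E z r)" using R(1) hd_in_set by blast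
  then obtain p1 z p2 where z: "p = p1 @ z # p2" "z \<in> set R \<or> (\<exists>r\<in>set R. E z r)"
      "\<forall>y\<in>set p1. \<not> (y \<in> set R \<or> (\<exists>r\<in>set R. E y r))"
    by (rule split_list_first_propE)
  have path: "induced_path (p1 @ [z])" using induced_path_infix[of "[]" "p1 @ [z]" p2] p(1) z(1) by simp
  have first: "hd (p1 @ [z]) = q" using p(4) z(1) by (cases p1) auto
  have "z \<notin> set R"
  proof
    assume "z \<in> set R"
    then have "p1 \<noteq> []" using first q(2) by auto
    then obtain p1' y where "p1 = p1' @ [y]" by (metis append_butlast_last_id)
    moreover from this have "E y z" using induced_path_infix[of p1' "[y, z]" "[]"] path by simp
    ultimately show False using z(3) \<open>z \<in> set R\<close> by auto
  qed
  moreover have "induced_path (z # rev p1)" using path induced_path_rev[of "p1 @ [z]"] by simp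
  moreover have "last (z # rev p1) = q" using first by (cases p1) auto
  moreover have "edges_between (set (rev p1)) (set R) = {}" using z(3) unfolding edges_between_def
    by auto
  ultimately show thesis using z p(3) by (intro that[of z "rev p1"]) auto
qed

lemma connected_set_three_terminals:
  assumes Q: "connected_set Q" and q: "qa \<in> Q" "qb \<in> Q" "qc \<in> Q"
  obtains (spider) u la lb lc where "spider u la lb lc" "set (u # la @ lb @ lc) \<subseteq> Q"
      "last (u # la) = qa" "last (u # lb) = qb" "last (u # lc) = qc"
  | (triangle) wa la wb lb wc lc where "legged_triangle wa la wb lb wc lc"
      "set ((wa # la) @ (wb # lb) @ (wc # lc)) \<subseteq> Q"
      "last (wa # la) = qa" "last (wb # lb) = qb" "last (wc # lc) = qc"
proof -
  obtain R where R: "induced_path R" "R \<noteq> []" "set R \<subseteq> Q" "hd R = qa" "last R = qb"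
    using connected_set_obtain_path[OF Q q(1,2)] .
  show thesis
  proof (cases "qc \<in> set R")
    case True
    then obtain R1 R2 where split: "R = R1 @ qc # R2" by (meson split_list)
    have "spider qc (rev R1) R2 []" using spider_on_path R(1) split by blast
    then show thesis
      by (rule spider) (use R split in \<open>auto simp: last_rev hd_append split: if_splits\<close>)
  next
    case False
    then obtain z S where S: "induced_path (z # S)" "set (z # S) \<subseteq> Q" "last (z # S) = qc" "z \<notin> set R"
      "\<exists>r\<in>set R. E z r" "set S \<inter> set R = {}" "edges_between (set S) (set R) = {}"
      by (rule connected_set_path_to_path[OF Q R(2,3) q(3)]) (rule that)
    have subset: "set R \<union> set (z # S) \<subseteq> Q" using R(3) S(2) by blast
    show thesis
    proof (cases rule: path_attachment_cases[OF R(1) S(1,4-7)])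
      case (1 u la lb lc)
      then show thesis using spider subset R(4,5) S(3) by (metis subset_trans)
    next
      case (2 wa la wb lb wc lc)
      then show thesis using triangle subset R(4,5) S(3) by (metis subset_trans)
    qed
  qed
qed

end

locale K4_prism_free_graph = simple_graph +
  assumes no_K4: "\<lbrakk>distinct ([a, b, c, d] @ p1 @ p2 @ p3 @ p4 @ p5 @ p6);
      set ([a, b, c, d] @ p1 @ p2 @ p3 @ p4 @ p5 @ p6) \<subseteq> V;
      adj_on (set ([a, b, c, d] @ p1 @ p2 @ p3 @ p4 @ p5 @ p6))
        = path_edges (a # p1 @ [b]) \<union> path_edges (a # p2 @ [c]) \<union> path_edges (a # p3 @ [d])
          \<union> path_edges (b # p4 @ [c]) \<union> path_edges (b # p5 @ [d]) \<union> path_edges (c # p6 @ [d])\<rbrakk> \<Longrightarrow> False"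
    and no_prism: "\<lbrakk>2 \<le> length p; 2 \<le> length q; 2 \<le> length r; distinct (p @ q @ r); set (p @ q @ r) \<subseteq> V;
      adj_on (set (p @ q @ r)) = path_edges p \<union> path_edges q \<union> path_edges r
        \<union> symcl {(hd p, hd q), (hd q, hd r), (hd r, hd p)}
        \<union> symcl {(last p, last q), (last q, last r), (last r, last p)}\<rbrakk> \<Longrightarrow> False"
begin

lemma no_spider:
  assumes cyc: "induced_cycle (a # A1 @ b # A2 @ c # A3)" and spider: "spider u la lb lc"
    and disjoint: "set (a # A1 @ b # A2 @ c # A3) \<inter> set (u # la @ lb @ lc) = {}"
    and edges: "edges_between (set (a # A1 @ b # A2 @ c # A3)) (set (u # la @ lb @ lc))
      = {(a, last (u # la)), (b, last (u # lb)), (c, last (u # lc))}"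
  shows False
proof (rule no_K4[of u a b c la lb lc A1 "rev A3" A2])
  let ?H = "a # A1 @ b # A2 @ c # A3" and ?T = "u # la @ lb @ lc"
  let ?U = "[u, a, b, c] @ la @ lb @ lc @ A1 @ rev A3 @ A2"
  note T = spider[unfolded spider_def]
  have U: "set ?U = set ?H \<union> set ?T" by auto
  have "distinct (?H @ ?T)" using induced_cycle_distinct[OF cyc] T disjoint
    by (simp only: distinct_append)
  then show "distinct ?U" by (rule distinct_reorder) (use U in auto)
  show "set ?U \<subseteq> V" unfolding U using induced_cycle_subset[OF cyc] T by blast
  show "adj_on (set ?U) = path_edges (u # la @ [a]) \<union> path_edges (u # lb @ [b])
    \<union> path_edges (u # lc @ [c])
      \<union> path_edges (a # A1 @ [b]) \<union> path_edges (a # rev A3 @ [c]) \<union> path_edges (b # A2 @ [c])"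
    unfolding U adj_on_Un edges adj_on_cycle_three_arcs[OF cyc] path_edges_snoc[of u la]
      path_edges_snoc[of u lb]
      path_edges_snoc[of u lc] T[THEN conjunct2, THEN conjunct2] by (simp add: Un_ac insert_commute)
qed

lemma no_legged_triangle_on_arc:
  assumes cyc: "induced_cycle (a # A1 @ b # A2 @ c # A3)" and A1: "A1 \<noteq> []"
    and triangle: "legged_triangle wa la wb lb wc lc"
    and disjoint: "set (a # A1 @ b # A2 @ c # A3) \<inter> set ((wa # la) @ (wb # lb) @ (wc # lc)) = {}"
    and edges: "edges_between (set (a # A1 @ b # A2 @ c # A3)) (set ((wa # la) @ (wb # lb) @ (wc # lc)))
      = {(a, last (wa # la)), (b, last (wb # lb)), (c, last (wc # lc))}"
  shows False
proof -
  let ?T = "(wa # la) @ (wb # lb) @ (wc # lc)" and ?K = "b # A2 @ c # A3 @ [a]"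
  let ?U = "[wc, wa, wb, c] @ lc @ (la @ a # rev A3) @ (lb @ b # A2)"
  note T = triangle[unfolded legged_triangle_def]
  have KH: "set ?K \<subseteq> set (a # A1 @ b # A2 @ c # A3)" by auto
  have "induced_cycle (?K @ A1)"
    using induced_cycle_rotate[of "a # A1" "b # A2 @ c # A3"]
      induced_cycle_rotate[of "[b] @ A2 @ c # A3" "a # A1"] cyc
    by (simp del: induced_cycle.simps)
  then have K: "induced_path ?K"
    using induced_cycle_infix[of "[]" ?K A1] A1 by (simp del: induced_cycle.simps induced_path.simps)
  have adj_K: "adj_on (set ?K) = path_edges (b # A2 @ [c]) \<union> path_edges (a # rev A3 @ [c])"
    using adj_on_induced_path[OF K] path_edges_glue[of "b # A2" c "A3 @ [a]"]
      path_edges_rev[of "c # A3 @ [a]"] by simp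
  have "last (wa # la) \<in> set ?T" "last (wb # lb) \<in> set ?T" "last (wc # lc) \<in> set ?T"
    using last_in_set[of "wa # la"] last_in_set[of "wb # lb"] last_in_set[of "wc # lc"] by auto
  then have edges_K: "edges_between (set ?K) (set ?T)
    = {(a, last (wa # la)), (b, last (wb # lb)), (c, last (wc # lc))}"
    by (intro edges_between_restrict[OF edges KH]) auto
  have U: "set ?U = set ?K \<union> set ?T" by auto
  have "distinct (?K @ ?T)"
    unfolding distinct_append[of ?K ?T] using induced_path_distinct[OF K] T disjoint KH by blast
  then have dist: "distinct ?U" by (rule distinct_reorder) (use U in auto)
  have subset: "set ?U \<subseteq> V" unfolding U using induced_path_subset[OF K] T by blast
  have legs: "path_edges (wa # (la @ a # rev A3) @ [c])
    = path_edges (wa # la @ [a]) \<union> path_edges (a # rev A3 @ [c])"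
    "path_edges (wb # (lb @ b # A2) @ [c]) = path_edges (wb # lb @ [b]) \<union> path_edges (b # A2 @ [c])"
    using path_edges_glue[of "wa # la" a "rev A3 @ [c]"] path_edges_glue[of "wb # lb" b "A2 @ [c]"]
    by simp_all
  have "adj_on (set ?U) = path_edges [wc, wa] \<union> path_edges [wc, wb] \<union> path_edges (wc # lc @ [c])
      \<union> path_edges [wa, wb] \<union> path_edges (wa # (la @ a # rev A3) @ [c])
        \<union> path_edges (wb # (lb @ b # A2) @ [c])"
    unfolding U adj_on_Un edges_K adj_K legs path_edges_snoc[of wa la] path_edges_snoc[of wb lb]
      path_edges_snoc[of wc lc] T[THEN conjunct2, THEN conjunct2] path_edges_simps
    by (simp add: Un_ac insert_commute)
  then show False
    by (rule no_K4[of wc wa wb c "[]" "[]" lc "[]" "la @ a # rev A3" "lb @ b # A2", unfolded append_Nil, OF dist subset])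
qed

lemma no_legged_triangle_on_triangle:
  assumes cyc: "induced_cycle [a, b, c]" and triangle: "legged_triangle wa la wb lb wc lc"
    and disjoint: "set [a, b, c] \<inter> set ((wa # la) @ (wb # lb) @ (wc # lc)) = {}"
    and edges: "edges_between (set [a, b, c]) (set ((wa # la) @ (wb # lb) @ (wc # lc)))
      = {(a, last (wa # la)), (b, last (wb # lb)), (c, last (wc # lc))}"
  shows False
proof (rule no_prism[of "wa # la @ [a]" "wb # lb @ [b]" "wc # lc @ [c]"])
  let ?T = "(wa # la) @ (wb # lb) @ (wc # lc)"
  let ?U = "(wa # la @ [a]) @ (wb # lb @ [b]) @ (wc # lc @ [c])"
  note T = triangle[unfolded legged_triangle_def]
  have U: "set ?U = set [a, b, c] \<union> set ?T" by auto
  have "distinct ([a, b, c] @ ?T)"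
    unfolding distinct_append[of "[a, b, c]" ?T] using induced_cycle_distinct[OF cyc] T disjoint
    by blast
  then show "distinct ?U" by (rule distinct_reorder) (use U in auto)
  show "set ?U \<subseteq> V" unfolding U using induced_cycle_subset[OF cyc] T by blast
  have cycle_edges: "adj_on (set [a, b, c]) = symcl {(a, b), (b, c), (c, a)}"
    using adj_on_induced_cycle[OF cyc] by auto
  have "adj_on (set ?U) = path_edges (wa # la @ [a]) \<union> path_edges (wb # lb @ [b])
    \<union> path_edges (wc # lc @ [c])
      \<union> symcl {(wa, wb), (wb, wc), (wc, wa)} \<union> symcl {(a, b), (b, c), (c, a)}"
    unfolding U adj_on_Un edges cycle_edges path_edges_snoc[of wa la] path_edges_snoc[of wb lb]
      path_edges_snoc[of wc lc] T[THEN conjunct2, THEN conjunct2]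
    by (simp add: Un_ac insert_commute)
  then show "adj_on (set ?U) = path_edges (wa # la @ [a]) \<union> path_edges (wb # lb @ [b])
    \<union> path_edges (wc # lc @ [c])
      \<union> symcl {(hd (wa # la @ [a]), hd (wb # lb @ [b])), (hd (wb # lb @ [b]), hd (wc # lc @ [c])),
          (hd (wc # lc @ [c]), hd (wa # la @ [a]))}
      \<union> symcl {(last (wa # la @ [a]), last (wb # lb @ [b])), (last (wb # lb @ [b]), last (wc # lc @ [c])),
          (last (wc # lc @ [c]), last (wa # la @ [a]))}" by simp
qed simp_all

lemma no_legged_triangle:
  assumes cyc: "induced_cycle (a # A1 @ b # A2 @ c # A3)"
    and triangle: "legged_triangle wa la wb lb wc lc"
    and disjoint: "set (a # A1 @ b # A2 @ c # A3) \<inter> set ((wa # la) @ (wb # lb) @ (wc # lc)) = {}"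
    and edges: "edges_between (set (a # A1 @ b # A2 @ c # A3)) (set ((wa # la) @ (wb # lb) @ (wc # lc)))
      = {(a, last (wa # la)), (b, last (wb # lb)), (c, last (wc # lc))}"
  shows False
proof -
  have rot1: "induced_cycle (b # A2 @ c # A3 @ a # A1)"
    and rot2: "induced_cycle (c # A3 @ a # A1 @ b # A2)"
    using induced_cycle_rotate[of "a # A1" "b # A2 @ c # A3"]
      induced_cycle_rotate[of "a # A1 @ b # A2" "c # A3"] cyc
    by (simp_all del: induced_cycle.simps)
  have sets: "set (b # A2 @ c # A3 @ a # A1) = set (a # A1 @ b # A2 @ c # A3)"
    "set (c # A3 @ a # A1 @ b # A2) = set (a # A1 @ b # A2 @ c # A3)"
    "set ((wb # lb) @ (wc # lc) @ (wa # la)) = set ((wa # la) @ (wb # lb) @ (wc # lc))"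
    "set ((wc # lc) @ (wa # la) @ (wb # lb)) = set ((wa # la) @ (wb # lb) @ (wc # lc))" by auto
  note triangle1 = legged_triangle_rotate[OF triangle] and triangle2
    = legged_triangle_rotate[OF legged_triangle_rotate[OF triangle]]
  consider (first) "A1 \<noteq> []" | (second) "A2 \<noteq> []" | (third) "A3 \<noteq> []"
    | (adjacent) "A1 = []" "A2 = []" "A3 = []" by blast
  then show False
  proof cases
    case first
    show False by (rule no_legged_triangle_on_arc[OF cyc first triangle disjoint edges])
  next
    case second
    show False
      by (rule no_legged_triangle_on_arc[OF rot1 second triangle1])
        (simp_all only: sets disjoint edges insert_commute)
  next
    case third
    show False
      by (rule no_legged_triangle_on_arc[OF rot2 third triangle2])
        (simp_all only: sets disjoint edges insert_commute)
  next
    case adjacent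
    show False
      by (rule no_legged_triangle_on_triangle[OF _ triangle, of a b c])
        (use cyc disjoint edges adjacent in simp_all)
  qed
qed

lemma no_ordered_tripod:
  assumes cyc: "induced_cycle (a # A1 @ b # A2 @ c # A3)"
    and Q: "connected_set Q" "qa \<in> Q" "qb \<in> Q" "qc \<in> Q"
    and disjoint: "set (a # A1 @ b # A2 @ c # A3) \<inter> Q = {}"
    and edges: "edges_between (set (a # A1 @ b # A2 @ c # A3)) Q = {(a, qa), (b, qb), (c, qc)}"
  shows False
proof (cases rule: connected_set_three_terminals[OF Q, case_names spider triangle])
  case (spider u la lb lc)
  have "{qa, qb, qc} \<subseteq> set (u # la @ lb @ lc)"
    using spider(3-5) last_in_set[of "u # la"] last_in_set[of "u # lb"] last_in_set[of "u # lc"] by auto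
  then have "edges_between (set (a # A1 @ b # A2 @ c # A3)) (set (u # la @ lb @ lc))
    = {(a, qa), (b, qb), (c, qc)}"
    by (intro edges_between_restrict[OF edges _ spider(2)]) auto
  then show False using no_spider[OF cyc spider(1)] spider(2-5) disjoint by blast
next
  case (triangle wa la wb lb wc lc)
  have "{qa, qb, qc} \<subseteq> set ((wa # la) @ (wb # lb) @ (wc # lc))"
    using triangle(3-5) last_in_set[of "wa # la"] last_in_set[of "wb # lb"] last_in_set[of "wc # lc"]
    by auto
  then have "edges_between (set (a # A1 @ b # A2 @ c # A3)) (set ((wa # la) @ (wb # lb) @ (wc # lc)))
      = {(a, qa), (b, qb), (c, qc)}"
    by (intro edges_between_restrict[OF edges _ triangle(2)]) auto
  then show False using no_legged_triangle[OF cyc triangle(1)] triangle(2-5) disjoint by blast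
qed

lemma no_tripod_at_first:
  assumes cyc: "induced_cycle (a # L)" and Q: "connected_set Q" "qa \<in> Q" "qb \<in> Q" "qc \<in> Q"
    and disjoint: "set (a # L) \<inter> Q = {}"
    and edges: "edges_between (set (a # L)) Q = {(a, qa), (b, qb), (c, qc)}"
    and bc: "b \<in> set L" "c \<in> set L" "b \<noteq> c"
  shows False
proof -
  obtain B1 B2 where b: "L = B1 @ b # B2" using bc(1) by (meson split_list)
  then consider (after) "c \<in> set B2" | (before) "c \<in> set B1" using bc(2,3) by auto
  then show False
  proof cases
    case after
    then obtain B3 B4 where "B2 = B3 @ c # B4" by (meson split_list)
    then show False using no_ordered_tripod[of a B1 b B3 c B4 Q qa qb qc] cyc Q disjoint edges b by simp
  next
    case before
    then obtain B3 B4 where "B1 = B3 @ c # B4" by (meson split_list)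
    then show False
      using no_ordered_tripod[of a B3 c B4 b B2 Q qa qc qb] cyc Q disjoint edges b
      by (simp add: insert_commute)
  qed
qed

lemma no_three_edges_to_connected_set:
  assumes cyc: "induced_cycle H" and Q: "connected_set Q" and disjoint: "set H \<inter> Q = {}"
    and card3: "card (edges_between (set H) Q) = 3" and inj: "inj_on fst (edges_between (set H) Q)"
  shows False
proof -
  obtain e1 e2 e3 where edges: "edges_between (set H) Q = {e1, e2, e3}"
    and edges_distinct: "e1 \<noteq> e2" "e1 \<noteq> e3" "e2 \<noteq> e3"
    using card3 unfolding card_3_iff by auto
  obtain a qa b qb c qc where e: "e1 = (a, qa)" "e2 = (b, qb)" "e3 = (c, qc)" by (metis surj_pair)
  have feet_distinct: "a \<noteq> b" "a \<noteq> c" "b \<noteq> c"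
    using inj_onD[OF inj, of e1 e2] inj_onD[OF inj, of e1 e3] inj_onD[OF inj, of e2 e3] edges_distinct
    unfolding edges by (simp_all add: e)
  have "{(a, qa), (b, qb), (c, qc)} \<subseteq> set H \<times> Q" using edges unfolding e edges_between_def by auto
  then have ends: "a \<in> set H" "b \<in> set H" "c \<in> set H" "qa \<in> Q" "qb \<in> Q" "qc \<in> Q" by auto
  obtain X Y where H: "H = X @ a # Y" using ends(1) by (meson split_list)
  have "induced_cycle (a # (Y @ X))"
    using induced_cycle_rotate[of X "a # Y"] cyc H by (simp del: induced_cycle.simps)
  moreover have "set H = set (a # (Y @ X))" using H by auto
  ultimately show False
    using no_tripod_at_first[of a "Y @ X" Q qa qb qc b c] Q ends feet_distinct disjoint edges
    unfolding e by auto
qed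

end

section \<open>Hubs and their spokes\<close>

locale tripod_free_graph = simple_graph +
  assumes no_tripod: "\<lbrakk>induced_cycle H; connected_set Q; set H \<inter> Q = {};
      card (edges_between (set H) Q) = 3; inj_on fst (edges_between (set H) Q)\<rbrakk> \<Longrightarrow> False"
    and triangle_unique: "\<lbrakk>E a b; E b c; E a c; E a d; E d e; E a e\<rbrakk> \<Longrightarrow> {b, c} = {d, e}"
begin

lemma no_three_edges:
  assumes "induced_cycle H" "connected_set Q" "set H \<inter> Q = {}" "a \<noteq> b" "a \<noteq> c" "b \<noteq> c"
    and edges: "edges_between (set H) Q = {(a, qa), (b, qb), (c, qc)}"
  shows False
  by (rule no_tripod[OF assms(1-3)]) (use assms(4-6) in \<open>auto simp: edges\<close>)

lemma card_nbrs_in_cycle_neq_3: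
  assumes "induced_cycle L" "v \<in> V" "v \<notin> set L"
  shows "card (nbrs_in v (set L)) \<noteq> 3"
proof
  assume card3: "card (nbrs_in v (set L)) = 3"
  have edges: "edges_between (set L) {v} = (\<lambda>h. (h, v)) ` nbrs_in v (set L)"
    unfolding edges_between_def nbrs_in_def by (auto simp: E_commute)
  have "card (edges_between (set L) {v}) = 3"
    unfolding edges using card3 by (subst card_image) (auto intro: inj_onI)
  moreover have "inj_on fst (edges_between (set L) {v})" unfolding edges_between_def
    by (auto intro: inj_onI)
  ultimately show False using no_tripod[of L "{v}"] connected_set_singleton assms by auto
qed

lemma triangles_share_edge:
  assumes "E y v" "E y u" "E v u" "E y w" "E v w"
  shows "u = w"
proof -
  have "{u, v} = {w, v}" using triangle_unique[of y u v w v] assms E_commute by blast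
  then show ?thesis using assms E_irrefl by blast
qed

end

locale hub = tripod_free_graph +
  fixes x
  assumes x_V: "x \<in> V"
begin

definition num_spokes :: "'a list \<Rightarrow> nat" where
  "num_spokes L = length (filter (E x) L)"

lemma num_spokes_simps[simp]:
  "num_spokes [] = 0" "num_spokes (a # L) = (if E x a then 1 else 0) + num_spokes L"
  "num_spokes (L @ M) = num_spokes L + num_spokes M" "num_spokes (rev L) = num_spokes L"
  by (auto simp: num_spokes_def rev_filter[symmetric])

lemma num_spokes_0_iff: "num_spokes L = 0 \<longleftrightarrow> (\<forall>a\<in>set L. \<not> E x a)"
  by (auto simp: num_spokes_def filter_empty_conv)

lemma num_spokes_0D: "num_spokes L = 0 \<Longrightarrow> a \<in> set L \<Longrightarrow> \<not> E x a"
  by (simp add: num_spokes_0_iff)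

lemma num_spokes_pos_iff: "0 < num_spokes L \<longleftrightarrow> (\<exists>a\<in>set L. E x a)"
  using num_spokes_0_iff[of L] by auto

lemma num_spokes_posI: "a \<in> set L \<Longrightarrow> E x a \<Longrightarrow> 0 < num_spokes L"
  unfolding num_spokes_pos_iff by blast

lemma num_spokes_card: "distinct L \<Longrightarrow> num_spokes L = card (nbrs_in x (set L))"
  unfolding num_spokes_def nbrs_in_def by (metis distinct_card distinct_filter set_filter)

lemma num_spokes_le_length: "num_spokes L \<le> length L"
  unfolding num_spokes_def by (rule length_filter_le)

lemma first_spoke:
  assumes "0 < num_spokes L"
  obtains A q B where "L = A @ q # B" "E x q" "num_spokes A = 0"
proof -
  have "\<exists>a\<in>set L. E x a" using assms num_spokes_pos_iff by auto
  then show thesis by (rule split_list_first_propE) (use that num_spokes_0_iff in blast)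
qed

lemma last_spoke:
  assumes "0 < num_spokes L"
  obtains A q B where "L = A @ q # B" "E x q" "num_spokes B = 0"
proof -
  have "\<exists>a\<in>set L. E x a" using assms num_spokes_pos_iff by auto
  then show thesis by (rule split_list_last_propE) (use that num_spokes_0_iff in blast)
qed

lemma outer_spokes:
  assumes "2 \<le> num_spokes L"
  obtains A q M q' B where "L = A @ q # M @ q' # B" "E x q" "E x q'" "num_spokes A = 0"
    "num_spokes B = 0"
proof -
  obtain A q L' where first: "L = A @ q # L'" "E x q" "num_spokes A = 0" using first_spoke[of L] assms
    by auto
  then have "0 < num_spokes L'" using assms by auto
  then obtain M q' B where "L' = M @ q' # B" "E x q'" "num_spokes B = 0" using last_spoke by blast
  then show thesis using first that by auto
qed

lemma later_spoke:
  assumes "2 \<le> num_spokes L"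
  obtains X q Y where "L = X @ q # Y" "E x q" "X \<noteq> []"
proof -
  obtain A q M q' B where "L = A @ q # M @ q' # B" "E x q'" by (rule outer_spokes[OF assms]) (rule that)
  then show thesis using that[of "A @ q # M" q' B] by simp
qed

lemma connected_set_insert_hub:
  "induced_path s \<Longrightarrow> 0 < num_spokes s \<Longrightarrow> connected_set (insert x (set s))"
  by (rule connected_set_star[OF x_V]) (auto simp: num_spokes_pos_iff)

lemma connected_set_insert_hub2:
  "induced_path s \<Longrightarrow> 0 < num_spokes s \<Longrightarrow> induced_path t \<Longrightarrow> 0 < num_spokes t \<Longrightarrow>
     connected_set (insert x (set s \<union> set t))"
  by (rule connected_set_star[OF x_V]) (metis UnE Un_upper1 Un_upper2 num_spokes_pos_iff)

lemma num_spokes_cycle_neq_3: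
  assumes "induced_cycle L" "x \<notin> set L"
  shows "num_spokes L \<noteq> 3"
  using card_nbrs_in_cycle_neq_3[OF assms(1) x_V assms(2)]
    num_spokes_card[OF induced_cycle_distinct[OF assms(1)]]
  by simp

context
  fixes S1 S2 D
  assumes cyc: "induced_cycle (S1 @ S2)" and S1: "2 \<le> length S1" and S2: "S2 \<noteq> []"
    and x: "x \<notin> set (S1 @ S2)" and D: "D \<subseteq> set S2"
begin

lemma arc_ends_distinct: "hd S1 \<noteq> last S1"
  using induced_cycle_distinct[OF cyc] S1 by (cases S1) auto

lemma edges_arc_hub: "edges_between (set S1) (insert x D) = (\<lambda>h. (h, x)) ` nbrs_in x (set S1) \<union>
    ((if last S2 \<in> D then {(hd S1, last S2)} else {}) \<union> (if hd S2 \<in> D then {(last S1, hd S2)} else {}))"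
proof -
  have "hd S1 \<in> set S1" "last S1 \<in> set S1" using S1 by (cases S1; auto)+
  moreover have "E h q \<longleftrightarrow> h = last S1 \<and> q = hd S2 \<or> h = hd S1 \<and> q = last S2" if "h \<in> set S1" "q \<in> D"
    for h q
    using induced_cycle_cross[OF cyc that(1)] that(2) D by auto
  ultimately show ?thesis unfolding edges_between_def nbrs_in_def by (auto simp: E_commute)
qed

lemma card_edges_arc_hub: "card (edges_between (set S1) (insert x D))
    = num_spokes S1 + (if last S2 \<in> D then 1 else 0) + (if hd S2 \<in> D then 1 else 0)"
proof -
  let ?spokes = "(\<lambda>h. (h, x)) ` nbrs_in x (set S1)"
  let ?ends = "(if last S2 \<in> D then {(hd S1, last S2)} else {})
    \<union> (if hd S2 \<in> D then {(last S1, hd S2)} else {})"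
  have dist: "distinct S1" using induced_cycle_distinct[OF cyc] by simp
  have "card ?spokes = num_spokes S1"
    unfolding num_spokes_card[OF dist] by (intro card_image) (auto intro: inj_onI)
  moreover have "finite ?spokes" unfolding nbrs_in_def by simp
  moreover have "?spokes \<inter> ?ends = {}" using x D by auto
  moreover have "card ?ends = (if last S2 \<in> D then 1 else 0) + (if hd S2 \<in> D then 1 else 0)"
    using arc_ends_distinct by simp
  ultimately show ?thesis unfolding edges_arc_hub by (subst card_Un_disjoint) auto
qed

lemma inj_on_edges_arc_hub:
  assumes "last S2 \<in> D \<Longrightarrow> \<not> E x (hd S1)" "hd S2 \<in> D \<Longrightarrow> \<not> E x (last S1)"
  shows "inj_on fst (edges_between (set S1) (insert x D))"
  unfolding edges_arc_hub nbrs_in_def using assms arc_ends_distinct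
  by (auto simp: inj_on_def split: if_splits)

end

text \<open>The cycle of the tripod is \<open>v # S1\<close> and its connected set consists of \<open>x\<close> and parts of \<open>S2\<close>, so
  the feet are the spokes in \<open>S1\<close>, the two ends of \<open>S1\<close>, and \<open>v\<close>.\<close>

lemma no_hub_tripod:
  assumes cyc: "induced_cycle (S1 @ S2)" and S2: "S2 \<noteq> []" and vcyc: "induced_cycle (v # S1)"
    and x: "x \<notin> set (S1 @ S2)" "x \<noteq> v" and v: "v \<notin> set S2"
    and D: "D \<subseteq> set S2" "connected_set (insert x D)"
    and ends: "last S2 \<in> D \<Longrightarrow> \<not> E x (hd S1)" "hd S2 \<in> D \<Longrightarrow> \<not> E x (last S1)"
    and W: "nbrs_in v (insert x D) = W" "card W \<le> 1"
    and three: "num_spokes S1 + (if last S2 \<in> D then 1 else 0) + (if hd S2 \<in> D then 1 else 0) + card W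
      = 3"
  shows False
proof (rule no_tripod[OF vcyc D(2)])
  have S1: "2 \<le> length S1" "v \<notin> set S1" using vcyc by auto
  have "finite D" using D(1) finite_subset by blast
  then have finite: "finite D" "finite W" unfolding W(1)[symmetric] nbrs_in_def by simp_all
  let ?A = "edges_between (set S1) (insert x D)"
  have edges: "edges_between (set (v # S1)) (insert x D) = ?A \<union> Pair v ` W"
    unfolding W(1)[symmetric] edges_between_def nbrs_in_def by auto
  have disjoint: "fst ` ?A \<inter> fst ` (Pair v ` W) = {}" using S1(2) unfolding edges_between_def by auto
  have "finite ?A" using finite(1) finite_subset[of ?A "set S1 \<times> insert x D"]
    unfolding edges_between_def by auto
  then have "card (?A \<union> Pair v ` W) = card ?A + card (Pair v ` W)"
    using finite disjoint by (intro card_Un_disjoint) auto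
  also have "card (Pair v ` W) = card W" by (intro card_image) (auto intro: inj_onI)
  finally show "card (edges_between (set (v # S1)) (insert x D)) = 3"
    unfolding edges card_edges_arc_hub[OF cyc S1(1) S2 x(1) D(1)] using three by simp
  have "inj_on fst (Pair v ` W)" using card_le_Suc0_iff_eq[OF finite(2)] W(2) by (auto simp: inj_on_def)
  then show "inj_on fst (edges_between (set (v # S1)) (insert x D))"
    unfolding edges inj_on_Un using inj_on_edges_arc_hub[OF cyc S1(1) S2 x(1) D(1) ends] disjoint
    by auto
  show "set (v # S1) \<inter> insert x D = {}" using x v D S1 induced_cycle_distinct[OF cyc] by auto
qed

section \<open>Attachments to a cycle with many spokes\<close>

lemma outer_spoke_legs:
  assumes path: "induced_path Z" and spokes: "2 \<le> num_spokes Z"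
  obtains S T where "S \<subseteq> set Z" "T \<subseteq> set Z" "hd Z \<in> S" "last Z \<notin> S" "last Z \<in> T" "hd Z \<notin> T"
    "connected_set (insert x S)" "connected_set (insert x T)" "connected_set (insert x (S \<union> T))"
proof -
  obtain A q M q' B where q: "Z = A @ q # M @ q' # B" "E x q" "E x q'" by (rule outer_spokes[OF spokes])
    (rule that)
  have legs: "induced_path (A @ [q])" "induced_path (q' # B)"
    using induced_path_infix[of "[]" "A @ [q]" "M @ q' # B"]
      induced_path_infix[of "A @ q # M" "q' # B" "[]"] path q
    by auto
  show thesis
  proof (rule that[of "set (A @ [q])" "set (q' # B)"])
    show "hd Z \<in> set (A @ [q])" "last Z \<notin> set (A @ [q])" "last Z \<in> set (q' # B)" "hd Z \<notin> set (q' # B)"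
      using induced_path_distinct[OF path] q by (cases A; auto)+
    show "connected_set (insert x (set (A @ [q])))" "connected_set (insert x (set (q' # B)))"
      "connected_set (insert x (set (A @ [q]) \<union> set (q' # B)))"
      using connected_set_insert_hub[OF legs(1)] connected_set_insert_hub[OF legs(2)]
        connected_set_insert_hub2[OF legs(1) _ legs(2)] q by auto
  qed (use q in auto)
qed

lemma two_nbrs_arc_spokes_ge_4:
  assumes cyc: "induced_cycle (c # I @ c' # Z)" and x: "x \<notin> set (c # I @ c' # Z)" "x \<noteq> v"
    and v: "v \<in> V" "v \<notin> set (c # I @ c' # Z)" "E v c" "E v c'" "\<And>b. b \<in> set (I @ Z) \<Longrightarrow> \<not> E v b"
      "\<not> E v x"
    and spokes: "0 < num_spokes I" "0 < num_spokes Z" "4 \<le> num_spokes (c # I @ c' # Z)"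
  shows "4 \<le> num_spokes (c # I @ [c'])"
proof (rule ccontr)
  assume small: "\<not> 4 \<le> num_spokes (c # I @ [c'])"
  let ?S = "c # I @ [c']"
  have cyc': "induced_cycle (?S @ Z)" using cyc by simp
  have Z: "Z \<noteq> []" using spokes(2) by auto
  have vcyc: "induced_cycle (v # ?S)" using v Z by (intro induced_cycle_bypass[OF cyc']) auto
  have no_nbr: "nbrs_in v (insert x D) = {}" if "D \<subseteq> set Z" for D using v that unfolding nbrs_in_def
    by auto
  have not_three: "num_spokes ?S \<noteq> 3" using num_spokes_cycle_neq_3[OF vcyc] x v(6)
    by (auto simp: E_commute)
  have tripod: False
    if "D \<subseteq> set Z" "connected_set (insert x D)" "last Z \<in> D \<Longrightarrow> \<not> E x c" "hd Z \<in> D \<Longrightarrow> \<not> E x c'"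
      "num_spokes ?S + (if last Z \<in> D then 1 else 0) + (if hd Z \<in> D then 1 else 0) = 3" for D
    by (rule no_hub_tripod[OF cyc' Z vcyc, of D, OF _ _ _ _ _ _ _ no_nbr[OF that(1)]])
      (use that x v in \<open>auto simp del: num_spokes_simps\<close>)
  have "2 \<le> num_spokes Z" using spokes(3) small not_three by auto
  moreover have "induced_path Z" using induced_cycle_infix[of ?S Z "[]"] cyc' by auto
  ultimately obtain S T where legs: "S \<subseteq> set Z" "T \<subseteq> set Z" "hd Z \<in> S" "last Z \<notin> S" "last Z \<in> T"
    "hd Z \<notin> T"
      "connected_set (insert x S)" "connected_set (insert x T)" "connected_set (insert x (S \<union> T))"
    using outer_spoke_legs by blast
  have "0 < num_spokes ?S" using spokes(1) by simp
  then have "num_spokes ?S = 1 \<or> num_spokes ?S = 2" using small not_three by linarith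
  then consider (one_spoke) "num_spokes ?S = 1" "\<not> E x c" "\<not> E x c'"
    | (two_spokes_left) "num_spokes ?S = 2" "\<not> E x c'"
    | (two_spokes_right) "num_spokes ?S = 2" "\<not> E x c" using spokes(1) by (auto split: if_splits)
  then show False
  proof cases
    case one_spoke
    then show ?thesis using tripod[of "S \<union> T"] legs by auto
  next
    case two_spokes_left
    then show ?thesis using tripod[of S] legs by simp
  next
    case two_spokes_right
    then show ?thesis using tripod[of T] legs by simp
  qed
qed

lemma no_hub_nbr_leg:
  assumes cyc: "induced_cycle (c # I @ c' # O1 @ q # O3)"
    and x: "x \<notin> set (c # I @ c' # O1 @ q # O3)" "x \<noteq> v"
    and v: "v \<in> V" "v \<notin> set (c # I @ c' # O1 @ q # O3)" "E v c" "E v c'" "\<And>b. b \<in> set I \<Longrightarrow> \<not> E v b"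
      "E v x" "\<And>b. b \<in> set (q # O3) \<Longrightarrow> \<not> E v b"
    and spokes: "num_spokes (c # I @ [c']) = 1" "\<not> E x c" "E x q" "O1 \<noteq> []"
  shows False
proof -
  let ?S = "c # I @ [c']" and ?Z = "O1 @ q # O3"
  have cyc': "induced_cycle (?S @ ?Z)" using cyc by simp
  have vcyc: "induced_cycle (v # ?S)" using v by (intro induced_cycle_bypass[OF cyc']) auto
  have leg: "induced_path (q # O3)" using induced_cycle_infix[of "?S @ O1" "q # O3" "[]"] cyc' by auto
  have nbrs: "nbrs_in v (insert x (set (q # O3))) = {x}" using v unfolding nbrs_in_def by auto
  have connected: "connected_set (insert x (set (q # O3)))"
    using connected_set_insert_hub[of "q # O3"] leg spokes by auto
  have ends: "hd ?Z \<notin> set (q # O3)" "last ?Z \<in> set (q # O3)"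
    using induced_cycle_distinct[OF cyc'] spokes(4) by (auto simp: hd_append disjoint_iff)
  show False
    by (rule no_hub_tripod[OF cyc' _ vcyc _ _ _ _ connected _ _ nbrs])
      (use x v spokes ends in \<open>auto simp del: num_spokes_simps\<close>)
qed

lemma no_two_spoke_arc_at_nonspoke:
  assumes cyc: "induced_cycle (y # J1 @ p # M @ p' # J2)"
    and x: "x \<notin> set (y # J1 @ p # M @ p' # J2)" "x \<noteq> v"
    and v: "v \<in> V" "v \<notin> set (y # J1 @ p # M @ p' # J2)" "E v y" "E v p" "E v p'"
      "\<And>b. b \<in> set (J1 @ J2) \<Longrightarrow> \<not> E v b" "\<not> E v x"
    and spokes: "num_spokes M \<le> 1" "4 \<le> num_spokes (y # J1 @ p # M @ p' # J2)"
    and arcs: "num_spokes (y # J1 @ [p]) = 2" "num_spokes (p' # J2 @ [y]) \<le> 2" and y: "\<not> E x y"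
  shows False
proof -
  have left_cyc: "induced_cycle ((y # J1 @ [p]) @ (M @ p' # J2))" using cyc by simp
  have right_cyc: "induced_cycle ((p' # J2 @ [y]) @ (J1 @ p # M))"
    using induced_cycle_rotate[of "y # J1 @ p # M" "p' # J2"] cyc
      induced_cycle_rotate[of "p' # J2" "y # J1 @ p # M"] by simp
  have left_vcyc: "induced_cycle (v # y # J1 @ [p])"
    using v by (intro induced_cycle_bypass[OF left_cyc]) auto
  have right_vcyc: "induced_cycle (v # p' # J2 @ [y])"
    using v by (intro induced_cycle_bypass[OF right_cyc]) auto
  have dist: "distinct (y # J1 @ p # M @ p' # J2)" using induced_cycle_distinct[OF cyc] .
  show False
  proof (cases "num_spokes J2 = 0")
    case False
    then obtain A q B where q: "J2 = A @ q # B" "E x q" "num_spokes B = 0" using last_spoke[of J2]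
      by auto
    have "induced_path (q # B)" using induced_cycle_infix[of "y # J1 @ p # M @ p' # A" "q # B" "[]"] cyc
      q by auto
    then have connected: "connected_set (insert x (set (q # B)))" by (rule connected_set_insert_hub)
      (use q in auto)
    have ends: "last (M @ p' # J2) \<in> set (q # B)" "hd (M @ p' # J2) \<notin> set (q # B)"
      using dist q by (cases M; auto)+
    have nbrs: "nbrs_in v (insert x (set (q # B))) = {}" using v q unfolding nbrs_in_def by auto
    show False
      by (rule no_hub_tripod[OF left_cyc _ left_vcyc _ _ _ _ connected _ _ nbrs])
        (use x v arcs ends y q in \<open>auto simp del: num_spokes_simps\<close>)
  next
    case True
    have M: "M \<noteq> []" and p': "E x p'" and left_spokes: "num_spokes J1 + (if E x p then 1 else 0) = 2"
      using True arcs y spokes by (auto split: if_splits)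
    have "induced_path (J1 @ [p])" using induced_cycle_infix[of "[y]" "J1 @ [p]" "M @ p' # J2"] cyc
      by auto
    then have connected: "connected_set (insert x (set (J1 @ [p])))"
      by (rule connected_set_insert_hub) (use left_spokes in auto)
    have ends: "last (J1 @ p # M) \<notin> set (J1 @ [p])" "hd (J1 @ p # M) \<in> set (J1 @ [p])"
      using dist M by (cases M rule: rev_cases; cases J1; auto)+
    have nbrs: "nbrs_in v (insert x (set (J1 @ [p]))) = {p}" using v unfolding nbrs_in_def by auto
    show False
      by (rule no_hub_tripod[OF right_cyc _ right_vcyc _ _ _ _ connected _ _ nbrs])
        (use x v y arcs M ends p' True in auto)
  qed
qed

lemma two_spoke_arc_next_spoke:
  assumes cyc: "induced_cycle (y # J1 @ p # M @ p' # J2)"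
    and x: "x \<notin> set (y # J1 @ p # M @ p' # J2)" "x \<noteq> v"
    and v: "v \<in> V" "v \<notin> set (y # J1 @ p # M @ p' # J2)" "E v y" "E v p" "E v p'"
      "\<And>b. b \<in> set (J1 @ J2) \<Longrightarrow> \<not> E v b" "\<not> E v x"
    and spokes: "0 < num_spokes M" "0 < num_spokes (J1 @ [p])" "num_spokes (p' # J2 @ [y]) = 2"
    and y: "E x y"
  shows "E x (hd (J1 @ [p])) \<and> E y (hd (J1 @ [p]))"
proof (rule ccontr)
  assume contra: "\<not> ?thesis"
  have right_cyc: "induced_cycle ((p' # J2 @ [y]) @ (J1 @ p # M))"
    using induced_cycle_rotate[of "y # J1 @ p # M" "p' # J2"] cyc
      induced_cycle_rotate[of "p' # J2" "y # J1 @ p # M"] by simp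
  have vcyc: "induced_cycle (v # p' # J2 @ [y])"
    using v by (intro induced_cycle_bypass[OF right_cyc]) auto
  have dist: "distinct (y # J1 @ p # M @ p' # J2)" using induced_cycle_distinct[OF cyc] .
  have M: "M \<noteq> []" using spokes by auto
  have "E y (hd (J1 @ [p]))"
    using induced_cycle_cross[of "[y]" "J1 @ p # M @ p' # J2" y "hd (J1 @ [p])"] cyc
    by (auto simp: hd_append)
  with contra have nonspoke: "\<not> E x (hd (J1 @ [p]))" by auto
  obtain A q B where q: "J1 @ [p] = A @ q # B" "E x q" "num_spokes B = 0" using last_spoke[OF spokes(2)]
    by blast
  have A: "A \<noteq> []" using nonspoke q by auto
  have "y # J1 @ p # M @ p' # J2 = (y # A) @ (q # B) @ (M @ p' # J2)"
    using arg_cong[OF q(1), of "\<lambda>l. y # l @ M @ p' # J2"] by simp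
  then have "induced_cycle ((y # A) @ (q # B) @ (M @ p' # J2))" using cyc by argo
  then have "induced_path (q # B)" by (rule induced_cycle_infix) simp
  then have connected: "connected_set (insert x (set (q # B)))" by (rule connected_set_insert_hub)
    (use q in auto)
  have subset: "set (q # B) \<subseteq> set (J1 @ [p])" "p \<in> set (q # B)"
    unfolding q(1) using arg_cong[OF q(1), of last] last_in_set[of "q # B"] by auto
  have ends: "last (J1 @ p # M) \<notin> set (q # B)" "hd (J1 @ p # M) \<notin> set (q # B)"
  proof -
    have "last (J1 @ p # M) \<in> set M" using M by auto
    then show "last (J1 @ p # M) \<notin> set (q # B)" using dist subset(1) by (auto simp: disjoint_iff)
    have "hd (J1 @ p # M) = hd A" using arg_cong[OF q(1), of hd] A
      by (simp add: hd_append split: if_splits)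
    moreover have "distinct (A @ q # B)" using dist unfolding q(1)[symmetric] by auto
    ultimately show "hd (J1 @ p # M) \<notin> set (q # B)" using A by (auto simp: disjoint_iff)
  qed
  have nbrs: "nbrs_in v (insert x (set (q # B))) = {p}" using v subset unfolding nbrs_in_def by auto
  show False
    by (rule no_hub_tripod[OF right_cyc _ vcyc _ _ _ _ connected _ _ nbrs])
      (use x v spokes M ends subset in \<open>auto simp del: num_spokes_simps\<close>)
qed

lemma no_two_spoke_arcs_to_nbr:
  assumes cyc: "induced_cycle (y # J1 @ p # M @ p' # J2)"
    and x: "x \<notin> set (y # J1 @ p # M @ p' # J2)" "x \<noteq> v"
    and v: "v \<in> V" "v \<notin> set (y # J1 @ p # M @ p' # J2)" "E v y" "E v p" "E v p'"
      "\<And>b. b \<in> set (J1 @ J2) \<Longrightarrow> \<not> E v b" "\<not> E v x"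
    and spokes: "num_spokes M \<le> 1" "4 \<le> num_spokes (y # J1 @ p # M @ p' # J2)"
    and arcs: "num_spokes (y # J1 @ [p]) \<le> 2" "num_spokes (p' # J2 @ [y]) \<le> 2"
  shows False
proof -
  have "induced_cycle (rev (J1 @ p # M @ p' # J2) @ [y])" using induced_cycle_rev[OF cyc] by simp
  then have rev_cyc: "induced_cycle (y # rev J2 @ p' # rev M @ p # rev J1)"
    using induced_cycle_rotate[of "rev (J1 @ p # M @ p' # J2)" "[y]"] by simp
  show False
  proof (cases "E x y")
    case True
    then have M: "0 < num_spokes M"
      and two: "num_spokes (y # J1 @ [p]) = 2" "num_spokes (p' # J2 @ [y]) = 2"
      using spokes arcs by auto
    have pos: "0 < num_spokes (J1 @ [p])" "0 < num_spokes (rev J2 @ [p'])" using two True by auto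
    have "E x (hd (J1 @ [p])) \<and> E y (hd (J1 @ [p]))"
      using two_spoke_arc_next_spoke[OF cyc x v M pos(1) two(2) True] by blast
    moreover have "E x (hd (rev J2 @ [p'])) \<and> E y (hd (rev J2 @ [p']))"
      using two_spoke_arc_next_spoke[OF rev_cyc, of v] x v M two(1) pos(2) True by auto
    ultimately have "hd (J1 @ [p]) = hd (rev J2 @ [p'])" using triangles_share_edge[of x y] True
      by blast
    moreover have "hd (J1 @ [p]) \<in> set (J1 @ [p])" "hd (rev J2 @ [p']) \<in> set (rev J2 @ [p'])"
      by (meson hd_in_set snoc_eq_iff_butlast)+
    ultimately show ?thesis using induced_cycle_distinct[OF cyc] by auto
  next
    case False
    then have "num_spokes (y # J1 @ [p]) = 2 \<or> num_spokes (p' # J2 @ [y]) = 2"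
      using spokes arcs by (auto split: if_splits)
    then consider (left) "num_spokes (y # J1 @ [p]) = 2" | (right) "num_spokes (p' # J2 @ [y]) = 2"
      by blast
    then show ?thesis
    proof cases
      case left
      then show ?thesis using no_two_spoke_arc_at_nonspoke[OF cyc x v spokes] arcs False by auto
    next
      case right
      then show ?thesis using no_two_spoke_arc_at_nonspoke[OF rev_cyc, of v] x v spokes arcs False
        by auto
    qed
  qed
qed

context
  fixes y J1 p M p' J2 y' G v
  assumes cyc: "induced_cycle (y # J1 @ p # M @ p' # J2 @ y' # G)"
    and x: "x \<notin> set (y # J1 @ p # M @ p' # J2 @ y' # G)" "x \<noteq> v"
    and v: "v \<in> V" "v \<notin> set (y # J1 @ p # M @ p' # J2 @ y' # G)" "E v y" "E v p" "E v p'" "E v y'"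
      "\<And>b. b \<in> set (J1 @ J2 @ G) \<Longrightarrow> \<not> E v b" "\<not> E v x"
    and spokes: "num_spokes M \<le> 1" "num_spokes G = 0"
      "4 \<le> num_spokes (y # J1 @ p # M @ p' # J2 @ y' # G)"
    and arcs: "num_spokes (y # J1 @ [p]) = 2" "num_spokes (p' # J2 @ [y']) \<le> 2"
begin

lemma nbr_pair_distinct: "distinct (y # J1 @ p # M @ p' # J2 @ y' # G)"
  using induced_cycle_distinct[OF cyc] .

lemma nbr_pair_gap_cycle: "induced_cycle ((y' # G @ [y]) @ (J1 @ p # M @ p' # J2))"
  using induced_cycle_rotate[of "y # J1 @ p # M @ p' # J2" "y' # G"] cyc by simp

lemma nbr_pair_gap_vertex_cycle: "induced_cycle (v # y' # G @ [y])"
  using v by (intro induced_cycle_bypass[OF nbr_pair_gap_cycle]) auto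

lemma nbr_pair_paths: "induced_path (J1 @ [p])" "induced_path (p' # J2)"
  using induced_cycle_infix[of "[y]" "J1 @ [p]" "M @ p' # J2 @ y' # G"]
    induced_cycle_infix[of "y # J1 @ p # M" "p' # J2" "y' # G"] cyc by auto

lemma no_nbr_pair_second_spoke:
  assumes y': "E x y'"
  shows False
proof (cases "G = []")
  case False
  have left_cyc: "induced_cycle ((y # J1 @ [p]) @ (M @ p' # J2 @ y' # G))" using cyc by simp
  have left_vcyc: "induced_cycle (v # y # J1 @ [p])"
    using v by (intro induced_cycle_bypass[OF left_cyc]) auto
  have connected: "connected_set (insert x (set [y']))"
    using connected_set_insert_hub[of "[y']"] y' induced_cycle_subset[OF cyc] by auto
  have ends: "last (M @ p' # J2 @ y' # G) \<notin> set [y']" "hd (M @ p' # J2 @ y' # G) \<notin> set [y']"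
    using nbr_pair_distinct False by (cases M; auto)+
  have nbrs: "nbrs_in v (insert x (set [y'])) = {y'}" using v unfolding nbrs_in_def by auto
  show ?thesis
    by (rule no_hub_tripod[OF left_cyc _ left_vcyc _ _ _ _ connected _ _ nbrs])
      (use x v arcs ends in \<open>auto simp del: num_spokes_simps\<close>)
next
  case True
  have "E y y'" using induced_cycle_cross[of "[y]" "J1 @ p # M @ p' # J2 @ y' # G" y y'] cyc True
    by auto
  then have y: "\<not> E x y" using triangles_share_edge[of y y' x v] y' v x(2) E_commute by blast
  have connected: "connected_set (insert x (set (J1 @ [p])))"
    by (rule connected_set_insert_hub[OF nbr_pair_paths(1)]) (use arcs y in auto)
  have ends: "last (J1 @ p # M @ p' # J2) \<notin> set (J1 @ [p])" "hd (J1 @ p # M @ p' # J2) \<in> set (J1 @ [p])"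
    using nbr_pair_distinct by (cases J2 rule: rev_cases; cases J1; auto)+
  have nbrs: "nbrs_in v (insert x (set (J1 @ [p]))) = {p}" using v unfolding nbrs_in_def by auto
  show ?thesis
    by (rule no_hub_tripod[OF nbr_pair_gap_cycle _ nbr_pair_gap_vertex_cycle _ _ _ _ connected _ _ nbrs])
      (use x v arcs ends y y' True in auto)
qed

lemma no_nbr_pair_first_spoke:
  assumes y: "E x y" "\<not> E x y'"
  shows False
proof -
  have connected: "connected_set (insert x (set (p' # J2)))"
    by (rule connected_set_insert_hub[OF nbr_pair_paths(2)]) (use arcs spokes y in auto)
  have ends: "last (J1 @ p # M @ p' # J2) \<in> set (p' # J2)" "hd (J1 @ p # M @ p' # J2) \<notin> set (p' # J2)"
    using nbr_pair_distinct by (cases J1; auto)+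
  have nbrs: "nbrs_in v (insert x (set (p' # J2))) = {p'}" using v unfolding nbrs_in_def by auto
  show False
    by (rule no_hub_tripod[OF nbr_pair_gap_cycle _ nbr_pair_gap_vertex_cycle _ _ _ _ connected _ _ nbrs])
      (use x v arcs ends y spokes in auto)
qed

lemma no_nbr_pair_nonspokes:
  assumes y: "\<not> E x y" "\<not> E x y'"
  shows False
proof (cases "num_spokes J2 = 0")
  case False
  then obtain A q B where q: "J2 = A @ q # B" "E x q" "num_spokes B = 0" using last_spoke[of J2] by auto
  have "induced_path (q # B)" using induced_path_infix[of "p' # A" "q # B" "[]"] nbr_pair_paths(2) q
    by auto
  then have connected: "connected_set (insert x (set (J1 @ [p]) \<union> set (q # B)))"
    using arcs y q by (intro connected_set_insert_hub2[OF nbr_pair_paths(1)]) auto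
  have ends: "last (J1 @ p # M @ p' # J2) \<in> set (J1 @ [p]) \<union> set (q # B)"
    "hd (J1 @ p # M @ p' # J2) \<in> set (J1 @ [p]) \<union> set (q # B)"
    using q by (cases J1; auto)+
  have nbrs: "nbrs_in v (insert x (set (J1 @ [p]) \<union> set (q # B))) = {p}" using v q unfolding nbrs_in_def
    by auto
  show ?thesis
    by (rule no_hub_tripod[OF nbr_pair_gap_cycle _ nbr_pair_gap_vertex_cycle _ _ _ _ connected _ _ nbrs])
      (use x v ends y spokes q in auto)
next
  case True
  then have p': "E x p'" and "0 < num_spokes J1" using arcs spokes y by (auto split: if_splits)
  then obtain A q B where q: "J1 = A @ q # B" "E x q" "num_spokes A = 0" using first_spoke[of J1]
    by auto
  have "induced_path (A @ [q])" using induced_path_infix[of "[]" "A @ [q]" "B @ [p]"]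
    nbr_pair_paths(1) q by auto
  then have connected: "connected_set (insert x (set (A @ [q]) \<union> set (p' # J2)))"
    using p' q by (intro connected_set_insert_hub2[OF _ _ nbr_pair_paths(2)]) auto
  have ends: "last (J1 @ p # M @ p' # J2) \<in> set (A @ [q]) \<union> set (p' # J2)"
    "hd (J1 @ p # M @ p' # J2) \<in> set (A @ [q]) \<union> set (p' # J2)"
    using q by (cases A; auto)+
  have nbrs: "nbrs_in v (insert x (set (A @ [q]) \<union> set (p' # J2))) = {p'}" using v q
    unfolding nbrs_in_def by auto
  show ?thesis
    by (rule no_hub_tripod[OF nbr_pair_gap_cycle _ nbr_pair_gap_vertex_cycle _ _ _ _ connected _ _ nbrs])
      (use x v ends y spokes q in auto)
qed

lemma no_two_spoke_arc_to_nbr_pair: False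
  using no_nbr_pair_second_spoke no_nbr_pair_first_spoke no_nbr_pair_nonspokes by blast

end

lemma no_two_spoke_arcs_to_nbr_pair:
  assumes cyc: "induced_cycle (y # J1 @ p # M @ p' # J2 @ y' # G)"
    and x: "x \<notin> set (y # J1 @ p # M @ p' # J2 @ y' # G)" "x \<noteq> v"
    and v: "v \<in> V" "v \<notin> set (y # J1 @ p # M @ p' # J2 @ y' # G)" "E v y" "E v p" "E v p'" "E v y'"
      "\<And>b. b \<in> set (J1 @ J2 @ G) \<Longrightarrow> \<not> E v b" "\<not> E v x"
    and spokes: "num_spokes M \<le> 1" "num_spokes G = 0"
      "4 \<le> num_spokes (y # J1 @ p # M @ p' # J2 @ y' # G)"
    and arcs: "num_spokes (y # J1 @ [p]) \<le> 2" "num_spokes (p' # J2 @ [y']) \<le> 2"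
  shows False
proof -
  have "induced_cycle (rev G @ y' # rev J2 @ p' # rev M @ p # rev J1 @ [y])"
    using induced_cycle_rev[OF cyc] by simp
  then have rev_cyc: "induced_cycle (y' # rev J2 @ p' # rev M @ p # rev J1 @ y # rev G)"
    using induced_cycle_rotate[of "rev G" "y' # rev J2 @ p' # rev M @ p # rev J1 @ [y]"] by simp
  consider (left) "num_spokes (y # J1 @ [p]) = 2" | (right) "num_spokes (p' # J2 @ [y']) = 2"
    using spokes arcs by fastforce
  then show False
  proof cases
    case left
    then show ?thesis using no_two_spoke_arc_to_nbr_pair[OF cyc x v spokes] arcs by auto
  next
    case right
    then show ?thesis using no_two_spoke_arc_to_nbr_pair[OF rev_cyc, of v] x v spokes arcs by auto
  qed
qed

section \<open>Vertices attached to a single sector\<close>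

text \<open>If there are at least four spokes, this means that all neighbours of \<open>v\<close> on the cycle lie in one
  sector.\<close>

definition unseparated :: "'a list \<Rightarrow> 'a \<Rightarrow> bool" where
  "unseparated L v \<longleftrightarrow> (\<forall>X c Y c' Z. L = X @ c # Y @ c' # Z \<longrightarrow> E v c \<longrightarrow> E v c' \<longrightarrow>
     num_spokes Y = 0 \<or> num_spokes (X @ Z) = 0)"

definition proper_for :: "'a list \<Rightarrow> 'a \<Rightarrow> bool" where
  "proper_for L v \<longleftrightarrow> unseparated L v \<and> (\<not> E v x \<longrightarrow> card (nbrs_in v (set L)) \<le> 2)"

lemma unseparatedD:
  "unseparated (X @ c # Y @ c' # Z) v \<Longrightarrow> E v c \<Longrightarrow> E v c' \<Longrightarrow> num_spokes Y = 0 \<or> num_spokes (X @ Z) = 0"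
  unfolding unseparated_def by (elim allE[of _ X] allE[of _ c] allE[of _ Y] allE[of _ c'] allE[of _ Z])
    simp

lemma unseparated_no_nbr:
  assumes "\<And>b. b \<in> set L \<Longrightarrow> \<not> E v b"
  shows "unseparated L v"
  unfolding unseparated_def using assms by auto

lemma unseparated_single_nbr:
  assumes L: "L = X @ c # Z" and none: "\<And>b. b \<in> set (X @ Z) \<Longrightarrow> \<not> E v b"
  shows "unseparated L v"
  unfolding unseparated_def
proof (intro allI impI)
  fix X1 c1 Y c2 Z1 assume split: "L = X1 @ c1 # Y @ c2 # Z1" and nbrs: "E v c1" "E v c2"
  have "X @ c # Z = X1 @ c1 # Y @ c2 # Z1" using L split by simp
  then obtain W where "c # Z = W @ c1 # Y @ c2 # Z1"
    by (rule before_first_occurrence[of _ _ _ _ _ _ "E v"]) (use nbrs(1) none in auto)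
  then have False using nbrs none by (cases W) auto
  then show "num_spokes Y = 0 \<or> num_spokes (X1 @ Z1) = 0" by blast
qed

lemma unseparated_inner:
  assumes L: "L = X @ c # Y @ c' # Z" and none: "\<And>b. b \<in> set (X @ Z) \<Longrightarrow> \<not> E v b"
    and Y: "num_spokes Y = 0"
  shows "unseparated L v"
  unfolding unseparated_def
proof (intro allI impI disjI1)
  fix X1 c1 Y1 c2 Z1 assume split: "L = X1 @ c1 # Y1 @ c2 # Z1" and nbrs: "E v c1" "E v c2"
  have "X @ c # Y @ c' # Z = X1 @ c1 # Y1 @ c2 # Z1" using L split by simp
  then obtain W where W: "c # Y @ c' # Z = W @ c1 # Y1 @ c2 # Z1"
    by (rule before_first_occurrence[of _ _ _ _ _ _ "E v"]) (use nbrs(1) none in auto)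
  then have "(c # Y) @ c' # Z = (W @ c1 # Y1) @ c2 # Z1" by simp
  then obtain W' where "(c # Y) @ [c'] = (W @ c1 # Y1) @ c2 # W'"
    by (rule after_last_occurrence[of _ _ _ _ _ _ "E v"]) (use nbrs(2) none in auto)
  then have "set Y1 \<subseteq> set Y" by (cases W; cases W' rule: rev_cases) auto
  then show "num_spokes Y1 = 0" using Y unfolding num_spokes_0_iff by blast
qed

lemma unseparated_rotate1:
  assumes "unseparated (a # L) v"
  shows "unseparated (L @ [a]) v"
  unfolding unseparated_def
proof (intro allI impI)
  fix X c Y c' Z assume L: "L @ [a] = X @ c # Y @ c' # Z" and nbrs: "E v c" "E v c'"
  show "num_spokes Y = 0 \<or> num_spokes (X @ Z) = 0"
  proof (cases Z rule: rev_cases)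
    case Nil
    then have "L = X @ c # Y" "c' = a" using L by auto
    then show ?thesis using unseparatedD[of "[]" a X c Y v] assms nbrs Nil by auto
  next
    case (snoc Z' b)
    then have "L = X @ c # Y @ c' # Z'" "a = b" using L by auto
    then show ?thesis using unseparatedD[of "a # X" c Y c' Z' v] assms nbrs snoc by auto
  qed
qed

lemma unseparated_rotate: "unseparated (A @ B) v \<Longrightarrow> unseparated (B @ A) v"
proof (induction A arbitrary: B)
  case (Cons a A)
  have "unseparated (A @ B @ [a]) v" using unseparated_rotate1[of a "A @ B" v] Cons.prems by simp
  then have "unseparated ((B @ [a]) @ A) v" using Cons.IH[of "B @ [a]"] by simp
  then show ?case by simp
qed simp

lemma unseparated_outer:
  assumes L: "L = X @ c # Y @ c' # Z" and none: "\<And>b. b \<in> set Y \<Longrightarrow> \<not> E v b"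
    and XZ: "num_spokes (X @ Z) = 0"
  shows "unseparated L v"
proof -
  have "unseparated ((c' # Z) @ (X @ c # Y)) v"
    by (rule unseparated_inner[of _ "[]" c' "Z @ X" c Y]) (use none XZ in auto)
  then show ?thesis using unseparated_rotate[of "c' # Z" "X @ c # Y"] L by simp
qed

lemma unseparated_rev:
  assumes L: "unseparated L v"
  shows "unseparated (rev L) v"
  unfolding unseparated_def
proof (intro allI impI)
  fix X c Y c' Z assume split: "rev L = X @ c # Y @ c' # Z" and nbrs: "E v c" "E v c'"
  have "L = rev Z @ c' # rev Y @ c # rev X" using arg_cong[OF split, of rev] by simp
  then show "num_spokes Y = 0 \<or> num_spokes (X @ Z) = 0"
    using unseparatedD[of "rev Z" c' "rev Y" c "rev X" v] L nbrs by auto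
qed

lemma proper_for_rotate: "proper_for (A @ B) v \<Longrightarrow> proper_for (B @ A) v"
  unfolding proper_for_def using unseparated_rotate by (simp add: Un_commute)

lemma proper_for_rev: "proper_for L v \<Longrightarrow> proper_for (rev L) v"
  unfolding proper_for_def using unseparated_rev by simp

lemma unseparated_segment:
  assumes L: "unseparated (X @ T @ Z) w" and outside: "0 < num_spokes (X @ Z)" and v: "\<not> E w v"
  shows "unseparated (v # T) w"
  unfolding unseparated_def
proof (intro allI impI)
  fix X' c Y c' Z' assume split: "v # T = X' @ c # Y @ c' # Z'" and nbrs: "E w c" "E w c'"
  then obtain X'' where "X' = v # X''" using v by (cases X') auto
  then have "unseparated ((X @ X'') @ c # Y @ c' # (Z' @ Z)) w" using L split by simp
  from unseparatedD[OF this nbrs] show "num_spokes Y = 0 \<or> num_spokes (X' @ Z') = 0" using outside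
    by auto
qed

lemma unseparated_same_cycle:
  assumes cycles: "induced_cycle as" "induced_cycle bs" and same: "set as = set bs"
    and as: "unseparated as v"
  shows "unseparated bs v"
proof -
  obtain c M where bs: "bs = c # M" using cycles(2) by (cases bs) auto
  then obtain X Y where split: "as = X @ c # Y" using same by (metis list.set_intros(1) split_list)
  let ?cs = "c # (Y @ X)" and ?ds = "c # rev (Y @ X)"
  have cs: "induced_cycle ?cs"
    using induced_cycle_rotate[of X "c # Y"] cycles(1) split by (simp del: induced_cycle.simps)
  have as_unseparated: "unseparated ?cs v" using unseparated_rotate[of X "c # Y" v] as split by simp
  then have rev_unseparated: "unseparated ?ds v"
    using unseparated_rotate[of "rev (Y @ X)" "[c]" v] unseparated_rev[OF as_unseparated] by simp
  obtain Z where Z: "?cs = bs @ Z \<or> ?ds = bs @ Z"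
    using induced_cycle_walk[OF cs induced_cycle_successively[OF cycles(2)]
      induced_cycle_distinct[OF cycles(2)]]
      same split bs by auto
  have "length as = length bs"
    using induced_cycle_distinct[OF cycles(1)] induced_cycle_distinct[OF cycles(2)] same distinct_card
    by metis
  then have "length ?cs = length bs" "length ?ds = length bs" using split by auto
  then have "length (bs @ Z) = length bs" using Z by metis
  then have "Z = []" by simp
  then have "?cs = bs \<or> ?ds = bs" using Z by simp
  then show ?thesis using as_unseparated rev_unseparated by metis
qed

lemma nonadjacent_spoke:
  assumes "4 \<le> num_spokes L" "unseparated L v"
  obtains e where "e \<in> set L" "E x e" "\<not> E v e"
proof -
  have "0 < num_spokes L" using assms(1) by simp
  then obtain A0 e0 A1 where e0: "L = A0 @ e0 # A1" "E x e0" "num_spokes A0 = 0" by (rule first_spoke)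
  have "0 < num_spokes A1" using assms(1) e0 by simp
  then obtain B1 e1 A2 where e1: "A1 = B1 @ e1 # A2" "E x e1" "num_spokes B1 = 0" by (rule first_spoke)
  have "0 < num_spokes A2" using assms(1) e0 e1 by simp
  then obtain B2 e2 A3 where e2: "A2 = B2 @ e2 # A3" "E x e2" "num_spokes B2 = 0" by (rule first_spoke)
  have "unseparated (A0 @ e0 # (B1 @ e1 # B2) @ e2 # A3) v" using assms(2) e0 e1 e2 by simp
  from unseparatedD[OF this] have "\<not> (E v e0 \<and> E v e2)" using assms(1) e0 e1 e2 by auto
  then show thesis using that e0 e1 e2 by auto
qed

lemma sector_around:
  assumes cyc: "induced_cycle ((e # L1) @ Y @ R1)" and e: "E x e"
    and spokes: "2 \<le> num_spokes ((e # L1) @ Y @ R1)" "num_spokes Y = 0" and R1: "R1 \<noteq> []"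
    and nbrs: "\<And>b. b \<in> set ((e # L1) @ Y @ R1) \<Longrightarrow> E v b \<Longrightarrow> b = last (e # L1) \<or> b \<in> set Y \<or> b = hd R1"
  obtains f X f' Z where "induced_cycle (f # X @ f' # Z)" "set (f # X @ f' # Z)
    = set ((e # L1) @ Y @ R1)"
    "E x f" "E x f'" "num_spokes X = 0"
    "\<And>b. b \<in> set ((e # L1) @ Y @ R1) \<Longrightarrow> E v b \<Longrightarrow> b \<in> set (f # X @ [f'])"
proof -
  have "0 < num_spokes (e # L1)" using e by simp
  then obtain U f W where f: "e # L1 = U @ f # W" "E x f" "num_spokes W = 0" by (rule last_spoke)
  have last: "last (e # L1) \<in> set (f # W)" unfolding f(1) by simp
  consider (spoke) W1 f' U' where "R1 = W1 @ f' # U'" "E x f'" "num_spokes W1 = 0"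
    | (spokeless) "num_spokes R1 = 0"
    using first_spoke[of R1] by blast
  then show thesis
  proof cases
    case spoke
    have hd: "hd R1 \<in> set (W1 @ [f'])" unfolding spoke(1) by (cases W1) auto
    show thesis
    proof (rule that[of f "W @ Y @ W1" f' "U' @ U"])
      show "induced_cycle (f # (W @ Y @ W1) @ f' # (U' @ U))"
        using induced_cycle_rotate[of U "f # W @ Y @ W1 @ f' # U'"] cyc unfolding f(1) spoke(1)
        by (simp del: induced_cycle.simps)
      show "b \<in> set (f # (W @ Y @ W1) @ [f'])" if "b \<in> set ((e # L1) @ Y @ R1)" "E v b" for b
        using nbrs[OF that] last hd by auto
      show "set (f # (W @ Y @ W1) @ f' # U' @ U) = set ((e # L1) @ Y @ R1)" unfolding f(1) spoke(1)
        by auto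
    qed (use f spoke spokes in auto)
  next
    case spokeless
    have "U \<noteq> []" using f spokeless spokes arg_cong[OF f(1), of num_spokes] by auto
    then obtain U2 where U: "U = e # U2" using f(1) by (cases U) auto
    show thesis
    proof (rule that[of f "W @ Y @ R1" e U2])
      show "induced_cycle (f # (W @ Y @ R1) @ e # U2)"
        using induced_cycle_rotate[of U "f # W @ Y @ R1"] cyc U unfolding f(1)
        by (simp del: induced_cycle.simps)
      show "b \<in> set (f # (W @ Y @ R1) @ [e])" if "b \<in> set ((e # L1) @ Y @ R1)" "E v b" for b
        using nbrs[OF that] last hd_in_set[OF R1] by auto
      show "set (f # (W @ Y @ R1) @ e # U2) = set ((e # L1) @ Y @ R1)" unfolding f(1) U by auto
    qed (use f spokeless spokes e in auto)
  qed
qed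

lemma unseparated_nbr_arc:
  assumes L: "unseparated (e # R) v" and e: "E x e" "\<not> E v e" and R: "R \<noteq> []"
  obtains L1 Y R1 where "e # R = (e # L1) @ Y @ R1" "num_spokes Y = 0" "R1 \<noteq> []"
    "\<And>b. b \<in> set (e # R) \<Longrightarrow> E v b \<Longrightarrow> b = last (e # L1) \<or> b \<in> set Y \<or> b = hd R1"
proof (rule outermost_occurrences[of R "E v"])
  assume "\<And>b. b \<in> set R \<Longrightarrow> \<not> E v b"
  then show thesis using that[of "[]" "[]" R] R e(2) by auto
next
  fix X c Z assume "R = X @ c # Z" "E v c" "\<And>b. b \<in> set (X @ Z) \<Longrightarrow> \<not> E v b"
  then show thesis using that[of X "[]" "c # Z"] e(2) by auto
next
  fix X c Y c' Z assume c: "R = X @ c # Y @ c' # Z" "E v c" "E v c'" "\<And>b. b \<in> set (X @ Z) \<Longrightarrow> \<not> E v b"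
  have "unseparated ((e # X) @ c # Y @ c' # Z) v" using L c(1) by simp
  from unseparatedD[OF this c(2,3)] have "num_spokes Y = 0" using e(1) by simp
  then show thesis using that[of "X @ [c]" Y "c' # Z"] c e(2) by auto
qed

lemma unseparated_sector:
  assumes L: "induced_cycle L" "4 \<le> num_spokes L" "unseparated L v"
  obtains f X f' Z where "induced_cycle (f # X @ f' # Z)" "set (f # X @ f' # Z) = set L" "E x f"
    "E x f'"
    "num_spokes X = 0" "\<And>b. b \<in> set L \<Longrightarrow> E v b \<Longrightarrow> b \<in> set (f # X @ [f'])"
proof -
  obtain e where e: "e \<in> set L" "E x e" "\<not> E v e" using nonadjacent_spoke[OF L(2,3)] .
  obtain X0 R0 where split: "L = X0 @ e # R0" using e(1) by (meson split_list)
  define R where "R = R0 @ X0"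
  have R: "induced_cycle (e # R)" "unseparated (e # R) v" "set (e # R) = set L" "num_spokes (e # R)
    = num_spokes L"
    using L(1,3) induced_cycle_rotate[of X0 "e # R0"] unseparated_rotate[of X0 "e # R0" v]
    unfolding R_def split
    by (auto simp del: induced_cycle.simps)
  have "R \<noteq> []" using R(1) by auto
  then obtain L1 Y R1 where arc: "e # R = (e # L1) @ Y @ R1" "num_spokes Y = 0" "R1 \<noteq> []"
    "\<And>b. b \<in> set (e # R) \<Longrightarrow> E v b \<Longrightarrow> b = last (e # L1) \<or> b \<in> set Y \<or> b = hd R1"
    by (rule unseparated_nbr_arc[OF R(2) e(2,3)]) (rule that)
  have nbrs: "b = last (e # L1) \<or> b \<in> set Y \<or> b = hd R1" if "b \<in> set ((e # L1) @ Y @ R1)" "E v b" for b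
    using arc(4)[of b] that unfolding arc(1) by blast
  have "2 \<le> num_spokes ((e # L1) @ Y @ R1)" using R(4) L(2) arc(1) by simp
  then obtain f X f' Z where f: "induced_cycle (f # X @ f' # Z)" "set (f # X @ f' # Z)
    = set ((e # L1) @ Y @ R1)"
    "E x f" "E x f'" "num_spokes X = 0"
    "\<And>b. b \<in> set ((e # L1) @ Y @ R1) \<Longrightarrow> E v b \<Longrightarrow> b \<in> set (f # X @ [f'])"
    by (rule sector_around[of e L1 Y R1 v, OF R(1)[unfolded arc(1)] e(2) _ arc(2,3)])
      (erule (1) nbrs, rule that)
  show thesis
    by (rule that[OF f(1) _ f(3-5)]) (use f(2,6) R(3) arc(1) in auto)
qed

end

section \<open>Detours\<close>

context hub
begin

text \<open>The spokes of the path of a detour will lie at one of its ends: up to reversal, at the last one.\<close>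

definition spokes_trailing :: "'a list \<Rightarrow> bool" where
  "spokes_trailing P \<longleftrightarrow>
     num_spokes P \<le> 1 \<or> (\<exists>Q u u'. P = Q @ [u, u'] \<and> num_spokes Q = 0 \<and> E x u \<and> E x u')"

definition spokes_terminal :: "'a list \<Rightarrow> bool" where
  "spokes_terminal P \<longleftrightarrow> spokes_trailing P \<or> spokes_trailing (rev P)"

lemma spokes_terminal_rev: "spokes_terminal (rev P) \<longleftrightarrow> spokes_terminal P"
  unfolding spokes_terminal_def by auto

lemma spokes_trailing_le_1: "num_spokes P \<le> 1 \<Longrightarrow> spokes_trailing P"
  unfolding spokes_trailing_def by blast

lemma spokes_terminal_le_1: "num_spokes P \<le> 1 \<Longrightarrow> spokes_terminal P"
  unfolding spokes_terminal_def by (simp add: spokes_trailing_le_1)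

lemma spokes_trailing_le_2: "spokes_trailing P \<Longrightarrow> num_spokes P \<le> 2"
  unfolding spokes_trailing_def by auto

lemma spokes_terminal_le_2: "spokes_terminal P \<Longrightarrow> num_spokes P \<le> 2"
  unfolding spokes_terminal_def using spokes_trailing_le_2[of P] spokes_trailing_le_2[of "rev P"]
  by auto

lemma spokes_trailing_two:
  assumes "spokes_trailing P" "2 \<le> num_spokes P"
  obtains Q u u' where "P = Q @ [u, u']" "num_spokes Q = 0" "E x u" "E x u'"
  using assms unfolding spokes_trailing_def by fastforce

lemma spokes_terminal_pair: "spokes_terminal [v, w]"
proof (cases "E x v \<and> E x w")
  case True
  then have "spokes_trailing ([] @ [v, w])" unfolding spokes_trailing_def
    by (metis append_Nil num_spokes_simps(1))
  then show ?thesis unfolding spokes_terminal_def by simp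
next
  case False
  then show ?thesis by (intro spokes_terminal_le_1) auto
qed

lemma spokes_trailing_split:
  assumes trailing: "spokes_trailing (X @ Y)" and spokes: "0 < num_spokes X" "0 < num_spokes Y"
  obtains Q u u' where "X = Q @ [u]" "Y = [u']" "num_spokes Q = 0" "E x u" "E x u'"
proof -
  have "2 \<le> num_spokes (X @ Y)" using spokes by simp
  then obtain Q u u' where Q: "X @ Y = Q @ [u, u']" "num_spokes Q = 0" "E x u" "E x u'"
    by (rule spokes_trailing_two[OF trailing])
  have "Y \<noteq> []" using spokes by auto
  then obtain Y' where Y: "Y = Y' @ [u']" "X @ Y' = Q @ [u]"
    using Q(1) by (cases Y rule: rev_cases) (auto simp: append_eq_append_conv2 Cons_eq_append_conv)
  then show thesis using that Q(2-4) spokes(1) by (cases Y' rule: rev_cases) auto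
qed

lemma spokes_trailing_prefix:
  assumes "spokes_trailing (X @ Y)" "Y \<noteq> []"
  shows "num_spokes X \<le> 1"
proof (cases "2 \<le> num_spokes (X @ Y)")
  case True
  then obtain Q u u' where Q: "X @ Y = Q @ [u, u']" "num_spokes Q = 0" "E x u"
    by (rule spokes_trailing_two[OF assms(1)])
  obtain Y' z where "Y = Y' @ [z]" using assms(2) by (metis append_butlast_last_id)
  then have eq: "X @ Y' = Q @ [u]" using Q(1)
    by (metis append.assoc append_Cons append_Nil butlast_snoc)
  have "num_spokes X + num_spokes Y' = 1" using arg_cong[OF eq, of num_spokes] Q(2,3) by simp
  then show ?thesis by simp
qed simp

lemma spokes_trailing_suffix:
  assumes trailing: "spokes_trailing (X @ Y)" and W: "num_spokes W = 0"
  shows "spokes_trailing (W @ Y)"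
proof (cases "2 \<le> num_spokes Y")
  case True
  then have "2 \<le> num_spokes (X @ Y)" by simp
  then obtain Q u u' where Q: "X @ Y = Q @ [u, u']" "num_spokes Q = 0" "E x u" "E x u'"
    by (rule spokes_trailing_two[OF trailing])
  have X: "num_spokes X = 0" using arg_cong[OF Q(1), of num_spokes] Q(2-4) True by simp
  consider (beyond) us where "X = Q @ us" "us @ Y = [u, u']"
    | (within) us where "Q = X @ us" "Y = us @ [u, u']"
    using Q(1) unfolding append_eq_append_conv2 by blast
  then obtain Q' where "Q = X @ Q'" "Y = Q' @ [u, u']"
  proof cases
    case beyond
    then have "us = []" using X Q(3) by (cases us) auto
    then show thesis using beyond that[of "[]"] by simp
  qed (rule that)
  then have "W @ Y = (W @ Q') @ [u, u'] \<and> num_spokes (W @ Q') = 0" using Q(2) W by simp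
  then show ?thesis using Q(3,4) unfolding spokes_trailing_def by blast
qed (use W in \<open>simp add: spokes_trailing_def\<close>)

lemma spokes_terminal_suffix:
  assumes "spokes_terminal (X @ Y)"
  shows "spokes_terminal Y"
  using assms unfolding spokes_terminal_def
proof
  assume "spokes_trailing (X @ Y)"
  then show "spokes_trailing Y \<or> spokes_trailing (rev Y)" using spokes_trailing_suffix[of X Y "[]"]
    by simp
next
  assume trailing: "spokes_trailing (rev (X @ Y))"
  show "spokes_trailing Y \<or> spokes_trailing (rev Y)"
  proof (cases "X = []")
    case False
    then have "num_spokes (rev Y) \<le> 1" using spokes_trailing_prefix[of "rev Y" "rev X"] trailing by simp
    then show ?thesis by (simp add: spokes_trailing_le_1)
  qed (use trailing in simp)
qed

lemma spokes_trailing_shortcut: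
  assumes trailing: "spokes_trailing (X @ M @ Y)" and M: "M \<noteq> []" and Y: "Y \<noteq> []" and v: "\<not> E x v"
  shows "spokes_terminal (X @ v # Y)"
proof (cases "num_spokes X = 0")
  case True
  then show ?thesis using spokes_trailing_suffix[of "X @ M" Y "X @ [v]"] trailing v
    unfolding spokes_terminal_def by simp
next
  case False
  show ?thesis
  proof (cases "2 \<le> num_spokes (X @ M @ Y)")
    case True
    then obtain Q u u' where Q: "X @ M @ Y = Q @ [u, u']" "num_spokes Q = 0"
      by (rule spokes_trailing_two[OF trailing])
    have "1 \<le> length M" "1 \<le> length Y" using M Y by (auto simp: Suc_le_eq)
    moreover have "length (X @ M @ Y) = length Q + 2" using Q by simp
    ultimately have "length X \<le> length Q" by simp
    then obtain W where "Q = X @ W" using Q(1) by (metis append_eq_append_conv_if append_eq_conv_conj)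
    then show ?thesis using Q(2) False by simp
  next
    case False
    then show ?thesis using v by (intro spokes_terminal_le_1) simp
  qed
qed

end

locale proper_rim = hub +
  fixes C :: "'a set"
  assumes rim_exists: "\<exists>cs. induced_cycle cs \<and> set cs = C"
    and hub_notin_rim: "x \<notin> C"
    and rim_proper: "\<lbrakk>induced_cycle cs; set cs = C; v \<in> V; v \<notin> C; v \<noteq> x\<rbrakk> \<Longrightarrow> proper_for cs v"
    and rim_four_spokes: "4 \<le> card (nbrs_in x C)"
begin

definition rim :: "'a list \<Rightarrow> bool" where
  "rim cs \<longleftrightarrow> induced_cycle cs \<and> set cs = C"

definition off_rim :: "'a \<Rightarrow> bool" where
  "off_rim v \<longleftrightarrow> v \<in> V \<and> v \<notin> C \<and> v \<noteq> x"

definition rim_spokes :: nat where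
  "rim_spokes = card (nbrs_in x C)"

lemma rim_cycle: "rim cs \<Longrightarrow> induced_cycle cs"
  and rim_set: "rim cs \<Longrightarrow> set cs = C"
  and rim_distinct: "rim cs \<Longrightarrow> distinct cs"
  unfolding rim_def using induced_cycle_distinct by auto

lemma rim_rotate: "rim (A @ B) \<Longrightarrow> rim (B @ A)"
  unfolding rim_def using induced_cycle_rotate by auto

lemma rim_rev: "rim A \<Longrightarrow> rim (rev A)"
  unfolding rim_def using induced_cycle_rev by auto

lemma rim_rev_arcs: "rim (B @ A) \<Longrightarrow> rim (rev B @ rev A)"
  using rim_rotate[of "rev A" "rev B"] rim_rev[of "B @ A"] by simp

lemma rim_flip: "rim (s # I @ t # Z) \<Longrightarrow> rim (s # rev Z @ t # rev I)"
  using rim_rev[of "s # I @ t # Z"] rim_rotate[of "rev Z @ t # rev I" "[s]"] by simp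

lemma rim_swap: "rim (s # I @ t # Z) \<Longrightarrow> rim (t # Z @ s # I)"
  using rim_rotate[of "s # I" "t # Z"] by simp

lemma rim_num_spokes: "rim cs \<Longrightarrow> num_spokes cs = rim_spokes"
  unfolding rim_spokes_def using num_spokes_card[OF rim_distinct] rim_set by auto

lemma rim_spokes_ge_4: "4 \<le> rim_spokes"
  using rim_four_spokes unfolding rim_spokes_def .

lemma rim_unseparated: "rim cs \<Longrightarrow> off_rim v \<Longrightarrow> unseparated cs v"
  unfolding rim_def off_rim_def using rim_proper unfolding proper_for_def by blast

lemma finite_rim: "finite C"
  using rim_exists by (metis List.finite_set)

lemma off_rim_card_nbrs: "off_rim v \<Longrightarrow> \<not> E v x \<Longrightarrow> card (nbrs_in v C) \<le> 2"
  using rim_exists rim_proper unfolding off_rim_def proper_for_def by metis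

lemma rim_start:
  assumes "s \<in> C"
  obtains L where "rim (s # L)"
proof -
  obtain cs where cs: "rim cs" using rim_exists unfolding rim_def by blast
  then obtain A B where "cs = A @ s # B" using assms unfolding rim_def by (metis split_list)
  then have "rim (s # B @ A)" using rim_rotate[of A "s # B"] cs by simp
  then show thesis by (rule that)
qed

definition detour :: "'a list \<Rightarrow> 'a list \<Rightarrow> bool" where
  "detour P B \<longleftrightarrow> induced_cycle (P @ B) \<and> P \<noteq> [] \<and> B \<noteq> [] \<and> set P \<inter> insert x C = {} \<and> (\<exists>A. rim (B @ A))
     \<and> spokes_terminal P \<and> 3 \<le> num_spokes (P @ B) \<and> num_spokes (P @ B) < rim_spokes"

lemma detourI:
  "\<lbrakk>induced_cycle (P @ B); P \<noteq> []; B \<noteq> []; set P \<inter> insert x C = {}; rim (B @ A); spokes_terminal P;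
    3 \<le> num_spokes (P @ B); num_spokes (P @ B) < rim_spokes\<rbrakk> \<Longrightarrow> detour P B"
  unfolding detour_def by blast

lemma
  assumes "detour P B"
  shows detour_cycle: "induced_cycle (P @ B)"
    and detour_path_nonempty: "P \<noteq> []"
    and detour_arc_nonempty: "B \<noteq> []"
    and detour_path_off_rim: "set P \<inter> insert x C = {}"
    and detour_arc_on_rim: "set B \<subseteq> C"
    and detour_hub_notin: "x \<notin> set (P @ B)"
    and detour_terminal: "spokes_terminal P"
    and detour_spokes_ge_4: "4 \<le> num_spokes (P @ B)"
    and detour_spokes_less: "num_spokes (P @ B) < rim_spokes"
proof -
  show cyc: "induced_cycle (P @ B)" and "P \<noteq> []" "B \<noteq> []" "set P \<inter> insert x C = {}" "set B \<subseteq> C"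
    "spokes_terminal P" "num_spokes (P @ B) < rim_spokes"
    using assms unfolding detour_def rim_def by auto
  then show x: "x \<notin> set (P @ B)" using hub_notin_rim by auto
  show "4 \<le> num_spokes (P @ B)"
    using num_spokes_cycle_neq_3[OF cyc x] assms unfolding detour_def by linarith
qed

lemma detour_distinct: "detour P B \<Longrightarrow> distinct (P @ B)"
  using induced_cycle_distinct[OF detour_cycle] .

lemma off_rim_notin_detour: "detour P B \<Longrightarrow> off_rim v \<Longrightarrow> v \<notin> set P \<Longrightarrow> v \<notin> set (P @ B)"
  using detour_arc_on_rim unfolding off_rim_def by auto

lemma detour_rim_arc:
  assumes "detour P B"
  obtains A where "rim (B @ A)" "num_spokes P < num_spokes A" "num_spokes B + num_spokes A = rim_spokes"
proof -
  obtain A where A: "rim (B @ A)" using assms unfolding detour_def by blast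
  then have "num_spokes B + num_spokes A = rim_spokes" using rim_num_spokes by force
  then show thesis using that A detour_spokes_less[OF assms] by simp
qed

lemma detour_rev: "detour P B \<Longrightarrow> detour (rev P) (rev B)"
proof -
  assume detour: "detour P B"
  then obtain A where "rim (B @ A)" by (rule detour_rim_arc)
  then have "rim (rev B @ rev A)" by (rule rim_rev_arcs)
  moreover have "induced_cycle (rev P @ rev B)"
    using induced_cycle_rev[OF detour_cycle[OF detour]] induced_cycle_rotate[of "rev B" "rev P"] by simp
  ultimately show ?thesis using detour unfolding detour_def by (auto simp: spokes_terminal_rev)
qed

lemma detour_path_spokes: "detour P B \<Longrightarrow> num_spokes P \<le> 2"
  using spokes_terminal_le_2[OF detour_terminal] .

lemma detour_arc_spokes_ge_2: "detour P B \<Longrightarrow> 2 \<le> num_spokes B"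
  using detour_spokes_ge_4 detour_path_spokes by fastforce

lemma detour_arc_spokes_ge_3: "detour P B \<Longrightarrow> num_spokes P \<le> 1 \<Longrightarrow> 3 \<le> num_spokes B"
  using detour_spokes_ge_4 by fastforce

lemma detour_arc_ends:
  assumes "detour P B"
  obtains t m s where "B = t # m @ [s]"
proof -
  have "2 \<le> length B" using detour_arc_spokes_ge_2[OF assms] num_spokes_le_length[of B] by linarith
  then obtain t B' where B: "B = t # B'" "B' \<noteq> []" by (cases B) (auto simp: Suc_le_eq)
  then have "B = t # butlast B' @ [last B']" by simp
  then show thesis by (rule that)
qed

lemma detour_arc_unseparated:
  assumes detour: "detour P B" and v: "off_rim v" and B: "B = X @ c # Y @ c' # Z"
    and nbrs: "E v c" "E v c'"
  shows "num_spokes Y = 0"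
proof -
  obtain A where A: "rim (B @ A)" "num_spokes P < num_spokes A" using detour_rim_arc[OF detour] by blast
  have "unseparated (X @ c # Y @ c' # (Z @ A)) v" using rim_unseparated[OF A(1) v] B by simp
  from unseparatedD[OF this nbrs] A(2) show ?thesis by simp
qed

lemma detour_cut_start:
  assumes detour: "detour P B" and P: "P = Pn @ p # Pz" and B: "B = Ba @ y # Bb"
    and v: "off_rim v" "v \<notin> set P" "E v p" "E v y" "\<And>b. b \<in> set (Pz @ Ba) \<Longrightarrow> \<not> E v b"
    and nonempty: "Pn @ Bb \<noteq> []" and terminal: "spokes_terminal (v # p # Pz)"
    and spokes: "3 \<le> num_spokes (v # p # Pz @ Ba @ [y])"
      "num_spokes (v # p # Pz @ Ba @ [y]) < rim_spokes"
  shows "detour (v # p # Pz) (Ba @ [y])"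
proof -
  have "induced_cycle (p # (Pz @ Ba) @ y # (Bb @ Pn))"
    using induced_cycle_rotate[of Pn "p # Pz @ Ba @ y # Bb"] detour_cycle[OF detour] P B by simp
  then have "induced_cycle (v # p # (Pz @ Ba) @ [y])"
    by (rule induced_cycle_bypass_Cons)
      (use v nonempty off_rim_notin_detour[OF detour v(1,2)] P B in \<open>auto simp: off_rim_def\<close>)
  moreover obtain A where "rim (B @ A)" using detour_rim_arc[OF detour] by blast
  then have "rim ((Ba @ [y]) @ (Bb @ A))" using B by simp
  ultimately show ?thesis
    using terminal spokes v(1) detour_path_off_rim[OF detour] P
    by (intro detourI) (auto simp: off_rim_def)
qed

lemma detour_cut_end:
  assumes detour: "detour P B" and P: "P = Pa @ p # Pm" and B: "B = Bc @ y # Bd"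
    and v: "off_rim v" "v \<notin> set P" "E v p" "E v y" "\<And>b. b \<in> set (Pa @ Bd) \<Longrightarrow> \<not> E v b"
    and nonempty: "Pm @ Bc \<noteq> []" and terminal: "spokes_terminal (Pa @ [p, v])"
    and spokes: "3 \<le> num_spokes (Pa @ [p, v] @ y # Bd)" "num_spokes (Pa @ [p, v] @ y # Bd) < rim_spokes"
  shows "detour (Pa @ [p, v]) (y # Bd)"
proof -
  have "spokes_terminal (v # p # rev Pa)" using terminal spokes_terminal_rev[of "Pa @ [p, v]"] by simp
  then have "detour (v # p # rev Pa) (rev Bd @ [y])"
    by (intro detour_cut_start[OF detour_rev[OF detour], of "rev Pm" p "rev Pa" "rev Bd" y "rev Bc"])
      (use P B v nonempty spokes in auto)
  then show ?thesis using detour_rev[of "v # p # rev Pa" "rev Bd @ [y]"] by simp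
qed

lemma detour_shortcut:
  assumes detour: "detour P B" and P: "P = Pa @ p # M @ p' # Pz" and M: "M \<noteq> []"
    and v: "off_rim v" "v \<notin> set P" "E v p" "E v p'" "\<And>b. b \<in> set (Pa @ Pz @ B) \<Longrightarrow> \<not> E v b"
    and terminal: "spokes_terminal (Pa @ [p, v, p'] @ Pz)"
    and spokes: "3 \<le> num_spokes (Pa @ [p, v, p'] @ Pz @ B)"
      "num_spokes (Pa @ [p, v, p'] @ Pz @ B) < rim_spokes"
  shows "detour (Pa @ [p, v, p'] @ Pz) B"
proof -
  have "induced_cycle (p' # (Pz @ B @ Pa) @ p # M)"
    using induced_cycle_rotate[of "Pa @ p # M" "p' # Pz @ B"] detour_cycle[OF detour] P by simp
  then have "induced_cycle (v # p' # (Pz @ B @ Pa) @ [p])"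
    by (rule induced_cycle_bypass_Cons)
      (use v M P off_rim_notin_detour[OF detour v(1,2)] in \<open>auto simp: off_rim_def\<close>)
  then have "induced_cycle ((Pa @ [p, v, p'] @ Pz) @ B)"
    using induced_cycle_rotate[of "v # p' # Pz @ B" "Pa @ [p]"] by simp
  moreover obtain A where "rim (B @ A)" using detour_rim_arc[OF detour] by blast
  ultimately show ?thesis
    using terminal spokes v(1) detour_path_off_rim[OF detour] detour_arc_nonempty[OF detour] P
    by (intro detourI) (auto simp: off_rim_def)
qed

definition detour_size :: "'a list \<Rightarrow> 'a list \<Rightarrow> nat \<times> nat \<times> nat" where
  "detour_size P B = (length P, num_spokes (P @ B), length (P @ B))"

definition min_detour :: "'a list \<Rightarrow> 'a list \<Rightarrow> bool" where
  "min_detour P B \<longleftrightarrow> detour P B \<and> (\<forall>P' B'. detour P' B' \<longrightarrow>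
     (detour_size P' B', detour_size P B) \<notin> less_than <*lex*> less_than <*lex*> less_than)"

lemma min_detourD: "min_detour P B \<Longrightarrow> detour P B"
  unfolding min_detour_def by blast

lemma min_detour_rev: "min_detour P B \<Longrightarrow> min_detour (rev P) (rev B)"
  unfolding min_detour_def using detour_rev[of P B] by (simp add: detour_size_def add.commute)

lemma min_detour_exists:
  assumes "detour P B"
  obtains P' B' where "min_detour P' B'"
proof -
  have "wf (inv_image (less_than <*lex*> less_than <*lex*> less_than) (\<lambda>(P, B). detour_size P B))"
    by (intro wf_inv_image wf_lex_prod wf_less_than)
  then obtain z where "z \<in> {(P, B). detour P B}" and "\<And>y. y \<in> {(P, B). detour P B} \<Longrightarrow>
      (y, z) \<notin> inv_image (less_than <*lex*> less_than <*lex*> less_than) (\<lambda>(P, B). detour_size P B)"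
    using assms by (elim wfE_min[of _ "(P, B)" "{(P, B). detour P B}"]) auto
  then show thesis using that unfolding min_detour_def by (cases z) fastforce
qed

lemma min_detour_shorter:
  assumes "min_detour P B" "detour P' B'"
  shows "length P \<le> length P'"
  using assms unfolding min_detour_def detour_size_def by (fastforce simp: not_less)

lemma min_detour_smaller:
  assumes "min_detour P B" "detour P' B'" "length P' \<le> length P"
    "num_spokes (P' @ B') \<le> num_spokes (P @ B)"
    "num_spokes (P' @ B') < num_spokes (P @ B) \<or> length (P' @ B') < length (P @ B)"
  shows False
  using assms unfolding min_detour_def detour_size_def by (auto simp: in_lex_prod le_less)

lemma detour_length_ge_2:
  assumes detour: "detour P B"
  shows "2 \<le> length P"
proof (rule ccontr)
  assume "\<not> 2 \<le> length P"
  then obtain p where P: "P = [p]" using detour_path_nonempty[OF detour] by (cases P; cases "tl P") auto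
  obtain A where A: "rim (B @ A)" "num_spokes P < num_spokes A" using detour_rim_arc[OF detour] by blast
  obtain t m s where B: "B = t # m @ [s]" using detour_arc_ends[OF detour] .
  have nbrs: "E p t" "E p s" using detour_cycle[OF detour] unfolding P B by auto
  have "off_rim p"
    using induced_cycle_subset[OF detour_cycle[OF detour]] detour_path_off_rim[OF detour] P
    unfolding off_rim_def by auto
  then have "unseparated ([] @ t # m @ s # A) p" using rim_unseparated[OF A(1)] B by simp
  from unseparatedD[OF this nbrs] show False
    using detour_spokes_ge_4[OF detour] A(2) P B by (auto split: if_splits)
qed

section \<open>Links between separated places of the rim\<close>

definition rim_separated :: "'a \<Rightarrow> 'a \<Rightarrow> bool" where
  "rim_separated s t \<longleftrightarrow> (\<exists>I Z. rim (s # I @ t # Z) \<and> 0 < num_spokes I \<and> 0 < num_spokes Z)"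

definition link :: "'a list \<Rightarrow> 'a \<Rightarrow> 'a \<Rightarrow> bool" where
  "link Q s t \<longleftrightarrow> induced_path Q \<and> Q \<noteq> [] \<and> set Q \<inter> insert x C = {} \<and> num_spokes Q = 0
     \<and> E (hd Q) s \<and> E (last Q) t \<and> rim_separated s t"

definition min_link :: "'a list \<Rightarrow> 'a \<Rightarrow> 'a \<Rightarrow> bool" where
  "min_link Q s t \<longleftrightarrow> link Q s t \<and> (\<forall>Q' s' t'. link Q' s' t' \<longrightarrow> length Q \<le> length Q')"

lemma rim_separatedI: "rim (s # I @ t # Z) \<Longrightarrow> 0 < num_spokes I \<Longrightarrow> 0 < num_spokes Z \<Longrightarrow> rim_separated s t"
  unfolding rim_separated_def by (intro exI conjI)

lemma rim_separatedE:
  assumes "rim_separated s t"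
  obtains I Z where "rim (s # I @ t # Z)" "0 < num_spokes I" "0 < num_spokes Z"
  using assms unfolding rim_separated_def by (elim exE conjE)

lemma rim_separated_sym: "rim_separated s t \<Longrightarrow> rim_separated t s"
  by (elim rim_separatedE) (rule rim_separatedI[OF rim_swap])

lemma rim_separated_common_nbr:
  assumes "off_rim v" "E v s" "E v t" "rim_separated s t"
  shows False
proof -
  obtain I Z where r: "rim (s # I @ t # Z)" "0 < num_spokes I" "0 < num_spokes Z"
    using assms(4) by (rule rim_separatedE)
  show False using unseparatedD[of "[]" s I t Z v] rim_unseparated[OF r(1) assms(1)] assms(2,3) r
    by simp
qed

lemma link_rev: "link Q s t \<Longrightarrow> link (rev Q) t s"
  unfolding link_def using rim_separated_sym by (auto simp: induced_path_rev hd_rev last_rev)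

lemma min_link_rev: "min_link Q s t \<Longrightarrow> min_link (rev Q) t s"
  unfolding min_link_def using link_rev by simp

lemma
  assumes "link Q s t"
  shows link_path: "induced_path Q"
    and link_nonempty: "Q \<noteq> []"
    and link_off_rim: "set Q \<inter> insert x C = {}"
    and link_spokes: "num_spokes Q = 0"
    and link_hd: "E (hd Q) s"
    and link_last: "E (last Q) t"
    and link_separated: "rim_separated s t"
  using assms unfolding link_def by auto

lemma link_vertex: "link Q s t \<Longrightarrow> q \<in> set Q \<Longrightarrow> off_rim q \<and> \<not> E q x"
  unfolding off_rim_def
  using induced_path_subset[OF link_path] link_off_rim link_spokes num_spokes_0D E_commute by blast

lemma link_length_ge_2:
  assumes "link Q s t"
  shows "2 \<le> length Q"
proof (rule ccontr)
  assume "\<not> 2 \<le> length Q"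
  then obtain q where Q: "Q = [q]" using link_nonempty[OF assms] by (cases Q; cases "tl Q") auto
  show False
    using rim_separated_common_nbr[of q s t] link_vertex[OF assms] link_hd[OF assms] link_last[OF assms]
      link_separated[OF assms] Q by simp
qed

lemma min_linkD: "min_link Q s t \<Longrightarrow> link Q s t"
  unfolding min_link_def by blast

lemma min_link_infix:
  assumes min: "min_link (Qa @ M @ Qb) s t"
    and M: "M \<noteq> []" "E (hd M) w" "E (last M) w'" "rim_separated w w'"
  shows "Qa = [] \<and> Qb = []"
proof -
  note link = min_linkD[OF min]
  have "link M w w'"
    using link_path[OF link] link_off_rim[OF link] link_spokes[OF link] M induced_path_infix[of Qa M Qb]
    unfolding link_def by auto
  then have "length (Qa @ M @ Qb) \<le> length M" using min unfolding min_link_def by blast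
  then show ?thesis by simp
qed

lemma min_link_hd_nbr_unique:
  assumes min: "min_link Q s t" and q: "q \<in> set Q" "E q s"
  shows "q = hd Q"
proof -
  note link = min_linkD[OF min]
  obtain Qa Qb where Q: "Q = Qa @ q # Qb" using q(1) by (meson split_list)
  then have "Qa = []"
    using min_link_infix[of Qa "q # Qb" "[]" s t s t] min q(2) link_last[OF link]
      link_separated[OF link] by simp
  then show ?thesis using Q by simp
qed

lemma min_link_last_nbr_unique: "min_link Q s t \<Longrightarrow> q \<in> set Q \<Longrightarrow> E q t \<Longrightarrow> q = last Q"
  using min_link_hd_nbr_unique[OF min_link_rev, of Q s t q] by (simp add: hd_rev)

context
  fixes q Qb s t I1 w I2 Z
  assumes min: "min_link (q # Qb) s t" and rim: "rim (s # I1 @ w # I2 @ t # Z)"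
    and spokes: "0 < num_spokes (I1 @ w # I2)" "0 < num_spokes Z" and w: "E q w"
begin

lemma min_link_hd_tail_nonempty: "Qb \<noteq> []"
  using link_length_ge_2[OF min_linkD[OF min]] by auto

lemma min_link_hd_tail_nonnbr:
  assumes q': "q' \<in> set Qb" and c: "rim_separated c t"
  shows "\<not> E q' c"
proof
  assume e: "E q' c"
  obtain Ba Bb where Qb: "Qb = Ba @ q' # Bb" using q' by (meson split_list)
  show False
    using min_link_infix[of "q # Ba" "q' # Bb" "[]" s t c t] min link_last[OF min_linkD[OF min]] Qb e c
    by simp
qed

lemma min_link_hd_attach_before: "num_spokes I1 = 0"
proof (rule ccontr)
  assume "num_spokes I1 \<noteq> 0"
  then have "rim_separated s w" using rim_separatedI[of s I1 w "I2 @ t # Z"] rim spokes by simp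
  then show False
    using min_link_infix[of "[]" "[q]" Qb s t s w] min w
      link_hd[OF min_linkD[OF min]] min_link_hd_tail_nonempty by simp
qed

lemma min_link_hd_tail_before:
  assumes "q' \<in> set Qb" "c \<in> set (s # I1)"
  shows "\<not> E q' c"
proof -
  obtain Ca Cb where c: "s # I1 = Ca @ c # Cb" using assms(2) by (meson split_list)
  have "rim ((s # I1) @ w # I2 @ t # Z)" using rim by simp
  then have "rim (Ca @ (c # Cb @ w # I2 @ t # Z))" unfolding c by simp
  then have "rim (c # (Cb @ w # I2) @ t # (Z @ Ca))" using rim_rotate by fastforce
  moreover have "0 < num_spokes (Cb @ w # I2)" using min_link_hd_attach_before spokes by auto
  ultimately have "rim_separated c t" using rim_separatedI[of c "Cb @ w # I2" t "Z @ Ca"] spokes by simp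
  then show ?thesis using min_link_hd_tail_nonnbr assms(1) by blast
qed

lemma min_link_hd_nbrs:
  assumes c: "c \<in> C" "E q c"
  shows "c = s \<or> c = w"
proof (rule ccontr)
  assume other: "\<not> (c = s \<or> c = w)"
  have q: "off_rim q" "\<not> E q x" using link_vertex[OF min_linkD[OF min]] by auto
  have "{s, w, c} \<subseteq> nbrs_in q C"
    using c w rim_set[OF rim] link_hd[OF min_linkD[OF min]] unfolding nbrs_in_def by auto
  then have "card {s, w, c} \<le> card (nbrs_in q C)" using finite_rim unfolding nbrs_in_def
    by (intro card_mono) auto
  moreover have "card {s, w, c} = 3" using other rim_distinct[OF rim] by auto
  ultimately show False using off_rim_card_nbrs[OF q] by simp
qed

lemma min_link_hd_attach_tail: "\<exists>q'\<in>set Qb. E q' w"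
proof (rule ccontr)
  assume contra: "\<not> ?thesis"
  note link = min_linkD[OF min] and cyc = rim_cycle[OF rim] and dist = rim_distinct[OF rim]
  have q: "off_rim q" using link_vertex[OF link] by simp
  have s: "E q s" using link_hd[OF link] by simp
  define S T where "S = s # I1 @ [w]" and "T = I2 @ t # Z"
  have ST: "induced_cycle (S @ T)" "set S \<union> set T = C" "set S \<inter> set T = {}"
    and in_ST: "s \<in> set S" "w \<in> set S" "t \<in> set T" "T \<noteq> []" "last S = w" "hd S = s" "s \<noteq> w" "S \<noteq> []"
    using cyc rim_set[OF rim] dist unfolding S_def T_def by auto
  have "induced_cycle (q # s # I1 @ [w])"
    by (rule induced_cycle_bypass_Cons[of s I1 w T])
      (use cyc q s w min_link_hd_nbrs rim_set[OF rim] dist in \<open>auto simp: off_rim_def T_def\<close>)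
  then have qcyc: "induced_cycle (q # S)" unfolding S_def .
  have "induced_path T" using induced_cycle_infix[of S T "[]"] ST(1) in_ST(8) by simp
  then have conn_T: "connected_set (set T)" using connected_set_induced_path in_ST(4) by blast
  have "induced_path Qb" using link_path[OF link] by simp
  then have conn_Qb: "connected_set (set Qb)" using connected_set_induced_path min_link_hd_tail_nonempty
    by blast
  have connected: "connected_set (set T \<union> set Qb)"
    by (rule connected_set_union[OF conn_T conn_Qb, of t "last Qb"])
      (use in_ST(3) min_link_hd_tail_nonempty link_last[OF link] E_commute in auto)
  have "edges_between (set S) (set T) = {(s, last T), (w, hd T)}"
    using induced_cycle_cross[OF ST(1)] in_ST unfolding edges_between_def by auto
  moreover have "edges_between {q} (set T) = {}"
    using min_link_hd_nbrs ST(2,3) in_ST(1,2) unfolding edges_between_def by blast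
  moreover have "edges_between {q} (set Qb) = {(q, hd Qb)}"
    using link_path[OF link] min_link_hd_tail_nonempty unfolding edges_between_def by auto
  moreover have "edges_between (set S) (set Qb) = {}"
    using min_link_hd_tail_before contra unfolding edges_between_def S_def by (auto dest: E_sym)
  moreover have "set (q # S) = {q} \<union> set S" by simp
  ultimately have "edges_between (set (q # S)) (set T \<union> set Qb) = {(s, last T), (w, hd T), (q, hd Qb)}"
    by (simp only: edges_between_Un) blast
  moreover have "set (q # S) \<inter> (set T \<union> set Qb) = {}" "s \<noteq> q" "w \<noteq> q"
    using induced_path_distinct[OF link_path[OF link]] link_off_rim[OF link] ST(2,3) in_ST(1,2) q
    unfolding off_rim_def by auto
  ultimately show False using no_three_edges[OF qcyc connected] in_ST(7) by blast
qed

lemma min_link_hd_attach: "num_spokes I1 = 0 \<and> num_spokes I2 = 0 \<and> (\<exists>q'\<in>set Qb. E q' w)"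
proof (intro conjI min_link_hd_attach_before min_link_hd_attach_tail)
  obtain q' where q': "q' \<in> set Qb" "E q' w" using min_link_hd_attach_tail by blast
  show "num_spokes I2 = 0"
  proof (rule ccontr)
    assume "num_spokes I2 \<noteq> 0"
    moreover have "rim (w # I2 @ t # (Z @ s # I1))" using rim_rotate[of "s # I1" "w # I2 @ t # Z"] rim
      by simp
    ultimately have "rim_separated w t" using rim_separatedI[of w I2 t "Z @ s # I1"] spokes by simp
    then show False using min_link_hd_tail_nonnbr q' by blast
  qed
qed

end

lemma min_link_attach:
  assumes min: "min_link Q s t" and rim: "rim (s # I1 @ w # I2 @ t # Z)"
    and spokes: "0 < num_spokes (I1 @ w # I2)" "0 < num_spokes Z" and w: "q \<in> set Q" "E q w"
  shows "num_spokes I1 = 0 \<and> num_spokes I2 = 0 \<and> (\<exists>q'\<in>set (tl Q). E q' w)"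
proof -
  note link = min_linkD[OF min]
  obtain Qa Qb where Q: "Q = Qa @ q # Qb" using w by (meson split_list)
  consider (first) "Qa = []" | (last) "Qa \<noteq> []" "Qb = []" | (inner) "Qa \<noteq> []" "Qb \<noteq> []" by blast
  then show ?thesis
  proof cases
    case first
    then show ?thesis using min_link_hd_attach[of q Qb s t I1 w I2 Z] min rim spokes w Q by simp
  next
    case last
    have "min_link (q # rev Qa) t s" using min_link_rev[OF min] Q last by simp
    moreover have "rim (t # rev I2 @ w # rev I1 @ s # rev Z)"
      using rim_flip[OF rim_swap[of s "I1 @ w # I2" t Z]] rim by simp
    ultimately have "num_spokes I1 = 0 \<and> num_spokes I2 = 0"
      using min_link_hd_attach[of q "rev Qa" t s "rev I2" w "rev I1" "rev Z"] spokes w by auto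
    then show ?thesis using w Q last by (cases Qa) auto
  next
    case inner
    have "\<not> rim_separated s w"
      using min_link_infix[of "[]" "Qa @ [q]" Qb s t s w] min w(2) link_hd[OF link] inner Q by auto
    then have "num_spokes I1 = 0" using rim_separatedI[of s I1 w "I2 @ t # Z"] rim spokes by auto
    moreover have "\<not> rim_separated w t"
      using min_link_infix[of Qa "q # Qb" "[]" s t w t] min w(2) link_last[OF link] inner Q by auto
    then have "num_spokes I2 = 0"
      using rim_separatedI[of w I2 t "Z @ s # I1"] rim_rotate[of "s # I1" "w # I2 @ t # Z"] rim spokes
      by auto
    moreover have "q \<in> set (tl Q)" using Q inner by (cases Qa) auto
    ultimately show ?thesis using w(2) by blast
  qed
qed

lemma min_link_inner_nbr:
  assumes min: "min_link Q s t" and rim: "rim (s # I @ t # Z)" "0 < num_spokes I" "0 < num_spokes Z"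
    and w: "w \<in> set I" "q \<in> set Q" "E q w"
  shows "num_spokes I = 1" "E x w" "\<exists>q'\<in>set (tl Q). E q' w"
proof -
  obtain I1 I2 where I: "I = I1 @ w # I2" using w by (meson split_list)
  then have "num_spokes I1 = 0 \<and> num_spokes I2 = 0 \<and> (\<exists>q'\<in>set (tl Q). E q' w)"
    using min_link_attach[OF min, of I1 w I2 Z q] rim w by simp
  then show "num_spokes I = 1" "E x w" "\<exists>q'\<in>set (tl Q). E q' w" using I rim(2)
    by (auto split: if_splits)
qed

lemma min_link_one_sided:
  assumes min: "min_link Q s t" and rim: "rim (s # I @ t # Z)" "0 < num_spokes I" "0 < num_spokes Z"
    and w: "w \<in> set I" "q \<in> set Q" "E q w" and w': "w' \<in> set Z" "q' \<in> set Q" "E q' w'"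
  shows False
proof -
  have flip: "rim (s # rev Z @ t # rev I)" using rim_flip[OF rim(1)] .
  have Z: "num_spokes Z = 1" "\<exists>p\<in>set (tl Q). E p w'"
    using min_link_inner_nbr[OF min flip _ _ _ w'(2,3)] rim w' by auto
  obtain p p' where p: "p \<in> set (tl Q)" "E p w" and p': "p' \<in> set (tl Q)" "E p' w'"
    using min_link_inner_nbr(3)[OF min rim w] Z(2) by blast
  have "num_spokes I + num_spokes Z + num_spokes [s] + num_spokes [t] = rim_spokes"
    using rim_num_spokes[OF rim(1)] by simp
  then have st_spokes: "E x s" "E x t"
    using rim_spokes_ge_4 Z(1) min_link_inner_nbr(1)[OF min rim w] by (auto split: if_splits)
  obtain I1 I2 where I: "I = I1 @ w # I2" using w by (meson split_list)
  obtain Z1 Z2 where Z: "Z = Z1 @ w' # Z2" using w' by (meson split_list)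
  have "rim (w # (I2 @ t # Z1) @ w' # (Z2 @ s # I1))"
    using rim_rotate[of "s # I1" "w # I2 @ t # Z"] rim(1) I Z by simp
  then have sep: "rim_separated w w'"
    using rim_separatedI[of w "I2 @ t # Z1" w' "Z2 @ s # I1"] st_spokes by simp
  obtain Qa M Qb where M: "tl Q = Qa @ M @ Qb" "M \<noteq> []" "hd M = p \<and> last M = p' \<or> hd M = p'
    \<and> last M = p"
    using infix_between[OF p(1) p'(1)] by blast
  have Q: "Q = (hd Q # Qa) @ M @ Qb" using link_nonempty[OF min_linkD[OF min]] M(1) by (cases Q) auto
  obtain a b where "E (hd M) a" "E (last M) b" "rim_separated a b"
    using M(3) p p' sep rim_separated_sym by blast
  then show False using min_link_infix[of "hd Q # Qa" M Qb s t a b] min Q M(2) by simp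
qed

lemma rim_separated_nonadjacent:
  assumes rim: "rim (s # I @ t # Z)" and sep: "rim_separated s t"
  shows "I \<noteq> []"
proof
  assume "I = []"
  then have "E s t" using rim unfolding rim_def by simp
  obtain I' Z' where rim': "rim (s # I' @ t # Z')" "0 < num_spokes I'" "0 < num_spokes Z'"
    using sep by (rule rim_separatedE)
  then have "I' \<noteq> []" "Z' \<noteq> []" by auto
  then show False
    using induced_cycle_cross[of "[s]" "I' @ t # Z'" s t] rim_cycle[OF rim'(1)]
      rim_distinct[OF rim'(1)] \<open>E s t\<close>
    by (cases I') auto
qed

lemma min_link_clean_cycle:
  assumes min: "min_link Q s t" and rim: "rim (s # I @ t # Z)"
    and clean: "\<And>q z. q \<in> set Q \<Longrightarrow> z \<in> set Z \<Longrightarrow> \<not> E q z"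
  shows "induced_cycle (Q @ t # Z @ [s])"
proof -
  note link = min_linkD[OF min]
  have "I \<noteq> []" using rim_separated_nonadjacent[OF rim link_separated[OF link]] .
  then have path: "induced_path (t # Z @ [s])"
    using induced_cycle_infix[of "[]" "t # Z @ [s]" I] rim_cycle[OF rim_swap[OF rim]]
    by (simp del: induced_cycle.simps induced_path.simps)
  have "E a b \<longleftrightarrow> a = last Q \<and> b = hd (t # Z @ [s]) \<or> a = hd Q \<and> b = last (t # Z @ [s])"
    if a: "a \<in> set Q" and b: "b \<in> set (t # Z @ [s])" for a b
    using b min_link_hd_nbr_unique[OF min a] min_link_last_nbr_unique[OF min a] clean[OF a]
      link_hd[OF link] link_last[OF link] rim_distinct[OF rim] by auto
  moreover have "set Q \<inter> set (t # Z @ [s]) = {}" using link_off_rim[OF link] rim_set[OF rim] by auto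
  ultimately show ?thesis
    using induced_cycle_append[of Q "t # Z @ [s]"] link_path[OF link] link_nonempty[OF link] path
      link_length_ge_2[OF link] by auto
qed

lemma min_link_clean_detour:
  assumes min: "min_link Q s t" and rim: "rim (s # I @ t # Z)" "0 < num_spokes I"
    and clean: "\<And>q z. q \<in> set Q \<Longrightarrow> z \<in> set Z \<Longrightarrow> \<not> E q z"
    and spokes: "3 \<le> num_spokes (t # Z @ [s])"
  shows "detour Q (t # Z @ [s])"
proof -
  note link = min_linkD[OF min]
  have "rim ((t # Z @ [s]) @ I)" using rim_swap[OF rim(1)] by simp
  moreover have "num_spokes (Q @ t # Z @ [s]) < rim_spokes"
    using rim_num_spokes[OF rim(1)] rim(2) link_spokes[OF link] by simp
  moreover have "spokes_terminal Q" "3 \<le> num_spokes (Q @ t # Z @ [s])"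
    using link_spokes[OF link] spokes spokes_terminal_le_1 by auto
  ultimately show ?thesis
    using min_link_clean_cycle[OF min rim(1) clean] link_nonempty[OF link] link_off_rim[OF link] detourI
    by blast
qed

lemma min_link_clean_two_spokes:
  assumes min: "min_link Q s t" and rim: "rim (s # I @ t # Z)"
    and clean: "\<And>q z. q \<in> set Q \<Longrightarrow> z \<in> set I \<union> set Z \<Longrightarrow> \<not> E q z"
    and spokes: "\<not> E x s" "\<not> E x t" "num_spokes I = 2" "num_spokes Z = 2"
  shows False
proof -
  note link = min_linkD[OF min] and dist = rim_distinct[OF rim]
  obtain A z M z' B where z: "Z = A @ z # M @ z' # B" "E x z" "E x z'" "num_spokes A = 0"
    "num_spokes B = 0"
    using outer_spokes[of Z] spokes(4) by (metis order_refl)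
  have M: "num_spokes M = 0" using spokes(4) z by simp
  have "0 < num_spokes I" using spokes(3) by simp
  then obtain Ia w Ib where w: "I = Ia @ w # Ib" "E x w" "num_spokes Ia = 0" by (rule first_spoke)
  have Ib: "Ib \<noteq> []" using spokes(3) w by auto
  define H T where "H = t # Z @ [s]" and "T = Ia @ [w]"
  have cyc: "induced_cycle (Q @ H)" using min_link_clean_cycle[OF min rim] clean unfolding H_def
    by blast
  have "induced_path T"
    using induced_cycle_infix[of "[s]" T "Ib @ t # Z"] rim_cycle[OF rim] w unfolding T_def by simp
  then have connected: "connected_set (insert x (set T))"
    by (rule connected_set_insert_hub) (use w in \<open>simp add: T_def\<close>)
  have T: "hd T = hd I" "last I \<notin> set T" "set T \<subseteq> set I" "hd T \<in> set T"
    using w Ib dist unfolding T_def by (cases Ia; cases Ib rule: rev_cases; auto)+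
  have HI: "induced_cycle (H @ I)" using rim_cycle[OF rim_swap[OF rim]] unfolding H_def by simp
  have H: "z \<in> set H" "z' \<in> set H" "s \<in> set H" "hd H = t" "last H = s" using z(1) unfolding H_def
    by auto
  have "edges_between (set H) {x} = {(z, x), (z', x)}"
    using z spokes(1,2) M num_spokes_0D E_commute unfolding edges_between_def H_def by auto
  moreover have "edges_between (set Q) {x} = {}"
    using link_vertex[OF link] unfolding edges_between_def by auto
  moreover have "edges_between (set H) (set T) = {(s, hd T)}"
    using induced_cycle_cross[OF HI] H T unfolding edges_between_def by auto
  moreover have "edges_between (set Q) (set T) = {}" using clean T(3) unfolding edges_between_def
    by blast
  moreover have "set (Q @ H) = set Q \<union> set H" "insert x (set T) = {x} \<union> set T" by auto
  ultimately have "edges_between (set (Q @ H)) (insert x (set T)) = {(z, x), (z', x), (s, hd T)}"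
    by (simp only: edges_between_Un) blast
  moreover have "set (Q @ H) \<inter> insert x (set T) = {}"
    using link_off_rim[OF link] rim_set[OF rim] dist T(3) hub_notin_rim unfolding H_def by auto
  moreover have "z \<noteq> z'" "z \<noteq> s" "z' \<noteq> s" using dist z(1) by auto
  ultimately show False using no_three_edges[OF cyc connected] by blast
qed

lemma min_link_detour:
  assumes min: "min_link Q s t"
  shows "\<exists>B. detour Q B"
proof (rule ccontr)
  assume contra: "\<not> ?thesis"
  obtain I Z where rim: "rim (s # I @ t # Z)" "0 < num_spokes I" "0 < num_spokes Z"
    using link_separated[OF min_linkD[OF min]] by (rule rim_separatedE)
  have flip: "rim (s # rev Z @ t # rev I)" using rim_flip[OF rim(1)] .
  have total: "num_spokes I + num_spokes Z + num_spokes [s] + num_spokes [t] = rim_spokes"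
    using rim_num_spokes[OF rim(1)] by simp
  have few_Z: "num_spokes (t # Z @ [s]) \<le> 2" if "\<And>q z. q \<in> set Q \<Longrightarrow> z \<in> set Z \<Longrightarrow> \<not> E q z"
    using min_link_clean_detour[OF min rim(1,2) that] contra by fastforce
  have few_I: "num_spokes (t # rev I @ [s]) \<le> 2" if "\<And>q z. q \<in> set Q \<Longrightarrow> z \<in> set I \<Longrightarrow> \<not> E q z"
    using min_link_clean_detour[OF min flip] that contra rim(3) by fastforce
  consider (left) q w where "q \<in> set Q" "w \<in> set I" "E q w"
    | (right) q w where "q \<in> set Q" "w \<in> set Z" "E q w"
    | (clean) "\<And>q z. q \<in> set Q \<Longrightarrow> z \<in> set I \<union> set Z \<Longrightarrow> \<not> E q z" by blast
  then show False
  proof cases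
    case left
    then have "num_spokes (t # Z @ [s]) \<le> 2" using min_link_one_sided[OF min rim] few_Z by blast
    then show False using min_link_inner_nbr(1)[OF min rim] left total rim_spokes_ge_4 by fastforce
  next
    case right
    then have "num_spokes (t # rev I @ [s]) \<le> 2" using min_link_one_sided[OF min rim] few_I by blast
    moreover have "num_spokes (rev Z) = 1" by (rule min_link_inner_nbr(1)[OF min flip])
      (use rim right in auto)
    ultimately show False using total rim_spokes_ge_4 by simp
  next
    case clean
    then have "num_spokes (t # rev I @ [s]) \<le> 2" "num_spokes (t # Z @ [s]) \<le> 2" using few_I few_Z
      by blast+
    then have "num_spokes [s] = 0" "num_spokes [t] = 0" "num_spokes I = 2" "num_spokes Z = 2"
      using total rim_spokes_ge_4 by auto
    then show False using min_link_clean_two_spokes[OF min rim(1)] clean by (auto split: if_splits)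
  qed
qed

lemma link_detour:
  assumes "link Q s t"
  obtains P B where "detour P B" "length P \<le> length Q"
proof -
  let ?link = "\<lambda>(Q, s, t). link Q s t"
  have "\<exists>z. ?link z \<and> (\<forall>y. ?link y \<longrightarrow> length (fst z) \<le> length (fst y))"
    by (rule ex_has_least_nat[of ?link "(Q, s, t)"]) (simp add: assms)
  then obtain z where z: "?link z" "\<And>y. ?link y \<Longrightarrow> length (fst z) \<le> length (fst y)" by blast
  obtain Q' s' t' where z': "z = (Q', s', t')" by (cases z)
  have "min_link Q' s' t'" unfolding min_link_def using z z' by auto
  then obtain B where "detour Q' B" using min_link_detour by blast
  moreover have "length Q' \<le> length Q" using z(2)[of "(Q, s, t)"] assms z' by simp
  ultimately show thesis by (rule that)
qed

end

section \<open>Rim vertices outside a minimal detour\<close>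

context proper_rim
begin

lemma detour_outside_cycle:
  assumes detour: "detour P B" and rim: "rim (B @ A1 @ w # A2)" and P: "P = Pn @ p # Pz"
    and nonempty: "Pn \<noteq> []" "A2 \<noteq> []"
    and w: "E w p" "\<And>b. b \<in> set Pz \<Longrightarrow> \<not> E w b"
    and first: "\<And>a b. a \<in> set A1 \<Longrightarrow> b \<in> set (p # Pz) \<Longrightarrow> \<not> E a b"
  shows "induced_cycle ((p # Pz) @ (B @ A1 @ [w]))"
proof -
  let ?S = "p # Pz" and ?T = "B @ A1 @ [w]"
  note cyc = detour_cycle[OF detour] and dist = rim_distinct[OF rim]
  obtain t m s where B: "B = t # m @ [s]" using detour_arc_ends[OF detour] .
  have S: "induced_path ?S"
    using induced_cycle_infix[of Pn ?S B] cyc detour_arc_nonempty[OF detour] P by simp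
  have T: "induced_path ?T" using induced_cycle_infix[of "[]" ?T A2] rim_cycle[OF rim] nonempty(2)
    by simp
  have hd_P: "hd P \<notin> set ?S" using detour_distinct[OF detour] P nonempty(1) by (cases Pn) auto
  have "E a b \<longleftrightarrow> a = last ?S \<and> b = hd ?T \<or> a = hd ?S \<and> b = last ?T"
    if a: "a \<in> set ?S" and b: "b \<in> set ?T" for a b
  proof -
    have aP: "a \<in> set P" using a P by auto
    have w_notin: "w \<notin> set B" "w \<noteq> hd B" using dist B by auto
    consider (on_arc) "b \<in> set B" | (off_arc) "b \<in> set A1" | (at_w) "b = w" using b by auto
    then show ?thesis
    proof cases
      case on_arc
      then have "E a b \<longleftrightarrow> a = last P \<and> b = hd B" using induced_cycle_cross[OF cyc aP on_arc] a hd_P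
        by blast
      then show ?thesis using P B w_notin on_arc by auto
    next
      case off_arc
      then have "\<not> E a b" using first a E_commute by blast
      moreover have "b \<noteq> w" "b \<noteq> hd B" using off_arc dist B by auto
      ultimately show ?thesis using B by auto
    next
      case at_w
      then have "E a b \<longleftrightarrow> a = p" using a w E_commute[of a w] by auto
      then show ?thesis using at_w w_notin B by auto
    qed
  qed
  moreover have "set ?S \<inter> set ?T = {}" using detour_path_off_rim[OF detour] P rim_set[OF rim] by auto
  moreover have "3 \<le> length (?S @ ?T)" using B by simp
  ultimately show ?thesis using induced_cycle_append[of ?S ?T] S T by blast
qed

lemma min_detour_outside_first:
  assumes min: "min_detour P B" and rim: "rim (B @ A1 @ w # A2)" and P: "P = Pn @ p # Pz"
    and Pn: "Pn \<noteq> []"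
    and w: "E w p" "\<And>b. b \<in> set Pz \<Longrightarrow> \<not> E w b"
    and first: "\<And>a b. a \<in> set A1 \<Longrightarrow> b \<in> set (p # Pz) \<Longrightarrow> \<not> E a b"
  shows "num_spokes A2 \<le> num_spokes (p # Pz)"
proof (rule ccontr)
  assume more: "\<not> ?thesis"
  note detour = min_detourD[OF min]
  have shorter: "length (p # Pz) < length P" using P Pn by (cases Pn) auto
  obtain t m s where B: "B = t # m @ [s]" using detour_arc_ends[OF detour] .
  show False
  proof (cases "num_spokes (p # Pz) = 0")
    case True
    have "0 < num_spokes (m @ s # A1)" using detour_arc_spokes_ge_2[OF detour] B
      by (auto split: if_splits)
    moreover have "rim (t # (m @ s # A1) @ w # A2)" "0 < num_spokes A2" using rim B more by auto
    ultimately have "rim_separated w t" using rim_separatedI rim_separated_sym by blast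
    moreover have "E (last (p # Pz)) t"
      using induced_cycle_cross[of P B "last P" t] detour_cycle[OF detour]
        detour_path_nonempty[OF detour] B P
      by (auto split: if_splits)
    moreover have "induced_path (p # Pz)"
      using induced_cycle_infix[of Pn "p # Pz" B] detour_cycle[OF detour] B P by simp
    ultimately have "link (p # Pz) w t"
      unfolding link_def using True w(1) E_commute detour_path_off_rim[OF detour] P by auto
    then obtain P2 B2 where "detour P2 B2" "length P2 \<le> length (p # Pz)" by (rule link_detour)
    then show False using min_detour_shorter[OF min] shorter by fastforce
  next
    case False
    have A2: "A2 \<noteq> []" using more by auto
    have arc: "rim ((B @ A1 @ [w]) @ A2)" using rim by simp
    have "num_spokes P = num_spokes Pn + num_spokes (p # Pz)" using P by simp
    then have "3 \<le> num_spokes (p # Pz) + num_spokes B"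
      using False detour_arc_spokes_ge_2[OF detour] by linarith
    moreover have "num_spokes ((p # Pz) @ B @ A1 @ [w]) < rim_spokes" using rim_num_spokes[OF arc] more
      by simp
    moreover have "spokes_terminal (p # Pz)" using spokes_terminal_suffix detour_terminal[OF detour] P
      by blast
    ultimately have "detour (p # Pz) (B @ A1 @ [w])"
      using detour_outside_cycle[OF detour rim P Pn A2 w first] arc detour_path_off_rim[OF detour] P
      by (intro detourI) auto
    then show False using min_detour_shorter[OF min] shorter by fastforce
  qed
qed

lemma min_detour_outside_suffix:
  assumes min: "min_detour P B" and rim: "rim (B @ A1 @ v # A2)" and P: "P = Pn @ p # Pz"
    and Pn: "Pn \<noteq> []" and nbr: "E v p"
  shows "num_spokes A2 \<le> num_spokes (p # Pz)"
proof -
  have "\<exists>w\<in>set (A1 @ [v]). \<exists>q\<in>set (p # Pz). E w q" using nbr by auto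
  then obtain B1 w B3 where w: "A1 @ [v] = B1 @ w # B3" "\<exists>q\<in>set (p # Pz). E w q"
      "\<forall>y\<in>set B1. \<not> (\<exists>q\<in>set (p # Pz). E y q)"
    by (rule split_list_first_propE)
  obtain Z1 r Z2 where r: "p # Pz = Z1 @ r # Z2" "E w r" "\<forall>b\<in>set Z2. \<not> E w b"
    using w(2) by (rule split_list_last_propE)
  have "A1 @ v # A2 = B1 @ w # (B3 @ A2)" using arg_cong[OF w(1), of "\<lambda>l. l @ A2"] by simp
  then have "rim (B @ B1 @ w # (B3 @ A2))" using rim by metis
  then have "num_spokes (B3 @ A2) \<le> num_spokes (r # Z2)"
    by (rule min_detour_outside_first[OF min, of _ _ _ "Pn @ Z1"]) (use P Pn r w(3) in auto)
  moreover have "num_spokes (r # Z2) \<le> num_spokes (p # Pz)" using r(1) by simp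
  ultimately show ?thesis by simp
qed

lemma min_detour_outside_prefix:
  assumes min: "min_detour P B" and rim: "rim (B @ A1 @ v # A2)" and P: "P = Pa @ p # R"
    and R: "R \<noteq> []" and nbr: "E v p"
  shows "num_spokes A1 \<le> num_spokes (Pa @ [p])"
proof -
  have "rim (rev B @ rev A2 @ v # rev A1)" using rim_rev_arcs[OF rim] by simp
  from min_detour_outside_suffix[OF min_detour_rev[OF min] this, of "rev R" p "rev Pa"]
  show ?thesis using P R nbr by simp
qed

context
  fixes P B A1 v A2 t m s
  assumes min: "min_detour P B" and rim: "rim (B @ A1 @ v # A2)" and B: "B = t # m @ [s]"
begin

lemma outside_arc_nbr: "b \<in> set B \<Longrightarrow> E v b \<longleftrightarrow> b = s \<and> A1 = [] \<or> b = t \<and> A2 = []"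
proof -
  assume b: "b \<in> set B"
  have "E b v \<longleftrightarrow> b = s \<and> v = hd (A1 @ v # A2) \<or> b = t \<and> v = last (A1 @ v # A2)"
    using induced_cycle_cross[OF rim_cycle[OF rim] b] B by simp
  moreover have "v = hd (A1 @ v # A2) \<longleftrightarrow> A1 = []" using rim_distinct[OF rim] by (cases A1) auto
  moreover have "v = last (A1 @ v # A2) \<longleftrightarrow> A2 = []" using rim_distinct[OF rim]
    by (cases A2 rule: rev_cases) auto
  ultimately show ?thesis using E_commute by blast
qed

lemma outside_arc_ends:
  "E v t \<longleftrightarrow> A2 = []" "E v s \<longleftrightarrow> A1 = []" "b \<in> set m \<Longrightarrow> \<not> E v b"
  using outside_arc_nbr[of t] outside_arc_nbr[of s] outside_arc_nbr[of b] rim_distinct[OF rim] B by auto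

lemma outside_spokes: "num_spokes P < num_spokes A1 + num_spokes [v] + num_spokes A2"
  using rim_num_spokes[OF rim] detour_spokes_less[OF min_detourD[OF min]] by simp

lemma outside_only_vertex_proper:
  assumes "A1 = []" "A2 = []"
  shows "proper_for (P @ B) v"
proof -
  have "num_spokes P < num_spokes [v]" using outside_spokes assms by simp
  then have "num_spokes P = 0" "E v x" using E_commute by (auto split: if_splits)
  moreover have "unseparated (P @ B) v"
    by (rule unseparated_outer[of _ P t m s "[]"]) (use B outside_arc_ends \<open>num_spokes P = 0\<close> in auto)
  ultimately show ?thesis unfolding proper_for_def by blast
qed

lemma outside_no_path_nbr_proper:
  assumes A: "\<not> (A1 = [] \<and> A2 = [])" and none: "\<And>b. b \<in> set P \<Longrightarrow> \<not> E v b"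
  shows "proper_for (P @ B) v"
proof -
  obtain X c Z where X: "P @ B = X @ c # Z" "\<And>b. b \<in> set (X @ Z) \<Longrightarrow> \<not> E v b"
  proof (cases "A1 = []")
    case True
    then show thesis using that[of "P @ t # m" s "[]"] none outside_arc_ends A B by auto
  next
    case False
    then show thesis using that[of P t "m @ [s]"] none outside_arc_ends B by auto
  qed
  then have "nbrs_in v (set (P @ B)) \<subseteq> {c, c}" unfolding nbrs_in_def by auto
  then have "card (nbrs_in v (set (P @ B))) \<le> 2" by (rule card_subset_pair_le)
  then show ?thesis using unseparated_single_nbr[OF X] unfolding proper_for_def by blast
qed

lemma outside_one_path_nbr_proper:
  assumes A: "\<not> (A1 = [] \<and> A2 = [])" and P: "P = Pa @ p # Pz" "E v p" "\<And>b. b \<in> set (Pa @ Pz) \<Longrightarrow> \<not> E v b"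
  shows "proper_for (P @ B) v"
proof -
  have "nbrs_in v (set (P @ B)) \<subseteq> {p, if A1 = [] then s else t}"
    using P B outside_arc_ends A unfolding nbrs_in_def by auto
  then have "card (nbrs_in v (set (P @ B))) \<le> 2" by (rule card_subset_pair_le)
  moreover have "num_spokes [v] \<le> 1" by simp
  note few = this
  consider (at_start) "A1 = []" "A2 \<noteq> []" | (at_end) "A1 \<noteq> []" "A2 = []" | (inner) "A1 \<noteq> []" "A2 \<noteq> []"
    using A by blast
  then have "unseparated (P @ B) v"
  proof cases
    case at_start
    have "Pa \<noteq> [] \<Longrightarrow> num_spokes A2 \<le> num_spokes (p # Pz)"
      using min_detour_outside_suffix[OF min rim P(1) _ P(2)] .
    then have "num_spokes Pa = 0" using outside_spokes few at_start P(1) by (cases "Pa = []") auto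
    then show ?thesis
      by (intro unseparated_outer[of _ Pa p "Pz @ t # m" s "[]"])
        (use P B outside_arc_ends at_start in auto)
  next
    case at_end
    have "Pz \<noteq> [] \<Longrightarrow> num_spokes A1 \<le> num_spokes (Pa @ [p])"
      using min_detour_outside_prefix[OF min rim P(1) _ P(2)] .
    then have "num_spokes Pz = 0" using outside_spokes few at_end P(1) by (cases "Pz = []") auto
    then show ?thesis
      by (intro unseparated_inner[of _ Pa p Pz t "m @ [s]"]) (use P B outside_arc_ends at_end in auto)
  next
    case inner
    then show ?thesis
      by (intro unseparated_single_nbr[of _ Pa p "Pz @ B"]) (use P B outside_arc_ends in auto)
  qed
  ultimately show ?thesis unfolding proper_for_def by blast
qed

lemma outside_two_path_nbrs_proper:
  assumes A: "\<not> (A1 = [] \<and> A2 = [])" and P: "P = Pa @ pf # M @ pj # Pz" "E v pf" "E v pj"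
    "\<And>b. b \<in> set (Pa @ Pz) \<Longrightarrow> \<not> E v b"
  shows "proper_for (P @ B) v"
proof -
  have "num_spokes A2 \<le> num_spokes (pj # Pz)"
    by (rule min_detour_outside_suffix[OF min rim, of "Pa @ pf # M"]) (use P in auto)
  moreover have "num_spokes A1 \<le> num_spokes (Pa @ [pf])"
    by (rule min_detour_outside_prefix[OF min rim, of _ _ "M @ pj # Pz"]) (use P in auto)
  moreover have "num_spokes P = num_spokes (Pa @ [pf]) + num_spokes M + num_spokes (pj # Pz)"
    using P by simp
  moreover have "num_spokes [v] \<le> 1" by simp
  ultimately have tight: "num_spokes [v] = 1" "num_spokes M = 0"
    "num_spokes A1 = num_spokes (Pa @ [pf])"
    "num_spokes A2 = num_spokes (pj # Pz)"
    using outside_spokes by linarith+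
  have "E v x" using tight(1) E_commute by (auto split: if_splits)
  consider (at_start) "A1 = []" "A2 \<noteq> []" | (at_end) "A1 \<noteq> []" "A2 = []" | (inner) "A1 \<noteq> []" "A2 \<noteq> []"
    using A by blast
  then have "unseparated (P @ B) v"
  proof cases
    case at_start
    then have "num_spokes (Pa @ [pf]) = 0" using tight by simp
    then show ?thesis
      by (intro unseparated_outer[of _ "Pa @ pf # M" pj "Pz @ t # m" s "[]"])
        (use P B outside_arc_ends at_start tight in auto)
  next
    case at_end
    then have "num_spokes (pj # Pz) = 0" using tight by simp
    then show ?thesis
      by (intro unseparated_inner[of _ Pa pf "M @ pj # Pz" t "m @ [s]"])
        (use P B outside_arc_ends at_end tight in auto)
  next
    case inner
    then show ?thesis
      by (intro unseparated_inner[of _ Pa pf M pj "Pz @ B"]) (use P B outside_arc_ends tight in auto)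
  qed
  then show ?thesis using \<open>E v x\<close> unfolding proper_for_def by blast
qed

end

lemma min_detour_outside_proper:
  assumes min: "min_detour P B" and rim: "rim (B @ A)" and v: "v \<in> set A"
  shows "proper_for (P @ B) v"
proof -
  obtain A1 A2 where A: "A = A1 @ v # A2" using v by (meson split_list)
  obtain t m s where B: "B = t # m @ [s]" using detour_arc_ends[OF min_detourD[OF min]] .
  note outside = min rim[unfolded A] B
  show ?thesis
  proof (cases "A1 = [] \<and> A2 = []")
    case True
    then show ?thesis using outside_only_vertex_proper[OF outside] by blast
  next
    case False
    then show ?thesis
      using outside_no_path_nbr_proper[OF outside] outside_one_path_nbr_proper[OF outside]
        outside_two_path_nbrs_proper[OF outside]
          by (cases rule: outermost_occurrences[of P "E v"]) blast+
  qed
qed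

section \<open>Non-neighbours of the hub attached to a minimal detour\<close>

lemma detour_no_path_nbr_proper:
  assumes detour: "detour P B" and v: "off_rim v" and none: "\<And>b. b \<in> set P \<Longrightarrow> \<not> E v b"
  shows "proper_for (P @ B) v"
proof -
  have "unseparated (P @ B) v"
  proof (rule outermost_occurrences[of B "E v"])
    assume "\<And>b. b \<in> set B \<Longrightarrow> \<not> E v b"
    then show ?thesis using none by (intro unseparated_no_nbr) auto
  next
    fix X c Z assume "B = X @ c # Z" "\<And>b. b \<in> set (X @ Z) \<Longrightarrow> \<not> E v b"
    then show ?thesis using none by (intro unseparated_single_nbr[of _ "P @ X" c Z]) auto
  next
    fix X c M c' Z assume B: "B = X @ c # M @ c' # Z" "E v c" "E v c'" "\<And>b. b \<in> set (X @ Z) \<Longrightarrow> \<not> E v b"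
    have "num_spokes M = 0" using detour_arc_unseparated[OF detour v B(1-3)] .
    then show ?thesis using none B by (intro unseparated_inner[of _ "P @ X" c M c' Z]) auto
  qed
  moreover have "nbrs_in v (set (P @ B)) = nbrs_in v (set B)" using none unfolding nbrs_in_def by auto
  then have "card (nbrs_in v (set (P @ B))) \<le> card (nbrs_in v C)"
    using card_nbrs_in_mono[OF detour_arc_on_rim[OF detour] finite_rim] by simp
  ultimately show ?thesis using off_rim_card_nbrs[OF v] unfolding proper_for_def by fastforce
qed

lemma min_detour_path_nbrs_close:
  assumes min: "min_detour P B" and v: "off_rim v" "v \<notin> set P" "\<not> E v x"
    and trailing: "spokes_trailing P"
    and P: "P = Pa @ pf # M @ pj # Pz" "E v pf" "E v pj" "\<And>b. b \<in> set (Pa @ Pz @ B) \<Longrightarrow> \<not> E v b"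
  shows "num_spokes M = 0 \<and> length M \<le> 1"
proof (cases "M = []")
  case False
  note detour = min_detourD[OF min]
  have xv: "\<not> E x v" using v(3) E_commute by blast
  have terminal: "spokes_terminal (Pa @ [pf, v, pj] @ Pz)"
    using spokes_trailing_shortcut[of "Pa @ [pf]" M "pj # Pz" v] trailing P(1) False xv by simp
  have "num_spokes (Pa @ pf # M) \<le> 1"
    using spokes_trailing_prefix[of "Pa @ pf # M" "pj # Pz"] trailing P(1) by simp
  then have M: "num_spokes M \<le> 1" by simp
  have total: "num_spokes (Pa @ [pf, v, pj] @ Pz @ B) + num_spokes M = num_spokes (P @ B)" using P(1) xv
    by simp
  have shortcut: "detour (Pa @ [pf, v, pj] @ Pz) B"
    by (rule detour_shortcut[OF detour P(1) False v(1,2) P(2,3) _ terminal])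
      (use P(4) total M detour_spokes_ge_4[OF detour] detour_spokes_less[OF detour]
        in \<open>auto simp: algebra_simps\<close>)
  have "length (Pa @ [pf, v, pj] @ Pz) + length M = length P + 1" "1 \<le> length M"
    using P(1) False by (auto simp: Suc_le_eq)
  then show ?thesis
    using min_detour_smaller[OF min shortcut] min_detour_shorter[OF min shortcut] total
    by (fastforce simp: algebra_simps)
qed simp

lemma min_detour_nonnbr_no_arc_nbr_proper:
  assumes min: "min_detour P B" and v: "off_rim v" "v \<notin> set P" "\<not> E v x"
    and trailing: "spokes_trailing P"
    and B: "\<And>b. b \<in> set B \<Longrightarrow> \<not> E v b"
  shows "proper_for (P @ B) v"
proof (rule outermost_occurrences[of P "E v"])
  assume "\<And>b. b \<in> set P \<Longrightarrow> \<not> E v b"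
  then show ?thesis by (rule detour_no_path_nbr_proper[OF min_detourD[OF min] v(1)])
next
  fix X c Z assume P: "P = X @ c # Z" "\<And>b. b \<in> set (X @ Z) \<Longrightarrow> \<not> E v b"
  then have "nbrs_in v (set (P @ B)) \<subseteq> {c, c}" using B unfolding nbrs_in_def by auto
  then have "card (nbrs_in v (set (P @ B))) \<le> 2" by (rule card_subset_pair_le)
  moreover have "unseparated (P @ B) v"
    using P B by (intro unseparated_single_nbr[of _ X c "Z @ B"]) auto
  ultimately show ?thesis unfolding proper_for_def by blast
next
  fix Pa pf M pj Pz assume P: "P = Pa @ pf # M @ pj # Pz" "E v pf" "E v pj" "\<And>b. b \<in> set (Pa @ Pz)
    \<Longrightarrow> \<not> E v b"
  note detour = min_detourD[OF min]
  have M: "num_spokes M = 0" "length M \<le> 1"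
    using min_detour_path_nbrs_close[OF min v trailing P(1-3)] P(4) B by auto
  have unseparated: "unseparated (P @ B) v"
    using P M B by (intro unseparated_inner[of _ Pa pf M pj "Pz @ B"]) auto
  have not_three: "card (nbrs_in v (set (P @ B))) \<noteq> 3"
    using card_nbrs_in_cycle_neq_3[OF detour_cycle[OF detour]] off_rim_notin_detour[OF detour v(1,2)]
      v(1)
    unfolding off_rim_def by blast
  have "card (nbrs_in v (set (P @ B))) \<le> 2"
  proof (cases "\<exists>b\<in>set M. E v b")
    case True
    then obtain q where q: "M = [q]" "E v q" using M by (cases M) auto
    have "nbrs_in v (set (P @ B)) = {pf, q, pj}" using P q B unfolding nbrs_in_def by auto
    moreover have "card {pf, q, pj} = 3" using detour_distinct[OF detour] P(1) q by auto
    ultimately show ?thesis using not_three by simp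
  next
    case False
    then have "nbrs_in v (set (P @ B)) \<subseteq> {pf, pj}" using P B unfolding nbrs_in_def by auto
    then show ?thesis by (rule card_subset_pair_le)
  qed
  then show ?thesis using unseparated unfolding proper_for_def by blast
qed

lemma min_detour_no_single_nbrs_cut:
  assumes min: "min_detour P B" and v: "off_rim v" "v \<notin> set P" "\<not> E x v"
    and trailing: "spokes_trailing P"
    and P: "P = Pa @ p # Pz" "E v p" "\<And>b. b \<in> set (Pa @ Pz) \<Longrightarrow> \<not> E v b"
    and B: "B = Ba @ y # Bb" "E v y" "\<And>b. b \<in> set (Ba @ Bb) \<Longrightarrow> \<not> E v b"
    and arcs: "0 < num_spokes (Pz @ Ba)" "0 < num_spokes (Pa @ Bb)"
    and inner: "3 \<le> num_spokes (p # (Pz @ Ba) @ [y])" and outer: "3 \<le> num_spokes (y # (Bb @ Pa) @ [p])"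
  shows False
proof -
  note detour = min_detourD[OF min]
  have total: "num_spokes (P @ B) = num_spokes (p # (Pz @ Ba) @ y # (Bb @ Pa))" using P(1) B(1) by simp
  show False
  proof (cases "Pa = []")
    case False
    have terminal: "spokes_terminal (v # p # Pz)"
      using spokes_trailing_suffix[of Pa "p # Pz" "[v]"] trailing P(1) v(3)
      unfolding spokes_terminal_def by simp
    have less: "num_spokes (v # p # Pz @ Ba @ [y]) + num_spokes (Pa @ Bb) = num_spokes (P @ B)"
      using total v(3) by simp
    have "detour (v # p # Pz) (Ba @ [y])"
      by (rule detour_cut_start[OF detour P(1) B(1) v(1,2) P(2) B(2) _ _ terminal])
        (use P B False detour_spokes_less[OF detour] arcs inner less in auto)
    moreover have "length (v # p # Pz) \<le> length P" using P(1) False by (cases Pa) auto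
    moreover have "num_spokes ((v # p # Pz) @ Ba @ [y]) < num_spokes (P @ B)"
      using less arcs(2) by (auto split: if_splits)
    ultimately show False using min_detour_smaller[OF min] less_imp_le by blast
  next
    case True
    have terminal: "spokes_terminal (Pa @ [p, v])" using True v(3) by (intro spokes_terminal_le_1) simp
    have less: "num_spokes (Pa @ [p, v] @ y # Bb) + num_spokes (Pz @ Ba) = num_spokes (P @ B)"
      using total v(3) by simp
    have "detour (Pa @ [p, v]) (y # Bb)"
      by (rule detour_cut_end[OF detour P(1) B(1) v(1,2) P(2) B(2) _ _ terminal])
        (use P B detour_spokes_less[OF detour] arcs outer less in auto)
    moreover have "length (Pa @ [p, v]) \<le> length P" using True detour_length_ge_2[OF detour] by simp
    moreover have "num_spokes ((Pa @ [p, v]) @ y # Bb) < num_spokes (P @ B)"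
      using less arcs(1) by (auto split: if_splits)
    ultimately show False using min_detour_smaller[OF min] less_imp_le by blast
  qed
qed

lemma min_detour_single_nbrs_unseparated:
  assumes min: "min_detour P B" and v: "off_rim v" "v \<notin> set P" "\<not> E v x"
    and trailing: "spokes_trailing P"
    and P: "P = Pa @ p # Pz" "E v p" "\<And>b. b \<in> set (Pa @ Pz) \<Longrightarrow> \<not> E v b"
    and B: "B = Ba @ y # Bb" "E v y" "\<And>b. b \<in> set (Ba @ Bb) \<Longrightarrow> \<not> E v b"
  shows "unseparated (P @ B) v"
proof (rule ccontr)
  assume separated: "\<not> ?thesis"
  note detour = min_detourD[OF min]
  have xv: "\<not> E x v" using v(3) E_commute by blast
  have v': "v \<in> V" "x \<noteq> v" "v \<notin> set (P @ B)"
    using v off_rim_notin_detour[OF detour] unfolding off_rim_def by auto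
  have split: "P @ B = Pa @ p # (Pz @ Ba) @ y # Bb" using P(1) B(1) by simp
  have arcs: "0 < num_spokes (Pz @ Ba)" "0 < num_spokes (Pa @ Bb)"
    using separated unseparated_inner[OF split] unseparated_outer[OF split] P(3) B(3)
    by (metis Un_iff neq0_conv set_append)+
  have cyc: "induced_cycle (p # (Pz @ Ba) @ y # (Bb @ Pa))"
    using induced_cycle_rotate[of Pa "p # (Pz @ Ba) @ y # Bb"] detour_cycle[OF detour] split by simp
  have cyc': "induced_cycle (y # (Bb @ Pa) @ p # (Pz @ Ba))"
    using induced_cycle_rotate[of "p # Pz @ Ba" "y # Bb @ Pa"] cyc by simp
  have total: "num_spokes (P @ B) = num_spokes (p # (Pz @ Ba) @ y # (Bb @ Pa))" using split by simp
  have hub: "x \<notin> set (p # (Pz @ Ba) @ y # (Bb @ Pa))" using detour_hub_notin[OF detour] split by auto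
  have inner: "4 \<le> num_spokes (p # (Pz @ Ba) @ [y])"
    by (rule two_nbrs_arc_spokes_ge_4[OF cyc hub v'(2,1)])
      (use v v' P B detour_spokes_ge_4[OF detour] arcs total in auto)
  have outer: "4 \<le> num_spokes (y # (Bb @ Pa) @ [p])"
    by (rule two_nbrs_arc_spokes_ge_4[OF cyc' _ v'(2,1)])
      (use v v' hub P B detour_spokes_ge_4[OF detour] arcs total in auto)
  show False using min_detour_no_single_nbrs_cut[OF min v(1,2) xv trailing P B arcs] inner outer by simp
qed

context
  fixes P B v Pa pf M pj Pz
  assumes min: "min_detour P B" and v: "off_rim v" "v \<notin> set P" "\<not> E v x"
    and trailing: "spokes_trailing P"
    and P: "P = Pa @ pf # M @ pj # Pz" "E v pf" "E v pj" "\<And>b. b \<in> set (Pa @ Pz) \<Longrightarrow> \<not> E v b"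
begin

lemma many_nbrs_card_neq_3: "card (nbrs_in v (set (P @ B))) \<noteq> 3"
  using card_nbrs_in_cycle_neq_3[OF detour_cycle] off_rim_notin_detour min_detourD[OF min] v
  unfolding off_rim_def by blast

lemma many_nbrs_hub_nonadj: "\<not> E x v"
  using v(3) E_commute by blast

lemma many_nbrs_prefix_spokes: "num_spokes (Pa @ pf # M) \<le> 1"
  using spokes_trailing_prefix[of "Pa @ pf # M" "pj # Pz"] trailing P by simp

lemma many_nbrs_prefix_arc_spokes:
  assumes B: "B = Bc @ y # Bd" "E v y" "\<And>b. b \<in> set Bd \<Longrightarrow> \<not> E v b"
  shows "num_spokes (Pa @ [pf, v] @ y # Bd) \<le> 2"
proof (rule ccontr)
  assume many: "\<not> ?thesis"
  note detour = min_detourD[OF min]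
  have terminal: "spokes_terminal (Pa @ [pf, v])"
    using many_nbrs_prefix_spokes many_nbrs_hub_nonadj by (intro spokes_terminal_le_1) simp
  have spokes_le: "num_spokes (Pa @ [pf, v] @ y # Bd) \<le> num_spokes (P @ B)"
    using P(1) B(1) many_nbrs_hub_nonadj by simp
  have cut: "detour (Pa @ [pf, v]) (y # Bd)"
    by (rule detour_cut_end[OF detour _ B(1) v(1,2) P(2) B(2) _ _ terminal, of "M @ pj # Pz"])
      (use P B many spokes_le detour_spokes_less[OF detour] in auto)
  have "\<not> (M = [] \<and> Pz = [] \<and> Bc = [])"
  proof
    assume "M = [] \<and> Pz = [] \<and> Bc = []"
    then have "nbrs_in v (set (P @ B)) = {pf, pj, y}" "card {pf, pj, y} = 3"
      using P B detour_distinct[OF detour] unfolding nbrs_in_def by auto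
    then show False using many_nbrs_card_neq_3 by simp
  qed
  then have "length ((Pa @ [pf, v]) @ y # Bd) < length (P @ B)" using P(1) B(1) by auto
  then show False using min_detour_smaller[OF min cut] spokes_le P(1) by simp
qed

lemma many_nbrs_suffix_arc_spokes:
  assumes B: "B = Ba @ y # Bb" "E v y" "\<And>b. b \<in> set Ba \<Longrightarrow> \<not> E v b"
  shows "num_spokes (v # pj # Pz @ Ba @ [y]) \<le> 2"
proof (rule ccontr)
  assume many: "\<not> ?thesis"
  note detour = min_detourD[OF min]
  have terminal: "spokes_terminal (v # pj # Pz)"
    using spokes_trailing_suffix[of "Pa @ pf # M" "pj # Pz" "[v]"] trailing P(1) many_nbrs_hub_nonadj
    unfolding spokes_terminal_def by simp
  have spokes_le: "num_spokes (v # pj # Pz @ Ba @ [y]) \<le> num_spokes (P @ B)"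
    using P(1) B(1) many_nbrs_hub_nonadj by simp
  have cut: "detour (v # pj # Pz) (Ba @ [y])"
    by (rule detour_cut_start[OF detour _ B(1) v(1,2) P(3) B(2) _ _ terminal, of "Pa @ pf # M"])
      (use P B many spokes_le detour_spokes_less[OF detour] in auto)
  have "\<not> (M = [] \<and> Pa = [] \<and> Bb = [])"
  proof
    assume "M = [] \<and> Pa = [] \<and> Bb = []"
    then have "nbrs_in v (set (P @ B)) = {pf, pj, y}" "card {pf, pj, y} = 3"
      using P B detour_distinct[OF detour] unfolding nbrs_in_def by auto
    then show False using many_nbrs_card_neq_3 by simp
  qed
  then have "length ((v # pj # Pz) @ Ba @ [y]) < length (P @ B)" using P(1) B(1) by auto
  then show False using min_detour_smaller[OF min cut] spokes_le P(1) by simp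
qed

lemma many_nbrs_one_arc_nbr:
  assumes B: "B = Ba @ y # Bd" "E v y" "\<And>b. b \<in> set (Ba @ Bd) \<Longrightarrow> \<not> E v b"
  shows False
proof -
  note detour = min_detourD[OF min]
  have cyc: "induced_cycle (y # (Bd @ Pa) @ pf # M @ pj # (Pz @ Ba))"
    using induced_cycle_rotate[of "P @ Ba" "y # Bd"] detour_cycle[OF detour] P(1) B(1) by simp
  have "num_spokes (y # (Bd @ Pa) @ [pf]) \<le> 2" "num_spokes (pj # (Pz @ Ba) @ [y]) \<le> 2"
    using many_nbrs_prefix_arc_spokes[OF B(1,2)]
      many_nbrs_suffix_arc_spokes[OF B(1,2)] B(3) many_nbrs_hub_nonadj
    by (simp_all add: algebra_simps)
  then show False
    by (intro no_two_spoke_arcs_to_nbr[OF cyc, of v])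
      (use v off_rim_notin_detour[OF detour v(1,2)] P B detour_hub_notin[OF detour]
        detour_spokes_ge_4[OF detour]
        many_nbrs_prefix_spokes in \<open>auto simp: off_rim_def\<close>)
qed

lemma many_nbrs_two_arc_nbrs:
  assumes B: "B = Ba @ y' # G @ y # Bd" "E v y'" "E v y" "\<And>b. b \<in> set (Ba @ Bd) \<Longrightarrow> \<not> E v b"
  shows False
proof -
  note detour = min_detourD[OF min]
  have G: "num_spokes G = 0" using detour_arc_unseparated[OF detour v(1) B(1-3)] .
  have beyond_free: "\<not> E v b" if b: "b \<in> set G" for b
  proof
    assume nbr: "E v b"
    have "{y', b, y} \<subseteq> nbrs_in v C" using B nbr b detour_arc_on_rim[OF detour] unfolding nbrs_in_def
      by auto
    then have "card {y', b, y} \<le> card (nbrs_in v C)"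
      using finite_rim unfolding nbrs_in_def by (intro card_mono) auto
    then show False
      using off_rim_card_nbrs[OF v(1,3)] detour_distinct[OF detour] B(1) b
      by (auto simp: card_insert_if split: if_splits)
  qed
  have cyc: "induced_cycle (y # (Bd @ Pa) @ pf # M @ pj # (Pz @ Ba) @ y' # G)"
    using induced_cycle_rotate[of "P @ Ba @ y' # G" "y # Bd"] detour_cycle[OF detour] P(1) B(1) by simp
  have "num_spokes (y # (Bd @ Pa) @ [pf]) \<le> 2" "num_spokes (pj # (Pz @ Ba) @ [y']) \<le> 2"
    using many_nbrs_prefix_arc_spokes[of "Ba @ y' # G" y Bd]
      many_nbrs_suffix_arc_spokes[of Ba y' "G @ y # Bd"]
      B many_nbrs_hub_nonadj by (simp_all add: algebra_simps)
  then show False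
    by (intro no_two_spoke_arcs_to_nbr_pair[OF cyc, of v])
      (use v off_rim_notin_detour[OF detour v(1,2)] P B detour_hub_notin[OF detour]
        detour_spokes_ge_4[OF detour]
        many_nbrs_prefix_spokes G beyond_free in \<open>auto simp: off_rim_def\<close>)
qed

lemma many_nbrs_no_arc_nbr: "b \<in> set B \<Longrightarrow> \<not> E v b"
  using many_nbrs_one_arc_nbr many_nbrs_two_arc_nbrs
  by (cases rule: outermost_occurrences[of B "E v"]) blast+

end

lemma min_detour_nonnbr_proper:
  assumes min: "min_detour P B" and v: "off_rim v" "v \<notin> set P" "\<not> E v x"
    and trailing: "spokes_trailing P"
  shows "proper_for (P @ B) v"
proof (cases "\<exists>b\<in>set B. E v b")
  case False
  then show ?thesis using min_detour_nonnbr_no_arc_nbr_proper[OF min v trailing] by blast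
next
  case True
  note detour = min_detourD[OF min]
  show ?thesis
  proof (rule outermost_occurrences[of P "E v"])
    assume "\<And>b. b \<in> set P \<Longrightarrow> \<not> E v b"
    then show ?thesis by (rule detour_no_path_nbr_proper[OF detour v(1)])
  next
    fix Pa pf M pj Pz assume "P = Pa @ pf # M @ pj # Pz" "E v pf" "E v pj" "\<And>b. b \<in> set (Pa @ Pz)
      \<Longrightarrow> \<not> E v b"
    then show ?thesis using many_nbrs_no_arc_nbr[OF min v trailing] True by blast
  next
    fix Pa p Pz assume P: "P = Pa @ p # Pz" "E v p" "\<And>b. b \<in> set (Pa @ Pz) \<Longrightarrow> \<not> E v b"
    have not_three: "card (nbrs_in v (set (P @ B))) \<noteq> 3"
      using card_nbrs_in_cycle_neq_3[OF detour_cycle[OF detour]] off_rim_notin_detour[OF detour v(1,2)]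
        v(1)
      unfolding off_rim_def by blast
    have "nbrs_in v (set (P @ B)) = insert p (nbrs_in v (set B))" using P unfolding nbrs_in_def by auto
    moreover have "p \<notin> nbrs_in v (set B)" using detour_distinct[OF detour] P(1) unfolding nbrs_in_def
      by auto
    moreover have finite: "finite (nbrs_in v (set B))" unfolding nbrs_in_def by simp
    ultimately have card: "card (nbrs_in v (set (P @ B))) = Suc (card (nbrs_in v (set B)))" by simp
    have "card (nbrs_in v (set B)) \<le> 2"
      using card_nbrs_in_mono[OF detour_arc_on_rim[OF detour] finite_rim] off_rim_card_nbrs[OF v(1,3)]
      by (rule order_trans)
    then have one: "card (nbrs_in v (set B)) \<le> Suc 0" using not_three card by simp
    obtain Ba y Bb where B: "B = Ba @ y # Bb" "E v y" using True by (metis split_list)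
    have "\<not> E v b" if b: "b \<in> set (Ba @ Bb)" for b
    proof
      assume "E v b"
      then have "b = y" using one card_le_Suc0_iff_eq[OF finite] b B unfolding nbrs_in_def by auto
      then show False using b detour_distinct[OF detour] B(1) by auto
    qed
    then have "unseparated (P @ B) v" using min_detour_single_nbrs_unseparated[OF min v trailing P B]
      by blast
    then show ?thesis using card one unfolding proper_for_def by simp
  qed
qed

end

section \<open>Neighbours of the hub attached to a minimal detour\<close>

context proper_rim
begin

text \<open>The corner is the spoke \<open>e\<close>. In the cycle formed by the detour, the two sectors at it are
  \<open>e # Bs @ P1 @ [u]\<close> and \<open>b # Bm @ [e]\<close>.\<close>

definition detour_corner :: "'a list \<Rightarrow> 'a list \<Rightarrow> 'a list \<Rightarrow> 'a \<Rightarrow> 'a list \<Rightarrow> 'a list \<Rightarrow> 'a \<Rightarrow> 'a list \<Rightarrow> 'a \<Rightarrow> 'a list \<Rightarrow> bool"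
  where
  "detour_corner P B P1 u P2 Bt b Bm e Bs \<longleftrightarrow> P = P1 @ u # P2 \<and> E x u \<and> num_spokes P1 = 0
     \<and> B = Bt @ b # Bm @ e # Bs \<and> E x b \<and> E x e \<and> num_spokes Bm = 0 \<and> num_spokes Bs = 0"

definition corner_obstruction :: "'a list \<Rightarrow> 'a list \<Rightarrow> 'a \<Rightarrow> bool" where
  "corner_obstruction P B v \<longleftrightarrow> off_rim v \<and> v \<notin> set P \<and> E x v \<and> (\<exists>P1 u P2 Bt b Bm e Bs.
     detour_corner P B P1 u P2 Bt b Bm e Bs \<and> (\<exists>p\<in>set P1. E v p) \<and> (\<exists>y\<in>set (b # Bm). E v y)
     \<and> (\<forall>p\<in>set (P2 @ Bt). \<not> E v p))"

lemma unseparated_rev_arcs: "unseparated (rev P @ rev B) v \<Longrightarrow> unseparated (P @ B) v"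
  using unseparated_rotate[of "rev P" "rev B" v] unseparated_rev[of "rev B @ rev P" v] by simp

lemma detour_outer_arc_nbrs:
  assumes detour: "detour P B" and v: "off_rim v"
    and first: "B = Ba @ y # Bb" "E v y" "\<forall>b\<in>set Ba. \<not> E v b"
    and last: "B = Bc @ z # Bd" "E v z" "\<forall>b\<in>set Bd. \<not> E v b"
  obtains (one) "Bc = Ba" "z = y" "Bd = Bb"
    | (two) M where "Bc = Ba @ y # M" "Bb = M @ z # Bd" "num_spokes M = 0"
proof -
  have "Ba @ y # Bb = Bc @ z # Bd" using first(1) last(1) by simp
  then obtain W where W: "Bc = Ba @ W" "y # Bb = W @ z # Bd"
    by (rule before_first_occurrence[of _ _ _ _ _ _ "E v"]) (use first(3) last(2) in auto)
  show thesis
  proof (cases W)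
    case Nil
    then show thesis using W one by simp
  next
    case (Cons _ M)
    then have M: "Bc = Ba @ y # M" "Bb = M @ z # Bd" using W by auto
    then have "B = Ba @ y # M @ z # Bd" using first(1) by simp
    from detour_arc_unseparated[OF detour v this first(2) last(2)] show thesis by (rule two[OF M])
  qed
qed

lemma detour_outer_arc_spokes:
  assumes detour: "detour P B" and v: "off_rim v"
    and first: "B = Ba @ y # Bb" "E v y" "\<forall>b\<in>set Ba. \<not> E v b"
    and last: "B = Bc @ z # Bd" "E v z" "\<forall>b\<in>set Bd. \<not> E v b"
  shows "num_spokes B \<le> num_spokes (Ba @ [y]) + num_spokes (z # Bd)"
    and "num_spokes Bc \<le> num_spokes (Ba @ [y])" and "num_spokes Bb \<le> num_spokes (z # Bd)"
    and "\<not> E x y \<Longrightarrow> num_spokes Bc = num_spokes Ba"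
  using first(1) by (cases rule: detour_outer_arc_nbrs[OF detour v first last]; simp)+

lemma hub_nbr_last_arc_le_1:
  assumes min: "min_detour P B" and v: "off_rim v" "v \<notin> set P" "E x v"
    and P: "P = Pa @ p # Pm" "E v p" "\<forall>b\<in>set Pa. \<not> E v b" "num_spokes (Pa @ [p]) = 0"
    and last: "B = Bc @ z # Bd" "E v z" "\<forall>b\<in>set Bd. \<not> E v b"
    and between: "0 < num_spokes (Pm @ Bc)" "Pm \<noteq> []" "2 \<le> length (Pm @ Bc)"
  shows "num_spokes (z # Bd) \<le> 1"
proof (rule ccontr)
  assume many: "\<not> ?thesis"
  note detour = min_detourD[OF min]
  have spokes_le: "num_spokes (Pa @ [p, v] @ z # Bd) \<le> num_spokes (P @ B)"
    using P last(1) v(3) between(1) by auto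
  have cut: "detour (Pa @ [p, v]) (z # Bd)"
    by (rule detour_cut_end[OF detour P(1) last(1) v(1,2) P(2) last(2)])
      (use P last(3) between spokes_le detour_spokes_less[OF detour] many v(3)
        in \<open>auto intro!: spokes_terminal_le_1\<close>)
  have "length (Pa @ [p, v]) \<le> length P" using P(1) between(2) by (cases Pm) auto
  moreover have "length ((Pa @ [p, v]) @ z # Bd) < length (P @ B)" using P(1) last(1) between(3) by simp
  ultimately show False using min_detour_smaller[OF min cut] spokes_le by simp
qed

lemma hub_nbr_first_arc_le_1:
  assumes min: "min_detour P B" and v: "off_rim v" "v \<notin> set P" "E x v"
    and P: "P = Pn @ p # Pz" "E v p" "\<forall>b\<in>set Pz. \<not> E v b" "num_spokes (p # Pz) = 0"
    and first: "B = Ba @ y # Bb" "E v y" "\<forall>b\<in>set Ba. \<not> E v b"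
    and between: "0 < num_spokes (Pn @ Bb)" "Pn \<noteq> []" "2 \<le> length (Pn @ Bb)"
  shows "num_spokes (Ba @ [y]) \<le> 1"
proof -
  have "num_spokes (y # rev Ba) \<le> 1"
    by (rule hub_nbr_last_arc_le_1[OF min_detour_rev[OF min] v(1) _ v(3), of "rev Pz" p "rev Pn" "rev Bb" y "rev Ba"])
      (use v P first between in auto)
  then show ?thesis by simp
qed

lemma hub_nbr_spokeless_path_arc_leg:
  assumes min: "min_detour P B" and v: "off_rim v" "v \<notin> set P" "E x v"
    and P: "P = Pa @ [p]" "num_spokes P = 0"
    and nbrs: "E v p" "\<forall>b\<in>set Pa. \<not> E v b"
    and first: "B = Ba @ y # Bb" "E v y" "\<forall>b\<in>set Ba. \<not> E v b"
    and last: "B = Bc @ z # Bd" "E v z" "\<forall>b\<in>set Bd. \<not> E v b"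
    and spokes: "num_spokes (Ba @ [y]) = 1" "num_spokes Bc = 1"
  shows False
proof -
  note detour = min_detourD[OF min]
  have "2 \<le> num_spokes Bd" using detour_spokes_ge_4[OF detour] last(1) P(2) spokes(2)
    by (auto split: if_splits)
  then obtain X q Y where q: "Bd = X @ q # Y" "E x q" "X \<noteq> []" by (rule later_spoke)
  have "\<exists>W. Bb = W @ Bd" by (cases rule: detour_outer_arc_nbrs[OF detour v(1) first last]) auto
  then obtain W where W: "Bb = (W @ X) @ q # Y" using q(1) by auto
  have cyc: "induced_cycle (p # Ba @ y # (W @ X) @ q # (Y @ Pa))"
    using induced_cycle_rotate[of Pa "p # B"] detour_cycle[OF detour] P(1) first(1) W by simp
  show False
    by (rule no_hub_nbr_leg[OF cyc, of v])
      (use v off_rim_notin_detour[OF detour v(1,2)] P nbrs first W q detour_hub_notin[OF detour] spokes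
        last(3)
        E_commute in \<open>auto simp: off_rim_def\<close>)
qed

lemma hub_nbr_spokeless_path_last_arc:
  assumes min: "min_detour P B" and v: "off_rim v" "v \<notin> set P" "E x v" and spokeless: "num_spokes P = 0"
    and P: "P = Pa @ p # Pm" "E v p" "\<forall>b\<in>set Pa. \<not> E v b"
    and first: "B = Ba @ y # Bb" "E v y" "\<forall>b\<in>set Ba. \<not> E v b"
    and last: "B = Bc @ z # Bd" "E v z" "\<forall>b\<in>set Bd. \<not> E v b" and Bc: "0 < num_spokes Bc"
  shows "num_spokes (z # Bd) \<le> 1"
proof (rule ccontr)
  assume many: "\<not> ?thesis"
  note detour = min_detourD[OF min]
  have Pa: "num_spokes (Pa @ [p]) = 0" using spokeless P(1) by auto
  have "1 \<le> length Bc" using Bc num_spokes_le_length[of Bc] by linarith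
  then have Pm: "Pm = []"
    using hub_nbr_last_arc_le_1[OF min v P Pa last] many Bc by (cases Pm) auto
  have "0 < num_spokes Bd" using many by (auto split: if_splits)
  then have Bb: "0 < num_spokes Bb"
    by (cases rule: detour_outer_arc_nbrs[OF detour v(1) first last]) auto
  then have "1 \<le> length Bb" using num_spokes_le_length[of Bb] by linarith
  moreover have "Pa \<noteq> []" using detour_length_ge_2[OF detour] P(1) Pm by auto
  ultimately have "num_spokes (Ba @ [y]) \<le> 1"
    by (intro hub_nbr_first_arc_le_1[OF min v, of Pa p "[]" _ _ Bb])
      (use P Pm first Bb spokeless in \<open>auto simp: Suc_le_eq simp flip: length_greater_0_conv\<close>)
  moreover note detour_outer_arc_spokes(2)[OF detour v(1) first last]
  ultimately have "num_spokes (Ba @ [y]) = 1" "num_spokes Bc = 1" using Bc by linarith+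
  then show False
    using hub_nbr_spokeless_path_arc_leg[OF min v _ spokeless _ _ first last] P Pm by blast
qed

lemma hub_nbr_spokeless_path_unseparated:
  assumes min: "min_detour P B" and v: "off_rim v" "v \<notin> set P" "E x v" and spokeless: "num_spokes P = 0"
    and nbrs: "\<exists>b\<in>set P. E v b" "\<exists>b\<in>set B. E v b"
  shows "unseparated (P @ B) v"
proof (rule ccontr)
  assume separated: "\<not> ?thesis"
  note detour = min_detourD[OF min]
  obtain Ba y Bb where first: "B = Ba @ y # Bb" "E v y" "\<forall>b\<in>set Ba. \<not> E v b"
    using nbrs(2) by (rule split_list_first_propE)
  obtain Bc z Bd where last: "B = Bc @ z # Bd" "E v z" "\<forall>b\<in>set Bd. \<not> E v b"
    using nbrs(2) by (rule split_list_last_propE)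
  obtain Pa p Pm where P: "P = Pa @ p # Pm" "E v p" "\<forall>b\<in>set Pa. \<not> E v b"
    using nbrs(1) by (rule split_list_first_propE)
  obtain Pn p' Pz where P': "P = Pn @ p' # Pz" "E v p'" "\<forall>b\<in>set Pz. \<not> E v b"
    using nbrs(1) by (rule split_list_last_propE)
  have path_spokes: "num_spokes Pa = 0" "num_spokes Pm = 0" "num_spokes Pn = 0" "num_spokes Pz = 0"
    using spokeless P(1) arg_cong[OF P'(1), of num_spokes] by auto
  have "0 < num_spokes Bc"
  proof (rule ccontr)
    assume "\<not> ?thesis"
    then have "unseparated (P @ B) v"
      using P last path_spokes by (intro unseparated_inner[of _ Pa p "Pm @ Bc" z Bd]) auto
    then show False using separated by blast
  qed
  then have last_arc: "num_spokes (z # Bd) \<le> 1"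
    by (rule hub_nbr_spokeless_path_last_arc[OF min v spokeless P first last])
  have "0 < num_spokes Bb"
  proof (rule ccontr)
    assume "\<not> ?thesis"
    then have "unseparated (P @ B) v"
      using P' first path_spokes by (intro unseparated_outer[of _ Pn p' "Pz @ Ba" y Bb]) auto
    then show False using separated by blast
  qed
  moreover have "rev B = rev Bb @ y # rev Ba" "rev B = rev Bd @ z # rev Bc"
    using arg_cong[OF first(1), of rev] arg_cong[OF last(1), of rev] by simp_all
  ultimately have first_arc: "num_spokes (y # rev Ba) \<le> 1"
    by (intro hub_nbr_spokeless_path_last_arc[OF min_detour_rev[OF min] v(1) _ v(3),
          of "rev Pz" p' "rev Pn" "rev Bd" z "rev Bc" "rev Bb" y "rev Ba"])
      (use v(2) spokeless P' first(2,3) last(2,3) in auto)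
  show False
    using detour_outer_arc_spokes(1)[OF detour v(1) first last] first_arc last_arc
      detour_spokes_ge_4[OF detour] spokeless by simp
qed

context
  fixes P B v Pa p M p' Pz
  assumes min: "min_detour P B" and v: "off_rim v" "v \<notin> set P" "E x v" and trailing: "spokes_trailing P"
    and P: "P = Pa @ p # M @ p' # Pz" "E v p" "E v p'" "\<And>b. b \<in> set (Pa @ Pz @ B) \<Longrightarrow> \<not> E v b"
    and M: "0 < num_spokes M"
begin

lemma hub_nbr_path_gap_spokes: "num_spokes M = 1" "num_spokes (Pa @ [p]) = 0" "num_spokes (p' # Pz) = 0"
proof -
  have split: "spokes_trailing ((Pa @ p # M) @ p' # Pz)" using trailing P(1) by simp
  have "num_spokes (Pa @ p # M) \<le> 1" using spokes_trailing_prefix[OF split] by simp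
  then show "num_spokes M = 1" "num_spokes (Pa @ [p]) = 0" using M by (auto split: if_splits)
  show "num_spokes (p' # Pz) = 0"
  proof (rule ccontr)
    assume "\<not> ?thesis"
    then have "0 < num_spokes (Pa @ p # M)" "0 < num_spokes (p' # Pz)" using M by simp_all
    then obtain Q u u' where Q: "Pa @ p # M = Q @ [u]" "p' # Pz = [u']" "E x u" "E x u'"
      by (rule spokes_trailing_split[OF split])
    have "P = (Pa @ p # M) @ p' # Pz" using P(1) by simp
    then have "P = Q @ [u, p']" using Q(2) unfolding Q(1) by simp
    then have "E u p'"
      using induced_cycle_infix[of Q "[u, p']" B] detour_cycle[OF min_detourD[OF min]]
        detour_arc_nonempty[OF min_detourD[OF min]] by simp
    then have "v = u" using triangles_share_edge[of x p' v u] v(3) Q P(3) E_commute by auto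
    moreover have "u \<in> set P" using arg_cong[OF Q(1), of set] P(1) by auto
    ultimately show False using v(2) by blast
  qed
qed

lemma hub_nbr_path_gap_length: "length M \<le> 1"
proof (rule ccontr)
  assume long: "\<not> ?thesis"
  note detour = min_detourD[OF min]
  have spokes: "num_spokes P = 1" "num_spokes (Pa @ [p, v, p'] @ Pz) = 1"
    using P(1) hub_nbr_path_gap_spokes v(3) by auto
  have "detour (Pa @ [p, v, p'] @ Pz) B"
    by (rule detour_shortcut[OF detour P(1) _ v(1,2) P(2,3)])
      (use P(4) long spokes detour_spokes_ge_4[OF detour] detour_spokes_less[OF detour] in
        \<open>auto intro!: spokes_terminal_le_1\<close>)
  then have "length P \<le> length (Pa @ [p, v, p'] @ Pz)" by (rule min_detour_shorter[OF min])
  then show False using P(1) long by simp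
qed

lemma no_hub_nbr_path_gap: False
proof -
  note detour = min_detourD[OF min]
  obtain u where u: "M = [u]" using hub_nbr_path_gap_length M by (cases M) auto
  have ux: "E x u" "\<not> E x p" "num_spokes Pa = 0" "\<not> E x p'" "num_spokes Pz = 0"
    using u hub_nbr_path_gap_spokes by (auto split: if_splits)
  have "induced_path [p, u]" using induced_cycle_infix[of Pa "[p, u]" "p' # Pz @ B"]
    detour_cycle[OF detour] P(1) u by simp
  then have pu: "E p u" by simp
  have vu: "\<not> E v u"
  proof
    assume "E v u"
    then have "x = p" using triangles_share_edge[of u v x p] P(2) pu ux(1) v(3) E_commute by blast
    then show False using detour_path_off_rim[OF detour] P(1) by auto
  qed
  obtain X q Y where q: "B = X @ q # Y" "E x q" "X \<noteq> []"
    using later_spoke[OF detour_arc_spokes_ge_2[OF detour]] .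
  have cyc: "induced_cycle (p # [u] @ p' # (Pz @ X) @ q # (Y @ Pa))"
    using induced_cycle_rotate[of Pa "p # u # p' # Pz @ B"] detour_cycle[OF detour] P(1) u q by simp
  show False
    by (rule no_hub_nbr_leg[OF cyc, of v])
      (use v off_rim_notin_detour[OF detour v(1,2)] P u q detour_hub_notin[OF detour] ux vu E_commute in
        \<open>auto simp: off_rim_def\<close>)
qed

end

lemma hub_nbr_no_arc_nbr_unseparated:
  assumes min: "min_detour P B" and v: "off_rim v" "v \<notin> set P" "E x v" and trailing: "spokes_trailing P"
    and B: "\<And>b. b \<in> set B \<Longrightarrow> \<not> E v b"
  shows "unseparated (P @ B) v"
proof (rule outermost_occurrences[of P "E v"])
  assume "\<And>b. b \<in> set P \<Longrightarrow> \<not> E v b"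
  then show ?thesis using B by (intro unseparated_no_nbr) auto
next
  fix X c Z assume "P = X @ c # Z" "\<And>b. b \<in> set (X @ Z) \<Longrightarrow> \<not> E v b"
  then show ?thesis using B by (intro unseparated_single_nbr[of _ X c "Z @ B"]) auto
next
  fix Pa p M p' Pz
  assume P: "P = Pa @ p # M @ p' # Pz" "E v p" "E v p'" "\<And>b. b \<in> set (Pa @ Pz) \<Longrightarrow> \<not> E v b"
  have "num_spokes M = 0" using no_hub_nbr_path_gap[OF min v trailing P(1-3)] P(4) B by auto
  then show ?thesis using P B by (intro unseparated_inner[of _ Pa p M p' "Pz @ B"]) auto
qed

context
  fixes P B v P1 u P2 Ba y Bb Bc z Bd
  assumes min: "min_detour P B" and v: "off_rim v" "v \<notin> set P" "E x v"
    and P: "P = P1 @ u # P2" "E x u" "num_spokes P1 = 0"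
    and path_nbrs: "\<exists>p\<in>set P1. E v p" "\<forall>p\<in>set P2. \<not> E v p"
    and first: "B = Ba @ y # Bb" "E v y" "\<forall>b\<in>set Ba. \<not> E v b"
    and last: "B = Bc @ z # Bd" "E v z" "\<forall>b\<in>set Bd. \<not> E v b"
begin

lemma before_spoke_adjacent_last_arc:
  assumes P1: "P1 = Pa @ [p]" "E v p" "\<forall>b\<in>set Pa. \<not> E v b" and ends: "P2 = []" "Bc = []"
  shows "num_spokes (z # Bd) \<le> 1"
proof (rule ccontr)
  assume many: "\<not> ?thesis"
  note detour = min_detourD[OF min]
  have PB: "P @ B = Pa @ p # u # z # Bd" using P(1) P1(1) ends last(1) by simp
  have "induced_path [p, u]" "induced_path [u, z]"
    using induced_cycle_infix[of Pa "[p, u]" "z # Bd"] induced_cycle_infix[of "Pa @ [p]" "[u, z]" Bd]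
      detour_cycle[OF detour] unfolding PB by auto
  then have edges: "E p u" "E u z" by auto
  have off: "p \<noteq> x" "u \<noteq> v" "v \<notin> set (P @ B)"
    using detour_path_off_rim[OF detour] off_rim_notin_detour[OF detour v(1,2)] P(1) P1(1) v(2) by auto
  have vu: "\<not> E v u" using triangles_share_edge[of u v x p] P1(2) edges P(2) v(3) off E_commute by blast
  have z_nonspoke: "\<not> E x z" using triangles_share_edge[of x z v u] v(3)
    last(2) edges P(2) off E_commute by blast
  then have "2 \<le> num_spokes Bd" using many by simp
  then obtain X q Y where q: "Bd = X @ q # Y" "E x q" "X \<noteq> []" by (rule later_spoke)
  have cyc: "induced_cycle (p # [u] @ z # X @ q # (Y @ Pa))"
    using induced_cycle_rotate[of Pa "p # u # z # Bd"] detour_cycle[OF detour] PB q by simp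
  show False
    by (rule no_hub_nbr_leg[OF cyc, of v])
      (use v(1,3) off detour_hub_notin[OF detour] PB P1 q last(2,3) P(2,3) vu z_nonspoke E_commute
        in \<open>auto simp: off_rim_def\<close>)
qed

lemma before_spoke_last_arc: "num_spokes (z # Bd) \<le> 1"
proof -
  obtain Pa p Pm where P1: "P1 = Pa @ p # Pm" "E v p" "\<forall>b\<in>set Pa. \<not> E v b"
    using path_nbrs(1) by (rule split_list_first_propE)
  show ?thesis
  proof (cases "Pm = [] \<and> P2 = [] \<and> Bc = []")
    case True
    then show ?thesis using before_spoke_adjacent_last_arc P1 by blast
  next
    case False
    then have "2 \<le> length ((Pm @ u # P2) @ Bc)" by (auto simp: Suc_le_eq)
    then show ?thesis
      by (intro hub_nbr_last_arc_le_1[OF min v _ P1(2,3) _ last, of "Pm @ u # P2"]) (use P P1 in auto)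
  qed
qed

lemma before_spoke_last_path_nbr:
  obtains Pn p Pz where "P = Pn @ p # Pz" "num_spokes Pn = 0" "E v p" "\<forall>b\<in>set Pz. \<not> E v b"
proof -
  have "\<exists>b\<in>set (P1 @ [u]). E v b" using path_nbrs(1) by auto
  then obtain Pn p Pz where p: "P1 @ [u] = Pn @ p # Pz" "E v p" "\<forall>b\<in>set Pz. \<not> E v b"
    by (rule split_list_last_propE)
  have "P = Pn @ p # (Pz @ P2)" using P(1) p(1) by (metis append.assoc append_Cons append_Nil)
  moreover have "\<exists>W. P1 = Pn @ W" using p(1) by (cases Pz rule: rev_cases) auto
  then have "num_spokes Pn = 0" using P(3) by auto
  ultimately show thesis using that[of Pn p "Pz @ P2"] p path_nbrs(2) by auto
qed

lemma before_spoke_corner_obstruction: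
  assumes separated: "\<not> unseparated (P @ B) v"
  shows "corner_obstruction P B v"
proof -
  note detour = min_detourD[OF min]
  obtain Pn p Pz where p: "P = Pn @ p # Pz" "num_spokes Pn = 0" "E v p" "\<forall>b\<in>set Pz. \<not> E v b"
    by (rule before_spoke_last_path_nbr)
  have outer: "0 < num_spokes Z" if "B = Y @ y' # Z" "E v y'" "\<forall>b\<in>set Y. \<not> E v b" for Y y' Z
    using separated unseparated_outer[of "P @ B" Pn p "Pz @ Y" y' Z v] that p by auto
  have one: "num_spokes (z # Bd) = 1"
    using before_spoke_last_arc detour_outer_arc_spokes(3)[OF detour v(1) first last] outer[OF first]
    by linarith
  then have "0 < num_spokes (z # Bd)" by simp
  then obtain W1 e Bs where e: "z # Bd = W1 @ e # Bs" "E x e" "num_spokes W1 = 0" by (rule first_spoke)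
  have Bs: "num_spokes Bs = 0" using one e by (auto split: if_splits)
  have "0 < num_spokes Bc" using one last(1) detour_arc_spokes_ge_2[OF detour] by auto
  then obtain Bt b W2 where b: "Bc = Bt @ b # W2" "E x b" "num_spokes W2 = 0" by (rule last_spoke)
  have corner: "detour_corner P B P1 u P2 Bt b (W2 @ W1) e Bs"
    unfolding detour_corner_def using P b e Bs last(1) by simp
  have Bt: "\<not> E v c" if c: "c \<in> set Bt" for c
  proof
    assume nbr: "E v c"
    obtain T1 T2 where T: "Bt = T1 @ c # T2" using c by (meson split_list)
    have "num_spokes (T2 @ b # W2) = 0"
      by (rule detour_arc_unseparated[OF detour v(1), of T1 c "T2 @ b # W2" z Bd])
        (use T nbr last b in auto)
    then show False using b by simp
  qed
  have "\<exists>c\<in>set (b # W2 @ W1). E v c"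
  proof (rule ccontr)
    assume none: "\<not> ?thesis"
    then have "W1 = []" using e(1) last(2) by (cases W1) auto
    then have "Bd = Bs" using e(1) by simp
    moreover have "\<forall>c\<in>set Bc. \<not> E v c" using none Bt b(1) by auto
    ultimately show False using outer[OF last(1,2)] Bs by simp
  qed
  then show ?thesis unfolding corner_obstruction_def using v corner path_nbrs Bt
    by (intro conjI exI) auto
qed

end

lemma hub_nbr_around_spoke_arcs:
  assumes min: "min_detour P B" and v: "off_rim v" "v \<notin> set P" "E x v"
    and P: "P = P1 @ u # P2" "E x u" "num_spokes P1 = 0" "num_spokes P2 = 0"
    and path_nbrs: "\<exists>p\<in>set P1. E v p" "\<exists>p\<in>set P2. E v p"
  shows "\<not> (\<exists>b\<in>set B. E v b)"
proof
  assume nbr: "\<exists>b\<in>set B. E v b"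
  note detour = min_detourD[OF min]
  obtain Ba y Bb where first: "B = Ba @ y # Bb" "E v y" "\<forall>b\<in>set Ba. \<not> E v b"
    using nbr by (rule split_list_first_propE)
  obtain Bc z Bd where last: "B = Bc @ z # Bd" "E v z" "\<forall>b\<in>set Bd. \<not> E v b"
    using nbr by (rule split_list_last_propE)
  obtain Pa p Pm where p: "P1 = Pa @ p # Pm" "E v p" "\<forall>b\<in>set Pa. \<not> E v b"
    using path_nbrs(1) by (rule split_list_first_propE)
  obtain Pn p' Pz where p': "P2 = Pn @ p' # Pz" "E v p'" "\<forall>b\<in>set Pz. \<not> E v b"
    using path_nbrs(2) by (rule split_list_last_propE)
  have last_arc: "num_spokes (z # Bd) \<le> 1"
    by (rule hub_nbr_last_arc_le_1[OF min v _ p(2,3) _ last, of "Pm @ u # P2"])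
      (use P p p'(1) in \<open>auto split: if_splits\<close>)
  have first_arc: "num_spokes (Ba @ [y]) \<le> 1"
    by (rule hub_nbr_first_arc_le_1[OF min v _ p'(2,3) _ first, of "P1 @ u # Pn"])
      (use P p(1) p' in \<open>auto split: if_splits\<close>)
  have "num_spokes P = 1" using P by simp
  then show False
    using last_arc first_arc detour_outer_arc_spokes(1)[OF detour v(1) first last]
      detour_arc_spokes_ge_3[OF detour]
    by linarith
qed

context
  fixes P B v P1 u P2
  assumes min: "min_detour P B" and v: "off_rim v" "v \<notin> set P" "E x v"
    and P: "P = P1 @ u # P2" "E x u" "num_spokes P1 = 0" "num_spokes P2 = 0"
    and path_nbrs: "E v u" "\<forall>p\<in>set (P1 @ P2). \<not> E v p"
begin

lemma at_spoke_arc_nbr_nonspoke: "y \<in> set B \<Longrightarrow> E v y \<Longrightarrow> \<not> E x y"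
  using triangles_share_edge[of x v u y] v(3) P(1,2) path_nbrs(1)
    detour_distinct[OF min_detourD[OF min]] by auto

lemma at_spoke_suffix_nonempty_unseparated:
  assumes P2: "P2 \<noteq> []" and arc_nbr: "\<exists>b\<in>set B. E v b"
  shows "unseparated (P @ B) v"
proof (rule ccontr)
  assume separated: "\<not> ?thesis"
  note detour = min_detourD[OF min]
  obtain Ba y Bb where first: "B = Ba @ y # Bb" "E v y" "\<forall>b\<in>set Ba. \<not> E v b"
    using arc_nbr by (rule split_list_first_propE)
  obtain Bc z Bd where last: "B = Bc @ z # Bd" "E v z" "\<forall>b\<in>set Bd. \<not> E v b"
    using arc_nbr by (rule split_list_last_propE)
  have nonspokes: "\<not> E x y" "\<not> E x z"
    using at_spoke_arc_nbr_nonspoke[of y] at_spoke_arc_nbr_nonspoke[of z] first(1,2)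
      arg_cong[OF last(1), of set] last(2)
    by auto
  have "num_spokes Bc \<noteq> 0"
    using separated unseparated_inner[of "P @ B" P1 u "P2 @ Bc" z Bd v] P path_nbrs last by auto
  moreover have Bc: "num_spokes Bc = num_spokes Ba"
    using detour_outer_arc_spokes(4)[OF detour v(1) first last nonspokes(1)] .
  moreover have "num_spokes Bb \<noteq> 0"
    using separated unseparated_outer[of "P @ B" P1 u "P2 @ Ba" y Bb v] P path_nbrs first by auto
  moreover have "num_spokes Bb \<le> num_spokes Bd"
    using detour_outer_arc_spokes(3)[OF detour v(1) first last] nonspokes(2) by simp
  ultimately have arcs: "0 < num_spokes Ba" "0 < num_spokes Bd" "0 < num_spokes Bb" by auto
  have total: "num_spokes (P @ B) = 1 + num_spokes Ba + num_spokes Bd" using P last(1) Bc nonspokes(2)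
    by simp
  have cut: "detour (P1 @ [u, v]) (z # Bd)"
    by (rule detour_cut_end[OF detour P(1) last(1) v(1,2) path_nbrs(1) last(2)])
      (use P P2 path_nbrs last detour_spokes_less[OF detour] arcs total v(3) nonspokes in
        \<open>auto simp: spokes_terminal_def spokes_trailing_def\<close>)
  have cut_spokes: "num_spokes ((P1 @ [u, v]) @ z # Bd) = 2 + num_spokes Bd" using P v(3) nonspokes
    by simp
  then have Bd: "2 \<le> num_spokes Bd" using detour_spokes_ge_4[OF cut] by simp
  have "num_spokes Ba \<noteq> 1"
  proof
    assume Ba: "num_spokes Ba = 1"
    have "detour (v # u # P2) (Ba @ [y])"
      by (rule detour_cut_start[OF detour P(1) first(1) v(1,2) path_nbrs(1) first(2)])
        (use P path_nbrs first detour_spokes_less[OF detour] arcs total v(3) nonspokes Ba Bd in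
          \<open>auto simp: spokes_terminal_def spokes_trailing_def\<close>)
    then show False using detour_spokes_ge_4 Ba P v(3) nonspokes by fastforce
  qed
  moreover have "length (P1 @ [u, v]) \<le> length P" using P(1) P2 by (cases P2) auto
  ultimately show False using min_detour_smaller[OF min cut] cut_spokes total arcs(1) by simp
qed

end

lemma hub_nbr_at_spoke_unseparated:
  assumes min: "min_detour P B" and v: "off_rim v" "v \<notin> set P" "E x v"
    and P: "P = P1 @ u # P2" "E x u" "num_spokes P1 = 0" "num_spokes P2 = 0"
    and path_nbrs: "E v u" "\<forall>p\<in>set (P1 @ P2). \<not> E v p" and arc_nbr: "\<exists>b\<in>set B. E v b"
  shows "unseparated (P @ B) v"
proof (cases "P2 = []")
  case False
  then show ?thesis using at_spoke_suffix_nonempty_unseparated[OF min v P path_nbrs] arc_nbr by blast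
next
  case True
  then have "P1 \<noteq> []" using detour_length_ge_2[OF min_detourD[OF min]] P(1) by auto
  then have "unseparated (rev P @ rev B) v"
    by (intro at_spoke_suffix_nonempty_unseparated[OF min_detour_rev[OF min] v(1) _ v(3), of "rev P2" u "rev P1"])
      (use v(2) P path_nbrs arc_nbr in auto)
  then show ?thesis by (rule unseparated_rev_arcs)
qed

lemma hub_nbr_before_spoke:
  assumes min: "min_detour P B" and v: "off_rim v" "v \<notin> set P" "E x v"
    and P: "P = P1 @ u # P2" "E x u" "num_spokes P1 = 0"
    and path_nbrs: "\<exists>p\<in>set P1. E v p" "\<forall>p\<in>set P2. \<not> E v p" and arc_nbr: "\<exists>b\<in>set B. E v b"
  shows "unseparated (P @ B) v \<or> corner_obstruction P B v"
proof -
  obtain Ba y Bb where first: "B = Ba @ y # Bb" "E v y" "\<forall>b\<in>set Ba. \<not> E v b"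
    using arc_nbr by (rule split_list_first_propE)
  obtain Bc z Bd where last: "B = Bc @ z # Bd" "E v z" "\<forall>b\<in>set Bd. \<not> E v b"
    using arc_nbr by (rule split_list_last_propE)
  show ?thesis using before_spoke_corner_obstruction[OF min v P path_nbrs first last] by blast
qed

lemma hub_nbr_one_path_spoke:
  assumes min: "min_detour P B" and v: "off_rim v" "v \<notin> set P" "E x v" and one: "num_spokes P = 1"
    and path_nbr: "\<exists>p\<in>set P. E v p" and arc_nbr: "\<exists>b\<in>set B. E v b"
  shows "unseparated (P @ B) v \<or> corner_obstruction P B v \<or> corner_obstruction (rev P) (rev B) v"
proof -
  have "0 < num_spokes P" using one by simp
  then obtain P1 u P2 where P: "P = P1 @ u # P2" "E x u" "num_spokes P1 = 0" by (rule first_spoke)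
  have P2: "num_spokes P2 = 0" using one P by simp
  consider (before) "\<exists>p\<in>set P1. E v p" "\<forall>p\<in>set P2. \<not> E v p"
    | (after) "\<exists>p\<in>set P2. E v p" "\<forall>p\<in>set P1. \<not> E v p"
    | (around) "\<exists>p\<in>set P1. E v p" "\<exists>p\<in>set P2. E v p" | (at) "E v u" "\<forall>p\<in>set (P1 @ P2). \<not> E v p"
    using path_nbr P(1) by auto
  then show ?thesis
  proof cases
    case before
    then show ?thesis using hub_nbr_before_spoke[OF min v P _ _ arc_nbr] by blast
  next
    case after
    have "unseparated (rev P @ rev B) v \<or> corner_obstruction (rev P) (rev B) v"
      by (rule hub_nbr_before_spoke[OF min_detour_rev[OF min] v(1) _ v(3), of "rev P2" u "rev P1"])
        (use v(2) P P2 after arc_nbr in auto)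
    then show ?thesis using unseparated_rev_arcs by blast
  next
    case around
    then show ?thesis using hub_nbr_around_spoke_arcs[OF min v P P2] arc_nbr by blast
  next
    case at
    then show ?thesis using hub_nbr_at_spoke_unseparated[OF min v P P2 _ _ arc_nbr] by blast
  qed
qed

lemma hub_nbr_two_path_spokes:
  assumes min: "min_detour P B" and v: "off_rim v" "v \<notin> set P" "E x v"
    and trailing: "spokes_trailing P" and two: "num_spokes P = 2"
    and path_nbr: "\<exists>p\<in>set P. E v p" and arc_nbr: "\<exists>b\<in>set B. E v b"
  shows "unseparated (P @ B) v \<or> corner_obstruction P B v"
proof -
  note detour = min_detourD[OF min]
  obtain Q u u' where Q: "P = Q @ [u, u']" "num_spokes Q = 0" "E x u" "E x u'"
    using spokes_trailing_two[OF trailing] two by auto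
  have "induced_path [u, u']"
    using induced_cycle_infix[of Q "[u, u']" B] detour_cycle[OF detour]
      detour_arc_nonempty[OF detour] Q(1) by simp
  then have "E u u'" by simp
  then have nonadj: "\<not> E v u" "\<not> E v u'"
    using triangles_share_edge[of x u v u'] triangles_share_edge[of x u' v u] Q v(2,3) E_commute by auto
  then have "\<exists>p\<in>set Q. E v p" using path_nbr Q(1) by auto
  then show ?thesis using hub_nbr_before_spoke[OF min v, of Q u "[u']"] Q nonadj arc_nbr by auto
qed

lemma hub_nbr_unseparated_or_corner_obstruction:
  assumes min: "min_detour P B" and v: "off_rim v" "v \<notin> set P" "E x v" and trailing: "spokes_trailing P"
  shows "unseparated (P @ B) v \<or> corner_obstruction P B v
    \<or> num_spokes P = 1 \<and> corner_obstruction (rev P) (rev B) v"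
proof -
  note detour = min_detourD[OF min]
  have no_path_nbr: "unseparated (P @ B) v" if "\<not> (\<exists>b\<in>set P. E v b)"
    using detour_no_path_nbr_proper[OF detour v(1)] that unfolding proper_for_def by blast
  have no_arc_nbr: "unseparated (P @ B) v" if "\<not> (\<exists>b\<in>set B. E v b)"
    using hub_nbr_no_arc_nbr_unseparated[OF min v trailing] that by blast
  consider "num_spokes P = 0" | "num_spokes P = 1" | "num_spokes P = 2"
    using detour_path_spokes[OF detour] by linarith
  then show ?thesis
    using hub_nbr_spokeless_path_unseparated[OF min v] hub_nbr_one_path_spoke[OF min v]
      hub_nbr_two_path_spokes[OF min v trailing] no_path_nbr no_arc_nbr
    by cases blast+
qed

end

section \<open>Cutting off a corner\<close>

context hub
begin

text \<open>The spoke \<open>e\<close> of the cycle and the two sectors at it, which end at the spokes \<open>a\<close> and \<open>b\<close>.\<close>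

definition corner :: "'a \<Rightarrow> 'a list \<Rightarrow> 'a \<Rightarrow> 'a list \<Rightarrow> 'a \<Rightarrow> 'a list \<Rightarrow> bool" where
  "corner e Lx a M b Rx \<longleftrightarrow> induced_cycle (e # Lx @ a # M @ b # Rx) \<and> x \<notin> set (e # Lx @ a # M @ b # Rx)
     \<and> E x e \<and> E x a \<and> E x b \<and> num_spokes Lx = 0 \<and> num_spokes Rx = 0 \<and> 0 < num_spokes M"

definition straddles_corner :: "'a \<Rightarrow> 'a list \<Rightarrow> 'a \<Rightarrow> 'a list \<Rightarrow> 'a \<Rightarrow> 'a list \<Rightarrow> 'a \<Rightarrow> bool" where
  "straddles_corner e Lx a M b Rx v \<longleftrightarrow> v \<in> V \<and> v \<notin> set (e # Lx @ a # M @ b # Rx) \<and> v \<noteq> x \<and> E x v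
     \<and> (\<exists>y\<in>set (Lx @ [a]). E v y) \<and> (\<exists>y\<in>set (b # Rx). E v y) \<and> (\<forall>y\<in>set M. \<not> E v y)"

definition corner_cut :: "'a \<Rightarrow> 'a list \<Rightarrow> 'a \<Rightarrow> 'a list \<Rightarrow> 'a \<Rightarrow> 'a list \<Rightarrow> 'a \<Rightarrow> 'a list \<Rightarrow> 'a \<Rightarrow> 'a list \<Rightarrow> 'a list
    \<Rightarrow> 'a \<Rightarrow> 'a list \<Rightarrow> bool" where
  "corner_cut e Lx a M b Rx v W l L R r Z \<longleftrightarrow> straddles_corner e Lx a M b Rx v
     \<and> Lx @ [a] = W @ l # L \<and> E v l \<and> (\<forall>y\<in>set L. \<not> E v y)
     \<and> b # Rx = R @ r # Z \<and> E v r \<and> (\<forall>y\<in>set R. \<not> E v y)"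

lemma corner_cut_exists:
  assumes "straddles_corner e Lx a M b Rx v"
  obtains W l L R r Z where "corner_cut e Lx a M b Rx v W l L R r Z"
proof -
  have nbrs: "\<exists>y\<in>set (Lx @ [a]). E v y" "\<exists>y\<in>set (b # Rx). E v y"
    using assms unfolding straddles_corner_def by blast+
  obtain W l L where "Lx @ [a] = W @ l # L" "E v l" "\<forall>y\<in>set L. \<not> E v y"
    using nbrs(1) by (rule split_list_last_propE)
  moreover obtain R r Z where "b # Rx = R @ r # Z" "E v r" "\<forall>y\<in>set R. \<not> E v y"
    using nbrs(2) by (rule split_list_first_propE)
  ultimately show thesis using that assms unfolding corner_cut_def by blast
qed

lemma no_hub_nbr_twin:
  assumes cyc: "induced_cycle (z # l # S @ [r])" and x: "x \<notin> set (z # l # S @ [r])" and z: "E x z"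
    and spokes: "4 \<le> num_spokes (z # l # S @ [r])"
    and w: "w \<in> V" "w \<notin> set (z # l # S @ [r])" "E x w" "E w l" "E w r" "\<And>y. y \<in> set S \<Longrightarrow> \<not> E w y"
  shows False
proof -
  have z_nbrs: "E z l" "E z r" using cyc by auto
  have nonspokes: "\<not> E x l" "\<not> E x r"
    using triangles_share_edge[of x l z w] triangles_share_edge[of x r z w] z w z_nbrs E_commute by auto
  have wz: "\<not> E w z" using triangles_share_edge[of w z x l] z w x z_nbrs E_commute by auto
  have "2 \<le> num_spokes S" using spokes z nonspokes by simp
  then obtain X q Y where q: "S = X @ q # Y" "E x q" "X \<noteq> []" by (rule later_spoke)
  have cyc': "induced_cycle (r # [z] @ l # X @ q # Y)"
    using induced_cycle_rotate[of "z # l # S" "[r]"] cyc q(1) by (simp del: induced_cycle.simps)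
  show False
    by (rule no_hub_nbr_leg[OF cyc', of w]) (use x z w q nonspokes wz E_commute[of w x] in auto)
qed

context
  fixes e Lx a M b Rx v W l L R r Z
  assumes corner: "corner e Lx a M b Rx" and cut: "corner_cut e Lx a M b Rx v W l L R r Z"
begin

lemma cutting_vertex:
  "v \<in> V" "v \<notin> set (e # Lx @ a # M @ b # Rx)" "v \<noteq> x" "E x v" "y \<in> set M \<Longrightarrow> \<not> E v y"
  using cut unfolding corner_cut_def straddles_corner_def by blast+

lemma cut_sides: "Lx @ [a] = W @ l # L" "b # Rx = R @ r # Z"
  and cut_nbrs: "E v l" "E v r" "y \<in> set (L @ M @ R) \<Longrightarrow> \<not> E v y"
  using cut cutting_vertex(5) unfolding corner_cut_def by auto

lemma corner_spokes: "E x e" "E x a" "E x b" "num_spokes Lx = 0" "num_spokes Rx = 0" "0 < num_spokes M"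
  using corner unfolding corner_def by auto

lemma cut_ends: "last (l # L) = a" "hd (R @ [r]) = b"
  using arg_cong[OF cut_sides(1), of last] arg_cong[OF cut_sides(2), of hd] by (auto simp: hd_append)

lemma cut_split: "e # Lx @ a # M @ b # Rx = (e # W) @ (l # L @ M @ R @ [r]) @ Z"
proof -
  have "e # Lx @ a # M @ b # Rx = e # (Lx @ [a]) @ M @ (b # Rx)" by simp
  then show ?thesis unfolding cut_sides by simp
qed

lemma cut_subset: "set (l # L @ M @ R @ [r]) \<subseteq> set (e # Lx @ a # M @ b # Rx)"
  unfolding cut_split by auto

lemma cut_spokes: "num_spokes W = 0" "num_spokes (l # L) = 1" "num_spokes (R @ [r]) = 1"
  "num_spokes Z = 0"
proof -
  have "a \<in> set (l # L)" "b \<in> set (R @ [r])"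
    using last_in_set[of "l # L"] hd_in_set[of "R @ [r]"] unfolding cut_ends by simp_all
  then have "0 < num_spokes (l # L)" "0 < num_spokes (R @ [r])" using num_spokes_posI corner_spokes
    by blast+
  moreover have "num_spokes W + num_spokes (l # L) = 1" "num_spokes (R @ [r]) + num_spokes Z = 1"
    using arg_cong[OF cut_sides(1), of num_spokes]
      arg_cong[OF cut_sides(2), of num_spokes] corner_spokes by simp_all
  ultimately show "num_spokes W = 0" "num_spokes (l # L) = 1" "num_spokes (R @ [r]) = 1"
    "num_spokes Z = 0"
    by linarith+
qed

lemma cut_num_spokes: "num_spokes (v # l # L @ M @ R @ [r]) = num_spokes (e # Lx @ a # M @ b # Rx)"
  using cut_spokes corner_spokes cutting_vertex(4) by simp

lemma corner_cycle: "induced_cycle (e # Lx @ a # M @ b # Rx)"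
  and corner_hub_notin: "x \<notin> set (e # Lx @ a # M @ b # Rx)"
  using corner unfolding corner_def by blast+

lemma cut_outer_cycle: "induced_cycle ((l # L @ M @ R @ [r]) @ (Z @ e # W))"
  using induced_cycle_rotate[of "e # W" "(l # L @ M @ R @ [r]) @ Z"] corner_cycle unfolding cut_split
  by (simp del: induced_cycle.simps)

lemma cut_cycle: "induced_cycle (v # l # L @ M @ R @ [r])"
proof -
  have "induced_cycle (l # (L @ M @ R) @ r # (Z @ e # W))"
    using cut_outer_cycle by (simp del: induced_cycle.simps)
  then have "induced_cycle (v # l # (L @ M @ R) @ [r])"
    by (rule induced_cycle_bypass_Cons) (use cutting_vertex cut_nbrs cut_subset in auto)
  then show ?thesis by (simp del: induced_cycle.simps)
qed

lemma cut_hub_notin: "x \<notin> set (v # l # L @ M @ R @ [r])"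
  using corner_hub_notin cut_subset cutting_vertex(3) by auto

lemma cut_removed_nonempty: "Z @ W \<noteq> []"
proof
  assume "Z @ W = []"
  then have split: "e # Lx @ a # M @ b # Rx = e # l # (L @ M @ R) @ [r]" using cut_split by simp
  have "4 \<le> num_spokes (e # Lx @ a # M @ b # Rx)" using corner_spokes by simp
  then show False
    using no_hub_nbr_twin[of e l "L @ M @ R" r v] corner_cycle corner_hub_notin corner_spokes(1)
      cutting_vertex(1,2,4) cut_nbrs unfolding split by blast
qed

lemma cut_left_unseparated:
  assumes none: "\<And>y. y \<in> set (M @ R @ [r]) \<Longrightarrow> \<not> E w y"
  shows "unseparated (v # l # L @ M @ R @ [r]) w"
proof (cases "\<exists>y\<in>set (l # L). E w y")
  case False
  then show ?thesis using none by (intro unseparated_single_nbr[of _ "[]" v]) auto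
next
  case True
  then obtain Ya c Yb where c: "l # L = Ya @ c # Yb" "E w c" "\<forall>y\<in>set Yb. \<not> E w y"
    by (rule split_list_last_propE)
  have "a \<in> set (c # Yb)" using last_in_set[of "c # Yb"] cut_ends(1) unfolding c(1) by simp
  then have "0 < num_spokes (c # Yb)" using num_spokes_posI corner_spokes(2) by blast
  then have "num_spokes Ya = 0" using cut_spokes(2) unfolding c(1) by auto
  moreover have "v # l # L @ M @ R @ [r] = [] @ v # Ya @ c # (Yb @ M @ R @ [r])"
    using arg_cong[OF c(1), of "\<lambda>Y. v # Y @ M @ R @ [r]"] by simp
  ultimately show ?thesis
    using none c(3) by (intro unseparated_inner[of _ "[]" v Ya c "Yb @ M @ R @ [r]"]) auto
qed

lemma cut_right_unseparated:
  assumes none: "\<And>y. y \<in> set (l # L @ M) \<Longrightarrow> \<not> E w y"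
  shows "unseparated (v # l # L @ M @ R @ [r]) w"
proof (cases "\<exists>y\<in>set (R @ [r]). E w y")
  case False
  then show ?thesis using none by (intro unseparated_single_nbr[of _ "[]" v]) auto
next
  case True
  then obtain Ya c Yb where c: "R @ [r] = Ya @ c # Yb" "E w c" "\<forall>y\<in>set Ya. \<not> E w y"
    by (rule split_list_first_propE)
  have "b \<in> set (Ya @ [c])" using cut_ends(2) unfolding c(1) by (cases Ya) auto
  then have "0 < num_spokes (Ya @ [c])" using num_spokes_posI corner_spokes(3) by blast
  then have "num_spokes Yb = 0" using cut_spokes(3) unfolding c(1) by auto
  moreover have "v # l # L @ M @ R @ [r] = [] @ v # (l # L @ M @ Ya) @ c # Yb"
    using arg_cong[OF c(1), of "\<lambda>Y. v # l # L @ M @ Y"] by simp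
  ultimately show ?thesis
    using none c(3) by (intro unseparated_outer[of _ "[]" v "l # L @ M @ Ya" c Yb]) auto
qed

lemma cut_one_sided_unseparated:
  assumes "\<And>y. y \<in> set M \<Longrightarrow> \<not> E w y" "\<not> ((\<exists>c\<in>set (l # L). E w c) \<and> (\<exists>c\<in>set (R @ [r]). E w c))"
  shows "unseparated (v # l # L @ M @ R @ [r]) w"
proof (cases "\<exists>c\<in>set (l # L). E w c")
  case True
  then show ?thesis using assms by (intro cut_left_unseparated) auto
next
  case False
  then show ?thesis using assms by (intro cut_right_unseparated) auto
qed

lemma cut_unseparated_one_sided:
  assumes "unseparated (e # Lx @ a # M @ b # Rx) w"
  shows "\<not> ((\<exists>c\<in>set (l # L). E w c) \<and> (\<exists>c\<in>set (R @ [r]). E w c))"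
proof
  assume "(\<exists>c\<in>set (l # L). E w c) \<and> (\<exists>c\<in>set (R @ [r]). E w c)"
  then obtain c c' where c: "c \<in> set (l # L)" "c' \<in> set (R @ [r])" "E w c" "E w c'" by blast
  obtain Ya Yb where left: "l # L = Ya @ c # Yb" using c(1) by (meson split_list)
  obtain Yc Yd where right: "R @ [r] = Yc @ c' # Yd" using c(2) by (meson split_list)
  have "e # Lx @ a # M @ b # Rx = (e # W) @ (l # L) @ M @ (R @ [r]) @ Z" using cut_split by simp
  then have "unseparated ((e # W @ Ya) @ c # (Yb @ M @ Yc) @ c' # (Yd @ Z)) w"
    using assms unfolding left right by simp
  from unseparatedD[OF this c(3,4)] show False using corner_spokes by simp
qed

lemma cut_removed_proper:
  assumes w: "w \<in> set (Z @ e # W)"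
  shows "proper_for (v # l # L @ M @ R @ [r]) w"
proof -
  have cross: "E w y \<longleftrightarrow> w = last (Z @ e # W) \<and> y = l \<or> w = hd (Z @ e # W) \<and> y = r"
    if "y \<in> set (l # L @ M @ R @ [r])" for y
    using induced_cycle_cross[OF cut_outer_cycle that w] E_commute by auto
  have dist: "distinct ((l # L @ M @ R @ [r]) @ (Z @ e # W))"
    using induced_cycle_distinct[OF cut_outer_cycle] .
  then have ends: "last (Z @ e # W) \<noteq> hd (Z @ e # W)"
    using cut_removed_nonempty by (cases Z; cases W rule: rev_cases) auto
  show ?thesis
  proof (cases "w = last (Z @ e # W)")
    case True
    then have none: "\<not> E w y" if "y \<in> set (L @ M @ R @ [r])" for y using cross[of y] that ends dist
      by auto
    then have "nbrs_in w (set (v # l # L @ M @ R @ [r])) \<subseteq> {v, l}" unfolding nbrs_in_def by auto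
    then have "card (nbrs_in w (set (v # l # L @ M @ R @ [r]))) \<le> 2" by (rule card_subset_pair_le)
    moreover have "unseparated (v # l # L @ M @ R @ [r]) w" by (rule cut_left_unseparated)
      (use none in auto)
    ultimately show ?thesis unfolding proper_for_def by blast
  next
    case False
    then have none: "\<not> E w y" if "y \<in> set (l # L @ M @ R)" for y using cross[of y] that dist by auto
    then have "nbrs_in w (set (v # l # L @ M @ R @ [r])) \<subseteq> {v, r}" unfolding nbrs_in_def by auto
    then have "card (nbrs_in w (set (v # l # L @ M @ R @ [r]))) \<le> 2" by (rule card_subset_pair_le)
    moreover have "unseparated (v # l # L @ M @ R @ [r]) w" by (rule cut_right_unseparated)
      (use none in auto)
    ultimately show ?thesis unfolding proper_for_def by blast
  qed
qed

lemma cut_card_nbrs: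
  assumes w: "w \<in> V" "w \<notin> set (v # l # L @ M @ R @ [r])"
    and card: "card (nbrs_in w (set (e # Lx @ a # M @ b # Rx))) \<le> 2"
  shows "card (nbrs_in w (set (v # l # L @ M @ R @ [r]))) \<le> 2"
proof -
  let ?T = "l # L @ M @ R @ [r]"
  have T: "card (nbrs_in w (set ?T)) \<le> 2" using card_nbrs_in_mono[OF cut_subset] card
    by (meson List.finite_set order_trans)
  have "nbrs_in w (set (v # ?T)) \<subseteq> insert v (nbrs_in w (set ?T))" unfolding nbrs_in_def by auto
  then have "card (nbrs_in w (set (v # ?T))) \<le> card (insert v (nbrs_in w (set ?T)))"
    by (intro card_mono) (auto simp: nbrs_in_def)
  also have "\<dots> \<le> 3" using T card_insert_le_m1[of 3 "nbrs_in w (set ?T)" v] by simp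
  finally show ?thesis using card_nbrs_in_cycle_neq_3[OF cut_cycle w] by linarith
qed

lemma cut_proper:
  assumes w: "w \<in> V" "w \<notin> set (v # l # L @ M @ R @ [r])"
    and proper: "proper_for (e # Lx @ a # M @ b # Rx) w"
    and none: "\<And>y. E w v \<Longrightarrow> y \<in> set M \<Longrightarrow> \<not> E w y"
  shows "proper_for (v # l # L @ M @ R @ [r]) w"
proof -
  have unseparated: "unseparated (e # Lx @ a # M @ b # Rx) w" using proper unfolding proper_for_def
    by blast
  have "unseparated (v # l # L @ M @ R @ [r]) w"
  proof (cases "E w v")
    case True
    then show ?thesis using cut_one_sided_unseparated cut_unseparated_one_sided[OF unseparated] none
      by blast
  next
    case False
    then show ?thesis
      using unseparated_segment[of "e # W" "l # L @ M @ R @ [r]" Z w v] unseparated corner_spokes(1)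
      unfolding cut_split by simp
  qed
  then show ?thesis using cut_card_nbrs[OF w] proper unfolding proper_for_def by blast
qed

end

lemma shortest_cut_one_sided:
  assumes corner: "corner e Lx a M b Rx"
    and cut: "corner_cut e Lx a M b Rx v W l L R r Z"
    and cut': "corner_cut e Lx a M b Rx w W' l' L' R' r' Z'"
    and shortest: "length L + length R \<le> length L' + length R'"
    and w: "w \<notin> set (v # l # L @ M @ R @ [r])"
  shows "\<not> ((\<exists>c\<in>set (l # L). E w c) \<and> (\<exists>c\<in>set (R @ [r]). E w c))"
proof
  assume "(\<exists>c\<in>set (l # L). E w c) \<and> (\<exists>c\<in>set (R @ [r]). E w c)"
  then obtain c c' where c: "c \<in> set (l # L)" "E w c" "c' \<in> set (R @ [r])" "E w c'" by blast
  note nbrs' = cut_nbrs[OF corner cut'] and sides = cut_sides[OF corner cut] and sides'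
    = cut_sides[OF corner cut']
  have "length L' \<le> length L"
  proof -
    obtain Ya Yb where Y: "l # L = Ya @ c # Yb" using c(1) by (meson split_list)
    have "W' @ l' # L' = (W @ Ya) @ c # Yb" using sides(1) sides'(1) Y by simp
    then obtain U where "Yb = U @ L'"
      by (rule after_last_occurrence[of _ _ _ _ _ _ "E w"]) (use c(2) nbrs'(3) in auto)
    then show ?thesis using arg_cong[OF Y, of length] by simp
  qed
  moreover have "length R' \<le> length R"
  proof -
    obtain Ya Yb where Y: "R @ [r] = Ya @ c' # Yb" using c(3) by (meson split_list)
    have "R' @ r' # Z' = Ya @ c' # (Yb @ Z)" using arg_cong[OF Y, of "\<lambda>Y. Y @ Z"] sides(2) sides'(2)
      by simp
    then obtain U where "Ya = R' @ U"
      by (rule before_first_occurrence[of _ _ _ _ _ _ "E w"]) (use c(4) nbrs'(3) in auto)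
    then show ?thesis using arg_cong[OF Y, of length] by simp
  qed
  ultimately have "length L' = length L" "length R' = length R" using shortest by simp_all
  then have same: "l' = l" "L' = L" "R' = R" "r' = r"
    using append_eq_append_conv[of "W' @ [l']" "W @ [l]" L' L]
      append_eq_append_conv[of R' R "r' # Z'" "r # Z"]
      sides sides' by simp_all
  show False
    by (rule no_hub_nbr_twin[of v l "L @ M @ R" r w])
      (use cut_cycle[OF corner cut] cut_hub_notin[OF corner cut] cutting_vertex[OF corner cut]
        cut_spokes[OF corner cut]
        corner_spokes[OF corner cut]
          cutting_vertex[OF corner cut'] nbrs' w same in \<open>auto simp del: induced_cycle.simps\<close>)
qed

lemma shortest_corner_cut:
  assumes straddling: "\<And>v. obstruction v \<Longrightarrow> straddles_corner e Lx a M b Rx v"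
    and exists: "obstruction v0"
  obtains v W l L R r Z where "obstruction v" "corner_cut e Lx a M b Rx v W l L R r Z"
    "\<And>w W' l' L' R' r' Z'. \<lbrakk>obstruction w; corner_cut e Lx a M b Rx w W' l' L' R' r' Z'\<rbrakk>
      \<Longrightarrow> length L + length R \<le> length L' + length R'"
proof -
  let ?cut = "\<lambda>(v, W, l, L, R, r, Z). obstruction v \<and> corner_cut e Lx a M b Rx v W l L R r Z"
  let ?len = "\<lambda>(v, W, l, L, R, r, Z). length L + length R"
  obtain W0 l0 L0 R0 r0 Z0 where "corner_cut e Lx a M b Rx v0 W0 l0 L0 R0 r0 Z0"
    using corner_cut_exists[OF straddling[OF exists]] .
  then have "\<exists>c. ?cut c \<and> (\<forall>c'. ?cut c' \<longrightarrow> ?len c \<le> ?len c')"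
    using exists by (intro ex_has_least_nat[of ?cut "(v0, W0, l0, L0, R0, r0, Z0)"]) simp
  then obtain v W l L R r Z where cut: "obstruction v" "corner_cut e Lx a M b Rx v W l L R r Z"
    and shortest: "\<And>c'. ?cut c' \<Longrightarrow> length L + length R \<le> ?len c'" by fast
  show thesis by (rule that[OF cut]) (use shortest in force)
qed

text \<open>Of the vertices straddling the corner, the one cutting off as much as possible leaves none of the
  others improper.\<close>

lemma corner_replacement:
  assumes corner: "corner e Lx a M b Rx"
    and straddling: "\<And>v. obstruction v \<Longrightarrow> straddles_corner e Lx a M b Rx v" and exists: "obstruction v0"
    and vertices: "\<And>w. \<lbrakk>w \<in> V; w \<notin> set (e # Lx @ a # M @ b # Rx); w \<noteq> x\<rbrakk>
      \<Longrightarrow> proper_for (e # Lx @ a # M @ b # Rx) w \<or> obstruction w \<or> deferred w"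
    and deferred: "\<And>w. deferred w \<Longrightarrow> \<exists>y\<in>set M. E w y"
    and free: "\<And>v w y. \<lbrakk>obstruction v; E w v; w \<in> V; w \<notin> set (e # Lx @ a # M @ b # Rx); w \<noteq> x; y \<in> set M\<rbrakk>
      \<Longrightarrow> \<not> E w y"
  obtains v W l L R r Z where "obstruction v" "corner_cut e Lx a M b Rx v W l L R r Z"
    "\<And>w. \<lbrakk>w \<in> V; w \<notin> set (v # l # L @ M @ R @ [r]); w \<noteq> x\<rbrakk>
      \<Longrightarrow> proper_for (v # l # L @ M @ R @ [r]) w \<or> deferred w \<and> \<not> E w v"
proof -
  obtain v W l L R r Z where v: "obstruction v" and cut: "corner_cut e Lx a M b Rx v W l L R r Z"
    and shortest: "\<And>w W' l' L' R' r' Z'. \<lbrakk>obstruction w; corner_cut e Lx a M b Rx w W' l' L' R' r' Z'\<rbrakk>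
      \<Longrightarrow> length L + length R \<le> length L' + length R'"
    by (rule shortest_corner_cut[of obstruction]) (erule straddling, rule exists, rule that)
  show thesis
  proof (rule that[OF v cut])
    fix w assume w: "w \<in> V" "w \<notin> set (v # l # L @ M @ R @ [r])" "w \<noteq> x"
    show "proper_for (v # l # L @ M @ R @ [r]) w \<or> deferred w \<and> \<not> E w v"
    proof (cases "w \<in> set (e # Lx @ a # M @ b # Rx)")
      case True
      then have "w \<in> set (Z @ e # W)" using w(2) unfolding cut_split[OF corner cut] by auto
      then show ?thesis using cut_removed_proper[OF corner cut] by blast
    next
      case False
      note none = free[OF v _ w(1) False w(3)]
      consider (proper) "proper_for (e # Lx @ a # M @ b # Rx) w" | (postponed) "deferred w"
        | (obstructing) "obstruction w"
        using vertices[OF w(1) False w(3)] by blast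
      then show ?thesis
      proof cases
        case proper
        then show ?thesis using cut_proper[OF corner cut w(1,2)] none by blast
      next
        case postponed
        then show ?thesis using deferred none by blast
      next
        case obstructing
        obtain W' l' L' R' r' Z' where cut': "corner_cut e Lx a M b Rx w W' l' L' R' r' Z'"
          using corner_cut_exists[OF straddling[OF obstructing]] .
        have "unseparated (v # l # L @ M @ R @ [r]) w"
          using shortest_cut_one_sided[OF corner cut cut' shortest[OF obstructing cut'] w(2)]
            cut_one_sided_unseparated[OF corner cut] cutting_vertex(5)[OF corner cut'] by blast
        then show ?thesis using cutting_vertex(4)[OF corner cut'] E_commute unfolding proper_for_def
          by blast
      qed
    qed
  qed
qed

end

section \<open>Corners of minimal detours\<close>

context hub
begin

lemma cutting_vertex_nbr_two_nbrs:
  assumes corner: "corner e Lx a M b Rx" and cut: "corner_cut e Lx a M b Rx v W l L R r Z"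
    and w: "w \<in> V" "w \<notin> set (v # l # L @ M @ R @ [r])"
      "card (nbrs_in w (set (e # Lx @ a # M @ b # Rx))) \<le> 2"
    and y: "E w v" "y \<in> set M" "E w y" and z: "z \<in> set (l # L @ M @ R @ [r])" "E w z"
  shows "z = y"
proof (rule ccontr)
  assume "z \<noteq> y"
  moreover have "v \<noteq> y" "v \<noteq> z" using induced_cycle_distinct[OF cut_cycle[OF corner cut]] y(2) z(1)
    by auto
  ultimately have "card {v, y, z} = 3" by simp
  moreover have "card {v, y, z} \<le> card (nbrs_in w (set (v # l # L @ M @ R @ [r])))"
    using y z unfolding nbrs_in_def by (intro card_mono) auto
  ultimately show False using cut_card_nbrs[OF corner cut w] by simp
qed

text \<open>A common neighbour of the cutting vertex and the hub near the corner would give a cycle with three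
  spokes.\<close>

lemma cutting_vertex_hub_nbr_spokeless:
  assumes corner: "corner e Lx a (Mq @ Mr) b Rx"
    and cut: "corner_cut e Lx a (Mq @ Mr) b Rx v W l L R r Z"
    and w: "w \<in> V" "w \<notin> set (e # Lx @ a # (Mq @ Mr) @ b # Rx)" "w \<noteq> x" "E x w" "E w v"
    and Mq: "num_spokes Mq = 0"
    and sides: "unseparated (e # Lx @ a # (Mq @ Mr) @ b # Rx) w \<or> (\<forall>c\<in>set Lx. \<not> E w c)"
  shows "\<forall>y\<in>set Mq. \<not> E w y"
proof (rule ccontr)
  assume "\<not> ?thesis"
  then have "\<exists>y\<in>set Mq. E w y" by blast
  then obtain Ma y Mc where y: "Mq = Ma @ y # Mc" "E w y" "\<forall>z\<in>set Ma. \<not> E w z"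
    by (rule split_list_first_propE)
  note spokes = corner_spokes[OF corner cut] and v = cutting_vertex[OF corner cut]
  have "\<not> E w c" if c: "c \<in> set Lx" for c
  proof
    assume nbr: "E w c"
    then have unseparated: "unseparated (e # Lx @ a # (Mq @ Mr) @ b # Rx) w" using sides c by blast
    obtain Ca Cb where "Lx = Ca @ c # Cb" using c by (meson split_list)
    then have "unseparated ((e # Ca) @ c # (Cb @ a # Ma) @ y # (Mc @ Mr @ b # Rx)) w"
      using unseparated y(1) by simp
    from unseparatedD[OF this nbr y(2)] show False using spokes by simp
  qed
  moreover have "\<not> E w a" using triangles_share_edge[of x w v a] w(4,5) v(2,4) spokes(2) by auto
  moreover have "set (l # L) \<subseteq> insert a (set Lx)" using arg_cong[OF cut_sides(1)[OF corner cut], of set]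
    by auto
  ultimately have left: "\<not> E w c" if "c \<in> set (l # L)" for c using that by blast
  have notin: "w \<notin> set (v # l # L @ (Mq @ Mr) @ R @ [r])"
    using cut_subset[OF corner cut] w(2,5) E_irrefl by auto
  have "induced_cycle (v # (l # L @ Ma) @ y # (Mc @ Mr @ R @ [r]))"
    using cut_cycle[OF corner cut] y(1) by (simp del: induced_cycle.simps)
  then have cyc: "induced_cycle (w # v # (l # L @ Ma) @ [y])"
    by (rule induced_cycle_bypass_Cons) (use w notin y left in auto)
  have "num_spokes (w # v # (l # L @ Ma) @ [y]) = 3"
    using cut_spokes(2)[OF corner cut] Mq y(1) v(4) w(4) by (simp split: if_splits)
  moreover have "x \<notin> set (w # v # (l # L @ Ma) @ [y])" using cut_hub_notin[OF corner cut] w(3) y(1)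
    by auto
  ultimately show False using num_spokes_cycle_neq_3[OF cyc] by blast
qed

end

context proper_rim
begin

lemma no_shorter_pair_detour:
  assumes min: "min_detour P B" and arc: "B = X @ H @ Y" "H \<noteq> []"
    and cyc: "induced_cycle ([v, w] @ H)" and vw: "off_rim v" "off_rim w"
    and spokes: "3 \<le> num_spokes ([v, w] @ H)" "num_spokes ([v, w] @ H) \<le> num_spokes (P @ B)"
    and shorter: "length H < length B"
  shows False
proof -
  note detour = min_detourD[OF min]
  obtain A where "rim (B @ A)" using detour_rim_arc[OF detour] .
  then have "rim (H @ (Y @ A @ X))" using rim_rotate[of X "H @ Y @ A"] arc(1) by simp
  then have pair: "detour [v, w] H"
    using cyc arc(2) vw spokes detour_spokes_less[OF detour] spokes_terminal_pair
    by (intro detourI) (auto simp: off_rim_def)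
  then show False
    using min_detour_smaller[OF min pair] spokes(2) shorter detour_length_ge_2[OF detour] by simp
qed

context
  fixes P B e Lx a Mp Mb b Rx X Y v W l L R r Z w
  assumes min: "min_detour P B" and path: "0 < num_spokes P"
    and corner: "corner e Lx a (Mp @ Mb) b Rx" and cut: "corner_cut e Lx a (Mp @ Mb) b Rx v W l L R r Z"
    and arc: "B = X @ (Mb @ b # Rx) @ Y" "0 < num_spokes (X @ Y)" and v: "off_rim v"
    and w: "w \<in> V" "w \<notin> set (e # Lx @ a # (Mp @ Mb) @ b # Rx)" "w \<noteq> x" "E w v"
begin

lemma cutting_vertex_nbr_notin: "w \<notin> set (v # l # L @ (Mp @ Mb) @ R @ [r])"
  using cut_subset[OF corner cut] w(2,4) E_irrefl by auto

lemma cutting_vertex_nbr_no_pair: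
  assumes y: "Mb = Ma @ y # Mc" "E w y" "\<And>c. c \<in> set (Mc @ R @ [r]) \<Longrightarrow> \<not> E w c" and C: "w \<notin> C"
    and spokes: "3 \<le> num_spokes (v # w # y # Mc @ R @ [r])"
  shows False
proof -
  have "induced_cycle (y # (Mc @ R @ [r]) @ v # (l # L @ Mp @ Ma))"
    using induced_cycle_rotate[of "v # l # L @ Mp @ Ma" "y # Mc @ R @ [r]"] cut_cycle[OF corner cut]
      y(1)
    by (simp del: induced_cycle.simps)
  then have "induced_cycle (w # y # (Mc @ R @ [r]) @ [v])"
    by (rule induced_cycle_bypass_Cons) (use w cutting_vertex_nbr_notin y in auto)
  then have cyc: "induced_cycle ([v, w] @ (y # Mc @ R @ [r]))"
    using induced_cycle_rotate[of "w # y # Mc @ R @ [r]" "[v]"] by (simp del: induced_cycle.simps)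
  have "B = X @ (Mb @ (R @ r # Z)) @ Y" using arc(1) unfolding cut_sides(2)[OF corner cut] .
  then have B: "B = (X @ Ma) @ (y # Mc @ R @ [r]) @ (Z @ Y)" using y(1) by simp
  have "X @ Y \<noteq> []" using arc(2) by fastforce
  then have shorter: "length (y # Mc @ R @ [r]) < length B" using B by auto
  have "num_spokes [v, w] \<le> num_spokes P + num_spokes (X @ Y)" using path arc(2) by auto
  then have "num_spokes ([v, w] @ (y # Mc @ R @ [r])) \<le> num_spokes (P @ B)" unfolding B by simp
  then show False using no_shorter_pair_detour[OF min B _ cyc v] w(1,3) C spokes shorter
    unfolding off_rim_def by auto
qed

lemma cutting_vertex_hub_nbr_free:
  assumes hub_nbr: "E x w" and C: "w \<notin> C"
  shows "\<forall>y\<in>set Mb. \<not> E w y"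
proof (rule ccontr)
  assume "\<not> ?thesis"
  then have "\<exists>y\<in>set Mb. E w y" by blast
  then obtain Ma y Mc where y: "Mb = Ma @ y # Mc" "E w y" "\<forall>z\<in>set Mc. \<not> E w z"
    by (rule split_list_last_propE)
  note spokes = corner_spokes[OF corner cut] and vertex = cutting_vertex[OF corner cut]
  have "\<not> E w c" if c: "c \<in> set (R @ [r])" for c
  proof
    assume nbr: "E w c"
    then have "c \<noteq> b" using triangles_share_edge[of x w v b] hub_nbr w(4) vertex(2,4) spokes(3) by auto
    moreover have "c \<in> set (b # Rx)" using arg_cong[OF cut_sides(2)[OF corner cut], of set] c by auto
    ultimately obtain R1 R2 where "Rx = R1 @ c # R2" by (metis set_ConsD split_list)
    then have "B = (X @ Ma) @ y # (Mc @ b # R1) @ c # (R2 @ Y)" using arc(1) y(1) by simp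
    moreover have "off_rim w" using w(1,3) C unfolding off_rim_def by blast
    ultimately have "num_spokes (Mc @ b # R1) = 0"
      using detour_arc_unseparated[OF min_detourD[OF min]] y(2) nbr by blast
    then show False using spokes(3) by simp
  qed
  then show False
    using cutting_vertex_nbr_no_pair[OF y(1,2) _ C] y(3) vertex(4) hub_nbr cut_spokes(3)[OF corner cut]
    by auto
qed

context
  fixes y
  assumes nonnbr: "\<not> E w x" "card (nbrs_in w (set (e # Lx @ a # (Mp @ Mb) @ b # Rx))) \<le> 2"
    and y: "y \<in> set (Mp @ Mb)" "E w y"
begin

lemma cutting_vertex_nonnbr_other: "c \<in> set (l # L @ (Mp @ Mb) @ R @ [r]) \<Longrightarrow> c \<noteq> y \<Longrightarrow> \<not> E w c"
  using cutting_vertex_nbr_two_nbrs[OF corner cut w(1) cutting_vertex_nbr_notin nonnbr(2) w(4) y]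
  by blast

lemma cutting_vertex_nonnbr_arcs:
  assumes split: "Mp @ Mb = Ma @ y # Mc"
  shows "2 \<le> num_spokes (Ma @ [y])" "2 \<le> num_spokes (y # Mc)"
proof -
  note spokes = cut_spokes[OF corner cut] and vertex = cutting_vertex[OF corner cut] and notin
    = cutting_vertex_nbr_notin
  have cyc: "induced_cycle (v # (l # L @ Ma) @ y # (Mc @ R @ [r]))"
    using cut_cycle[OF corner cut] split by (simp del: induced_cycle.simps)
  then have cyc': "induced_cycle (y # (Mc @ R @ [r]) @ v # (l # L @ Ma))"
    using induced_cycle_rotate[of "v # l # L @ Ma" "y # Mc @ R @ [r]"]
    by (simp del: induced_cycle.simps)
  have verts: "set (v # (l # L @ Ma) @ y # (Mc @ R @ [r])) = set (v # l # L @ (Mp @ Mb) @ R @ [r])"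
    unfolding split by auto
  have dist: "distinct (v # (l # L @ Ma) @ y # (Mc @ R @ [r]))" using induced_cycle_distinct[OF cyc] .
  have other: "\<not> E w c" if "c \<in> set ((l # L @ Ma) @ Mc @ R @ [r])" for c
    using cutting_vertex_nonnbr_other[of c] that dist split by auto
  have total: "4 \<le> num_spokes (v # (l # L @ Ma) @ y # (Mc @ R @ [r]))"
    using spokes vertex(4) corner_spokes(6)[OF corner cut] arg_cong[OF split, of num_spokes]
    by (auto split: if_splits)
  have pos: "0 < num_spokes (l # L @ Ma)" "0 < num_spokes (Mc @ R @ [r])" using spokes by auto
  have hub: "x \<notin> set (v # (l # L @ Ma) @ y # (Mc @ R @ [r]))" using cut_hub_notin[OF corner cut] verts
    by simp
  have "4 \<le> num_spokes (v # (l # L @ Ma) @ [y])"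
    by (rule two_nbrs_arc_spokes_ge_4[OF cyc hub, of w])
      (use w nonnbr y other total pos notin verts in \<open>auto simp del: num_spokes_simps\<close>)
  then show "2 \<le> num_spokes (Ma @ [y])" using spokes(2) vertex(4) by (auto split: if_splits)
  have total': "4 \<le> num_spokes (y # (Mc @ R @ [r]) @ v # (l # L @ Ma))" using total by simp
  have "4 \<le> num_spokes (y # (Mc @ R @ [r]) @ [v])"
    by (rule two_nbrs_arc_spokes_ge_4[OF cyc', of w])
      (use w nonnbr y other total' pos notin verts hub in \<open>auto simp del: num_spokes_simps\<close>)
  then show "2 \<le> num_spokes (y # Mc)" using spokes(3) vertex(4) by (auto split: if_splits)
qed

lemma cutting_vertex_nonnbr_free:
  assumes Mp: "num_spokes Mp \<le> 1" and C: "w \<in> C \<Longrightarrow> num_spokes Mb = 0"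
  shows False
proof -
  obtain Ma Mc where split: "Mp @ Mb = Ma @ y # Mc" using y(1) by (meson split_list)
  note arcs = cutting_vertex_nonnbr_arcs[OF split]
  obtain U where Mb: "Ma = Mp @ U" "Mb = U @ y # Mc"
  proof -
    consider (after) us where "Mp = Ma @ us" "us @ Mb = y # Mc"
      | (before) us where "Ma = Mp @ us" "Mb = us @ y # Mc"
      using split unfolding append_eq_append_conv2 by blast
    then show thesis
    proof cases
      case after
      then show thesis using that[of "[]"] arcs(1) Mp by (cases us) auto
    qed (rule that)
  qed
  have "w \<notin> C" using C arcs(1) Mp Mb by auto
  moreover have "distinct (v # l # L @ (Mp @ Mb) @ R @ [r])"
    using induced_cycle_distinct[OF cut_cycle[OF corner cut]] .
  then have "\<not> E w c" if "c \<in> set (Mc @ R @ [r])" for c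
    using cutting_vertex_nonnbr_other[of c] that Mb(2) by auto
  ultimately show False
    using cutting_vertex_nbr_no_pair[OF Mb(2) y(2)] arcs(2) cutting_vertex(4)[OF corner cut] by auto
qed

end

end

lemma detour_corner_unique:
  assumes "detour_corner P B P1 u P2 Bt b Bm e Bs" "detour_corner P B P1' u' P2' Bt' b' Bm' e' Bs'"
  shows "P1 = P1' \<and> P2 = P2' \<and> Bt = Bt' \<and> b = b' \<and> Bm = Bm'"
proof -
  note corner = assms[unfolded detour_corner_def]
  have "P1 = P1' \<and> u = u' \<and> P2 = P2'"
    by (rule first_occurrence_unique[of _ _ _ _ _ _ "E x"]) (use corner num_spokes_0D in blast)+
  moreover have last: "Bt @ b # Bm = Bt' @ b' # Bm' \<and> e = e' \<and> Bs = Bs'"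
    by (rule last_occurrence_unique[of _ _ _ _ _ _ "E x"]) (use corner num_spokes_0D in auto)
  moreover have "Bt = Bt' \<and> b = b' \<and> Bm = Bm'"
    by (rule last_occurrence_unique[of _ _ _ _ _ _ "E x"]) (use corner last num_spokes_0D in blast)+
  ultimately show ?thesis by blast
qed

lemma corner_obstruction_obtain:
  assumes "corner_obstruction P B v"
  obtains P1 u P2 Bt b Bm e Bs where "detour_corner P B P1 u P2 Bt b Bm e Bs"
  using assms unfolding corner_obstruction_def by blast

lemma corner_obstruction_iff:
  assumes "detour_corner P B P1 u P2 Bt b Bm e Bs"
  shows "corner_obstruction P B v \<longleftrightarrow> off_rim v \<and> v \<notin> set P \<and> E x v \<and> (\<exists>p\<in>set P1. E v p)
    \<and> (\<exists>y\<in>set (b # Bm). E v y) \<and> (\<forall>p\<in>set (P2 @ Bt). \<not> E v p)"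
  unfolding corner_obstruction_def using assms by (blast dest: detour_corner_unique[OF assms])

lemma min_detour_proper_or_corner_obstruction:
  assumes min: "min_detour P B" and trailing: "spokes_trailing P"
    and w: "w \<in> V" "w \<notin> set (P @ B)" "w \<noteq> x"
  shows "proper_for (P @ B) w \<or> corner_obstruction P B w \<or> num_spokes P = 1
    \<and> corner_obstruction (rev P) (rev B) w"
proof (cases "w \<in> C")
  case True
  obtain A where A: "rim (B @ A)" using detour_rim_arc[OF min_detourD[OF min]] .
  then have "w \<in> set A" using True w(2) rim_set[OF A] by auto
  then show ?thesis using min_detour_outside_proper[OF min A] by blast
next
  case False
  then have off: "off_rim w" "w \<notin> set P" using w unfolding off_rim_def by auto
  show ?thesis
  proof (cases "E x w")
    case True
    then show ?thesis
      using hub_nbr_unseparated_or_corner_obstruction[OF min off True trailing] E_commute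
      unfolding proper_for_def by blast
  next
    case False
    then show ?thesis using min_detour_nonnbr_proper[OF min off _ trailing] E_commute by blast
  qed
qed

lemma corner_obstruction_rim_nbr:
  assumes detour: "detour P B" and corner: "detour_corner P B P1 u P2 Bt b Bm e Bs"
    and v: "corner_obstruction P B v" and c: "c \<in> C" "c \<notin> set B" "E v c"
  shows "num_spokes Bt = 0 \<and> \<not> E x c"
proof -
  note parts = corner[unfolded detour_corner_def]
  have off: "off_rim v" "E x v" and "\<exists>y\<in>set (b # Bm). E v y"
    using v unfolding corner_obstruction_iff[OF corner] by auto
  then obtain y Ya Yb where y: "b # Bm = Ya @ y # Yb" "E v y" by (meson split_list)
  obtain A where A: "rim (B @ A)" using detour_rim_arc[OF detour] .
  then have "c \<in> set A" using c rim_set[OF A] by auto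
  then obtain A1 A2 where A12: "A = A1 @ c # A2" by (meson split_list)
  have "B @ A = Bt @ (b # Bm) @ e # Bs @ A" using parts by simp
  then have "B @ A = (Bt @ Ya) @ y # (Yb @ e # Bs @ A1) @ c # A2" unfolding y(1) A12 by simp
  then have "unseparated ((Bt @ Ya) @ y # (Yb @ e # Bs @ A1) @ c # A2) v"
    using rim_unseparated[OF A off(1)] by simp
  from unseparatedD[OF this y(2) c(3)] have before: "num_spokes (Bt @ Ya) = 0" using parts by simp
  then have "Ya = []" using y(1) parts by (cases Ya) auto
  then have "y = b" using y(1) by simp
  then have "\<not> E x c" using triangles_share_edge[of x v b c] off(2) parts y(2) c by auto
  then show ?thesis using before by simp
qed

context
  fixes P B P1 u P2 Bt b Bm e Bs
  assumes min: "min_detour P B" and detour_corner: "detour_corner P B P1 u P2 Bt b Bm e Bs"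
begin

lemma detour_corner_parts:
  "P = P1 @ u # P2" "E x u" "num_spokes P1 = 0" "B = Bt @ b # Bm @ e # Bs" "E x b" "E x e"
  "num_spokes Bm = 0" "num_spokes Bs = 0"
  using detour_corner unfolding detour_corner_def by auto

lemma detour_corner_rotate:
  "P @ B = (P1 @ u # P2 @ Bt @ b # Bm) @ (e # Bs)"
  "e # (Bs @ P1) @ u # (P2 @ Bt) @ b # Bm = (e # Bs) @ (P1 @ u # P2 @ Bt @ b # Bm)"
  using detour_corner_parts by simp_all

lemma detour_corner_set: "set (e # (Bs @ P1) @ u # (P2 @ Bt) @ b # Bm) = set (P @ B)"
  unfolding detour_corner_rotate by auto

lemma detour_corner_num_spokes: "num_spokes (e # (Bs @ P1) @ u # (P2 @ Bt) @ b # Bm)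
  = num_spokes (P @ B)"
  unfolding detour_corner_rotate by simp

lemma detour_corner_proper:
  "proper_for (P @ B) w \<Longrightarrow> proper_for (e # (Bs @ P1) @ u # (P2 @ Bt) @ b # Bm) w"
  unfolding detour_corner_rotate by (rule proper_for_rotate)

lemma corner_of_detour: "corner e (Bs @ P1) u (P2 @ Bt) b Bm"
proof -
  note detour = min_detourD[OF min]
  have "induced_cycle (e # (Bs @ P1) @ u # (P2 @ Bt) @ b # Bm)"
    using detour_cycle[OF detour] unfolding detour_corner_rotate by (rule induced_cycle_rotate)
  moreover have "x \<notin> set (e # (Bs @ P1) @ u # (P2 @ Bt) @ b # Bm)"
    using detour_hub_notin[OF detour] detour_corner_set by blast
  moreover have "0 < num_spokes (P2 @ Bt)"
    using detour_spokes_ge_4[OF detour] detour_corner_parts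
    unfolding detour_corner_num_spokes[symmetric] by force
  ultimately show ?thesis unfolding corner_def using detour_corner_parts by simp
qed

lemma corner_obstruction_straddles:
  assumes "corner_obstruction P B v"
  shows "straddles_corner e (Bs @ P1) u (P2 @ Bt) b Bm v"
proof -
  have "v \<notin> set (e # (Bs @ P1) @ u # (P2 @ Bt) @ b # Bm)"
    using off_rim_notin_detour[OF min_detourD[OF min], of v] assms detour_corner_set
    unfolding corner_obstruction_def by blast
  then show ?thesis
    using assms unfolding corner_obstruction_iff[OF detour_corner] straddles_corner_def off_rim_def
    by auto
qed

lemma rev_corner_obstruction_nbrs:
  assumes one: "num_spokes P = 1" and obstruction: "corner_obstruction (rev P) (rev B) w"
  shows "(\<exists>p\<in>set P2. E w p) \<and> (\<forall>p\<in>set (Bs @ P1). \<not> E w p)"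
proof -
  obtain P1' u' P2' Bt' b' Bm' e' Bs'
    where corner': "detour_corner (rev P) (rev B) P1' u' P2' Bt' b' Bm' e' Bs'"
    by (rule corner_obstruction_obtain[OF obstruction])
  note parts' = corner'[unfolded detour_corner_def]
  have "num_spokes P2 = 0" using one detour_corner_parts by simp
  moreover have "rev P2 @ u # rev P1 = P1' @ u' # P2'" using parts' detour_corner_parts(1) by simp
  ultimately have "rev P2 = P1' \<and> u = u' \<and> rev P1 = P2'"
    using parts' detour_corner_parts(2) num_spokes_0D
    by (intro first_occurrence_unique[of _ _ _ _ _ _ "E x"]) auto
  then have sides: "set P1' = set P2" "set P2' = set P1" using set_rev by metis+
  have "rev Bs @ e # rev (Bt @ b # Bm) = Bt' @ b' # (Bm' @ e' # Bs')"
    using parts' detour_corner_parts(4) by simp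
  then obtain U where "Bt' = rev Bs @ U"
    by (rule before_first_occurrence[of _ _ _ _ _ _ "E x"])
      (use parts' detour_corner_parts(8) num_spokes_0D in auto)
  then have "set Bs \<subseteq> set Bt'" by auto
  then show ?thesis using obstruction sides unfolding corner_obstruction_iff[OF corner'] by auto
qed

context
  fixes v w
  assumes trailing: "spokes_trailing P" and v: "corner_obstruction P B v"
    and w: "w \<in> V" "w \<notin> set (P @ B)" "w \<noteq> x" "E w v"
begin

lemma corner_obstruction_nbr_on_rim: "w \<in> C \<Longrightarrow> num_spokes Bt = 0 \<and> \<not> E x w"
  using corner_obstruction_rim_nbr[OF min_detourD[OF min] detour_corner v, of w] w(2,4) E_commute
  by auto

lemma corner_obstruction_nonnbr_free:
  assumes nonnbr: "\<not> E x w" and y: "y \<in> set (P2 @ Bt)"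
  shows "\<not> E w y"
proof
  assume nbr: "E w y"
  obtain W l L R r Z where cut: "corner_cut e (Bs @ P1) u (P2 @ Bt) b Bm v W l L R r Z"
    using corner_cut_exists[OF corner_obstruction_straddles[OF v]] .
  have "proper_for (P @ B) w"
    using min_detour_proper_or_corner_obstruction[OF min trailing w(1-3)] nonnbr
    unfolding corner_obstruction_def by blast
  then have "card (nbrs_in w (set (e # (Bs @ P1) @ u # (P2 @ Bt) @ b # Bm))) \<le> 2"
    using nonnbr E_commute unfolding proper_for_def detour_corner_set by blast
  moreover have "num_spokes P2 \<le> 1" using detour_path_spokes[OF min_detourD[OF min]] detour_corner_parts
    by simp
  moreover have "B = [] @ (Bt @ b # Bm) @ (e # Bs)" "0 < num_spokes ([] @ (e # Bs))" "0 < num_spokes P"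
    using detour_corner_parts by simp_all
  moreover have "off_rim v" using v unfolding corner_obstruction_def by blast
  ultimately show False
    using cutting_vertex_nonnbr_free[OF min _ corner_of_detour cut, of "[]" "e # Bs" w y] w nonnbr y nbr
      E_commute
      corner_obstruction_nbr_on_rim unfolding detour_corner_set by blast
qed

lemma corner_obstruction_hub_nbr_free:
  assumes hub_nbr: "E x w" and y: "y \<in> set (P2 @ Bt)"
  shows "\<not> E w y"
proof -
  note detour = min_detourD[OF min]
  obtain W l L R r Z where cut: "corner_cut e (Bs @ P1) u (P2 @ Bt) b Bm v W l L R r Z"
    using corner_cut_exists[OF corner_obstruction_straddles[OF v]] .
  have off: "off_rim v" "v \<notin> set P" "E x v" using v unfolding corner_obstruction_def by auto
  have "w \<notin> C" using corner_obstruction_nbr_on_rim hub_nbr by blast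
  have w_notin: "w \<notin> set (e # (Bs @ P1) @ u # (P2 @ Bt) @ b # Bm)" using w(2)
    unfolding detour_corner_set .
  have one: "num_spokes P = 1"
  proof (rule ccontr)
    assume "num_spokes P \<noteq> 1"
    then have "2 \<le> num_spokes P" using detour_corner_parts(1,2) by auto
    then obtain Q u1 u2 where Q: "P = Q @ [u1, u2]" "num_spokes Q = 0" "E x u1" "E x u2"
      by (rule spokes_trailing_two[OF trailing])
    have "induced_path [u1, u2]"
      using induced_cycle_infix[of Q "[u1, u2]" B] detour_cycle[OF detour]
        detour_arc_nonempty[OF detour] Q(1) by simp
    then have "{u1, u2} = {v, w}" using triangle_unique[of x u1 u2 v w] Q(3,4) off(3) hub_nbr
      w(4) E_commute by auto
    then show False using off(2) Q(1) by auto
  qed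
  have sides: "unseparated (e # (Bs @ P1) @ u # (P2 @ Bt) @ b # Bm) w \<or> (\<forall>c\<in>set (Bs @ P1). \<not> E w c)"
    if "\<exists>z\<in>set P2. E w z"
  proof -
    have "\<not> corner_obstruction P B w" using that unfolding corner_obstruction_iff[OF detour_corner]
      by auto
    then show ?thesis
      using min_detour_proper_or_corner_obstruction[OF min trailing w(1-3)] detour_corner_proper[of w]
        rev_corner_obstruction_nbrs[OF one] unfolding proper_for_def by blast
  qed
  have P2: "num_spokes P2 = 0" using one detour_corner_parts(1-3) by simp
  have "\<forall>z\<in>set P2. \<not> E w z"
    using cutting_vertex_hub_nbr_spokeless[OF corner_of_detour cut w(1) w_notin w(3) hub_nbr w(4) P2]
      sides by blast
  moreover have "\<forall>z\<in>set Bt. \<not> E w z"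
    by (rule cutting_vertex_hub_nbr_free[OF min _ corner_of_detour cut, of "[]" "e # Bs"])
      (use detour_corner_parts off w w_notin hub_nbr \<open>w \<notin> C\<close> in auto)
  ultimately show ?thesis using y by auto
qed

end

lemma detour_corner_replacement:
  assumes trailing: "spokes_trailing P" and exists: "corner_obstruction P B v0"
  obtains v W l L R r Z where "corner_obstruction P B v"
    "corner_cut e (Bs @ P1) u (P2 @ Bt) b Bm v W l L R r Z"
    "\<And>w. \<lbrakk>w \<in> V; w \<notin> set (v # l # L @ (P2 @ Bt) @ R @ [r]); w \<noteq> x\<rbrakk>
      \<Longrightarrow> proper_for (v # l # L @ (P2 @ Bt) @ R @ [r]) w
        \<or> (num_spokes P = 1 \<and> corner_obstruction (rev P) (rev B) w) \<and> \<not> E w v"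
proof (rule corner_replacement[of e "Bs @ P1" u "P2 @ Bt" b Bm "corner_obstruction P B" v0
    "\<lambda>w. num_spokes P = 1 \<and> corner_obstruction (rev P) (rev B) w"])
  show "proper_for (e # (Bs @ P1) @ u # (P2 @ Bt) @ b # Bm) w \<or> corner_obstruction P B w
      \<or> (num_spokes P = 1 \<and> corner_obstruction (rev P) (rev B) w)"
    if "w \<in> V" "w \<notin> set (e # (Bs @ P1) @ u # (P2 @ Bt) @ b # Bm)" "w \<noteq> x" for w
    using min_detour_proper_or_corner_obstruction[OF min trailing] detour_corner_proper that
    unfolding detour_corner_set by blast
  show "\<exists>y\<in>set (P2 @ Bt). E w y" if "num_spokes P = 1 \<and> corner_obstruction (rev P) (rev B) w" for w
    using rev_corner_obstruction_nbrs that by auto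
  show "\<not> E w y" if "corner_obstruction P B v" "E w v" "w \<in> V"
    "w \<notin> set (e # (Bs @ P1) @ u # (P2 @ Bt) @ b # Bm)"
      "w \<noteq> x" "y \<in> set (P2 @ Bt)" for v w y
    using corner_obstruction_nonnbr_free[OF trailing that(1)]
      corner_obstruction_hub_nbr_free[OF trailing that(1)] that
    unfolding detour_corner_set by blast
qed (use corner_of_detour corner_obstruction_straddles exists that in blast)+

end

end

section \<open>The opposite corner\<close>

context proper_rim
begin

text \<open>When the corner at \<open>e\<close> has been cut off by \<open>v\<close>, the remaining obstructions are at the corner \<open>e'\<close>
  of the reversed detour. The new cycle is read backwards from \<open>e'\<close>.\<close>

context
  fixes P B P1 u P2 Bt b Bm e Bs v W l L R r Z Bu e' Y S b' U L'
  assumes min: "min_detour P B" and one: "num_spokes P = 1"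
    and detour_corner: "detour_corner P B P1 u P2 Bt b Bm e Bs" and v: "corner_obstruction P B v"
    and cut: "corner_cut e (Bs @ P1) u (P2 @ Bt) b Bm v W l L R r Z"
    and Bt: "Bt = Bu @ e' # Y" "E x e'" "num_spokes Bu = 0"
    and S: "Y @ R @ [r] = S @ b' # U" "E x b'" "num_spokes S = 0"
    and L: "l # L = L' @ [u]"
begin

lemma first_corner: "corner e (Bs @ P1) u (P2 @ Bt) b Bm"
  using corner_of_detour[OF min detour_corner] .

lemma first_corner_path_spokeless: "num_spokes P1 = 0" "num_spokes P2 = 0"
  using detour_corner_parts[OF min detour_corner] one by simp_all

lemma cut_cycle_backwards:
  "rev (v # l # L @ (P2 @ Bt) @ R @ [r])
    = (rev U @ b' # rev S) @ (e' # rev Bu @ rev P2 @ u # rev L' @ [v])"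
  "e' # (rev Bu @ rev P2) @ u # (rev L' @ v # rev U) @ b' # rev S
    = (e' # rev Bu @ rev P2 @ u # rev L' @ [v]) @ (rev U @ b' # rev S)"
proof -
  have "v # l # L @ (P2 @ Bt) @ R @ [r] = v # (l # L) @ P2 @ Bu @ e' # (Y @ R @ [r])"
    using Bt(1) by simp
  then show "rev (v # l # L @ (P2 @ Bt) @ R @ [r])
      = (rev U @ b' # rev S) @ (e' # rev Bu @ rev P2 @ u # rev L' @ [v])" unfolding L S(1) by simp
qed simp

lemma opposite_corner_set:
  "set (e' # (rev Bu @ rev P2) @ u # (rev L' @ v # rev U) @ b' # rev S)
    = set (v # l # L @ (P2 @ Bt) @ R @ [r])"
  using arg_cong[OF cut_cycle_backwards(1), of set] unfolding cut_cycle_backwards(2) set_rev by auto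

lemma opposite_corner_num_spokes:
  "num_spokes (e' # (rev Bu @ rev P2) @ u # (rev L' @ v # rev U) @ b' # rev S)
    = num_spokes (v # l # L @ (P2 @ Bt) @ R @ [r])"
  using arg_cong[OF cut_cycle_backwards(1), of num_spokes] unfolding cut_cycle_backwards(2) by simp

lemma opposite_corner_proper:
  "proper_for (v # l # L @ (P2 @ Bt) @ R @ [r]) w
    \<Longrightarrow> proper_for (e' # (rev Bu @ rev P2) @ u # (rev L' @ v # rev U) @ b' # rev S) w"
  unfolding cut_cycle_backwards(2)
  using proper_for_rotate[of "rev U @ b' # rev S"]
    proper_for_rev[of "v # l # L @ (P2 @ Bt) @ R @ [r]" w]
  unfolding cut_cycle_backwards(1) by blast

lemma opposite_corner: "corner e' (rev Bu @ rev P2) u (rev L' @ v # rev U) b' (rev S)"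
proof -
  let ?D = "e' # (rev Bu @ rev P2) @ u # (rev L' @ v # rev U) @ b' # rev S"
  have "induced_cycle ((rev U @ b' # rev S) @ (e' # rev Bu @ rev P2 @ u # rev L' @ [v]))"
    using induced_cycle_rev[OF cut_cycle[OF first_corner cut]] unfolding cut_cycle_backwards(1) .
  then have "induced_cycle ?D" unfolding cut_cycle_backwards(2) by (rule induced_cycle_rotate)
  moreover have "x \<notin> set ?D" using cut_hub_notin[OF first_corner cut] unfolding opposite_corner_set .
  moreover have "0 < num_spokes (rev L' @ v # rev U)" using cutting_vertex(4)[OF first_corner cut]
    by simp
  ultimately show ?thesis
    unfolding corner_def
    using Bt S first_corner_path_spokeless corner_spokes(2)[OF first_corner cut]
    by (simp del: induced_cycle.simps)
qed

lemma opposite_left_side: "set L' \<subseteq> set (Bs @ P1)" "num_spokes L' = 0"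
proof -
  have "(Bs @ P1) @ [u] = (W @ L') @ [u]" using cut_sides(1)[OF first_corner cut] unfolding L by simp
  then have "Bs @ P1 = W @ L'" by simp
  then show "set L' \<subseteq> set (Bs @ P1)" "num_spokes L' = 0"
    using corner_spokes(4)[OF first_corner cut]
    by (metis Un_upper2 set_append, metis add_is_0 num_spokes_simps(3))
qed

lemma opposite_arc: "B = (Bu @ e' # S @ b' # U) @ Z @ e # Bs"
proof -
  have "B = Bt @ (b # Bm) @ e # Bs" using detour_corner_parts(4)[OF min detour_corner] by simp
  also have "\<dots> = Bu @ e' # (Y @ R @ [r]) @ Z @ e # Bs"
    unfolding cut_sides(2)[OF first_corner cut] using Bt(1) by simp
  finally show ?thesis unfolding S(1) by simp
qed

lemma opposite_detour_corner:
  "detour_corner (rev P) (rev B) (rev P2) u (rev P1) (rev Bs @ e # rev Z @ rev U) b' (rev S) e' (rev Bu)"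
  unfolding detour_corner_def
  using detour_corner_parts[OF min detour_corner] first_corner_path_spokeless opposite_arc Bt S by simp

lemma opposite_obstruction_straddles:
  assumes w: "corner_obstruction (rev P) (rev B) w" "\<not> E w v"
  shows "straddles_corner e' (rev Bu @ rev P2) u (rev L' @ v # rev U) b' (rev S) w"
proof -
  note nbrs = w(1)[unfolded corner_obstruction_iff[OF opposite_detour_corner]]
  have "w \<noteq> v" using nbrs v unfolding corner_obstruction_iff[OF detour_corner] by auto
  moreover have "w \<notin> set (P @ B)" using off_rim_notin_detour[OF min_detourD[OF min]] nbrs by auto
  moreover have "set (l # L @ (P2 @ Bt) @ R @ [r]) \<subseteq> set (P @ B)"
    using cut_subset[OF first_corner cut] unfolding detour_corner_set[OF min detour_corner] .
  ultimately have "w \<notin> set (e' # (rev Bu @ rev P2) @ u # (rev L' @ v # rev U) @ b' # rev S)"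
    unfolding opposite_corner_set by auto
  moreover have "\<forall>y\<in>set (rev L' @ v # rev U). \<not> E w y" using nbrs w(2) opposite_left_side(1) by auto
  ultimately show ?thesis using nbrs unfolding straddles_corner_def off_rim_def by auto
qed

context
  fixes v' w
  assumes v': "corner_obstruction (rev P) (rev B) v'" "\<not> E v' v"
    and w: "w \<in> V" "w \<notin> set (e' # (rev Bu @ rev P2) @ u # (rev L' @ v # rev U) @ b' # rev S)" "w \<noteq> x"
      "E w v'"
    and others: "\<And>w. \<lbrakk>w \<in> V; w \<notin> set (v # l # L @ (P2 @ Bt) @ R @ [r]); w \<noteq> x\<rbrakk>
      \<Longrightarrow> proper_for (v # l # L @ (P2 @ Bt) @ R @ [r]) w \<or> corner_obstruction (rev P) (rev B) w \<and> \<not> E w v"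
begin

lemma opposite_obstruction_vertex: "off_rim v'" "v' \<notin> set (rev P)" "E x v'"
  using v'(1) unfolding corner_obstruction_def by auto

lemma opposite_obstruction_nbr_off_rim: "w \<notin> C"
proof
  assume C: "w \<in> C"
  show False
  proof (cases "w \<in> set B")
    case True
    have "w \<notin> set Bt" "w \<notin> set (R @ [r])" using w(2) unfolding opposite_corner_set by auto
    moreover have "B = Bt @ (R @ r # Z) @ e # Bs"
      using detour_corner_parts(4)[OF min detour_corner]
      unfolding cut_sides(2)[OF first_corner cut, symmetric] by simp
    ultimately have "w \<in> set (rev Bs @ e # rev Z)" using True by auto
    then show False using v'(1) w(4) E_commute
      unfolding corner_obstruction_iff[OF opposite_detour_corner] by auto
  next
    case False
    then show False
      using corner_obstruction_rim_nbr[OF detour_rev[OF min_detourD[OF min]] opposite_detour_corner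
        v'(1) C]
        w(4) E_commute detour_corner_parts(6)[OF min detour_corner] by auto
  qed
qed

lemma opposite_obstruction_nonnbr_free:
  assumes nonnbr: "\<not> E x w" and y: "y \<in> set (rev L' @ v # rev U)"
  shows "\<not> E w y"
proof
  assume nbr: "E w y"
  obtain W' l' M' R' r' Z' where cut':
      "corner_cut e' (rev Bu @ rev P2) u ((rev L' @ [v]) @ rev U) b' (rev S) v' W' l' M' R' r' Z'"
    using corner_cut_exists[OF opposite_obstruction_straddles[OF v']]
    unfolding append_assoc append_Cons append_Nil .
  have corner': "corner e' (rev Bu @ rev P2) u ((rev L' @ [v]) @ rev U) b' (rev S)"
    using opposite_corner by simp
  have "proper_for (v # l # L @ (P2 @ Bt) @ R @ [r]) w"
    using others[of w] w nonnbr unfolding opposite_corner_set corner_obstruction_def by blast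
  then have "card (nbrs_in w (set (e' # (rev Bu @ rev P2) @ u # ((rev L' @ [v]) @ rev U) @ b' # rev S)))
    \<le> 2"
    using opposite_corner_proper nonnbr E_commute unfolding proper_for_def by simp
  moreover have "rev B = (rev Bs @ e # rev Z) @ (rev U @ b' # rev S) @ (e' # rev Bu)"
    using arg_cong[OF opposite_arc, of rev] by simp
  moreover have "0 < num_spokes ((rev Bs @ e # rev Z) @ (e' # rev Bu))" "0 < num_spokes (rev P)"
    using Bt(2) one by simp_all
  moreover have "w \<notin> set (e' # (rev Bu @ rev P2) @ u # ((rev L' @ [v]) @ rev U) @ b' # rev S)"
    "y \<in> set ((rev L' @ [v]) @ rev U)" "\<not> E w x"
    using w(2) y nonnbr E_commute by auto
  moreover have "num_spokes (rev L' @ [v]) \<le> 1" using opposite_left_side(2) by simp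
  ultimately show False
    using cutting_vertex_nonnbr_free[OF min_detour_rev[OF min] _ corner' cut' _ _
      opposite_obstruction_vertex(1)]
      w(1,3,4) nbr opposite_obstruction_nbr_off_rim by blast
qed

lemma opposite_obstruction_hub_nbr_free:
  assumes hub_nbr: "E x w" and y: "y \<in> set (rev L' @ v # rev U)"
  shows "\<not> E w y"
proof -
  obtain W' l' M' R' r' Z' where
      cut': "corner_cut e' (rev Bu @ rev P2) u (rev L' @ v # rev U) b' (rev S) v' W' l' M' R' r' Z'"
    using corner_cut_exists[OF opposite_obstruction_straddles[OF v']] .
  have sides: "unseparated (e' # (rev Bu @ rev P2) @ u # (rev L' @ v # rev U) @ b' # rev S) w"
    if "\<exists>z\<in>set L'. E w z"
  proof -
    have "\<not> corner_obstruction (rev P) (rev B) w"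
      using that opposite_left_side(1) unfolding corner_obstruction_iff[OF opposite_detour_corner]
      by auto
    then have "proper_for (v # l # L @ (P2 @ Bt) @ R @ [r]) w" using others w
      unfolding opposite_corner_set by blast
    then show ?thesis using opposite_corner_proper unfolding proper_for_def by blast
  qed
  have "num_spokes (rev L') = 0" using opposite_left_side(2) by simp
  then have "\<forall>z\<in>set (rev L'). \<not> E w z"
    using cutting_vertex_hub_nbr_spokeless[OF opposite_corner cut' w(1-3) hub_nbr w(4)] sides by auto
  moreover have "\<not> E w v"
  proof
    assume "E w v"
    then have "v' = v"
      using triangles_share_edge[of x w v' v] hub_nbr w(4) opposite_obstruction_vertex(3) v
      unfolding corner_obstruction_def by auto
    then show False using v'(1) v unfolding corner_obstruction_iff[OF opposite_detour_corner]
        corner_obstruction_iff[OF detour_corner] by auto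
  qed
  moreover have "\<forall>z\<in>set (rev U). \<not> E w z"
  proof (rule cutting_vertex_hub_nbr_free[OF min_detour_rev[OF min], of e' "rev Bu @ rev P2" u "rev L' @ [v]"
        "rev U" b' "rev S" v' W' l' M' R' r' Z' "rev Bs @ e # rev Z" "e' # rev Bu"])
    show "rev B = (rev Bs @ e # rev Z) @ (rev U @ b' # rev S) @ e' # rev Bu"
      using arg_cong[OF opposite_arc, of rev] by simp
  qed (use one opposite_corner cut' Bt(2) opposite_obstruction_vertex w hub_nbr
    opposite_obstruction_nbr_off_rim
      in auto)
  ultimately show ?thesis using y by auto
qed

end

lemma opposite_corner_replacement:
  assumes exists: "corner_obstruction (rev P) (rev B) v0" "\<not> E v0 v"
    and others: "\<And>w. \<lbrakk>w \<in> V; w \<notin> set (v # l # L @ (P2 @ Bt) @ R @ [r]); w \<noteq> x\<rbrakk>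
      \<Longrightarrow> proper_for (v # l # L @ (P2 @ Bt) @ R @ [r]) w \<or> corner_obstruction (rev P) (rev B) w \<and> \<not> E w v"
  obtains D where "induced_cycle D" "x \<notin> set D" "num_spokes D = num_spokes (P @ B)"
    "\<And>w. \<lbrakk>w \<in> V; w \<notin> set D; w \<noteq> x\<rbrakk> \<Longrightarrow> proper_for D w"
proof (rule corner_replacement[OF opposite_corner,
      of "\<lambda>w. corner_obstruction (rev P) (rev B) w \<and> \<not> E w v" v0 "\<lambda>_. False"])
  fix w assume "w \<in> V" "w \<notin> set (e' # (rev Bu @ rev P2) @ u # (rev L' @ v # rev U) @ b' # rev S)"
    "w \<noteq> x"
  then show "proper_for (e' # (rev Bu @ rev P2) @ u # (rev L' @ v # rev U) @ b' # rev S) w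
      \<or> (corner_obstruction (rev P) (rev B) w \<and> \<not> E w v) \<or> False"
    using others opposite_corner_proper unfolding opposite_corner_set by blast
next
  fix v' w y assume v': "corner_obstruction (rev P) (rev B) v' \<and> \<not> E v' v" and w: "E w v'" "w \<in> V"
    "w \<notin> set (e' # (rev Bu @ rev P2) @ u # (rev L' @ v # rev U) @ b' # rev S)" "w \<noteq> x"
    and y: "y \<in> set (rev L' @ v # rev U)"
  show "\<not> E w y"
    using opposite_obstruction_nonnbr_free[OF _ _ w(2-4,1) others _ y]
      opposite_obstruction_hub_nbr_free[OF _ _ w(2-4,1) others _ y] v' by blast
next
  fix v' W' l' M' R' r' Z'
  let ?D = "v' # l' # M' @ (rev L' @ v # rev U) @ R' @ [r']"
  assume cut': "corner_cut e' (rev Bu @ rev P2) u (rev L' @ v # rev U) b' (rev S) v' W' l' M' R' r' Z'"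
    and proper: "\<And>w. \<lbrakk>w \<in> V; w \<notin> set ?D; w \<noteq> x\<rbrakk> \<Longrightarrow> proper_for ?D w \<or> False \<and> \<not> E w v'"
  show thesis
  proof (rule that[of ?D])
    show "num_spokes ?D = num_spokes (P @ B)"
      using cut_num_spokes[OF opposite_corner cut']
        cut_num_spokes[OF first_corner cut] opposite_corner_num_spokes
        detour_corner_num_spokes[OF min detour_corner] by argo
  qed (use proper cut_cycle[OF opposite_corner cut'] cut_hub_notin[OF opposite_corner cut'] in blast)+
qed (use opposite_obstruction_straddles exists in blast)+

end

lemma detour_opposite_corner_replacement:
  assumes min: "min_detour P B" and one: "num_spokes P = 1"
    and corner: "detour_corner P B P1 u P2 Bt b Bm e Bs" and v: "corner_obstruction P B v"
    and cut: "corner_cut e (Bs @ P1) u (P2 @ Bt) b Bm v W l L R r Z"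
    and exists: "corner_obstruction (rev P) (rev B) v0" "\<not> E v0 v"
    and others: "\<And>w. \<lbrakk>w \<in> V; w \<notin> set (v # l # L @ (P2 @ Bt) @ R @ [r]); w \<noteq> x\<rbrakk>
      \<Longrightarrow> proper_for (v # l # L @ (P2 @ Bt) @ R @ [r]) w \<or> corner_obstruction (rev P) (rev B) w \<and> \<not> E w v"
  obtains D where "induced_cycle D" "x \<notin> set D" "num_spokes D = num_spokes (P @ B)"
    "\<And>w. \<lbrakk>w \<in> V; w \<notin> set D; w \<noteq> x\<rbrakk> \<Longrightarrow> proper_for D w"
proof -
  note first = corner_of_detour[OF min corner]
  have "0 < num_spokes Bt"
    using detour_arc_spokes_ge_3[OF min_detourD[OF min]] one detour_corner_parts[OF min corner] by simp
  then obtain Bu e' Y where Bt: "Bt = Bu @ e' # Y" "E x e'" "num_spokes Bu = 0" by (rule first_spoke)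
  have "0 < num_spokes (Y @ R @ [r])" using cut_spokes(3)[OF first cut] by simp
  then obtain S b' U where S: "Y @ R @ [r] = S @ b' # U" "E x b'" "num_spokes S = 0"
    by (rule first_spoke)
  have L: "l # L = butlast (l # L) @ [u]"
    using append_butlast_last_id[of "l # L"] unfolding cut_ends(1)[OF first cut] by simp
  show thesis
    by (rule opposite_corner_replacement[OF min one corner v cut Bt S L exists])
      (erule (2) others, rule that)
qed

end

section \<open>No detours around a minimal rim\<close>

locale minimal_proper_rim = proper_rim +
  assumes minimal: "\<lbrakk>induced_cycle L; x \<notin> set L; 4 \<le> num_spokes L; num_spokes L < rim_spokes;
      \<And>v. \<lbrakk>v \<in> V; v \<notin> set L; v \<noteq> x\<rbrakk> \<Longrightarrow> proper_for L v\<rbrakk> \<Longrightarrow> False"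
begin

lemma no_proper_cycle_of_detour_size:
  assumes "min_detour P B" "induced_cycle D" "x \<notin> set D" "num_spokes D = num_spokes (P @ B)"
  obtains w where "w \<in> V" "w \<notin> set D" "w \<noteq> x" "\<not> proper_for D w"
  using minimal[of D] assms detour_spokes_ge_4[OF min_detourD] detour_spokes_less[OF min_detourD]
  by metis

lemma no_corner_obstruction:
  assumes min: "min_detour P B" and trailing: "spokes_trailing P"
  shows "\<not> corner_obstruction P B v0"
proof
  assume exists: "corner_obstruction P B v0"
  then obtain P1 u P2 Bt b Bm e Bs where corner: "detour_corner P B P1 u P2 Bt b Bm e Bs"
    by (rule corner_obstruction_obtain)
  note first = corner_of_detour[OF min corner]
  obtain v W l L R r Z where v: "corner_obstruction P B v"
    and cut: "corner_cut e (Bs @ P1) u (P2 @ Bt) b Bm v W l L R r Z"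
    and others: "\<And>w. \<lbrakk>w \<in> V; w \<notin> set (v # l # L @ (P2 @ Bt) @ R @ [r]); w \<noteq> x\<rbrakk>
      \<Longrightarrow> proper_for (v # l # L @ (P2 @ Bt) @ R @ [r]) w
        \<or> (num_spokes P = 1 \<and> corner_obstruction (rev P) (rev B) w) \<and> \<not> E w v"
    by (rule detour_corner_replacement[OF min corner trailing exists]) (rule that)
  let ?D = "v # l # L @ (P2 @ Bt) @ R @ [r]"
  have "num_spokes ?D = num_spokes (P @ B)"
    using cut_num_spokes[OF first cut] detour_corner_num_spokes[OF min corner] by argo
  then obtain w where "w \<in> V" "w \<notin> set ?D" "w \<noteq> x" "\<not> proper_for ?D w"
    by (rule no_proper_cycle_of_detour_size[OF min cut_cycle[OF first cut] cut_hub_notin[OF first cut]])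
      (rule that)
  then have w: "num_spokes P = 1" "corner_obstruction (rev P) (rev B) w" "\<not> E w v" using others
    by blast+
  then have "proper_for ?D z \<or> corner_obstruction (rev P) (rev B) z \<and> \<not> E z v"
    if "z \<in> V" "z \<notin> set ?D" "z \<noteq> x" for z
    using others that by blast
  then obtain D where "induced_cycle D" "x \<notin> set D" "num_spokes D = num_spokes (P @ B)"
    "\<And>w. \<lbrakk>w \<in> V; w \<notin> set D; w \<noteq> x\<rbrakk> \<Longrightarrow> proper_for D w"
    by (rule detour_opposite_corner_replacement[OF min w(1) corner v cut w(2,3)])
      (assumption | rule that)+
  then show False using no_proper_cycle_of_detour_size[OF min] by metis
qed

lemma no_detour: "\<not> detour P B"
proof
  assume "detour P B"
  then obtain P0 B0 where min0: "min_detour P0 B0" by (rule min_detour_exists)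
  obtain P B where min: "min_detour P B" and trailing: "spokes_trailing P"
    using detour_terminal[OF min_detourD[OF min0]] min0 min_detour_rev unfolding spokes_terminal_def
    by blast
  note detour = min_detourD[OF min]
  obtain w where w: "w \<in> V" "w \<notin> set (P @ B)" "w \<noteq> x" and "\<not> proper_for (P @ B) w"
    using no_proper_cycle_of_detour_size[OF min detour_cycle[OF detour] detour_hub_notin[OF detour]
      refl] .
  then have "num_spokes P = 1" "corner_obstruction (rev P) (rev B) w"
    using min_detour_proper_or_corner_obstruction[OF min trailing w]
      no_corner_obstruction[OF min trailing] by blast+
  then show False
    using no_corner_obstruction[OF min_detour_rev[OF min]] spokes_trailing_le_1[of "rev P"] by simp
qed

lemma no_link: "\<not> link Q s t"
  using link_detour no_detour by blast

end

section \<open>Sectors and components\<close>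

lemma (in simple_graph) shortest_leg:
  assumes path: "induced_path (u # Z)" and nbr: "z \<in> set (u # Z)" "c \<in> set L" "E z c"
  obtains L1 s L2 Y where "L = L1 @ s # L2" "induced_path (u # Y)" "set Y \<subseteq> set Z" "E (last (u # Y)) s"
    "\<And>z. z \<in> set (u # Y) \<Longrightarrow> E z s \<Longrightarrow> z = last (u # Y)" "\<And>z c. z \<in> set (u # Y) \<Longrightarrow> c \<in> set L1 \<Longrightarrow> \<not> E z c"
proof -
  have "\<exists>c\<in>set L. \<exists>z\<in>set (u # Z). E z c" using nbr by blast
  then obtain L1 s L2 where s: "L = L1 @ s # L2" "\<exists>z\<in>set (u # Z). E z s"
    "\<forall>c\<in>set L1. \<not> (\<exists>z\<in>set (u # Z). E z c)"
    by (rule split_list_first_propE)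
  obtain Za q Zb where q: "u # Z = Za @ q # Zb" "E q s" "\<forall>z\<in>set Za. \<not> E z s"
    using s(2) by (rule split_list_first_propE)
  obtain Y where Y: "Za @ [q] = u # Y" using q(1) by (cases Za) auto
  have split: "u # Z = (u # Y) @ Zb" using q(1) unfolding Y[symmetric] by simp
  have last: "last (u # Y) = q" unfolding Y[symmetric] by simp
  show thesis
  proof (rule that[of L1 s L2 Y])
    show "induced_path (u # Y)" using induced_path_infix[of "[]" "u # Y" Zb] path split by simp
    show "z = last (u # Y)" if "z \<in> set (u # Y)" "E z s" for z
      using that q(3) unfolding last unfolding Y[symmetric] by auto
  qed (use s q(2) split last in auto)
qed

context proper_rim
begin

definition sector :: "'a \<Rightarrow> 'a list \<Rightarrow> 'a \<Rightarrow> bool" where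
  "sector e X e' \<longleftrightarrow> (\<exists>Y. rim (e # X @ e' # Y)) \<and> E x e \<and> E x e' \<and> num_spokes X = 0"

lemma sectorI: "rim (e # X @ e' # Y) \<Longrightarrow> E x e \<Longrightarrow> E x e' \<Longrightarrow> num_spokes X = 0 \<Longrightarrow> sector e X e'"
  unfolding sector_def by blast

lemma sector_rim:
  assumes "sector e X e'"
  obtains Y where "rim (e # X @ e' # Y)"
  using assms unfolding sector_def by blast

lemma sector_spokes:
  assumes "sector e X e'"
  shows "E x e" "E x e'" "num_spokes X = 0"
  using assms unfolding sector_def by auto

lemma sector_rev: "sector e X e' \<Longrightarrow> sector e' (rev X) e"
  using rim_flip[OF rim_swap] unfolding sector_def by fastforce

lemma sector_on_rim: "sector e X e' \<Longrightarrow> set (e # X @ [e']) \<subseteq> C"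
  using rim_set unfolding sector_def by fastforce

lemma sector_separated:
  assumes sector: "sector e X e'" and a: "a \<in> set X" and c: "c \<in> C" "c \<notin> set (e # X @ [e'])"
  shows "rim_separated a c"
proof -
  obtain Y where rim: "rim (e # X @ e' # Y)" using sector_rim[OF sector] .
  then have "c \<in> set Y" using c rim_set[OF rim] by auto
  then obtain Y1 Y2 where Y: "Y = Y1 @ c # Y2" by (meson split_list)
  obtain X1 X2 where X: "X = X1 @ a # X2" using a by (meson split_list)
  have "rim (a # (X2 @ e' # Y1) @ c # (Y2 @ e # X1))"
    using rim_rotate[of "e # X1" "a # X2 @ e' # Y"] rim X Y by simp
  then show ?thesis by (rule rim_separatedI) (use sector_spokes[OF sector] in auto)
qed

lemma sector_nbr_on_rim:
  assumes sector: "sector e X e'" and a: "a \<in> set X" and c: "c \<in> C" "E a c"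
  shows "c \<in> set (e # X @ [e'])"
proof (rule ccontr)
  assume outside: "c \<notin> set (e # X @ [e'])"
  obtain Y where rim: "rim (e # X @ e' # Y)" using sector_rim[OF sector] .
  then have cyc: "induced_cycle ((e # X @ [e']) @ Y)" using rim_cycle by fastforce
  have "c \<in> set Y" using c(1) outside rim_set[OF rim] by auto
  then have "a = e' \<or> a = e" using induced_cycle_cross[OF cyc, of a c] a c(2) by auto
  then show False using induced_cycle_distinct[OF cyc] a by auto
qed

lemma sector_along_rim:
  assumes sector: "sector g X g'" and rim: "rim (g # M)"
  shows "\<exists>Z. M = X @ g' # Z \<or> rev M = X @ g' # Z"
proof -
  obtain Y where rim': "rim (g # X @ g' # Y)" using sector_rim[OF sector] .
  have "successively E (g # X @ [g'])"
    using induced_cycle_successively[OF rim_cycle[OF rim']]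
      successively_append_iff[of E "g # X @ [g']" Y] by auto
  moreover have "distinct (g # X @ [g'])" using rim_distinct[OF rim'] by auto
  moreover have "set (g # X @ [g']) \<subseteq> set (g # M)" using sector_on_rim[OF sector] rim_set[OF rim]
    by simp
  ultimately have "\<exists>Z. g # M = (g # X @ [g']) @ Z \<or> g # rev M = (g # X @ [g']) @ Z"
    by (intro induced_cycle_walk[OF rim_cycle[OF rim]]) auto
  then show ?thesis by auto
qed

lemma disjoint_sectors_rim:
  assumes sectors: "sector e X e'" "sector g X' g'"
    and disjoint: "set (e # X @ [e']) \<inter> set (g # X' @ [g']) = {}"
  obtains (forward) A B where "rim (e # X @ e' # A @ g # X' @ g' # B)"
    | (backward) A B where "rim (e # X @ e' # A @ g' # rev X' @ g # B)"
proof -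
  obtain Y where rim: "rim (e # X @ e' # Y)" using sector_rim[OF sectors(1)] .
  have "g \<in> set Y" using sector_on_rim[OF sectors(2)] disjoint rim_set[OF rim] by auto
  then obtain A B where Y: "Y = A @ g # B" by (meson split_list)
  have "rim (g # (B @ e # X @ e' # A))" using rim_rotate[of "e # X @ e' # A" "g # B"] rim Y by simp
  then obtain Z where "B @ e # X @ e' # A = X' @ g' # Z \<or> rev (B @ e # X @ e' # A) = X' @ g' # Z"
    using sector_along_rim[OF sectors(2)] by blast
  then show thesis
  proof
    assume "B @ e # X @ e' # A = X' @ g' # Z"
    then obtain W where "B = X' @ g' # W" by (rule append_Cons_before_notin) (use disjoint in auto)
    then show thesis using forward rim Y by auto
  next
    assume "rev (B @ e # X @ e' # A) = X' @ g' # Z"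
    then have "rev A @ e' # (rev X @ e # rev B) = X' @ g' # Z" by simp
    then obtain W where "rev A = X' @ g' # W" by (rule append_Cons_before_notin) (use disjoint in auto)
    then have "A = rev W @ g' # rev X'" by (simp add: rev_swap)
    then show thesis using backward rim Y by auto
  qed
qed

lemma sector_end_nbr:
  assumes sector: "sector e X e'" and X: "X \<noteq> []" and c: "c \<in> {e, e'}"
  obtains y where "y \<in> set X" "E c y"
proof -
  obtain Y where rim: "rim (e # X @ e' # Y)" using sector_rim[OF sector] .
  then have "successively E ([e] @ X @ e' # Y)" using induced_cycle_successively[OF rim_cycle[OF rim]]
    by simp
  then have "E e (hd X)" "E e' (last X)"
    using X E_commute by (auto simp: successively_append_iff successively_Cons)
  then show thesis using that[of "hd X"] that[of "last X"] c X by auto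
qed

lemma no_three_sectors_at_spoke:
  assumes sectors: "sector e1 X1 f1" "sector e2 X2 f2" "sector e3 X3 f3"
    and nonempty: "X1 \<noteq> []" "X2 \<noteq> []" "X3 \<noteq> []"
    and disjoint: "set X1 \<inter> set X2 = {}" "set X1 \<inter> set X3 = {}" "set X2 \<inter> set X3 = {}"
    and c: "c \<in> {e1, f1}" "c \<in> {e2, f2}" "c \<in> {e3, f3}"
  shows False
proof -
  obtain y1 where y1: "y1 \<in> set X1" "E c y1" using sector_end_nbr[OF sectors(1) nonempty(1) c(1)] .
  obtain y2 where y2: "y2 \<in> set X2" "E c y2" using sector_end_nbr[OF sectors(2) nonempty(2) c(2)] .
  obtain y3 where y3: "y3 \<in> set X3" "E c y3" using sector_end_nbr[OF sectors(3) nonempty(3) c(3)] .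
  have on_rim: "y1 \<in> C" "y2 \<in> C" "y3 \<in> C" "c \<in> C"
    using sector_on_rim[OF sectors(1)] sector_on_rim[OF sectors(2)]
      sector_on_rim[OF sectors(3)] y1 y2 y3 c(1) by auto
  obtain M where M: "rim (c # M)" using on_rim(4) by (rule rim_start)
  have "b = hd M \<or> b = last M" if "b \<in> C" "E c b" for b
    using rim_cycle[OF M] rim_set[OF M] that E_irrefl by auto
  then have "y1 = hd M \<or> y1 = last M" "y2 = hd M \<or> y2 = last M" "y3 = hd M \<or> y3 = last M"
    using y1 y2 y3 on_rim by blast+
  moreover have "y1 \<noteq> y2" "y1 \<noteq> y3" "y2 \<noteq> y3" using y1 y2 y3 disjoint by auto
  ultimately show False by metis
qed

lemma no_sector_triangle:
  assumes sectors: "sector a X1 b" "sector b X2 c" "sector a X3 c"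
    and nonempty: "X1 \<noteq> []" "X2 \<noteq> []" "X3 \<noteq> []"
    and disjoint: "set X1 \<inter> set X2 = {}" "set X1 \<inter> set X3 = {}" and ends: "a \<noteq> b" "a \<noteq> c" "b \<noteq> c"
  shows False
proof -
  obtain Y where rim: "rim (a # X1 @ b # Y)" using sector_rim[OF sectors(1)] .
  note spokes = sector_spokes[OF sectors(1)] sector_spokes[OF sectors(2)] sector_spokes[OF sectors(3)]
  have "rim (b # (Y @ a # X1))" using rim_rotate[of "a # X1" "b # Y"] rim by simp
  then obtain Z where "Y @ a # X1 = X2 @ c # Z \<or> rev (Y @ a # X1) = X2 @ c # Z"
    using sector_along_rim[OF sectors(2)] by blast
  then obtain W where W: "Y = X2 @ c # W"
  proof
    assume eq: "Y @ a # X1 = X2 @ c # Z"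
    show thesis by (rule append_Cons_before_notin[OF eq]) (use spokes ends num_spokes_0D that in auto)
  next
    assume "rev (Y @ a # X1) = X2 @ c # Z"
    then have "hd (rev X1 @ a # rev Y) = hd (X2 @ c # Z)" by simp
    then have "hd (rev X1) = hd X2" using nonempty by (simp add: hd_append)
    then have "hd X2 \<in> set X1" using nonempty hd_in_set[of "rev X1"] by simp
    then show thesis using disjoint(1) nonempty(2) by auto
  qed
  obtain Z' where "X1 @ b # Y = X3 @ c # Z' \<or> rev (X1 @ b # Y) = X3 @ c # Z'"
    using sector_along_rim[OF sectors(3) rim] by blast
  then have "rev W = X3"
  proof
    assume "X1 @ b # Y = X3 @ c # Z'"
    then have "hd X1 = hd X3" using nonempty by (metis hd_append2)
    then have "hd X3 \<in> set X1" using nonempty hd_in_set[of X1] by simp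
    then show ?thesis using disjoint(2) nonempty(3) by auto
  next
    assume "rev (X1 @ b # Y) = X3 @ c # Z'"
    then have "rev W @ c # (rev X2 @ b # rev X1) = X3 @ c # Z'" using W by simp
    moreover have "c \<notin> set (rev W)" "c \<notin> set (rev X2 @ b # rev X1)" using rim_distinct[OF rim] W by auto
    ultimately show ?thesis using append_Cons_eq_iff[of c "rev W" "rev X2 @ b # rev X1" X3 Z'] by blast
  qed
  then have "num_spokes W = 0" using spokes by auto
  then have "rim_spokes = 3" using rim_num_spokes[OF rim] W spokes by simp
  then show False using rim_spokes_ge_4 by simp
qed

lemma sector_orient:
  assumes sector: "sector e X e'" and ab: "a \<in> {e, e'}" "b \<in> {e, e'}" "a \<noteq> b"
  obtains Y where "sector a Y b" "set Y = set X"
proof (cases "a = e")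
  case True
  then show thesis using that[of X] sector ab by auto
next
  case False
  then show thesis using that[of "rev X"] sector_rev[OF sector] ab by auto
qed

lemma sectors_meet_at_end:
  assumes sectors: "sector e X e'" "sector g X' g'" and disjoint: "set X \<inter> set X' = {}"
    and meet: "set (e # X @ [e']) \<inter> set (g # X' @ [g']) \<noteq> {}"
  obtains c where "c \<in> {e, e'}" "c \<in> {g, g'}"
proof -
  obtain c where c: "c \<in> set (e # X @ [e'])" "c \<in> set (g # X' @ [g'])" using meet by blast
  moreover have "c \<notin> set X" "c \<notin> set X'"
    using c disjoint sector_spokes[OF sectors(1)] sector_spokes[OF sectors(2)] num_spokes_0D[of X c]
      num_spokes_0D[of X' c]
    by auto
  ultimately show thesis using that by auto
qed

end

context minimal_proper_rim
begin

definition non_nbrs :: "'a set" where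
  "non_nbrs = {v\<in>V. v \<noteq> x \<and> \<not> E x v}"

lemma no_connected_link:
  assumes Q: "connected_set Q" "Q \<subseteq> non_nbrs - C"
    and s: "q \<in> Q" "E q s" and t: "q' \<in> Q" "E q' t" and separated: "rim_separated s t"
  shows False
proof -
  obtain p where p: "induced_path p" "p \<noteq> []" "set p \<subseteq> Q" "hd p = q" "last p = q'"
    using connected_set_obtain_path[OF Q(1) s(1) t(1)] .
  then have "set p \<inter> insert x C = {}" "num_spokes p = 0"
    using Q(2) unfolding num_spokes_0_iff non_nbrs_def by auto
  then have "link p s t" unfolding link_def using p s t separated by auto
  then show False using no_link by blast
qed

definition hangs_on :: "'a list \<Rightarrow> 'a \<Rightarrow> bool" where
  "hangs_on X w \<longleftrightarrow> (\<exists>Q. connected_set Q \<and> w \<in> Q \<and> Q \<subseteq> non_nbrs - C \<and> (\<exists>q\<in>Q. \<exists>a\<in>set X. E q a))"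

lemma hangs_onE:
  assumes "hangs_on X w"
  obtains Q q a where "connected_set Q" "w \<in> Q" "Q \<subseteq> non_nbrs - C" "q \<in> Q" "a \<in> set X" "E q a"
  using assms unfolding hangs_on_def by blast

lemma hangs_on_non_nbr: "hangs_on X w \<Longrightarrow> w \<in> non_nbrs - C"
  unfolding hangs_on_def by blast

lemma hangs_on_rim_nbr:
  assumes sector: "sector e X e'" and w: "hangs_on X w" and c: "c \<in> C" "E w c"
  shows "c \<in> set (e # X @ [e'])"
proof (rule ccontr)
  assume outside: "c \<notin> set (e # X @ [e'])"
  obtain Q q a where Q: "connected_set Q" "w \<in> Q" "Q \<subseteq> non_nbrs - C" "q \<in> Q" "a \<in> set X" "E q a"
    using w by (rule hangs_onE)
  have "rim_separated a c" using sector_separated[OF sector Q(5) c(1) outside] .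
  then show False by (rule no_connected_link[OF Q(1,3,4,6,2) c(2)])
qed

lemma hangs_on_step:
  assumes "hangs_on X w" "w' \<in> non_nbrs - C" "E w w'"
  shows "hangs_on X w'"
proof -
  obtain Q q a where Q: "connected_set Q" "w \<in> Q" "Q \<subseteq> non_nbrs - C" "q \<in> Q" "a \<in> set X" "E q a"
    using assms(1) by (rule hangs_onE)
  then have "connected_set (insert w' Q)" using connected_set_insert assms(3) by blast
  then show ?thesis unfolding hangs_on_def using Q assms(2) by blast
qed

lemma hangs_on_sector_nbr: "a \<in> set X \<Longrightarrow> w \<in> non_nbrs - C \<Longrightarrow> E a w \<Longrightarrow> hangs_on X w"
  unfolding hangs_on_def non_nbrs_def using connected_set_singleton E_commute
  by (intro exI[of _ "{w}"]) auto

lemma sector_component: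
  assumes sector: "sector e X e'" and a: "a \<in> set X" and w: "(a, w) \<in> (adj_on non_nbrs)\<^sup>*"
  shows "if w \<in> C then w \<in> set X else hangs_on X w"
  using w
proof (induction rule: rtrancl_induct)
  case base
  then show ?case using a sector_on_rim[OF sector] by auto
next
  case (step w w')
  then have w': "w' \<in> non_nbrs" "E w w'" unfolding adj_on_def by auto
  have not_end: "w' \<noteq> e" "w' \<noteq> e'" using w'(1) sector_spokes[OF sector] unfolding non_nbrs_def by auto
  show ?case
  proof (cases "w' \<in> C")
    case True
    have "w' \<in> set (e # X @ [e'])"
      using step.IH sector_nbr_on_rim[OF sector _ True w'(2)] hangs_on_rim_nbr[OF sector _ True w'(2)]
      by (auto split: if_splits)
    then show ?thesis using True not_end by auto
  next
    case False
    then have "hangs_on X w'" using step.IH w' hangs_on_step hangs_on_sector_nbr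
      by (auto split: if_splits)
    then show ?thesis using False by simp
  qed
qed

lemma sector_interior_connected:
  assumes sector: "sector e X e'" and "a \<in> set X" "b \<in> set X"
  shows "(a, b) \<in> (adj_on non_nbrs)\<^sup>*"
proof -
  obtain Y where rim: "rim (e # X @ e' # Y)" using sector_rim[OF sector] .
  have "induced_path X" using induced_cycle_infix[of "[e]" X "e' # Y"] rim_cycle[OF rim] by simp
  then have "connected_set (set X)" using connected_set_induced_path assms(2) by fastforce
  moreover have "set X \<subseteq> non_nbrs"
    using num_spokes_0D[OF sector_spokes(3)[OF sector]] induced_cycle_subset[OF rim_cycle[OF rim]]
      sector_on_rim[OF sector] hub_notin_rim unfolding non_nbrs_def by auto
  ultimately show ?thesis using connected_set_reach assms(2,3) by blast
qed

lemma sector_subset: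
  assumes sectors: "sector e X e'" "sector g X' g'" and c: "c \<in> set X" "c \<in> set X'"
  shows "set (g # X' @ [g']) \<subseteq> set (e # X @ [e'])"
proof -
  have interior: "set X' \<subseteq> set X"
  proof
    fix d assume "d \<in> set X'"
    then show "d \<in> set X"
      using sector_component[OF sectors(1) c(1) sector_interior_connected[OF sectors(2) c(2)], of d]
        sector_on_rim[OF sectors(2)] by (auto split: if_splits)
  qed
  have "X' \<noteq> []" using c(2) by auto
  then have ends: "h \<in> set (e # X @ [e'])" if end_of: "h \<in> {g, g'}" for h
  proof -
    obtain y where y: "y \<in> set X'" "E h y" using sector_end_nbr[OF sectors(2) \<open>X' \<noteq> []\<close> end_of] .
    have "h \<in> C" using sector_on_rim[OF sectors(2)] end_of by auto
    then show ?thesis using sector_nbr_on_rim[OF sectors(1), of y h] interior y E_commute by blast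
  qed
  show ?thesis using interior ends[of g] ends[of g'] by auto
qed

lemma sector_eq:
  assumes "sector e X e'" "sector g X' g'" "c \<in> set X" "c \<in> set X'"
  shows "set (g # X' @ [g']) = set (e # X @ [e'])"
  using sector_subset[OF assms] sector_subset[OF assms(2,1,4,3)] by blast

lemma sector_component_unique:
  assumes sectors: "sector e X e'" "sector g X' g'"
    and ab: "a \<in> set X" "b \<in> set X'" "(a, b) \<in> (adj_on non_nbrs)\<^sup>*"
  shows "set (g # X' @ [g']) = set (e # X @ [e'])"
proof -
  have "b \<in> C" using sector_on_rim[OF sectors(2)] ab(2) by auto
  then have "b \<in> set X" using sector_component[OF sectors(1) ab(1,3)] by simp
  then show ?thesis using sector_eq[OF sectors] ab(2) by blast
qed

lemma no_three_meeting_sectors: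
  assumes sectors: "sector e1 X1 f1" "sector e2 X2 f2" "sector e3 X3 f3"
    and nonempty: "X1 \<noteq> []" "X2 \<noteq> []" "X3 \<noteq> []"
    and different: "set (e1 # X1 @ [f1]) \<noteq> set (e2 # X2 @ [f2])"
      "set (e1 # X1 @ [f1]) \<noteq> set (e3 # X3 @ [f3])"
      "set (e2 # X2 @ [f2]) \<noteq> set (e3 # X3 @ [f3])"
    and meet: "set (e1 # X1 @ [f1]) \<inter> set (e2 # X2 @ [f2]) \<noteq> {}"
      "set (e1 # X1 @ [f1]) \<inter> set (e3 # X3 @ [f3]) \<noteq> {}"
        "set (e2 # X2 @ [f2]) \<inter> set (e3 # X3 @ [f3]) \<noteq> {}"
  shows False
proof -
  have disjoint: "set X1 \<inter> set X2 = {}" "set X1 \<inter> set X3 = {}" "set X2 \<inter> set X3 = {}"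
    using sector_eq[OF sectors(1,2)] sector_eq[OF sectors(1,3)] sector_eq[OF sectors(2,3)] different
    by blast+
  obtain c12 where c12: "c12 \<in> {e1, f1}" "c12 \<in> {e2, f2}"
    using sectors_meet_at_end[OF sectors(1,2) disjoint(1) meet(1)] .
  obtain c13 where c13: "c13 \<in> {e1, f1}" "c13 \<in> {e3, f3}"
    using sectors_meet_at_end[OF sectors(1,3) disjoint(2) meet(2)] .
  obtain c23 where c23: "c23 \<in> {e2, f2}" "c23 \<in> {e3, f3}"
    using sectors_meet_at_end[OF sectors(2,3) disjoint(3) meet(3)] .
  note three = no_three_sectors_at_spoke[OF sectors nonempty disjoint]
  have ends: "c13 \<noteq> c12" "c12 \<noteq> c23" "c13 \<noteq> c23" using three c12 c13 c23 by blast+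
  obtain Y1 where Y1: "sector c13 Y1 c12" "set Y1 = set X1"
    using sector_orient[OF sectors(1) c13(1) c12(1) ends(1)] .
  obtain Y2 where Y2: "sector c12 Y2 c23" "set Y2 = set X2"
    using sector_orient[OF sectors(2) c12(2) c23(1) ends(2)] .
  obtain Y3 where Y3: "sector c13 Y3 c23" "set Y3 = set X3"
    using sector_orient[OF sectors(3) c13(2) c23(2) ends(3)] .
  have "Y1 \<noteq> []" "Y2 \<noteq> []" "Y3 \<noteq> []" using nonempty Y1(2) Y2(2) Y3(2) by auto
  then show False
    using no_sector_triangle[OF Y1(1) Y2(1) Y3(1)] disjoint Y1(2) Y2(2) Y3(2) ends by auto
qed

section \<open>Sectors joined through a neighbour of the hub\<close>

definition sector_leg :: "'a \<Rightarrow> 'a list \<Rightarrow> 'a list \<Rightarrow> bool" where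
  "sector_leg u Z X \<longleftrightarrow> induced_path (u # Z) \<and> set Z \<inter> insert x C = {} \<and> num_spokes Z = 0
     \<and> (\<exists>a\<in>set X. E (last (u # Z)) a)"

lemma sector_leg_rev: "sector_leg u Z (rev X) \<longleftrightarrow> sector_leg u Z X"
  unfolding sector_leg_def by simp

lemma sector_leg_hangs_on:
  assumes leg: "sector_leg u Z X" and z: "z \<in> set Z"
  shows "hangs_on X z"
proof -
  have "set Z \<subseteq> non_nbrs - C"
    using leg induced_path_subset[of Z] num_spokes_0D[of Z] unfolding sector_leg_def non_nbrs_def
    by auto
  moreover have "last (u # Z) \<in> set Z" using z by auto
  moreover have "connected_set (set Z)" using leg z connected_set_induced_path unfolding sector_leg_def
    by fastforce
  ultimately show ?thesis using leg z unfolding sector_leg_def hangs_on_def by blast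
qed

lemma hangs_on_sector_leg:
  assumes w: "hangs_on X w" and u: "E x u" "E w u"
  obtains Z where "sector_leg u Z X"
proof -
  obtain Q q a where Q: "connected_set Q" "w \<in> Q" "Q \<subseteq> non_nbrs - C" "q \<in> Q" "a \<in> set X" "E q a"
    using w by (rule hangs_onE)
  obtain p where p: "induced_path p" "p \<noteq> []" "set p \<subseteq> insert u Q" "hd p = u" "last p = q"
    using connected_set_obtain_path[OF connected_set_insert[OF Q(1,2) u(2)], of u q] Q(4) by blast
  then obtain Z where Z: "p = u # Z" by (cases p) auto
  then have "set Z \<subseteq> Q" using p(1,3) by auto
  then have "set Z \<inter> insert x C = {}" "num_spokes Z = 0"
    using Q(3) unfolding num_spokes_0_iff non_nbrs_def by auto
  then have "sector_leg u Z X" unfolding sector_leg_def using p Z Q(5,6) by auto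
  then show thesis by (rule that)
qed

lemma sector_legs_apart:
  assumes sectors: "sector e X e'" "sector f Y f'"
    and disjoint: "set (e # X @ [e']) \<inter> set (f # Y @ [f']) = {}"
    and legs: "sector_leg u Z X" "sector_leg u Z' Y"
  shows "set Z \<inter> set Z' = {}" "edges_between (set Z) (set Z') = {}"
proof -
  have hangs_on_both: False if z: "hangs_on X z" "hangs_on Y z" for z
  proof -
    obtain Q q b where Q: "connected_set Q" "z \<in> Q" "Q \<subseteq> non_nbrs - C" "q \<in> Q" "b \<in> set Y" "E q b"
      using z(2) by (rule hangs_onE)
    obtain Q' q' a where Q': "connected_set Q'" "z \<in> Q'" "Q' \<subseteq> non_nbrs - C" "q' \<in> Q'" "a \<in> set X"
      "E q' a"
      using z(1) by (rule hangs_onE)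
    have "connected_set (Q' \<union> Q)" using connected_set_union_meet[OF Q'(1) Q(1)] Q(2) Q'(2) by blast
    moreover have "Q' \<union> Q \<subseteq> non_nbrs - C" using Q(3) Q'(3) by blast
    ultimately have "hangs_on X q" unfolding hangs_on_def using Q(4) Q'(4-6) by blast
    then show False using hangs_on_rim_nbr[OF sectors(1), of q b]
      sector_on_rim[OF sectors(2)] Q(5,6) disjoint by auto
  qed
  then show "set Z \<inter> set Z' = {}" using sector_leg_hangs_on legs by blast
  have "\<not> E z z'" if z: "z \<in> set Z" "z' \<in> set Z'" for z z'
  proof
    assume "E z z'"
    moreover have "z' \<in> non_nbrs - C" using hangs_on_non_nbr[OF sector_leg_hangs_on[OF legs(2) z(2)]] .
    ultimately have "hangs_on X z'" using hangs_on_step sector_leg_hangs_on[OF legs(1) z(1)] by blast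
    then show False using hangs_on_both sector_leg_hangs_on[OF legs(2) z(2)] by blast
  qed
  then show "edges_between (set Z) (set Z') = {}" unfolding edges_between_def by blast
qed

context
  fixes e X e' A f' Y f B u Z1 Z2 Xa s Xb Ya t Yb
  assumes rim: "rim (e # X @ e' # A @ f' # rev Y @ f # B)"
    and sectors: "sector e X e'" "sector f Y f'"
    and u: "u \<notin> C" "E x u" "\<And>b. b \<in> set B \<Longrightarrow> \<not> E u b"
    and s: "e # X = Xa @ s # Xb" "E (last (u # Z1)) s" "\<And>z. z \<in> set (u # Z1) \<Longrightarrow> E z s
      \<Longrightarrow> z = last (u # Z1)"
    and t: "f # Y = Ya @ t # Yb" "E (last (u # Z2)) t" "\<And>z. z \<in> set (u # Z2) \<Longrightarrow> E z t
      \<Longrightarrow> z = last (u # Z2)"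
    and Z1: "induced_path (u # Z1)" "\<And>z. z \<in> set Z1 \<Longrightarrow> hangs_on X z"
      "\<And>z c. z \<in> set (u # Z1) \<Longrightarrow> c \<in> set Xa \<Longrightarrow> \<not> E z c"
    and Z2: "induced_path (u # Z2)" "\<And>z. z \<in> set Z2 \<Longrightarrow> hangs_on Y z"
      "\<And>z c. z \<in> set (u # Z2) \<Longrightarrow> c \<in> set Ya \<Longrightarrow> \<not> E z c"
    and apart: "set Z1 \<inter> set Z2 = {}" "edges_between (set Z1) (set Z2) = {}"
begin

lemma joined_legs_arc: "rim ((t # rev Ya @ B @ Xa @ [s]) @ (Xb @ e' # A @ f' # rev Yb))"
proof -
  have "rev Y @ [f] = rev Yb @ t # rev Ya" using arg_cong[OF t(1), of rev] by simp
  then have split: "e # X @ e' # A @ f' # rev Y @ f # B = (e # X) @ e' # A @ f' # (rev Yb @ t # rev Ya)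
    @ B"
    by (metis append.assoc append_Cons append_Nil)
  have "rim ((Xa @ s # Xb) @ e' # A @ f' # (rev Yb @ t # rev Ya) @ B)" using rim unfolding split s(1) .
  then have "rim ((Xa @ [s]) @ (Xb @ e' # A @ f' # rev Yb) @ (t # rev Ya @ B))" by simp
  from rim_rotate[OF this] have "rim ((Xb @ e' # A @ f' # rev Yb) @ (t # rev Ya @ B @ Xa @ [s]))"
    by simp
  then show ?thesis by (rule rim_rotate)
qed

lemma joined_legs_subsets: "set (Xa @ [s]) \<subseteq> set (e # X)" "set (Ya @ [t]) \<subseteq> set (f # Y)"
  unfolding s(1) t(1) by auto

lemma joined_legs_cross:
  assumes z: "z \<in> set (rev Z1 @ u # Z2)" and c: "c \<in> set (t # rev Ya @ B @ Xa @ [s])"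
  shows "E z c \<longleftrightarrow> z = last (u # Z2) \<and> c = t \<or> z = last (u # Z1) \<and> c = s"
proof -
  note dist = rim_distinct[OF rim]
  have on_rim: "c \<in> C" using c rim_set[OF joined_legs_arc] by auto
  have Z1_away: "\<not> E z c" if "z \<in> set Z1" "c \<in> set (Ya @ [t]) \<union> set B" for z
    using hangs_on_rim_nbr[OF sectors(1) Z1(2)[OF that(1)] on_rim] that(2) joined_legs_subsets(2) dist
    by auto
  have Z2_away: "\<not> E z c" if "z \<in> set Z2" "c \<in> set (Xa @ [s]) \<union> set B" for z
    using hangs_on_rim_nbr[OF sectors(2) Z2(2)[OF that(1)] on_rim] that(2) joined_legs_subsets(1) dist
    by auto
  have s_neq_t: "s \<noteq> t" using joined_legs_subsets dist by auto
  consider (inner) "c \<in> set Xa \<union> set Ya \<union> set B" | (at_s) "c = s" | (at_t) "c = t" using c by auto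
  then show ?thesis
  proof cases
    case inner
    then have "\<not> E z c" using z u(3) Z1_away Z2_away Z1(3) Z2(3) by auto
    then show ?thesis using s(2) t(2) by blast
  next
    case at_s
    then show ?thesis using z s(2,3) Z2_away s_neq_t by auto
  next
    case at_t
    then show ?thesis using z t(2,3) Z1_away s_neq_t by auto
  qed
qed

lemma joined_legs_cycle: "induced_cycle ((rev Z1 @ u # Z2) @ (t # rev Ya @ B @ Xa @ [s]))"
proof -
  have arc: "induced_path (t # rev Ya @ B @ Xa @ [s])"
    using induced_cycle_infix[of "[]" "t # rev Ya @ B @ Xa @ [s]" "Xb @ e' # A @ f' # rev Yb"]
      rim_cycle[OF joined_legs_arc] by (simp del: induced_cycle.simps induced_path.simps)
  have path: "induced_path (rev Z1 @ u # Z2)" using induced_path_join Z1(1) Z2(1) apart by blast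
  have ends: "hd (rev Z1 @ u # Z2) = last (u # Z1)" "last (rev Z1 @ u # Z2) = last (u # Z2)"
    by (simp_all add: hd_append hd_rev)
  have "set (t # rev Ya @ B @ Xa @ [s]) \<subseteq> C" using rim_set[OF joined_legs_arc] by auto
  moreover have "set (rev Z1 @ u # Z2) \<inter> C = {}"
    using u(1) hangs_on_non_nbr[OF Z1(2)] hangs_on_non_nbr[OF Z2(2)] by auto
  ultimately have disjoint: "set (rev Z1 @ u # Z2) \<inter> set (t # rev Ya @ B @ Xa @ [s]) = {}" by blast
  have length: "3 \<le> length ((rev Z1 @ u # Z2) @ (t # rev Ya @ B @ Xa @ [s]))" by simp
  show ?thesis
    using induced_cycle_append[of "rev Z1 @ u # Z2" "t # rev Ya @ B @ Xa @ [s]"] path arc disjoint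
      length
      joined_legs_cross unfolding ends by simp
qed

lemma joined_legs_detour: "detour (rev Z1 @ u # Z2) (t # rev Ya @ B @ Xa @ [s])"
proof (rule detourI[OF joined_legs_cycle _ _ _ joined_legs_arc])
  have "z \<notin> insert x C \<and> \<not> E x z" if "z \<in> set Z1 \<union> set Z2" for z
    using that hangs_on_non_nbr Z1(2)[of z] Z2(2)[of z] unfolding non_nbrs_def by blast
  then have off: "set (rev Z1 @ u # Z2) \<inter> insert x C = {}"
    and spokeless: "num_spokes Z1 = 0" "num_spokes Z2 = 0"
    using u(1,2) E_irrefl unfolding num_spokes_0_iff by auto
  show "set (rev Z1 @ u # Z2) \<inter> insert x C = {}" by (rule off)
  have path: "num_spokes (rev Z1 @ u # Z2) = 1" using spokeless u(2) by simp
  then show "spokes_terminal (rev Z1 @ u # Z2)" by (intro spokes_terminal_le_1) simp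
  have "num_spokes (Xa @ [s]) = 1" using s(1) sector_spokes[OF sectors(1)] by (cases Xa) auto
  moreover have "num_spokes (Ya @ [t]) = 1" using t(1) sector_spokes[OF sectors(2)] by (cases Ya) auto
  ultimately have total: "num_spokes ((rev Z1 @ u # Z2) @ (t # rev Ya @ B @ Xa @ [s]))
    = 3 + num_spokes B"
    using path by simp
  then show "3 \<le> num_spokes ((rev Z1 @ u # Z2) @ (t # rev Ya @ B @ Xa @ [s]))" by simp
  have "rim_spokes = 4 + num_spokes A + num_spokes B"
    using rim_num_spokes[OF rim] sector_spokes[OF sectors(1)] sector_spokes[OF sectors(2)] by simp
  then show "num_spokes ((rev Z1 @ u # Z2) @ (t # rev Ya @ B @ Xa @ [s])) < rim_spokes"
    using total by simp
qed auto

end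

text \<open>The detour passes through \<open>u\<close> and along the rim through \<open>B\<close>, missing \<open>e'\<close> and \<open>f'\<close>.\<close>

lemma hub_nbr_no_legs_across_gap:
  assumes rim: "rim (e # X @ e' # A @ f' # rev Y @ f # B)" and sectors: "sector e X e'" "sector f Y f'"
    and u: "u \<notin> C" "E x u" "\<And>b. b \<in> set B \<Longrightarrow> \<not> E u b"
    and legs: "sector_leg u L X" "sector_leg u M Y"
  shows False
proof -
  have disjoint: "set (e # X @ [e']) \<inter> set (f # Y @ [f']) = {}" using rim_distinct[OF rim] by auto
  note apart = sector_legs_apart[OF sectors disjoint legs]
  obtain a where a: "a \<in> set (e # X)" "E (last (u # L)) a" using legs(1) unfolding sector_leg_def
    by auto
  have "induced_path (u # L)" using legs(1) unfolding sector_leg_def by blast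
  then obtain Xa s Xb Z1 where s: "e # X = Xa @ s # Xb" and Z1: "induced_path (u # Z1)" "set Z1 \<subseteq> set L"
    "E (last (u # Z1)) s" "\<And>z. z \<in> set (u # Z1) \<Longrightarrow> E z s \<Longrightarrow> z = last (u # Z1)"
    "\<And>z c. z \<in> set (u # Z1) \<Longrightarrow> c \<in> set Xa \<Longrightarrow> \<not> E z c"
    by (rule shortest_leg[OF _ last_in_set a]) (simp, rule that)
  obtain b where b: "b \<in> set (f # Y)" "E (last (u # M)) b" using legs(2) unfolding sector_leg_def
    by auto
  have "induced_path (u # M)" using legs(2) unfolding sector_leg_def by blast
  then obtain Ya t Yb Z2 where t: "f # Y = Ya @ t # Yb" and Z2: "induced_path (u # Z2)" "set Z2 \<subseteq> set M"
    "E (last (u # Z2)) t" "\<And>z. z \<in> set (u # Z2) \<Longrightarrow> E z t \<Longrightarrow> z = last (u # Z2)"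
    "\<And>z c. z \<in> set (u # Z2) \<Longrightarrow> c \<in> set Ya \<Longrightarrow> \<not> E z c"
    by (rule shortest_leg[OF _ last_in_set b]) (simp, rule that)
  have "detour (rev Z1 @ u # Z2) (t # rev Ya @ B @ Xa @ [s])"
  proof (rule joined_legs_detour[OF rim sectors u s Z1(3,4) t Z2(3,4) Z1(1) _ Z1(5) Z2(1) _ Z2(5)])
    show "hangs_on X z" if "z \<in> set Z1" for z using sector_leg_hangs_on[OF legs(1)] Z1(2) that by blast
    show "hangs_on Y z" if "z \<in> set Z2" for z using sector_leg_hangs_on[OF legs(2)] Z2(2) that by blast
    show "set Z1 \<inter> set Z2 = {}" "edges_between (set Z1) (set Z2) = {}"
      using apart Z1(2) Z2(2) unfolding edges_between_def by blast+
  qed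
  then show False using no_detour by blast
qed

lemma hub_nbr_one_gap:
  assumes rim: "rim (e # X @ e' # A @ f' # Y @ f # B)" and spokes: "E x e" "E x e'" "E x f" "E x f'"
    and u: "off_rim u" "E x u" and c: "c \<in> set (e' # A @ [f'])" "E u c"
    and c': "c' \<in> set (f # B @ [e])" "E u c'"
  shows False
proof -
  obtain A1 A2 where A: "e' # A @ [f'] = A1 @ c # A2" using c(1) by (meson split_list)
  obtain B1 B2 where B: "f # B @ [e] = B1 @ c' # B2" using c'(1) by (meson split_list)
  note dist = rim_distinct[OF rim]
  have different: "\<not> (E x c \<and> E x c')"
  proof
    assume "E x c \<and> E x c'"
    then have "c = c'" using triangles_share_edge[of x u c c'] u(2) c(2) c'(2) by blast
    then show False using c(1) c'(1) dist by auto
  qed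
  have "rim (X @ (e' # A @ [f']) @ Y @ (f # B @ [e]))"
    using rim_rotate[of "[e]" "X @ e' # A @ f' # Y @ f # B"] rim by simp
  then have "rim (X @ (A1 @ c # A2) @ Y @ (B1 @ c' # B2))" unfolding A B .
  then have "unseparated ((X @ A1) @ c # (A2 @ Y @ B1) @ c' # B2) u" using rim_unseparated[OF _ u(1)]
    by simp
  from unseparatedD[OF this c(2) c'(2)] show False
  proof
    assume gap: "num_spokes (A2 @ Y @ B1) = 0"
    have "c = f'" using A gap spokes(4) by (cases A2 rule: rev_cases) auto
    moreover have "c' = f" using B gap spokes(3) by (cases B1) auto
    ultimately show False using different spokes by blast
  next
    assume gap: "num_spokes ((X @ A1) @ B2) = 0"
    have "c = e'" using A gap spokes(2) by (cases A1) auto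
    moreover have "c' = e" using B gap spokes(1) by (cases B2 rule: rev_cases) auto
    ultimately show False using different spokes by blast
  qed
qed

lemma hub_nbr_no_legs_to_disjoint_sectors:
  assumes rim: "rim (e # X @ e' # A @ f' # rev Y @ f # B)" and sectors: "sector e X e'" "sector f Y f'"
    and u: "off_rim u" "E x u" and legs: "sector_leg u L X" "sector_leg u M Y"
  shows False
proof (cases "\<exists>b\<in>set B. E u b")
  case False
  then show False using hub_nbr_no_legs_across_gap[OF rim sectors _ u(2) _ legs] u(1)
    unfolding off_rim_def by blast
next
  case True
  then obtain c' where c': "c' \<in> set (f # B @ [e])" "E u c'" by auto
  have no_nbr: "\<not> E u c" if "c \<in> set (rev A)" for c
    using hub_nbr_one_gap[OF rim sector_spokes(1,2)[OF sectors(1)] sector_spokes(1,2)[OF sectors(2)] u _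
      _ c'] that
    by auto
  have "rim ((rev B @ [f] @ Y @ f' # rev A) @ (e' # rev X @ [e]))" using rim_rev[OF rim] by simp
  from rim_rotate[OF this] have "rim (e' # rev X @ e # rev B @ f # rev (rev Y) @ f' # rev A)" by simp
  then show False
    by (rule hub_nbr_no_legs_across_gap[OF _ sector_rev[OF sectors(1)] sector_rev[OF sectors(2)]])
      (use u no_nbr legs in \<open>auto simp: sector_leg_rev off_rim_def\<close>)
qed

lemma sector_leg_exists:
  assumes sector: "sector e X e'" and a: "a \<in> set X" "(a, z) \<in> (adj_on non_nbrs)\<^sup>*" "E z u"
    and u: "E x u"
  obtains Z where "sector_leg u Z X"
proof (cases "z \<in> C")
  case True
  then have "z \<in> set X" using sector_component[OF sector a(1,2)] by simp
  then have "sector_leg u [] X" unfolding sector_leg_def using a(3) E_V[OF E_sym[OF u]] E_commute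
    by auto
  then show thesis by (rule that)
next
  case False
  then have "hangs_on X z" using sector_component[OF sector a(1,2)] by simp
  then show thesis using hangs_on_sector_leg u a(3) that by blast
qed

lemma sector_component_rim_nbr:
  assumes sector: "sector e X e'" and a: "a \<in> set X" "(a, z) \<in> (adj_on non_nbrs)\<^sup>*" "E z u"
    and u: "u \<in> C"
  shows "u \<in> set (e # X @ [e'])"
  using sector_component[OF sector a(1,2)] sector_nbr_on_rim[OF sector _ u a(3)]
    hangs_on_rim_nbr[OF sector _ u a(3)]
  by (auto split: if_splits)

lemma sectors_through_nbr_meet:
  assumes sectors: "sector e X e'" "sector g X' g'" and u: "E x u"
    and a: "a \<in> set X" "(a, z) \<in> (adj_on non_nbrs)\<^sup>*" "E z u"
    and b: "b \<in> set X'" "(b, z') \<in> (adj_on non_nbrs)\<^sup>*" "E z' u"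
  shows "set (e # X @ [e']) \<inter> set (g # X' @ [g']) \<noteq> {}"
proof (cases "u \<in> C")
  case True
  then show ?thesis using sector_component_rim_nbr[OF sectors(1) a]
    sector_component_rim_nbr[OF sectors(2) b] by blast
next
  case False
  then have off: "off_rim u" using E_V[OF E_sym[OF u]] u E_irrefl unfolding off_rim_def by auto
  obtain L where leg: "sector_leg u L X" using sector_leg_exists[OF sectors(1) a u] .
  obtain M where leg': "sector_leg u M X'" using sector_leg_exists[OF sectors(2) b u] .
  show ?thesis
  proof
    assume "set (e # X @ [e']) \<inter> set (g # X' @ [g']) = {}"
    then show False
    proof (cases rule: disjoint_sectors_rim[OF sectors, case_names _ forward backward])
      case (forward A B)
      then have "rim (e # X @ e' # A @ g # rev (rev X') @ g' # B)" by simp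
      then show False
        using hub_nbr_no_legs_to_disjoint_sectors[OF _ sectors(1) sector_rev[OF sectors(2)] off u leg]
          leg'
        unfolding sector_leg_rev by blast
    next
      case (backward A B)
      then show False using hub_nbr_no_legs_to_disjoint_sectors[OF _ sectors off u leg leg'] by blast
    qed
  qed
qed

lemma non_nbrs_path_to_nbr:
  assumes path: "(a, u) \<in> (adj_on S)\<^sup>*" and S: "S \<subseteq> insert u non_nbrs" and a: "a \<in> non_nbrs"
    and u: "u \<notin> non_nbrs"
  obtains z where "(a, z) \<in> (adj_on non_nbrs)\<^sup>*" "E z u"
proof -
  have "(\<exists>z. (a, z) \<in> (adj_on non_nbrs)\<^sup>* \<and> E z u) \<or> b \<in> non_nbrs \<and> (a, b) \<in> (adj_on non_nbrs)\<^sup>*"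
    if "(a, b) \<in> (adj_on S)\<^sup>*" for b
    using that
  proof (induction rule: rtrancl_induct)
    case base
    then show ?case using a by blast
  next
    case (step b c)
    have c: "c \<in> S" "E b c" using step.hyps(2) unfolding adj_on_def by auto
    then have "b \<in> non_nbrs \<Longrightarrow> c \<noteq> u \<Longrightarrow> c \<in> non_nbrs \<and> (b, c) \<in> adj_on non_nbrs"
      using S unfolding adj_on_def by blast
    then show ?case using step.IH c(2) by (metis rtrancl_into_rtrancl)
  qed
  then show thesis using path u that by blast
qed

end

section \<open>Pair graphs\<close>

definition adj :: "'a pair_pre_digraph \<Rightarrow> 'a \<Rightarrow> 'a \<Rightarrow> bool" where
  "adj G a b \<longleftrightarrow> (a, b) \<in> parcs G"

lemma pcas_vwalk_arcs:
  "pcas u es v \<Longrightarrow> es = vwalk_arcs (map fst es @ [v]) \<and> pawalk_verts u es = map fst es @ [v]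
     \<and> hd (map fst es @ [v]) = u"
proof (induction es arbitrary: u)
  case (Cons e es)
  obtain a b where e: "e = (a, b)" by (cases e)
  have "a = u" "pcas b es v" using Cons.prems e by auto
  then have IH: "es = vwalk_arcs (map fst es @ [v])" "pawalk_verts b es = map fst es @ [v]"
    "hd (map fst es @ [v]) = b"
    using Cons.IH by blast+
  obtain ws where ws: "map fst es @ [v] = b # ws" using IH(3) by (cases es) auto
  have "vwalk_arcs (a # map fst es @ [v]) = (a, b) # vwalk_arcs (map fst es @ [v])" unfolding ws by simp
  then show ?case using IH e \<open>a = u\<close> by simp
qed simp

lemma vwalk_arcs_pcas:
  "p \<noteq> [] \<Longrightarrow> pcas (hd p) (vwalk_arcs p) (last p) \<and> pawalk_verts (hd p) (vwalk_arcs p) = p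
     \<and> fst ` set (vwalk_arcs p) = set (butlast p) \<and> Suc (length (vwalk_arcs p)) = length p"
  by (induction p rule: induct_list012) auto

lemma successively_vwalk_arcs: "successively P p \<longleftrightarrow> (\<forall>(y, z)\<in>set (vwalk_arcs p). P y z)"
  by (induction p rule: induct_list012) auto

sublocale pair_graph \<subseteq> simple_graph "pverts G" "adj G"
proof
  show "finite (pverts G)" by (rule pair_finite_verts)
  show "adj G b a" if "adj G a b" for a b using that arcs_symmetric unfolding adj_def by blast
  show "\<not> adj G a a" for a using pair_no_loops[of "(a, a)"] unfolding adj_def by auto
  show "a \<in> pverts G" if "adj G a b" for a b using that arc_fst_in_verts[of "(a, b)"] unfolding adj_def
    by auto
qed

context pair_graph
begin

lemma nbhd_adj: "nbhd G v = {y. adj G v y}"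
  unfolding nbhd_def adj_def by simp

lemma nbhd_Int: "nbhd G v \<inter> C = nbrs_in v C"
  unfolding nbhd_adj nbrs_in_def by auto

lemma arcs_induce_subgraph: "arcs (with_proj G \<restriction> C) = adj_on C"
  unfolding adj_on_def adj_def induce_subgraph_def by auto

lemma arcs_ends_induce_subgraph: "arcs_ends (with_proj G \<restriction> C) = adj_on C"
  unfolding arcs_ends_def arcs_induce_subgraph unfolding arc_to_ends_def induce_subgraph_def by auto

definition induced_pgraph :: "'a set \<Rightarrow> 'a pair_pre_digraph" where
  "induced_pgraph U = \<lparr>pverts = U, parcs = adj_on U\<rparr>"

lemma induced_pgraph_simps[simp]: "pverts (induced_pgraph U) = U" "parcs (induced_pgraph U) = adj_on U"
  unfolding induced_pgraph_def by simp_all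

lemma induced_freeD:
  assumes free: "induced_free P G" and U: "U \<subseteq> pverts G"
  shows "\<not> P (induced_pgraph U)"
proof -
  have "pair_wf_digraph (induced_pgraph U)" by unfold_locales (auto simp: adj_on_def)
  then have "wf_digraph (with_proj (induced_pgraph U))" unfolding wf_digraph_wp_iff .
  moreover have "wf_digraph (with_proj G)" unfolding wf_digraph_wp_iff by unfold_locales
  moreover have "adj_on U \<subseteq> parcs G" "adj_on U = {e\<in>parcs G. fst e \<in> U \<and> snd e \<in> U}"
    unfolding adj_on_def adj_def by auto
  ultimately have "induced_subgraph (with_proj (induced_pgraph U)) (with_proj G)"
    unfolding induced_subgraph_def subgraph_def compatible_def using U by auto
  then show ?thesis using free unfolding induced_free_def by blast
qed

lemma hole_induced_cycle:
  assumes "hole G C"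
  obtains cs where "induced_cycle cs" "set cs = C"
proof -
  obtain es where cycle: "pre_digraph.cycle (with_proj G) es" and len: "4 \<le> length es"
    and C: "C = fst ` set es"
    and arcs: "arcs (with_proj G \<restriction> C) = symcl (set es)"
    using assms unfolding hole_def by blast
  obtain u where walk: "pre_digraph.awalk (with_proj G) u es u"
    and dist: "distinct (tl (pawalk_verts u es))"
    and nonempty: "es \<noteq> []"
    using cycle unfolding pre_digraph.cycle_def awalk_verts_with_proj_eq by blast
  have subset: "set es \<subseteq> parcs G" and cas: "pcas u es u"
    using walk unfolding pre_digraph.awalk_def cas_with_proj_eq by auto
  note verts = pcas_vwalk_arcs[OF cas]
  obtain L where L: "map fst es = u # L" using verts nonempty by (cases es) auto
  have "set es = set (vwalk_arcs (u # L @ [u]))" using verts L by (metis append_Cons)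
  then have adj_on: "adj_on C = path_edges (u # L @ [u])" using arcs
    unfolding arcs_induce_subgraph path_edges_def by simp
  have C': "C = set (u # L)" using C arg_cong[OF L, of set] by simp
  have "C \<subseteq> pverts G" using C subset E_V unfolding adj_def by fastforce
  moreover have "distinct (u # L)" using dist verts L by auto
  moreover have "2 \<le> length L" using arg_cong[OF L, of length] len by simp
  ultimately have "induced_cycle (u # L)" using induced_cycleI adj_on unfolding C' by blast
  then show thesis using that C' by blast
qed

lemma induced_cycle_hole:
  assumes cyc: "induced_cycle cs" and len: "4 \<le> length cs"
  shows "hole G (set cs)"
proof -
  obtain u L where cs: "cs = u # L" using len by (cases cs) auto
  define p where "p = u # L @ [u]"
  have ends: "hd p = u" "last p = u" "butlast p = u # L" "p \<noteq> []" unfolding p_def by auto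
  note walk = vwalk_arcs_pcas[OF ends(4), unfolded ends(1-3)]
  have edges: "adj_on (set cs) = path_edges p"
    using adj_on_induced_cycle[of u L] cyc unfolding cs p_def by blast
  then have arcs: "arcs (with_proj G \<restriction> set cs) = symcl (set (vwalk_arcs p))"
    unfolding arcs_induce_subgraph path_edges_def .
  have "set (vwalk_arcs p) \<subseteq> parcs G"
    using edges unfolding path_edges_def adj_on_def adj_def by (auto simp: symcl_iff set_eq_iff)
  moreover have "u \<in> pverts G" using induced_cycle_subset[OF cyc] cs by auto
  ultimately have "pre_digraph.awalk (with_proj G) u (vwalk_arcs p) u"
    unfolding pre_digraph.awalk_def cas_with_proj_eq using walk by auto
  moreover have "distinct (tl (pawalk_verts u (vwalk_arcs p)))"
    using walk induced_cycle_distinct[OF cyc] unfolding cs p_def by auto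
  moreover have "length (vwalk_arcs p) = length cs" "vwalk_arcs p \<noteq> []" using walk len
    unfolding cs p_def by auto
  ultimately have "pre_digraph.cycle (with_proj G) (vwalk_arcs p)"
    unfolding pre_digraph.cycle_def awalk_verts_with_proj_eq by blast
  then show ?thesis
    unfolding hole_def using arcs walk len cs \<open>length (vwalk_arcs p) = length cs\<close>
    by (intro exI[of _ "vwalk_arcs p"]) auto
qed

lemma vpath_induce_subgraph:
  "vpath p (with_proj G \<restriction> C) \<longleftrightarrow> p \<noteq> [] \<and> distinct p \<and> set p \<subseteq> C \<and> successively (adj G) p"
proof -
  have "set (vwalk_arcs p) \<subseteq> set p \<times> set p"
    using path_edges_subset[of p] unfolding path_edges_def symcl_def by auto
  then have "set (vwalk_arcs p) \<subseteq> adj_on C \<longleftrightarrow> successively (adj G) p" if "set p \<subseteq> C"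
    using that unfolding successively_vwalk_arcs adj_on_def by blast
  then show ?thesis unfolding vpath_def vwalk_def arcs_ends_induce_subgraph by auto
qed

lemma sector_path_induced_cycle:
  assumes cyc: "induced_cycle cs" "set cs = C" and path: "sector_path G C x p"
  obtains e X e' Z where "p = e # X @ [e']" "induced_cycle (e # X @ e' # Z)" "set (e # X @ e' # Z) = C"
    "adj G x e" "adj G x e'" "\<forall>y\<in>set X. \<not> adj G x y" "path_interior p = set X"
proof -
  have p: "distinct p" "set p \<subseteq> C" "successively (adj G) p" "2 \<le> length p"
    "hd p \<in> spokes G C x" "last p \<in> spokes G C x" "path_interior p \<inter> spokes G C x = {}"
    using path unfolding sector_path_def vpath_induce_subgraph by auto
  obtain e p1 where "p = e # p1" "p1 \<noteq> []" using p(4) by (cases p) (auto simp: Suc_le_eq)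
  then obtain X e' where split: "p = e # X @ [e']" by (metis append_butlast_last_id)
  then have interior: "path_interior p = set X" unfolding path_interior_def by simp
  have "e \<in> set cs" using p(2) split cyc(2) by auto
  then obtain A B where cs: "cs = A @ e # B" by (meson split_list)
  have rotated: "induced_cycle (e # (B @ A))" "set (e # (B @ A)) = C"
    using induced_cycle_rotate[of A "e # B"] cyc cs by (auto simp del: induced_cycle.simps)
  obtain Z where "e # (B @ A) = p @ Z \<or> e # rev (B @ A) = p @ Z"
    using induced_cycle_walk[OF rotated(1) p(3,1)] p(2) rotated(2) split by auto
  moreover have "induced_cycle (e # rev (B @ A))" "set (e # rev (B @ A)) = C"
    using induced_cycle_reorient[OF rotated(1)] rotated(2) by auto
  ultimately have "induced_cycle (p @ Z)" "set (p @ Z) = C" using rotated by metis+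
  moreover have "p @ Z = e # X @ e' # Z" using split by simp
  ultimately show thesis
    using that[OF split] interior p(2,5-7) split unfolding spokes_def nbhd_adj by auto
qed

lemma induced_cycle_sector_path:
  assumes cyc: "induced_cycle (e # X @ e' # Z)" and ends: "adj G x e" "adj G x e'"
    and X: "\<forall>y\<in>set X. \<not> adj G x y"
  shows "sector_path G (set (e # X @ e' # Z)) x (e # X @ [e'])"
proof -
  have "successively (adj G) (e # X @ [e'])"
    using induced_cycle_successively[OF cyc] successively_append_iff[of "adj G" "e # X @ [e']" Z]
    by auto
  moreover have "distinct (e # X @ [e'])" using induced_cycle_distinct[OF cyc] by auto
  moreover have "path_interior (e # X @ [e']) = set X" unfolding path_interior_def by simp
  ultimately show ?thesis
    unfolding sector_path_def vpath_induce_subgraph spokes_def nbhd_adj using ends X by auto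
qed

lemma component_subset:
  assumes "D \<in> components_without G Y"
  shows "verts D \<subseteq> pverts G - Y"
  using assms
  unfolding components_without_def pre_digraph.sccs_def induced_subgraph_def subgraph_def
    induce_subgraph_def by auto

lemma component_reach:
  assumes D: "D \<in> components_without G Y" and ab: "a \<in> verts D" "b \<in> verts D"
  shows "(a, b) \<in> (adj_on (verts D))\<^sup>*"
proof -
  have induced: "induced_subgraph D (with_proj G \<restriction> (pverts G - Y))" and strong: "strongly_connected D"
    using D unfolding components_without_def pre_digraph.sccs_def by auto
  have D_arcs: "arcs D \<subseteq> parcs G" "tail D = fst" "head D = snd"
    using induced unfolding induced_subgraph_def subgraph_def compatible_def induce_subgraph_def by auto
  have "(a, b) \<in> rtrancl_on (verts D) (arcs_ends D)"
    using strong ab unfolding strongly_connected_def reachable_def by blast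
  then show ?thesis
  proof (induction rule: rtrancl_on_induct)
    case (step y z)
    then have "(y, z) \<in> adj_on (verts D)"
      using D_arcs unfolding adj_on_def adj_def arcs_ends_def arc_to_ends_def by auto
    then show ?case using step.IH by simp
  qed simp
qed

end

section \<open>Wheels\<close>

locale prism_ISK4_diamond_bowtie_free = pair_graph +
  assumes ISK4_free: "induced_free is_subdivided_K4 G"
    and diamond_free: "induced_free is_diamond G"
    and bowtie_free: "induced_free is_bowtie G"
    and prism_free: "induced_free is_prism G"

sublocale prism_ISK4_diamond_bowtie_free \<subseteq> K4_prism_free_graph "pverts G" "adj G"
proof
  fix a b c d :: 'a and p1 p2 p3 p4 p5 p6
  let ?U = "set ([a, b, c, d] @ p1 @ p2 @ p3 @ p4 @ p5 @ p6)"
  assume "distinct ([a, b, c, d] @ p1 @ p2 @ p3 @ p4 @ p5 @ p6)" and U: "?U \<subseteq> pverts G"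
    and "adj_on ?U = path_edges (a # p1 @ [b]) \<union> path_edges (a # p2 @ [c]) \<union> path_edges (a # p3 @ [d])
      \<union> path_edges (b # p4 @ [c]) \<union> path_edges (b # p5 @ [d]) \<union> path_edges (c # p6 @ [d])"
  then have "is_subdivided_K4 (induced_pgraph ?U)" by (intro subdivided_K4I) simp_all
  then show False using induced_freeD[OF ISK4_free U] by blast
next
  fix p q r :: "'a list"
  assume "2 \<le> length p" "2 \<le> length q" "2 \<le> length r" "distinct (p @ q @ r)"
    and U: "set (p @ q @ r) \<subseteq> pverts G"
    and "adj_on (set (p @ q @ r)) = path_edges p \<union> path_edges q \<union> path_edges r
      \<union> symcl {(hd p, hd q), (hd q, hd r), (hd r, hd p)}
        \<union> symcl {(last p, last q), (last q, last r), (last r, last p)}"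
  then have "is_prism (induced_pgraph (set (p @ q @ r)))"
    unfolding is_prism_def path_edges_def induced_pgraph_simps symcl_Un
    by (intro exI[of _ p] exI[of _ q] exI[of _ r]) (simp add: Un_assoc)
  then show False using induced_freeD[OF prism_free U] by blast
qed

context prism_ISK4_diamond_bowtie_free
begin

lemma edge_common_nbr_unique:
  assumes edges: "adj G a b" "adj G a c" "adj G b c" "adj G a e" "adj G b e"
  shows "c = e"
proof (rule ccontr)
  assume c_neq_e: "c \<noteq> e"
  note sym = edges[THEN E_sym]
  have distinct: "distinct [a, b, c, e]" using edges E_irrefl c_neq_e by auto
  have subset: "{a, b, c, e} \<subseteq> pverts G" using edges sym E_V by blast
  show False
  proof (cases "adj G c e")
    case True
    then have "adj_on {a, b, c, e} = path_edges [a, b] \<union> path_edges [a, c] \<union> path_edges [a, e]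
        \<union> path_edges [b, c] \<union> path_edges [b, e] \<union> path_edges [c, e]"
      using edges by (simp add: adj_on_insert nbrs_in_insert insert_commute)
    then show False using no_K4[of a b c e "[]" "[]" "[]" "[]" "[]" "[]"] distinct subset by simp
  next
    case False
    then have "adj_on {a, b, c, e} = symcl {(a, b), (a, c), (a, e), (b, c), (b, e)}"
      using edges by (simp add: adj_on_insert nbrs_in_insert insert_commute)
    then have "is_diamond (induced_pgraph {a, b, c, e})" unfolding is_diamond_def using distinct by auto
    then show False using induced_freeD[OF diamond_free subset] by blast
  qed
qed

lemma triangles_at_vertex_eq:
  assumes edges: "adj G a b" "adj G b c" "adj G a c" "adj G a d" "adj G d e" "adj G a e"
  shows "{b, c} = {d, e}"
proof (rule ccontr)
  assume different: "{b, c} \<noteq> {d, e}"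
  note sym = edges[THEN E_sym]
  have disjoint: "b \<noteq> d" "b \<noteq> e" "c \<noteq> d" "c \<noteq> e"
    using edge_common_nbr_unique[of a b c e] edge_common_nbr_unique[of a b c d]
      edge_common_nbr_unique[of a c b e] edge_common_nbr_unique[of a c b d] edges sym different
        by blast+
  have "\<not> adj G b d" "\<not> adj G b e" "\<not> adj G c d" "\<not> adj G c e"
    using edge_common_nbr_unique[of a b c d] edge_common_nbr_unique[of a b c e]
      edge_common_nbr_unique[of a c b d] edge_common_nbr_unique[of a c b e] edges sym disjoint by blast+
  then have "adj_on {a, b, c, d, e} = symcl {(a, b), (b, c), (c, a), (a, d), (d, e), (e, a)}"
    using edges by (simp add: adj_on_insert nbrs_in_insert insert_commute)
  moreover have "distinct [a, b, c, d, e]" using edges E_irrefl disjoint by auto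
  ultimately have "is_bowtie (induced_pgraph {a, b, c, d, e})"
    unfolding is_bowtie_def by (intro exI[of _ a] exI[of _ b] exI[of _ c] exI[of _ d] exI[of _ e]) simp
  moreover have "{a, b, c, d, e} \<subseteq> pverts G" using edges sym E_V by blast
  ultimately show False using induced_freeD[OF bowtie_free] by blast
qed

end

sublocale prism_ISK4_diamond_bowtie_free \<subseteq> tripod_free_graph "pverts G" "adj G"
  by unfold_locales (rule no_three_edges_to_connected_set triangles_at_vertex_eq; assumption)+

locale proper_wheel_graph = prism_ISK4_diamond_bowtie_free +
  fixes C x
  assumes proper_wheel: "proper_wheel G C x"

sublocale proper_wheel_graph \<subseteq> hub "pverts G" "adj G" x
  using proper_wheel unfolding proper_wheel_def wheel_def by unfold_locales blast

context proper_wheel_graph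
begin

lemma proper_wheel_vertex_unseparated:
  assumes cyc: "induced_cycle cs" "set cs = C" and v: "v \<in> pverts G" "v \<notin> C" "v \<noteq> x"
  shows "unseparated cs v"
proof -
  obtain p where p: "sector_path G C x p" "nbhd G v \<inter> C \<subseteq> set p"
    using proper_wheel v unfolding proper_wheel_def proper_vertex_def by blast
  obtain e X e' Z where sector: "p = e # X @ [e']" "induced_cycle (e # X @ e' # Z)"
    "set (e # X @ e' # Z) = C"
    "\<forall>y\<in>set X. \<not> adj G x y"
    by (rule sector_path_induced_cycle[OF cyc p(1)]) (rule that)
  have "\<not> adj G v b" if "b \<in> set Z" for b
  proof
    assume "adj G v b"
    then have "b \<in> set p" using p(2) that sector(3) unfolding nbhd_adj by auto
    then show False using induced_cycle_distinct[OF sector(2)] that sector(1) by auto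
  qed
  moreover have "num_spokes X = 0" unfolding num_spokes_0_iff by (rule sector(4))
  ultimately have "unseparated (e # X @ e' # Z) v" by (intro unseparated_inner[of _ "[]" e X e' Z]) auto
  then show ?thesis using unseparated_same_cycle[OF sector(2) cyc(1)] sector(3) cyc(2) by simp
qed

end

sublocale proper_wheel_graph \<subseteq> proper_rim "pverts G" "adj G" x C
proof
  have wheel: "hole G C" "x \<notin> C" "3 \<le> card (spokes G C x)"
    using proper_wheel unfolding proper_wheel_def wheel_def by auto
  obtain cs where cs: "induced_cycle cs" "set cs = C" using hole_induced_cycle[OF wheel(1)] .
  then show "\<exists>cs. induced_cycle cs \<and> set cs = C" by blast
  show "x \<notin> C" by (rule wheel(2))
  have "num_spokes cs = card (nbrs_in x C)"
    using num_spokes_card[OF induced_cycle_distinct[OF cs(1)]] cs(2) by simp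
  moreover have "num_spokes cs \<noteq> 3" using num_spokes_cycle_neq_3[OF cs(1)] wheel(2) cs(2) by simp
  ultimately show "4 \<le> card (nbrs_in x C)" using wheel(3) unfolding spokes_def nbhd_Int by simp
  fix bs v assume bs: "induced_cycle bs" "set bs = C" and v: "v \<in> pverts G" "v \<notin> C" "v \<noteq> x"
  have "proper_vertex G C x v" using proper_wheel v(1) unfolding proper_wheel_def by blast
  then have "card (nbrs_in v (set bs)) \<le> 2" if "\<not> adj G v x"
    using that v(2,3) bs(2) unfolding proper_vertex_def nbhd_Int by (auto simp: nbhd_adj)
  then show "proper_for bs v" using proper_wheel_vertex_unseparated[OF bs v] unfolding proper_for_def
    by blast
qed

context proper_wheel_graph
begin

lemma proper_wheelI:
  assumes L: "induced_cycle L" "x \<notin> set L" "4 \<le> num_spokes L"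
    and proper: "\<And>v. \<lbrakk>v \<in> pverts G; v \<notin> set L; v \<noteq> x\<rbrakk> \<Longrightarrow> proper_for L v"
  shows "proper_wheel G (set L) x"
proof -
  have "4 \<le> length L" using L(3) num_spokes_le_length[of L] by linarith
  then have wheel: "wheel G (set L) x"
    unfolding wheel_def spokes_def nbhd_Int
    using induced_cycle_hole[OF L(1)] x_V L(2,3) num_spokes_card[OF induced_cycle_distinct[OF L(1)]]
    by simp
  have "proper_vertex G (set L) x v" if v: "v \<in> pverts G" "v \<notin> insert x (set L)" for v
  proof -
    have v_proper: "unseparated L v" "\<not> adj G v x \<Longrightarrow> card (nbrs_in v (set L)) \<le> 2"
      using proper v unfolding proper_for_def by auto
    obtain f X f' Z where sector: "induced_cycle (f # X @ f' # Z)" "set (f # X @ f' # Z) = set L"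
      "adj G x f" "adj G x f'"
      "num_spokes X = 0" "\<And>b. b \<in> set L \<Longrightarrow> adj G v b \<Longrightarrow> b \<in> set (f # X @ [f'])"
      by (rule unseparated_sector[OF L(1,3) v_proper(1)]) (rule that)
    have "sector_path G (set L) x (f # X @ [f'])"
      using induced_cycle_sector_path[OF sector(1,3,4)] sector(5) unfolding sector(2) num_spokes_0_iff
      by blast
    moreover have "nbrs_in v (set L) \<subseteq> set (f # X @ [f'])" using sector(6) unfolding nbrs_in_def
      by blast
    moreover have "2 < card (nbrs_in v (set L)) \<longrightarrow> x \<in> nbhd G v" using v_proper(2) unfolding nbhd_adj
      by (metis mem_Collect_eq not_le)
    ultimately show ?thesis unfolding proper_vertex_def nbhd_Int by blast
  qed
  then show ?thesis using wheel unfolding proper_wheel_def proper_vertex_def by blast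
qed

lemma sectors_with_interior_inE:
  assumes "A \<in> sectors_with_interior_in G C x Y"
  obtains e X e' where "A = set (e # X @ [e'])" "sector e X e'" "X \<noteq> []" "set X \<subseteq> Y"
proof -
  obtain cs where cs: "induced_cycle cs" "set cs = C" using rim_exists by blast
  obtain p where p: "A = set p" "sector_path G C x p" "path_interior p \<noteq> {}" "path_interior p \<subseteq> Y"
    using assms unfolding sectors_with_interior_in_def by blast
  obtain e X e' Z where split: "p = e # X @ [e']" and rim: "rim (e # X @ e' # Z)"
    and ends: "adj G x e" "adj G x e'"
    and X: "num_spokes X = 0" and interior: "path_interior p = set X"
    using sector_path_induced_cycle[OF cs p(2)] unfolding rim_def num_spokes_0_iff by metis
  show thesis
    by (rule that[OF _ sectorI[OF rim ends X]]) (use p split interior in auto)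
qed

end

locale minimal_proper_wheel_graph = proper_wheel_graph +
  assumes fewest_spokes: "proper_wheel G C' x \<Longrightarrow> card (spokes G C x) \<le> card (spokes G C' x)"

sublocale minimal_proper_wheel_graph \<subseteq> minimal_proper_rim "pverts G" "adj G" x C
proof
  fix L assume L: "induced_cycle L" "x \<notin> set L" "4 \<le> num_spokes L" "num_spokes L < rim_spokes"
    and "\<And>v. \<lbrakk>v \<in> pverts G; v \<notin> set L; v \<noteq> x\<rbrakk> \<Longrightarrow> proper_for L v"
  then have "card (spokes G C x) \<le> card (spokes G (set L) x)" by (intro fewest_spokes proper_wheelI)
  then show False
    using L(4) num_spokes_card[OF induced_cycle_distinct[OF L(1)]]
    unfolding rim_spokes_def spokes_def nbhd_Int by simp
qed

context minimal_proper_wheel_graph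
begin

lemma non_nbrs_eq: "non_nbrs = pverts G - closed_nbhd G x"
  unfolding non_nbrs_def closed_nbhd_def nbhd_adj by auto

lemma component_of_non_nbrs_one_sector:
  assumes D: "D \<in> components_without G (closed_nbhd G x)"
  shows "card (sectors_with_interior_in G C x (verts D)) \<le> 1"
proof -
  have "A = B" if AB: "A \<in> sectors_with_interior_in G C x (verts D)"
    "B \<in> sectors_with_interior_in G C x (verts D)" for A B
  proof -
    obtain e X e' where A: "A = set (e # X @ [e'])" "sector e X e'" "X \<noteq> []" "set X \<subseteq> verts D"
      using AB(1) by (rule sectors_with_interior_inE)
    obtain g Y g' where B: "B = set (g # Y @ [g'])" "sector g Y g'" "Y \<noteq> []" "set Y \<subseteq> verts D"
      using AB(2) by (rule sectors_with_interior_inE)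
    have hds: "hd X \<in> set X" "hd Y \<in> set Y" using A(3) B(3) by auto
    then have "(hd X, hd Y) \<in> (adj_on (verts D))\<^sup>*" using component_reach[OF D] A(4) B(4) by blast
    then have "(hd X, hd Y) \<in> (adj_on non_nbrs)\<^sup>*"
      using rtrancl_adj_on_mono component_subset[OF D] unfolding non_nbrs_eq by blast
    then show ?thesis using sector_component_unique[OF A(2) B(2) hds] A(1) B(1) by blast
  qed
  then show ?thesis
    using card_le_Suc0_iff_eq[of "sectors_with_interior_in G C x (verts D)"]
    by (cases "finite (sectors_with_interior_in G C x (verts D))") auto
qed

context
  fixes u D
  assumes u: "u \<in> nbhd G x" and D: "D \<in> components_without G (closed_nbhd G x - {u})" "u \<in> verts D"
begin

lemma component_at_spoke_reach:
  assumes sector: "sector e X e'" and X: "X \<noteq> []" "set X \<subseteq> verts D"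
  obtains z where "(hd X, z) \<in> (adj_on non_nbrs)\<^sup>*" "adj G z u"
proof -
  have D_subset: "verts D \<subseteq> insert u non_nbrs" using component_subset[OF D(1)] unfolding non_nbrs_eq
    by blast
  have u': "adj G x u" "u \<notin> non_nbrs" using u unfolding nbhd_adj non_nbrs_def by auto
  have X_hd: "hd X \<in> verts D" using X by auto
  have "\<not> adj G x (hd X)" using num_spokes_0D[OF sector_spokes(3)[OF sector]] X(1) by simp
  then have "hd X \<in> non_nbrs" using X_hd D_subset u'(1) by auto
  then show thesis
    using non_nbrs_path_to_nbr[OF component_reach[OF D(1) X_hd D(2)] D_subset _ u'(2)] that by blast
qed

lemma component_at_spoke_sectors_meet:
  assumes AB: "A \<in> sectors_with_interior_in G C x (verts D)"
    "B \<in> sectors_with_interior_in G C x (verts D)"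
  shows "A \<inter> B \<noteq> {}"
proof -
  obtain e X e' where A: "A = set (e # X @ [e'])" "sector e X e'" "X \<noteq> []" "set X \<subseteq> verts D"
    using AB(1) by (rule sectors_with_interior_inE)
  obtain g Y g' where B: "B = set (g # Y @ [g'])" "sector g Y g'" "Y \<noteq> []" "set Y \<subseteq> verts D"
    using AB(2) by (rule sectors_with_interior_inE)
  have hds: "hd X \<in> set X" "hd Y \<in> set Y" using A(3) B(3) by auto
  obtain z where z: "(hd X, z) \<in> (adj_on non_nbrs)\<^sup>*" "adj G z u"
    using component_at_spoke_reach[OF A(2-4)] .
  obtain z' where z': "(hd Y, z') \<in> (adj_on non_nbrs)\<^sup>*" "adj G z' u"
    using component_at_spoke_reach[OF B(2-4)] .
  have "adj G x u" using u unfolding nbhd_adj by simp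
  then show ?thesis using sectors_through_nbr_meet[OF A(2) B(2) _ hds(1) z hds(2) z'] A(1) B(1) by blast
qed

lemma component_at_spoke_two_sectors: "card (sectors_with_interior_in G C x (verts D)) \<le> 2"
proof (rule ccontr)
  let ?S = "sectors_with_interior_in G C x (verts D)"
  assume "\<not> ?thesis"
  then have "3 \<le> card ?S" by simp
  then obtain T where "T \<subseteq> ?S" "card T = 3" by (meson obtain_subset_with_card_n)
  then obtain A1 A2 A3 where "T = {A1, A2, A3}" and different: "A1 \<noteq> A2" "A1 \<noteq> A3" "A2 \<noteq> A3"
    unfolding card_3_iff by blast
  then have A: "A1 \<in> ?S" "A2 \<in> ?S" "A3 \<in> ?S" using \<open>T \<subseteq> ?S\<close> by auto
  obtain e1 X1 f1 where A1: "A1 = set (e1 # X1 @ [f1])" "sector e1 X1 f1" "X1 \<noteq> []" "set X1 \<subseteq> verts D"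
    using A(1) by (rule sectors_with_interior_inE)
  obtain e2 X2 f2 where A2: "A2 = set (e2 # X2 @ [f2])" "sector e2 X2 f2" "X2 \<noteq> []" "set X2 \<subseteq> verts D"
    using A(2) by (rule sectors_with_interior_inE)
  obtain e3 X3 f3 where A3: "A3 = set (e3 # X3 @ [f3])" "sector e3 X3 f3" "X3 \<noteq> []" "set X3 \<subseteq> verts D"
    using A(3) by (rule sectors_with_interior_inE)
  note meet = component_at_spoke_sectors_meet[OF A(1,2)] component_at_spoke_sectors_meet[OF A(1,3)]
    component_at_spoke_sectors_meet[OF A(2,3)]
  show False
    using no_three_meeting_sectors[OF A1(2) A2(2) A3(2) A1(3) A2(3) A3(3)] different meet
    unfolding A1(1) A2(1) A3(1) by blast
qed

end

end

theorem theorem3p16: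
  fixes G :: "'a pair_pre_digraph" and C :: "'a set" and x :: 'a
  assumes "pair_graph G"
    and "induced_free is_subdivided_K4 G"
    and "induced_free is_diamond G"
    and "induced_free is_bowtie G"
    and "induced_free is_prism G"
    and "induced_free is_K33 G"
    and "proper_wheel G C x"
    and "\<And>C'. proper_wheel G C' x \<Longrightarrow> card (spokes G C x) \<le> card (spokes G C' x)"
  shows "(\<forall>D \<in> components_without G (closed_nbhd G x).
            card (sectors_with_interior_in G C x (verts D)) \<le> 1)
       \<and> (\<forall>u \<in> nbhd G x. \<forall>D \<in> components_without G (closed_nbhd G x - {u}). u \<in> verts D \<longrightarrow>
            card (sectors_with_interior_in G C x (verts D)) \<le> 2
          \<and> (\<forall>S1 \<in> sectors_with_interior_in G C x (verts D).
             \<forall>S2 \<in> sectors_with_interior_in G C x (verts D). S1 \<inter> S2 \<noteq> {}))"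
proof -
  interpret pair_graph G by fact
  interpret minimal_proper_wheel_graph G C x by unfold_locales (use assms(2-5,7,8) in auto)
  show ?thesis
    using component_of_non_nbrs_one_sector component_at_spoke_two_sectors
      component_at_spoke_sectors_meet by blast
qed

end
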